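(* Let $L$ be an oriented link diagram and let $C$ be an admissible cut of $L$. Over the field $\mathbb{Q}$, there is a spectral sequence of ($q$-)graded vector spaces converging to the Khovanov homology of $L$, $$E^2_{p,q}\Rightarrow Kh_{\mathbb{Q}}(L)=H(\mathcal{C}(L),\mathbb{Q}),$$ such that $$E^2_{p,q}\cong H^p\Big(\bigoplus_{\mathcal{A}\in NC_n}\mathcal{C}(L_1)_{\mathcal{A}}^{\bullet}\otimes Kh^q_{\mathbb{Q}}(L_2^{\mathcal{A}}),\ \bigoplus_{\mathcal{A}\in NC_n}\big[d_1^{\mathcal{A},\bullet}\otimes id_{2,\mathcal{A}}^{\,q}\big]\Big).$$
   Context: **Khovanov complex.** Work over $k=\mathbb{Q}$. Let $V=\langle v_-\rangle\oplus\langle v_+\rangle$ with $\deg_q v_\pm=\pm1$. Shifts: $W\{l\}_m=W_{m-l}$ for $q$-graded spaces, $\mathcal{C}[s]^m=\mathcal{C}^{m-s}$ for complexes. Let $L$ be an oriented link diagram with set of crossings $\chi$. At a positive crossing the $0$-smoothing is the orientation-consistent smoothing and the $1$-smoothing is the other one; at a negative crossing the roles are exchanged. A state $\alpha\in\{0,1\}^\chi$ yields the smoothing $\mathcal{S}_\alpha(L)$, a set of disjoint circles; $r(\alpha)=\sum_c\alpha(c)$. Put $F(\mathcal{S}_\alpha(L))=\bigotimes_{\text{circles}}V$ and $[\![L]\!]^r=\bigoplus_{r(\alpha)=r}F(\mathcal{S}_\alpha(L))\{r\}$. An arrow $a\in\{0,1,*\}^\chi$ (with $*$ occurring exactly once)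 goes from the state $a(0)$ to $a(1)$ and merges two circles or splits one; $d_a$ is correspondingly the multiplication $m$ ($v_+v_\pm=v_\pm$, $v_-v_+=v_-$, $v_-v_-=0$) or comultiplication $\Delta$ ($v_+\mapsto v_+\otimes v_-+v_-\otimes v_+$, $v_-\mapsto v_-\otimes v_-$), tensored with the identity on the other circles. With a total order on $\chi$, the differential is $\sum_a(-1)^{sg(a)}d_a$, where $sg(a)$ is the sum of the $a(j)$ over the crossings $j$ preceding the position of $*$. If $l^\pm$ is the number of positive/negative crossings, then $\mathcal{C}(L)=[\![L]\!][-l^-]\{l^+-2l^-\}$ and $Kh_{\mathbb{Q}}(L)=H(\mathcal{C}(L))$. **Cuts and surgeries.** Diagrams are regarded on $S^2=\mathbb{R}^2\cup\{\infty\}$. An admissible cut of $L$ is a Jordan curve $C$ in the plane, transversal to $L$ (in particular avoiding the crossings), such that, walking along $C$, the directions in which $L$ crosses $C$ at the successive intersection points alternate. There are then $2n$ intersection points. Orient $C$, choose a base point on $C$, and label the points $a_1,b_1,\dots,a_n,b_n$ in the order met; let $R_1,R_2$ be the two closed discs of $S^2$ bounded by $C$, the choices being made so that $L$ enters $R_1$ (leaves $R_2$) at each $a_i$ and leaves $R_1$ (enters $R_2$) at each $b_i$. $NC_n$ is the set of non crossing partitions of $\{1,\dots,n\}$: partitions such that the convex hulls of the images of distinct blocks under $m\mapsto e^{2\pi i m/n}$ are disjoint ($NC_0$ has exactly one element). For $\mathcal{A}\in NC_n$, let $\vec{\mathcal{A}}$ be the system of disjoint oriented chords of a disc (with $a_1,b_1,\dots,a_n,b_n$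 placed cyclically on its boundary) consisting, for each block $i_1<\dots<i_k$, of chords from $b_{i_1}$ to $a_{i_2}$, ..., from $b_{i_{k-1}}$ to $a_{i_k}$, from $b_{i_k}$ to $a_{i_1}$ (for $k=1$: from $b_{i_1}$ to $a_{i_1}$). $L_1^{\mathcal{A}}$ is $L\cap R_1$ closed up by a copy of $\vec{\mathcal{A}}$ in $R_2$; $L_2^{\mathcal{A}}$ is $L\cap R_2$ closed up by a copy of $\vec{\mathcal{A}}$ with reversed orientation in $R_1$. Write $L_i=L_i^{full}$ where $full=\{\{1\},\dots,\{n\}\}$. All $L_i^{\mathcal{A}}$ have the same crossings $\chi_i=\chi\cap R_i$, with $l_i^\pm$ positive/negative ones; $\chi=\chi_1\sqcup\chi_2$, and states of $L$ are pairs $\alpha=(\alpha_1,\alpha_2)$. A fixed total order on $\chi_i$ is used for all $L_i^{\mathcal{A}}$. **The spaces $\mathcal{C}(L_i)_{\mathcal{A}}$.** For $\beta\in\{0,1\}^{\chi_i}$ let $\mathcal{C}_i(\beta)\in NC_n$ be the partition in which $r,s$ are equivalent iff $a_r,a_s$ lie on the same circle of $\mathcal{S}_\beta(L_i)$; let $k_i(\beta)$ be the number of circles of $\mathcal{S}_\beta(L_i)$. Put $$\mathcal{C}(L_i)_{\mathcal{A}}=\Big(\bigoplus_{\beta:\ \mathcal{C}_i(\beta)=\mathcal{A}}V^{\otimes(k_i(\beta)-|\mathcal{A}|)}\{r(\beta)\}[r(\beta)]\Big)[-l_i^-]\{l_i^+-2l_i^-\};$$ the tensor factors correspond to the inner circles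 of $\mathcal{S}_\beta(L_i)$, i.e. those containing none of the points $a_j,b_j$. The superscript $\bullet$ denotes homological degree. **The double complex and the induced differential.** Put $$\mathcal{CC}(L;C)^{s,t}=\bigoplus_{\mathcal{A}\in NC_n}\mathcal{C}(L_1)_{\mathcal{A}}^{s}\otimes\mathcal{C}(L_2^{\mathcal{A}})^{t}\cong\bigoplus_{\mathcal{A}\in NC_n}\mathcal{C}(L_1^{\mathcal{A}})^{s}\otimes\mathcal{C}(L_2)_{\mathcal{A}}^{t},$$ where both sides are identified with the sum of the (shifted) spaces $F(\mathcal{S}_\alpha(L))$ over states $\alpha=(\alpha_1,\alpha_2)$ with $r(\alpha_1)-l_1^-=s$, $r(\alpha_2)-l_2^-=t$, via the natural bijections of circles $\mathcal{S}_\alpha(L)\cong\{\text{inner circles of }\mathcal{S}_{\alpha_1}(L_1)\}\sqcup\mathcal{S}_{\alpha_2}(L_2^{\mathcal{C}_1(\alpha_1)})\cong\mathcal{S}_{\alpha_1}(L_1^{\mathcal{C}_2(\alpha_2)})\sqcup\{\text{inner circles of }\mathcal{S}_{\alpha_2}(L_2)\}$ (corresponding circles have the same intersection with $R_2$, respectively $R_1$). Let $d_i^{\mathcal{A},\bullet}$ be the differential of $\mathcal{C}(L_i^{\mathcal{A}})$ and $id_{i,\mathcal{A}}^{\,j}$ the identity of $\mathcal{C}(L_i)_{\mathcal{A}}^j$. The vertical differential is $d_{vert}^{s,t}=\bigoplus_{\mathcal{A}}id_{1,\mathcal{A}}^{\,s}\otimes d_2^{\mathcal{A},t}$ (first description)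 and the horizontal one is $d_{hor}^{s,t}=\bigoplus_{\mathcal{A}}d_1^{\mathcal{A},s}\otimes id_{2,\mathcal{A}}^{\,t}$ (second description). The vertical cohomology in degree $q$ of column $p$ is $\bigoplus_{\mathcal{A}}\mathcal{C}(L_1)^p_{\mathcal{A}}\otimes Kh^q_{\mathbb{Q}}(L_2^{\mathcal{A}})$, and $\bigoplus_{\mathcal{A}}[d_1^{\mathcal{A},p}\otimes id_{2,\mathcal{A}}^{\,q}]$ denotes the map induced on it by $d_{hor}$, from column $p$ to column $p+1$. The subscripts $p,q$ of $E^2_{p,q}$ are homological degrees ($q$ here is not the quantum grading); convergence is to $Kh_{\mathbb{Q}}(L)$ in total degree $p+q$. *)

theory Defs
  imports
    "HOL-Analysis.Analysis"
    "HOL-Library.Function_Algebras"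
    "HOL-Library.Disjoint_Sets"
begin

section \<open>Rational vector spaces presented as subquotients\<close>

text \<open>
  All vector spaces are taken inside spaces \<open>'b \<Rightarrow> rat\<close> with pointwise operations. A pair
  \<open>(Z, B)\<close> of subspaces with \<open>B \<subseteq> Z\<close> stands for the quotient \<open>Z/B\<close>; a subspace \<open>Z\<close>
  is \<open>(Z, {0})\<close>. A linear map \<open>Z/B \<rightarrow> Z'/B'\<close> is given by a linear map of the ambient spaces that
  induces it (over a field every linear map of quotients arises in this way).
\<close>

definition fscale :: "rat \<Rightarrow> ('b \<Rightarrow> rat) \<Rightarrow> 'b \<Rightarrow> rat" where
  "fscale c f = (\<lambda>x. c * f x)"

global_interpretation fun_vs: vector_space fscale
  by unfold_locales (auto simp: fscale_def fun_eq_iff algebra_simps)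

type_synonym 'b subq = "('b \<Rightarrow> rat) set \<times> ('b \<Rightarrow> rat) set"

definition subquotient :: "'b subq \<Rightarrow> bool" where
  "subquotient Q \<longleftrightarrow> fun_vs.subspace (fst Q) \<and> fun_vs.subspace (snd Q) \<and> snd Q \<subseteq> fst Q"

definition induces_map :: "(('a \<Rightarrow> rat) \<Rightarrow> ('b \<Rightarrow> rat)) \<Rightarrow> 'a subq \<Rightarrow> 'b subq \<Rightarrow> bool" where
  "induces_map f Q Q' \<longleftrightarrow>
     Vector_Spaces.linear fscale fscale f \<and> f ` fst Q \<subseteq> fst Q' \<and> f ` snd Q \<subseteq> snd Q'"

definition induces_zero :: "(('a \<Rightarrow> rat) \<Rightarrow> ('b \<Rightarrow> rat)) \<Rightarrow> 'a subq \<Rightarrow> 'b subq \<Rightarrow> bool" where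
  "induces_zero f Q Q' \<longleftrightarrow> f ` fst Q \<subseteq> snd Q'"

definition induces_iso :: "(('a \<Rightarrow> rat) \<Rightarrow> ('b \<Rightarrow> rat)) \<Rightarrow> 'a subq \<Rightarrow> 'b subq \<Rightarrow> bool" where
  "induces_iso f Q Q' \<longleftrightarrow> induces_map f Q Q' \<and>
     (\<forall>z\<in>fst Q. f z \<in> snd Q' \<longrightarrow> z \<in> snd Q) \<and>
     (\<forall>z'\<in>fst Q'. \<exists>z\<in>fst Q. z' - f z \<in> snd Q')"

definition subq_isomorphic :: "'a subq \<Rightarrow> 'b subq \<Rightarrow> bool"  (infix \<open>\<cong>\<^sub>\<rat>\<close> 50) where
  "Q \<cong>\<^sub>\<rat> Q' \<longleftrightarrow> subquotient Q \<and> subquotient Q' \<and> (\<exists>f. induces_iso f Q Q')"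

text \<open>Cohomology at the middle term of \<open>P \<rightarrow> Q \<rightarrow> R\<close>, the maps being induced by \<open>f\<close> and \<open>g\<close>.\<close>

definition middle_cohomology ::
  "(('b \<Rightarrow> rat) \<Rightarrow> ('b \<Rightarrow> rat)) \<Rightarrow> (('b \<Rightarrow> rat) \<Rightarrow> ('b \<Rightarrow> rat))
    \<Rightarrow> 'b subq \<Rightarrow> 'b subq \<Rightarrow> 'b subq \<Rightarrow> 'b subq" where
  "middle_cohomology f g P Q R =
     ({z \<in> fst Q. g z \<in> snd R}, {f w + b | w b. w \<in> fst P \<and> b \<in> snd Q})"

definition cochain_complex ::
  "(int \<Rightarrow> 'b subq) \<Rightarrow> (int \<Rightarrow> ('b \<Rightarrow> rat) \<Rightarrow> ('b \<Rightarrow> rat)) \<Rightarrow> bool" where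
  "cochain_complex Q d \<longleftrightarrow>
     (\<forall>p. subquotient (Q p) \<and> induces_map (d p) (Q p) (Q (p + 1)) \<and>
          induces_zero (d (p + 1) \<circ> d p) (Q p) (Q (p + 2)))"

definition cohomology ::
  "(int \<Rightarrow> 'b subq) \<Rightarrow> (int \<Rightarrow> ('b \<Rightarrow> rat) \<Rightarrow> ('b \<Rightarrow> rat)) \<Rightarrow> int \<Rightarrow> 'b subq" where
  "cohomology Q d p = middle_cohomology (d (p - 1)) (d p) (Q (p - 1)) (Q p) (Q (p + 1))"

text \<open>
  The tensor product \<open>(Z\<^sub>1/B\<^sub>1) \<otimes> (Z\<^sub>2/B\<^sub>2)\<close> is
  \<open>Z\<^sub>1 \<otimes> Z\<^sub>2 / (Z\<^sub>1 \<otimes> B\<^sub>2 + B\<^sub>1 \<otimes> Z\<^sub>2)\<close>. In the graded version the argument of type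
  \<^typ>\<open>int\<close> is the degree; the spaces in different degrees are required to be linearly
  independent, so that the span below is the direct sum over all decompositions of \<open>j\<close>.
\<close>

definition pure_tensors ::
  "('a \<Rightarrow> rat) set \<Rightarrow> ('b \<Rightarrow> rat) set \<Rightarrow> ('a \<times> 'b \<Rightarrow> rat) set" where
  "pure_tensors U W = {\<lambda>(x, y). u x * w y | u w. u \<in> U \<and> w \<in> W}"

definition graded_tensor ::
  "(int \<Rightarrow> 'a subq) \<Rightarrow> (int \<Rightarrow> 'b subq) \<Rightarrow> int \<Rightarrow> ('a \<times> 'b) subq" where
  "graded_tensor G H j =
     (fun_vs.span (\<Union>k. pure_tensors (fst (G k)) (fst (H (j - k)))),
      fun_vs.span (\<Union>k. pure_tensors (fst (G k)) (snd (H (j - k))) \<union>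
                        pure_tensors (snd (G k)) (fst (H (j - k)))))"

definition direct_sum_of_spaces ::
  "'i set \<Rightarrow> ('i \<Rightarrow> ('a \<Rightarrow> rat) set) \<Rightarrow> ('i \<times> 'a \<Rightarrow> rat) set" where
  "direct_sum_of_spaces I U =
     {f. (\<forall>i\<in>I. (\<lambda>x. f (i, x)) \<in> U i) \<and> (\<forall>i x. i \<notin> I \<longrightarrow> f (i, x) = 0)}"

definition direct_sum :: "'i set \<Rightarrow> ('i \<Rightarrow> 'a subq) \<Rightarrow> ('i \<times> 'a) subq" where
  "direct_sum I Q =
     (direct_sum_of_spaces I (\<lambda>i. fst (Q i)), direct_sum_of_spaces I (\<lambda>i. snd (Q i)))"

text \<open>The vector space with finite basis \<open>B\<close>, and the linear map with matrix \<open>M\<close> (row index first).\<close>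

definition spanned_by :: "'b set \<Rightarrow> ('b \<Rightarrow> rat) set" where
  "spanned_by B = {f. \<forall>x. x \<notin> B \<longrightarrow> f x = 0}"

definition matrix_map :: "'b set \<Rightarrow> ('b \<Rightarrow> 'b \<Rightarrow> rat) \<Rightarrow> ('b \<Rightarrow> rat) \<Rightarrow> 'b \<Rightarrow> rat" where
  "matrix_map B M f = (\<lambda>y. if y \<in> B then (\<Sum>x\<in>B. M y x * f x) else 0)"


section \<open>Spectral sequences of graded vector spaces\<close>

text \<open>
  \<open>E r p q j\<close> is the part of degree \<open>j\<close> (the internal grading) of the term in position
  \<open>(p, q)\<close> of the \<open>r\<close>-th page; the pages start at \<open>r = 2\<close>, and the differentials
  preserve the internal degree and have bidegree \<open>(r, 1 - r)\<close>.
\<close>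

type_synonym 'b pages = "nat \<Rightarrow> int \<Rightarrow> int \<Rightarrow> int \<Rightarrow> 'b subq"
type_synonym 'b page_maps = "nat \<Rightarrow> int \<Rightarrow> int \<Rightarrow> int \<Rightarrow> ('b \<Rightarrow> rat) \<Rightarrow> ('b \<Rightarrow> rat)"

definition spectral_sequence :: "'b pages \<Rightarrow> 'b page_maps \<Rightarrow> bool" where
  "spectral_sequence E d \<longleftrightarrow>
     (\<forall>r\<ge>2. \<forall>p q j.
        subquotient (E r p q j) \<and>
        induces_map (d r p q j) (E r p q j) (E r (p + int r) (q - int r + 1) j) \<and>
        induces_zero (d r (p + int r) (q - int r + 1) j \<circ> d r p q j)
          (E r p q j) (E r (p + 2 * int r) (q - 2 * int r + 2) j) \<and>
        E (Suc r) p q j \<cong>\<^sub>\<rat>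
          middle_cohomology (d r (p - int r) (q + int r - 1) j) (d r p q j)
            (E r (p - int r) (q + int r - 1) j) (E r p q j) (E r (p + int r) (q - int r + 1) j))"

text \<open>
  \<open>H n j\<close> is the part of internal degree \<open>j\<close> of the abutment in total degree \<open>n\<close>.
  A decreasing filtration of \<open>Z/B\<close> is given by subspaces \<open>F p\<close> between \<open>B\<close> and
  \<open>Z\<close>; it is required to be finite, and for every \<open>(p, q)\<close> the terms \<open>E r p q\<close>
  become stationary with value the \<open>p\<close>-th graded piece in total degree \<open>p + q\<close>.
\<close>

definition converges_to :: "'b pages \<Rightarrow> 'b page_maps \<Rightarrow> (int \<Rightarrow> int \<Rightarrow> 'c subq) \<Rightarrow> bool" where
  "converges_to E d H \<longleftrightarrow>
     (\<exists>F :: int \<Rightarrow> int \<Rightarrow> int \<Rightarrow> ('c \<Rightarrow> rat) set.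
        (\<forall>n j p. fun_vs.subspace (F p n j) \<and> snd (H n j) \<subseteq> F p n j \<and> F p n j \<subseteq> fst (H n j) \<and>
                 F (p + 1) n j \<subseteq> F p n j) \<and>
        (\<forall>n. \<exists>p0 p1. \<forall>j. F p0 n j = fst (H n j) \<and> F p1 n j = snd (H n j)) \<and>
        (\<forall>p q. \<exists>r0\<ge>2. \<forall>r\<ge>r0. \<forall>j.
           induces_zero (d r p q j) (E r p q j) (E r (p + int r) (q - int r + 1) j) \<and>
           induces_zero (d r (p - int r) (q + int r - 1) j)
             (E r (p - int r) (q + int r - 1) j) (E r p q j) \<and>
           E r p q j \<cong>\<^sub>\<rat> (F p (p + q) j, F (p + 1) (p + q) j)))"


section \<open>The Khovanov complex\<close>

text \<open>
  The smoothings of a diagram only depend on the following data: the set of its oriented arcs,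
  the crossings with their signs, the incoming and outgoing arcs of the over- and understrand at
  each crossing, and further pairs of arcs whose ends are joined without a crossing.
  A circle of a smoothing is recorded as the set of the arcs it runs through.
\<close>

record ('c, 'e) diagram =
  arcs :: "'e set"
  joins :: "'e rel"
  crossings :: "'c set"
  positive :: "'c \<Rightarrow> bool"
  over_in :: "'c \<Rightarrow> 'e"
  over_out :: "'c \<Rightarrow> 'e"
  under_in :: "'c \<Rightarrow> 'e"
  under_out :: "'c \<Rightarrow> 'e"

text \<open>
  A state is identified with the set of crossings at which it takes the value 1. The smoothing at
  \<open>c\<close> is inconsistent with the orientation iff \<open>c\<close> is positive with value 1 or
  negative with value 0.
\<close>

definition smoothing_rel :: "('c, 'e, 'm) diagram_scheme \<Rightarrow> 'c set \<Rightarrow> 'e rel" where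
  "smoothing_rel D \<alpha> = joins D \<union>
     (\<Union>c\<in>crossings D.
        if (c \<in> \<alpha>) = positive D c
        then {(over_in D c, under_in D c), (over_out D c, under_out D c)}
        else {(over_in D c, under_out D c), (under_in D c, over_out D c)})"

definition circles :: "('c, 'e, 'm) diagram_scheme \<Rightarrow> 'c set \<Rightarrow> 'e set set" where
  "circles D \<alpha> = arcs D // (smoothing_rel D \<alpha> \<union> (smoothing_rel D \<alpha>)\<inverse>)\<^sup>*"

definition num_pos :: "('c, 'e, 'm) diagram_scheme \<Rightarrow> nat" where
  "num_pos D = card {c \<in> crossings D. positive D c}"

definition num_neg :: "('c, 'e, 'm) diagram_scheme \<Rightarrow> nat" where
  "num_neg D = card {c \<in> crossings D. \<not> positive D c}"

text \<open>
  The basis vectors \<open>v\<^sub>+\<close>, \<open>v\<^sub>-\<close> of \<open>V\<close> are encoded by their degrees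
  \<open>1\<close>, \<open>-1\<close>. The standard basis of the tensor power of \<open>V\<close> over a set \<open>S\<close> of
  circles consists of the labellings of \<open>S\<close> by \<open>\<plusminus>1\<close>.
\<close>

type_synonym ('c, 'e) gen = "'c set \<times> ('e set \<Rightarrow> int)"

definition labellings :: "'e set set \<Rightarrow> ('e set \<Rightarrow> int) set" where
  "labellings S = S \<rightarrow>\<^sub>E {1, -1}"

definition generators :: "('c, 'e, 'm) diagram_scheme \<Rightarrow> ('c, 'e) gen set" where
  "generators D = {(\<alpha>, \<epsilon>). \<alpha> \<subseteq> crossings D \<and> \<epsilon> \<in> labellings (circles D \<alpha>)}"

definition hdeg :: "('c, 'e, 'm) diagram_scheme \<Rightarrow> ('c, 'e) gen \<Rightarrow> int" where
  "hdeg D = (\<lambda>(\<alpha>, \<epsilon>). int (card \<alpha>) - int (num_neg D))"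

text \<open>\<open>S \<alpha>\<close> is the set of circles of the state \<open>\<alpha>\<close> that are labelled.\<close>

definition qdeg ::
  "('c, 'e, 'm) diagram_scheme \<Rightarrow> ('c set \<Rightarrow> 'e set set) \<Rightarrow> ('c, 'e) gen \<Rightarrow> int" where
  "qdeg D S = (\<lambda>(\<alpha>, \<epsilon>). (\<Sum>z\<in>S \<alpha>. \<epsilon> z) + int (card \<alpha>) + int (num_pos D) - 2 * int (num_neg D))"

text \<open>The coefficient of \<open>v\<^sub>c\<close> in \<open>m(v\<^sub>a \<otimes> v\<^sub>b)\<close> and that of \<open>v\<^sub>b \<otimes> v\<^sub>c\<close> in \<open>\<Delta>(v\<^sub>a)\<close>.\<close>

definition mult_coeff :: "int \<Rightarrow> int \<Rightarrow> int \<Rightarrow> rat" where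
  "mult_coeff a b c = of_bool ((a, b, c) \<in> {(1, 1, 1), (1, -1, -1), (-1, 1, -1)})"

definition comult_coeff :: "int \<Rightarrow> int \<Rightarrow> int \<Rightarrow> rat" where
  "comult_coeff a b c = of_bool ((a, b, c) \<in> {(1, 1, -1), (1, -1, 1), (-1, -1, -1)})"

text \<open>
  The coefficient of the labelling \<open>\<eta>\<close> of \<open>S'\<close> in \<open>d\<^sub>a \<epsilon>\<close>, where \<open>\<epsilon>\<close>
  is a labelling of \<open>S\<close> and \<open>S\<close>, \<open>S'\<close> are the sets of circles at the two ends of the arrow
  \<open>a\<close>. As \<open>m\<close> is commutative and \<open>\<Delta>\<close> cocommutative, the order in which the two merged
  (or split) circles are chosen is irrelevant.
\<close>

definition edge_coeff ::
  "'e set set \<Rightarrow> ('e set \<Rightarrow> int) \<Rightarrow> 'e set set \<Rightarrow> ('e set \<Rightarrow> int) \<Rightarrow> rat" where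
  "edge_coeff S \<epsilon> S' \<eta> =
     (if \<exists>z\<in>S \<inter> S'. \<epsilon> z \<noteq> \<eta> z then 0
      else if \<exists>z1 z2 z. z1 \<noteq> z2 \<and> S - S' = {z1, z2} \<and> S' - S = {z}
        then (THE k. \<exists>z1 z2 z. z1 \<noteq> z2 \<and> S - S' = {z1, z2} \<and> S' - S = {z} \<and>
                       k = mult_coeff (\<epsilon> z1) (\<epsilon> z2) (\<eta> z))
      else if \<exists>z z1 z2. z1 \<noteq> z2 \<and> S - S' = {z} \<and> S' - S = {z1, z2}
        then (THE k. \<exists>z z1 z2. z1 \<noteq> z2 \<and> S - S' = {z} \<and> S' - S = {z1, z2} \<and>
                       k = comult_coeff (\<epsilon> z) (\<eta> z1) (\<eta> z2))
      else 0)"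

text \<open>\<open>ord\<close> is the total (reflexive) order on the crossings.\<close>

definition kh_coeff ::
  "('c, 'e, 'm) diagram_scheme \<Rightarrow> 'c rel \<Rightarrow> ('c, 'e) gen \<Rightarrow> ('c, 'e) gen \<Rightarrow> rat" where
  "kh_coeff D ord = (\<lambda>(\<beta>, \<eta>) (\<alpha>, \<epsilon>).
     \<Sum>c\<in>crossings D - \<alpha>. if \<beta> = insert c \<alpha>
        then (-1) ^ card {b \<in> \<alpha>. (b, c) \<in> ord} * edge_coeff (circles D \<alpha>) \<epsilon> (circles D \<beta>) \<eta>
        else 0)"

definition kh_diff ::
  "('c, 'e, 'm) diagram_scheme \<Rightarrow> 'c rel \<Rightarrow> (('c, 'e) gen \<Rightarrow> rat) \<Rightarrow> (('c, 'e) gen \<Rightarrow> rat)" where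
  "kh_diff D ord = matrix_map (generators D) (kh_coeff D ord)"

definition kh_chains ::
  "('c, 'e, 'm) diagram_scheme \<Rightarrow> int \<Rightarrow> int \<Rightarrow> (('c, 'e) gen \<Rightarrow> rat) set" where
  "kh_chains D i j = spanned_by {x \<in> generators D. hdeg D x = i \<and> qdeg D (circles D) x = j}"

definition Kh :: "('c, 'e, 'm) diagram_scheme \<Rightarrow> 'c rel \<Rightarrow> int \<Rightarrow> int \<Rightarrow> ('c, 'e) gen subq" where
  "Kh D ord i j =
     cohomology (\<lambda>i. (kh_chains D i j, {0})) (\<lambda>_. kh_diff D ord) i"


section \<open>Non crossing partitions and closures of tangles\<close>

definition NC :: "nat \<Rightarrow> nat set set set" where
  "NC n = {\<A>. partition_on {1..n} \<A> \<and>
     (\<forall>S\<in>\<A>. \<forall>S'\<in>\<A>. S \<noteq> S' \<longrightarrow>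
        convex hull ((\<lambda>m. cis (2 * pi * real m / real n)) ` S) \<inter>
        convex hull ((\<lambda>m. cis (2 * pi * real m / real n)) ` S') = {})}"

definition full :: "nat \<Rightarrow> nat set set" where
  "full n = {{i} | i. i \<in> {1..n}}"

text \<open>\<open>(i, j) \<in> chords \<A>\<close> iff there is a chord from \<open>b\<^sub>i\<close> to \<open>a\<^sub>j\<close>.\<close>

definition chords :: "nat set set \<Rightarrow> (nat \<times> nat) set" where
  "chords \<A> = {(i, if {k \<in> S. i < k} = {} then Min S else Min {k \<in> S. i < k}) | i S. S \<in> \<A> \<and> i \<in> S}"

text \<open>
  The part of a diagram in a disc, with the arcs ending at the boundary points
  \<open>a\<^sub>1, b\<^sub>1, \<dots>, a\<^sub>n, b\<^sub>n\<close>.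
\<close>

record ('c, 'e) tangle = "('c, 'e) diagram" +
  half_ends :: nat
  a_arc :: "nat \<Rightarrow> 'e"
  b_arc :: "nat \<Rightarrow> 'e"

text \<open>
  Closing up by a copy of the chord system in the complementary disc. The orientation of the
  chords does not matter for joining the arcs, so the same definition serves both discs.
\<close>

definition closing :: "('c, 'e) tangle \<Rightarrow> nat set set \<Rightarrow> ('c, 'e) tangle" where
  "closing T \<A> = T\<lparr>joins := joins T \<union> {(b_arc T i, a_arc T j) | i j. (i, j) \<in> chords \<A>}\<rparr>"

definition full_closing :: "('c, 'e) tangle \<Rightarrow> ('c, 'e) tangle" where
  "full_closing T = closing T (full (half_ends T))"

definition state_partition :: "('c, 'e) tangle \<Rightarrow> 'c set \<Rightarrow> nat set set" where
  "state_partition T \<beta> = {1..half_ends T} //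
     {(r, s). r \<in> {1..half_ends T} \<and> s \<in> {1..half_ends T} \<and>
        (\<exists>z\<in>circles (full_closing T) \<beta>. a_arc T r \<in> z \<and> a_arc T s \<in> z)}"

definition inner_circles :: "('c, 'e) tangle \<Rightarrow> 'c set \<Rightarrow> 'e set set" where
  "inner_circles T \<beta> =
     {z \<in> circles (full_closing T) \<beta>. \<forall>r\<in>{1..half_ends T}. a_arc T r \<notin> z \<and> b_arc T r \<notin> z}"

definition inner_generators :: "('c, 'e) tangle \<Rightarrow> nat set set \<Rightarrow> ('c, 'e) gen set" where
  "inner_generators T \<A> =
     {(\<beta>, \<epsilon>). \<beta> \<subseteq> crossings T \<and> state_partition T \<beta> = \<A> \<and> \<epsilon> \<in> labellings (inner_circles T \<beta>)}"

text \<open>The space \<open>\<C>(L\<^sub>i)\<^sub>\<A>\<close> in homological degree \<open>s\<close> and quantum degree \<open>j\<close>.\<close>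

definition inner_chains ::
  "('c, 'e) tangle \<Rightarrow> nat set set \<Rightarrow> int \<Rightarrow> int \<Rightarrow> (('c, 'e) gen \<Rightarrow> rat) set" where
  "inner_chains T \<A> s j =
     spanned_by {x \<in> inner_generators T \<A>. hdeg T x = s \<and> qdeg T (inner_circles T) x = j}"


section \<open>Oriented link diagrams in the plane\<close>

text \<open>
  A diagram consists of finitely many closed curves of period 1, oriented by their
  parametrisation; a position is a pair of the index of a curve and a parameter in \<open>[0,1)\<close>.
  \<open>over_positions\<close> selects the positions on the overstrands.
\<close>

record link_diagram =
  components_number :: nat
  strand :: "nat \<Rightarrow> real \<Rightarrow> complex"
  over_positions :: "(nat \<times> real) set"

definition positions :: "link_diagram \<Rightarrow> (nat \<times> real) set" where
  "positions L = {..<components_number L} \<times> {0..<1}"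

definition pt :: "link_diagram \<Rightarrow> nat \<times> real \<Rightarrow> complex" where
  "pt L x = strand L (fst x) (snd x)"

definition tangent :: "link_diagram \<Rightarrow> nat \<times> real \<Rightarrow> complex" where
  "tangent L x = vector_derivative (strand L (fst x)) (at (snd x))"

definition trace :: "link_diagram \<Rightarrow> complex set" where
  "trace L = pt L ` positions L"

text \<open>The determinant of the pair \<open>(v, w)\<close> of plane vectors.\<close>

definition plane_det :: "complex \<Rightarrow> complex \<Rightarrow> real" where
  "plane_det v w = Re v * Im w - Im v * Re w"

definition double_points :: "link_diagram \<Rightarrow> ((nat \<times> real) \<times> (nat \<times> real)) set" where
  "double_points L =
     {(x, y). x \<in> positions L \<and> y \<in> positions L \<and> x \<noteq> y \<and> pt L x = pt L y}"

definition is_link_diagram :: "link_diagram \<Rightarrow> bool" where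
  "is_link_diagram L \<longleftrightarrow>
     (\<forall>i<components_number L.
        strand L i C1_differentiable_on UNIV \<and>
        (\<forall>t. strand L i (t + 1) = strand L i t) \<and>
        (\<forall>t. vector_derivative (strand L i) (at t) \<noteq> 0)) \<and>
     finite (double_points L) \<and>
     (\<forall>(x, y)\<in>double_points L. plane_det (tangent L x) (tangent L y) \<noteq> 0) \<and>
     (\<forall>x y z. (x, y) \<in> double_points L \<and> (x, z) \<in> double_points L \<longrightarrow> y = z) \<and>
     (\<forall>(x, y)\<in>double_points L. x \<in> over_positions L \<longleftrightarrow> y \<notin> over_positions L)"

definition crossing_points :: "link_diagram \<Rightarrow> complex set" where
  "crossing_points L = (\<lambda>(x, y). pt L x) ` double_points L"

definition over_pos :: "link_diagram \<Rightarrow> complex \<Rightarrow> nat \<times> real" where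
  "over_pos L c = (THE x. x \<in> positions L \<and> pt L x = c \<and> x \<in> over_positions L)"

definition under_pos :: "link_diagram \<Rightarrow> complex \<Rightarrow> nat \<times> real" where
  "under_pos L c = (THE x. x \<in> positions L \<and> pt L x = c \<and> x \<notin> over_positions L)"

definition positive_crossing :: "link_diagram \<Rightarrow> complex \<Rightarrow> bool" where
  "positive_crossing L c \<longleftrightarrow> plane_det (tangent L (over_pos L c)) (tangent L (under_pos L c)) > 0"

text \<open>
  If \<open>M\<close> contains the crossings, the arcs are the connected components of the diagram
  with \<open>M\<close> removed, and every position has an arc just before and one just after it.
\<close>

definition arc_before :: "link_diagram \<Rightarrow> complex set \<Rightarrow> nat \<times> real \<Rightarrow> complex set" where
  "arc_before L M x = (THE e. e \<in> components (trace L - M) \<and>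
     (\<forall>\<^sub>F h in at_right 0. strand L (fst x) (snd x - h) \<in> e))"

definition arc_after :: "link_diagram \<Rightarrow> complex set \<Rightarrow> nat \<times> real \<Rightarrow> complex set" where
  "arc_after L M x = (THE e. e \<in> components (trace L - M) \<and>
     (\<forall>\<^sub>F h in at_right 0. strand L (fst x) (snd x + h) \<in> e))"

definition diagram_of :: "link_diagram \<Rightarrow> (complex, complex set) diagram" where
  "diagram_of L = (let M = crossing_points L in
     \<lparr>arcs = components (trace L - M), joins = {}, crossings = M,
      positive = positive_crossing L,
      over_in = (\<lambda>c. arc_before L M (over_pos L c)),
      over_out = (\<lambda>c. arc_after L M (over_pos L c)),
      under_in = (\<lambda>c. arc_before L M (under_pos L c)),
      under_out = (\<lambda>c. arc_after L M (under_pos L c))\<rparr>)"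


section \<open>Admissible cuts\<close>

text \<open>
  The parametrisation of the Jordan curve \<open>C\<close> provides its orientation and, as \<open>C 0\<close>, the base
  point, which is taken off the diagram.
\<close>

definition cut_times :: "link_diagram \<Rightarrow> (real \<Rightarrow> complex) \<Rightarrow> real list" where
  "cut_times L C = sorted_list_of_set {t \<in> {0<..<1}. C t \<in> trace L}"

definition pos_of :: "link_diagram \<Rightarrow> complex \<Rightarrow> nat \<times> real" where
  "pos_of L z = (THE x. x \<in> positions L \<and> pt L x = z)"

text \<open>The direction (from right to left or from left to right) in which \<open>L\<close> crosses \<open>C\<close> at time \<open>t\<close>.\<close>

definition cut_direction :: "link_diagram \<Rightarrow> (real \<Rightarrow> complex) \<Rightarrow> real \<Rightarrow> real" where
  "cut_direction L C t =
     sgn (plane_det (vector_derivative C (at t)) (tangent L (pos_of L (C t))))"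

definition admissible_cut :: "link_diagram \<Rightarrow> (real \<Rightarrow> complex) \<Rightarrow> bool" where
  "admissible_cut L C \<longleftrightarrow>
     simple_path C \<and> pathfinish C = pathstart C \<and> pathstart C \<notin> trace L \<and>
     path_image C \<inter> crossing_points L = {} \<and>
     finite {t \<in> {0<..<1}. C t \<in> trace L} \<and>
     (\<forall>t\<in>{0<..<1}. C t \<in> trace L \<longrightarrow> C differentiable (at t) \<and> cut_direction L C t \<noteq> 0) \<and>
     (let ts = cut_times L C in \<forall>k<length ts.
        cut_direction L C (ts ! k) \<noteq> cut_direction L C (ts ! (Suc k mod length ts)))"

definition cut_number :: "link_diagram \<Rightarrow> (real \<Rightarrow> complex) \<Rightarrow> nat" where
  "cut_number L C = length (cut_times L C) div 2"

text \<open>The points \<open>a\<^sub>1, b\<^sub>1, \<dots>, a\<^sub>n, b\<^sub>n\<close>; indices start at 1, list positions at 0.\<close>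

definition a_point :: "link_diagram \<Rightarrow> (real \<Rightarrow> complex) \<Rightarrow> nat \<Rightarrow> complex" where
  "a_point L C i = C (cut_times L C ! (2 * i - 2))"

definition b_point :: "link_diagram \<Rightarrow> (real \<Rightarrow> complex) \<Rightarrow> nat \<Rightarrow> complex" where
  "b_point L C i = C (cut_times L C ! (2 * i - 1))"

definition passes_from_to :: "link_diagram \<Rightarrow> complex set \<Rightarrow> complex set \<Rightarrow> complex \<Rightarrow> bool" where
  "passes_from_to L R R' z \<longleftrightarrow>
     (\<forall>\<^sub>F h in at_right 0. strand L (fst (pos_of L z)) (snd (pos_of L z) - h) \<in> R \<and>
                         strand L (fst (pos_of L z)) (snd (pos_of L z) + h) \<in> R')"

text \<open>
  \<open>R1\<close>, \<open>R2\<close> are the two discs of the sphere bounded by \<open>C\<close>, without the point at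
  infinity in the unbounded one; either of them may be the bounded one.
\<close>

definition cut_discs ::
  "link_diagram \<Rightarrow> (real \<Rightarrow> complex) \<Rightarrow> complex set \<Rightarrow> complex set \<Rightarrow> bool" where
  "cut_discs L C R1 R2 \<longleftrightarrow>
     {R1, R2} = {inside (path_image C) \<union> path_image C, outside (path_image C) \<union> path_image C} \<and>
     (\<forall>i\<in>{1..cut_number L C}. passes_from_to L R2 R1 (a_point L C i) \<and>
                             passes_from_to L R1 R2 (b_point L C i))"

text \<open>\<open>L \<inter> R\<close>, for one of the two discs \<open>R\<close>.\<close>

definition tangle_in :: "link_diagram \<Rightarrow> (real \<Rightarrow> complex) \<Rightarrow> complex set \<Rightarrow> (complex, complex set) tangle"
  where
  "tangle_in L C R = (let M = crossing_points L \<union> path_image C;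
       E = {e \<in> components (trace L - M). e \<subseteq> R};
       ending_at = (\<lambda>z. THE e. e \<in> E \<and> z \<in> closure e) in
     \<lparr>arcs = E, joins = {}, crossings = crossing_points L \<inter> R,
      positive = positive_crossing L,
      over_in = (\<lambda>c. arc_before L M (over_pos L c)),
      over_out = (\<lambda>c. arc_after L M (over_pos L c)),
      under_in = (\<lambda>c. arc_before L M (under_pos L c)),
      under_out = (\<lambda>c. arc_after L M (under_pos L c)),
      half_ends = cut_number L C,
      a_arc = (\<lambda>i. ending_at (a_point L C i)),
      b_arc = (\<lambda>i. ending_at (b_point L C i))\<rparr>)"


section \<open>The double complex of a cut\<close>

text \<open>
  For \<open>{R, R'} = {R1, R2}\<close>, a generator of \<open>\<C>(L)\<close> determines a generator of
  \<open>\<Oplus>\<^sub>\<A> \<C>(L \<inter> R)\<^sub>\<A> \<otimes> \<C>((L \<inter> R')\<^sup>\<A>)\<close>: the inner circles in \<open>R\<close> keep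
  their labels, and a circle of the closure of \<open>L \<inter> R'\<close> gets the label of the circle with the
  same intersection with the open disc \<open>R' - R\<close> (the points on \<open>C\<close> belong to no arc of the tangle).
  With \<open>R = R1\<close> this is the first description of the double complex. With \<open>R = R2\<close> it
  is the second one, except that the tensor factors are interchanged.
\<close>

type_synonym kh_gen = "(complex, complex set) gen"

definition split_gen ::
  "link_diagram \<Rightarrow> (real \<Rightarrow> complex) \<Rightarrow> complex set \<Rightarrow> complex set \<Rightarrow> kh_gen
    \<Rightarrow> nat set set \<times> kh_gen \<times> kh_gen" where
  "split_gen L C R R' = (\<lambda>(\<alpha>, \<epsilon>).
     let T = tangle_in L C R; T' = tangle_in L C R'; \<A> = state_partition T (\<alpha> \<inter> R) in
     (\<A>,
      (\<alpha> \<inter> R, restrict \<epsilon> (inner_circles T (\<alpha> \<inter> R))),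
      (\<alpha> \<inter> R',
       \<lambda>w\<in>circles (closing T' \<A>) (\<alpha> \<inter> R').
         \<epsilon> (THE z. z \<in> circles (diagram_of L) \<alpha> \<and> \<Union>z \<inter> (R' - R) = \<Union>w))))"

definition split_generators ::
  "link_diagram \<Rightarrow> (real \<Rightarrow> complex) \<Rightarrow> complex set \<Rightarrow> complex set
    \<Rightarrow> (nat set set \<times> kh_gen \<times> kh_gen) set" where
  "split_generators L C R R' =
     {(\<A>, x, y). \<A> \<in> NC (cut_number L C) \<and> x \<in> inner_generators (tangle_in L C R) \<A> \<and>
                 y \<in> generators (closing (tangle_in L C R') \<A>)}"

text \<open>
  The matrix of \<open>\<Oplus>\<^sub>\<A> id \<otimes> d\<^sup>\<A>\<close> on \<open>\<Oplus>\<^sub>\<A> \<C>(L \<inter> R)\<^sub>\<A> \<otimes> \<C>((L \<inter> R')\<^sup>\<A>)\<close>.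
\<close>

definition split_coeff ::
  "link_diagram \<Rightarrow> (real \<Rightarrow> complex) \<Rightarrow> complex set \<Rightarrow> complex rel
    \<Rightarrow> nat set set \<times> kh_gen \<times> kh_gen \<Rightarrow> nat set set \<times> kh_gen \<times> kh_gen \<Rightarrow> rat" where
  "split_coeff L C R' ord' = (\<lambda>(\<A>2, x2, y2) (\<A>1, x1, y1).
     if \<A>2 = \<A>1 \<and> x2 = x1 then kh_coeff (closing (tangle_in L C R') \<A>1) ord' y2 y1 else 0)"

text \<open>
  The horizontal differential \<open>\<Oplus>\<^sub>\<A> d\<^sub>1\<^sup>\<A> \<otimes> id\<close> is given in the second description; here
  it is transported to the first one.
\<close>

definition to_second ::
  "link_diagram \<Rightarrow> (real \<Rightarrow> complex) \<Rightarrow> complex set \<Rightarrow> complex set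
    \<Rightarrow> nat set set \<times> kh_gen \<times> kh_gen \<Rightarrow> nat set set \<times> kh_gen \<times> kh_gen" where
  "to_second L C R1 R2 = split_gen L C R2 R1 \<circ> inv_into (generators (diagram_of L)) (split_gen L C R1 R2)"

definition d_hor ::
  "link_diagram \<Rightarrow> (real \<Rightarrow> complex) \<Rightarrow> complex set \<Rightarrow> complex set \<Rightarrow> complex rel
    \<Rightarrow> (nat set set \<times> kh_gen \<times> kh_gen \<Rightarrow> rat) \<Rightarrow> (nat set set \<times> kh_gen \<times> kh_gen \<Rightarrow> rat)" where
  "d_hor L C R1 R2 ord1 = matrix_map (split_generators L C R1 R2)
     (\<lambda>y x. split_coeff L C R1 ord1 (to_second L C R1 R2 y) (to_second L C R1 R2 x))"

text \<open>
  The term \<open>\<Oplus>\<^sub>\<A> \<C>(L\<^sub>1)\<^sub>\<A>\<^sup>p \<otimes> Kh\<^sup>q(L\<^sub>2\<^sup>\<A>)\<close> in quantum degree \<open>j\<close>. By the definition of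
  \<^const>\<open>graded_tensor\<close> it is a subquotient of the column \<open>p\<close> of the double complex in its first
  description, so \<^const>\<open>d_hor\<close> induces maps between these spaces.
\<close>

definition vertical_cohomology ::
  "link_diagram \<Rightarrow> (real \<Rightarrow> complex) \<Rightarrow> complex set \<Rightarrow> complex set \<Rightarrow> complex rel
    \<Rightarrow> int \<Rightarrow> int \<Rightarrow> int \<Rightarrow> (nat set set \<times> kh_gen \<times> kh_gen) subq" where
  "vertical_cohomology L C R1 R2 ord2 q j p =
     direct_sum (NC (cut_number L C))
       (\<lambda>\<A>. graded_tensor (\<lambda>k. (inner_chains (tangle_in L C R1) \<A> p k, {0}))
                           (Kh (closing (tangle_in L C R2) \<A>) ord2 q) j)"

end

theory Submission imports Defs begin

text \<open>
 The complex of \<open>L\<close> has a basis of labelled states, bigraded by the numbers of crossings in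
 \<open>R1\<close> and in \<open>R2\<close> with smoothing 1. The number of crossings in \<open>R1\<close> filters it; the second page
 of a filtered complex is the cohomology of the horizontal part on that of the vertical part.
 It remains to recognise the two parts. The strands of a smoothed tangle in a disc match the boundary
 points, and by the Jordan curve theorem this matching is non crossing; hence the chords of its
 partition reconnect the other side as the tangle does, and a circle of the state of \<open>L\<close> is either inner or
 determined by its intersection with the other disc. Both differentials are then the parts of the
 differential of \<open>L\<close>, up to signs that come from comparing \<open>ord\<close> with the order in which all crossings in
 \<open>R2\<close> precede those in \<open>R1\<close>.
\<close>

text \<open>One planarity statement is used for two different curves. For the given cut it makes the
  matching of boundary points non crossing. For a small circle around a crossing it shows that, with
  the crossing removed, the two ends of a strand there are never paired with each other; therefore
  changing a smoothing always merges two circles or splits one, on which the square of the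
  differential and its degree rest. This is why cuts are studied without alternation of the
  directions: the small circle is met in the order in, in, out, out.

  Circles are recorded as sets of arcs, but the arcs of L run through the cut while those of the
  tangles end on it. Both are compared with circles of fine arcs, which are cut along C as well;
  \<open>kap\<close> sends a fine arc to the arc of L containing it.

  The horizontal differential agrees with its part of the differential of L only up to a sign given
  by the number of 1-smoothings in R2. This number is constant on a row, so the sign is invisible in
  cohomology.\<close>

section \<open>Plane topology: interleaved pairs of points on a Jordan curve\<close>

text \<open>Janiszewski's theorem for S Un P and T Un P, which meet in the connected set P. A ball
  around q2 avoids S Un P and meets both Q and W, so it joins x to y off that set; a ball around q1
  does the same for T Un P.\<close>

lemma theta_connected:
 fixes S T P Q W :: "complex set"
 assumes "compact S" "compact T" "compact P" "connected P" "S Int T \<subseteq> P"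
  and "connected Q" "Q Int (S Un T Un P) = {}" "connected W" "W Int (S Un T Un P) = {}"
  and "q1 : S" "q1 ~: T Un P" "q1 : closure Q" "q1 : closure W"
  and "q2 : T" "q2 ~: S Un P" "q2 : closure Q" "q2 : closure W"
  and "x : Q" "y : W"
 shows "connected_component (- (S Un T)) x y"
proof -
 have key: "connected_component (- K) x y"
  if K: "closed K" "q ~: K" "q : closure Q" "q : closure W" "Q Int K = {}" "W Int K = {}" for K q
 proof -
  from K(1,2) obtain e where e: "e > 0" "ball q e \<subseteq> - K"
   by (metis ComplI open_Compl open_contains_ball_eq)
  have "Q Int ball q e ~= {}" "W Int ball q e ~= {}"
   using K(3,4) e(1) by (metis centre_in_ball open_ball open_Int_closure_eq_empty disjoint_iff)+
  hence "connected (Q Un ball q e Un W)"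
   by (intro connected_Un assms) auto
  moreover have "Q Un ball q e Un W \<subseteq> - K" using K e by auto
  ultimately show ?thesis
   using assms unfolding connected_component_def by blast
 qed
 have "connected_component (- ((S Un P) Un (T Un P))) x y"
 proof (rule Janiszewski)
  show "compact (S Un P)" "closed (T Un P)"
   using assms by (auto intro: compact_imp_closed)
  have "(S Un P) Int (T Un P) = P" using assms(5) by auto
  thus "connected ((S Un P) Int (T Un P))" using assms by simp
  show "connected_component (- (S Un P)) x y"
   using assms by (intro key[of _ q2]) (auto intro: compact_imp_closed)
  show "connected_component (- (T Un P)) x y"
   using assms by (intro key[of _ q1]) (auto intro: compact_imp_closed)
 qed
 thus ?thesis
  by (rule connected_component_of_subset) auto
qed

text \<open>The curve cut at C t1 and C t2 forms a theta with P, and C t3 and C t4 lie on different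
  arcs of it. Both Q, inside U, and the whole other side W touch these two points, so
  \<open>theta_connected\<close> would join U to W off the curve.\<close>

lemma Jordan_separation:
 fixes C :: "real => complex"
 assumes C: "simple_path C" "pathfinish C = pathstart C"
  and t: "0 <= t1" "t1 < t3" "t3 < t2" "t2 < t4" "t4 < 1"
  and side: "{U, W} = {inside (path_image C), outside (path_image C)}"
  and P: "compact P" "connected P" "C t1 : P" "C t2 : P" "C t3 ~: P" "C t4 ~: P"
  and PU: "P \<subseteq> U Un path_image C"
  and Q: "connected Q" "Q \<subseteq> U" "Q Int P = {}" "C t3 : closure Q" "C t4 : closure Q"
 shows False
proof -
 define S where "S = C ` {t1..t2}"
 define T where "T = C ` ({0..t1} Un {t2..1})"
 have cont: "continuous_on {0..1} C" using C(1) by (simp add: simple_path_def path_def)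
 have inj: "C x = C y \<longleftrightarrow> x = y \<or> (x = 0 & y = 1) \<or> (x = 1 & y = 0)"
  if "x : {0..1}" "y : {0..1}" for x y
  using that C unfolding simple_path_def loop_free_def pathstart_def pathfinish_def by metis
 have ST: "S Un T = path_image C" unfolding S_def T_def path_image_def using t by force
 have disj: "U Int path_image C = {}" "W Int path_image C = {}" "U Int W = {}"
  using side inside_no_overlap[of "path_image C"] outside_no_overlap[of "path_image C"]
   inside_Int_outside[of "path_image C"] unfolding doubleton_eq_iff by blast+
 have Jordan: "connected W" "W ~= {}" "frontier W = path_image C"
  using Jordan_inside_outside[OF C] side by (auto simp: doubleton_eq_iff)
 obtain x where x: "x : Q" using Q(4) by fastforce
 obtain y where y: "y : W" using Jordan by auto
 have q: "C t3 : S" "C t3 ~: T" "C t4 : T" "C t4 ~: S"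
  unfolding S_def T_def using t inj by (auto simp: image_iff)
 have cl: "C t3 : closure W" "C t4 : closure W"
  using Jordan(3) ST q unfolding frontier_def by auto
 have "connected_component (- (S Un T)) x y"
 proof (rule theta_connected[of S T P Q W "C t3" "C t4"])
  show "compact S" "compact T" unfolding S_def T_def using t
   by (auto intro!: compact_continuous_image continuous_on_subset[OF cont] compact_Un)
  show "S Int T \<subseteq> P"
   unfolding S_def T_def using t inj P by (auto simp: image_iff)
  show "W Int (S Un T Un P) = {}" using PU disj ST by auto
  show "Q Int (S Un T Un P) = {}" using Q disj ST by auto
 qed (use assms Jordan x y q cl in auto)
 hence "connected_component (- path_image C) x y" using ST by simp
 \<comment> \<open>A connected set leading from U to W must meet the frontier of W, which is the
   curve.\<close>
 then obtain D where D: "connected D" "D \<subseteq> - path_image C" "x : D" "y : D"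
  unfolding connected_component_def by blast
 have "D Int frontier W = {}" using D Jordan by auto
 moreover have "y : D Int W" "x : D - W" using D y x Q disj by auto
 ultimately show False using connected_Int_frontier[OF D(1), of W] by blast
qed

section \<open>Counting edges and free ends in graphs\<close>

text \<open>Grow a vertex set from x0: every edge leaving it adds one vertex and at least one inner
  edge, so the bound survives until the component is exhausted. Taking a set of greatest size with
  this bound replaces the induction.\<close>

lemma card_connected_le:
 fixes f g :: "'k => 'v" and K :: "'k set"
 defines "R \<equiv> (%k. (f k, g k)) ` K Un ((%k. (f k, g k)) ` K)\<inverse>"
 assumes "finite K" "finite X" and X: "X = {x. (x0, x) : R\<^sup>*}"
 shows "card X <= card {k : K. f k : X} + 1"
proof -
 let ?E = "%Y. {k : K. f k : Y & g k : Y}"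
 let ?P = "%Y. Y \<subseteq> X & x0 : Y & card Y <= card (?E Y) + 1"
 have "?P {x0}" using X by auto
 moreover have "\<forall>Y. ?P Y --> card Y < Suc (card X)"
  using card_mono[OF assms(3)] le_imp_less_Suc by blast
 ultimately have "\<exists>Y. ?P Y & (\<forall>Z. ?P Z --> card Z <= card Y)"
  by (rule ex_has_greatest_nat)
 then obtain Y where Y: "?P Y" and max: "!!Z. ?P Z ==> card Z <= card Y" by blast
 have finY: "finite Y" using Y assms(3) finite_subset by blast
 have "Y = X"
 proof (rule ccontr)
  assume "Y ~= X"
  then obtain x where x: "x : X" "x ~: Y" using Y by auto
  have "\<exists>u v. (u, v) : R & u : Y & v ~: Y"
  proof (rule ccontr)
   assume no: "~ ?thesis"
   have "(x0, x) : R\<^sup>*" using x X by auto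
   hence "x : Y" by (induction rule: rtrancl_induct) (use no Y in auto)
   thus False using x by simp
  qed
  then obtain u v where uv: "(u, v) : R" "u : Y" "v ~: Y" by auto
  have "u : X" using Y uv by auto
  hence vX: "v : X" using uv(1) X by (auto intro: rtrancl.rtrancl_into_rtrancl)
  obtain k where k: "k : K" "(f k = u & g k = v) \<or> (f k = v & g k = u)"
   using uv(1) unfolding R_def by auto
  have "insert k (?E Y) \<subseteq> ?E (insert v Y)" using k uv by auto
  hence "card (insert k (?E Y)) <= card (?E (insert v Y))"
   using assms(2) by (intro card_mono) auto
  moreover have "card (insert k (?E Y)) = card (?E Y) + 1"
   using assms(2) k uv by (subst card_insert_disjoint) auto
  ultimately have "?P (insert v Y)" using Y vX uv finY by auto
  from max[OF this] show False using finY uv by simp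
 qed
 have "card (?E X) <= card {k : K. f k : X}" using assms(2) by (intro card_mono) auto
 thus ?thesis using Y \<open>Y = X\<close> by auto
qed

text \<open>
 Think of \<open>H\<close> as the set of ends of the arcs \<open>V\<close>, of \<open>K\<close> as gluings of pairs of ends.
\<close>

lemma unique_free_partner:
 fixes v :: "'h => 'v" and l r :: "'k => 'h"
 assumes fin: "finite V" "finite H" "finite K"
  and V: "v ` H \<subseteq> V" "!!e. e : V ==> card {h : H. v h = e} : {0, 2}"
  and inj: "inj_on l K" "inj_on r K" "l ` K Int r ` K = {}" "l ` K Un r ` K \<subseteq> H"
  and h: "h : H" "h ~: l ` K Un r ` K"
  and R: "R = (%k. (v (l k), v (r k))) ` K"
 shows "\<exists>!h'. h' : H - (l ` K Un r ` K) & h' ~= h & (v h, v h') : (R Un R\<inverse>)\<^sup>*"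
proof -
 define X where "X = {x. (v h, x) : (R Un R\<inverse>)\<^sup>*}"
 define F where "F = H - (l ` K Un r ` K)"
 have XV: "X \<subseteq> V"
 proof
  fix x assume "x : X"
  hence "(v h, x) : (R Un R\<inverse>)\<^sup>*" by (simp add: X_def)
  thus "x : V"
  proof (induction rule: rtrancl_induct)
   case base thus ?case using V h by blast
  next
   case (step y z)
   then obtain k where "k : K" "z = v (r k) \<or> z = v (l k)" unfolding R by auto
   thus ?case using V(1) inj(4) by (metis UnCI imageI subsetD)
  qed
 qed
 have finX: "finite X" using XV fin finite_subset by blast
 have cl: "x : X \<longleftrightarrow> y : X" if "(x, y) : R" for x y
  using that unfolding X_def by (auto intro: rtrancl.rtrancl_into_rtrancl)
 \<comment> \<open>Ends on the component X are free or glued in pairs, one pair for each edge. Each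
   arc has 0 or 2 ends, so the number of free ends is even and at most 2 card X - 2 card ?K, hence
   at most 2; as h is free, it is exactly 2.\<close>
 let ?K = "{k : K. v (l k) : X}"
 have "card X <= card ?K + 1"
  using card_connected_le[of K X "v h" "%k. v (l k)" "%k. v (r k)"] fin finX
  by (simp add: X_def R)
 have split: "{h : H. v h : X} = {h : F. v h : X} Un (l ` ?K Un r ` ?K)"
 proof -
  have "v (l k) : X \<longleftrightarrow> v (r k) : X" if "k : K" for k using cl that unfolding R by blast
  thus ?thesis using inj(4) unfolding F_def by blast
 qed
 have "card {h : H. v h : X} = card {h : F. v h : X} + card (l ` ?K Un r ` ?K)"
  unfolding split using fin by (intro card_Un_disjoint) (auto simp: F_def)
 also have "card (l ` ?K Un r ` ?K) = card (l ` ?K) + card (r ` ?K)"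
  using fin inj(3) by (intro card_Un_disjoint) auto
 finally have 0: "card {h : H. v h : X} = card {h : F. v h : X} + (card (l ` ?K) + card (r ` ?K))" .
 have "card (l ` ?K) = card ?K" "card (r ` ?K) = card ?K"
  by (rule card_image, rule inj_on_subset[OF inj(1)], blast)
   (rule card_image, rule inj_on_subset[OF inj(2)], blast)
 hence 1: "card {h : H. v h : X} = card {h : F. v h : X} + 2 * card ?K" using 0 by simp
 have "{h : H. v h : X} = (\<Union>e\<in>X. {h : H. v h = e})" by auto
 hence sum: "card {h : H. v h : X} = (\<Sum>e\<in>X. card {h : H. v h = e})"
  using finX fin by (subst card_UN_disjoint[symmetric]) auto
 have "even (card {h : H. v h : X})" unfolding sum using V(2) XV by (intro dvd_sum) fastforce
 moreover have "card {h : H. v h : X} <= (\<Sum>e\<in>X. 2)" unfolding sum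
  using V(2) XV by (intro sum_mono) fastforce
 ultimately have "even (card {h : F. v h : X})" "card {h : F. v h : X} <= 2"
  using 1 \<open>card X <= card ?K + 1\<close> by auto
 moreover have hF: "h : {h : F. v h : X}" using h by (auto simp: F_def X_def)
 moreover have finF: "finite {h : F. v h : X}" using fin by (auto simp: F_def)
 ultimately have "card {h : F. v h : X} = 2"
 proof -
  have "card {h : F. v h : X} ~= 0" using hF finF card_0_eq by blast
  moreover have "even c ==> c <= 2 ==> c ~= 0 ==> c = 2" for c :: nat by presburger
  ultimately show ?thesis using \<open>even (card {h : F. v h : X})\<close> \<open>card {h : F. v h : X} <= 2\<close>
   by blast
 qed
 then obtain a b where ab: "a ~= b" "{h : F. v h : X} = {a, b}" by (auto simp: card_2_iff)
 hence "\<exists>!h'. h' : {h : F. v h : X} & h' ~= h" using hF by auto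
 thus ?thesis unfolding X_def F_def by (simp add: conj_ac)
qed

lemma connected_subset_closed:
 assumes "connected d" "closed K1" "closed K2" "d \<subseteq> K1 Un K2" "d Int K1 Int K2 = {}" "d Int K1 ~= {}"
 shows "d \<subseteq> K1"
proof -
 have "K2 Int d = {}"
  using assms(1,2,3,4,5,6) unfolding connected_closed by blast
 thus ?thesis using assms by auto
qed

text \<open>The two closed sets cover X and are disjoint on X, so e is closed and open in X; being
  connected, it is a whole component. Arcs are recognised in this way.\<close>

lemma component_closed_pieces:
 assumes "connected e" "e ~= {}" "e \<subseteq> X" "closed K1" "closed K2" "X \<subseteq> K1 Un K2" "X Int K1 Int K2 = {}"
  and "X Int K1 = e"
 shows "e : components X"
proof -
 have "d = e" if d: "d ~= {}" "d \<subseteq> X" "e \<subseteq> d" "connected d" for d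
 proof -
  have "d Int K1 ~= {}" using d assms(2,8) by blast
  hence "d \<subseteq> K1" using connected_subset_closed[of d K1 K2] d assms(4-7) by blast
  thus "d = e" using d assms(8) by blast
 qed
 thus ?thesis unfolding in_components_maximal using assms(1-3) by blast
qed

lemma arc_unique:
 assumes "e : components X" "e' : components X"
  and "\<forall>\<^sub>F h in at_right (0::real). f h : e" "\<forall>\<^sub>F h in at_right 0. f h : e'"
 shows "e = e'"
proof -
 have "\<forall>\<^sub>F h in at_right 0. f h : e & f h : e'" using assms by (simp add: eventually_conj)
 then obtain h where "f h : e Int e'"
  using eventually_happens'[OF trivial_limit_at_right_real] by blast
 thus ?thesis using components_nonoverlap[OF assms(1,2)] by blast
qed

lemma bij_betw_finite_self: "finite A ==> f ` A \<subseteq> A ==> inj_on f A ==> bij_betw f A A"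
 by (simp add: bij_betw_def endo_inj_surj)

section \<open>Arcs of a link diagram\<close>

locale link =
 fixes L :: link_diagram
 assumes diag: "is_link_diagram L"
begin

abbreviation "CR \<equiv> crossing_points L"

abbreviation "NN \<equiv> components_number L"

lemma strand_derivative:
 assumes "i < NN"
 shows "(strand L i has_vector_derivative vector_derivative (strand L i) (at t)) (at t)"
  and "continuous_on UNIV (%t. vector_derivative (strand L i) (at t))"
proof -
 have "strand L i C1_differentiable_on UNIV" using diag assms by (simp add: is_link_diagram_def)
 then obtain D where D: "!!t. (strand L i has_vector_derivative D t) (at t)" "continuous_on UNIV D"
  unfolding C1_differentiable_on_def by auto
 have "vector_derivative (strand L i) (at t) = D t" for t
  using D(1) by (rule vector_derivative_at)
 thus "(strand L i has_vector_derivative vector_derivative (strand L i) (at t)) (at t)"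
  "continuous_on UNIV (%t. vector_derivative (strand L i) (at t))" using D by auto
qed

lemma isCont_strand: "i < NN ==> isCont (strand L i) t"
 using strand_derivative(1) has_vector_derivative_continuous by blast

lemma cont_strand: "i < NN ==> continuous_on A (strand L i)"
 using isCont_strand continuous_at_imp_continuous_on by blast

lemma strand_int: assumes "i < NN" shows "strand L i (t + of_int k) = strand L i t"
proof -
 have 1: "strand L i (t + 1) = strand L i t" for t using diag assms by (simp add: is_link_diagram_def)
 have 2: "strand L i (t + real n) = strand L i t" for t n
 proof (induction n)
  case (Suc n) thus ?case using 1[of "t + real n"] by (simp add: add_ac)
 qed simp
 show ?thesis
 proof (cases "k \<ge> 0")
  case True thus ?thesis using 2[of t "nat k"] by simp
 next
  case False thus ?thesis using 2[of "t + of_int k" "nat (-k)"] by simp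
 qed
qed

lemma strand_frac: "i < NN ==> strand L i (frac t) = strand L i t"
 using strand_int[of i t "- floor t"] by (simp add: frac_def)

lemma frac_pos: "i < NN ==> (i, frac t) : positions L" "pt L (i, t) = strand L i t"
 by (auto simp: positions_def pt_def frac_lt_1)

lemma trace_eq: "trace L = (\<Union>i<NN. strand L i ` {0..1})"
proof
 show "trace L \<subseteq> (\<Union>i<NN. strand L i ` {0..1})"
  unfolding trace_def positions_def pt_def by fastforce
 show "(\<Union>i<NN. strand L i ` {0..1}) \<subseteq> trace L"
 proof safe
  fix i t assume "i < NN"
  thus "strand L i t : trace L" unfolding trace_def
   using frac_pos[of i t] strand_frac[of i t] by (metis imageI pt_def fst_conv snd_conv)
 qed
qed

lemma strand_in_trace: "i < NN ==> strand L i t : trace L"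
 unfolding trace_def using frac_pos(1)[of i t] strand_frac[of i t] by (metis imageI pt_def fst_conv snd_conv)

lemma compact_strands: "compact (\<Union>i\<in>A Int {..<NN}. strand L i ` {0..1})"
 by (intro compact_UN finite_Int) (auto intro: compact_continuous_image cont_strand)

lemma strand_period: assumes "i < NN" "b = a + 1" shows "strand L i ` {a..b} = strand L i ` UNIV"
proof safe
 fix s :: real
 have "s - of_int \<lfloor>s - a\<rfloor> : {a..a+1}"
  using of_int_floor_le[of "s - a"] real_of_int_floor_add_one_gt[of "s - a"] by (simp only: atLeastAtMost_iff) linarith
 thus "strand L i s : strand L i ` {a..b}"
  using strand_int[OF assms(1), of s "- \<lfloor>s - a\<rfloor>"] assms(2) by (metis add_uminus_conv_diff imageI of_int_minus)
qed auto

lemma strand_inj: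
 assumes "i < NN" "j < NN" "strand L i s = strand L j t" "strand L i s ~: CR"
 shows "i = j" "frac s = frac t"
proof -
 have "(i, frac s) = (j, frac t)"
 proof (rule ccontr)
  assume "~ ?thesis"
  hence "((i, frac s), (j, frac t)) : double_points L"
   unfolding double_points_def using assms frac_pos strand_frac by (auto simp: pt_def)
  hence "pt L (i, frac s) : CR" unfolding crossing_points_def by force
  thus False using assms strand_frac by (simp add: pt_def)
 qed
 thus "i = j" "frac s = frac t" by auto
qed

lemma finite_crossings: "finite CR"
 using diag unfolding is_link_diagram_def crossing_points_def by auto

end

lemma frac_eq_int: assumes "frac s = frac (t::real)" obtains k :: int where "s = t + of_int k"
 using assms that[of "floor s - floor t"] by (simp add: frac_def)

text \<open>The same theory of arcs serves two sets M: the crossings alone give the arcs of L, the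
  crossings together with the cut give those of the tangles. M itself may be infinite; only its part
  on the diagram is finite.\<close>

locale marked = link +
 fixes M :: "complex set"
 assumes M: "crossing_points L \<subseteq> M" "finite (trace L Int M)"
begin

definition "mpos = {x : positions L. pt L x : M}"

lemma mposD: "x : mpos ==> fst x < NN" "x : mpos ==> snd x : {0..<1}"
 "x : mpos ==> strand L (fst x) (snd x) : M"
 by (auto simp: mpos_def positions_def pt_def)

lemma mposI: "i < NN ==> strand L i t : M ==> (i, frac t) : mpos"
 using frac_pos strand_frac by (auto simp: mpos_def pt_def)

text \<open>M contains finitely many points of the diagram, but a point can have several positions.
  Off the finitely many double points the position is determined by the point.\<close>

lemma finite_mpos: "finite mpos"
proof -
 let ?D = "fst ` double_points L"
 have "inj_on (pt L) (positions L - ?D)"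
 proof (rule inj_onI, rule ccontr)
  fix x y assume *: "x : positions L - ?D" "y : positions L - ?D" "pt L x = pt L y" "x ~= y"
  hence "(x, y) : double_points L" unfolding double_points_def by blast
  hence "x : ?D" by (metis fst_conv image_eqI)
  thus False using * by blast
 qed
 have "finite (mpos - ?D)"
 proof (rule finite_imageD[rotated])
  show "inj_on (pt L) (mpos - ?D)"
   by (rule inj_on_subset[OF \<open>inj_on (pt L) (positions L - ?D)\<close>]) (auto simp: mpos_def)
  show "finite (pt L ` (mpos - ?D))"
   by (rule finite_subset[OF _ M(2)]) (auto simp: mpos_def trace_def)
 qed
 moreover have "finite ?D" using diag by (auto simp: is_link_diagram_def)
 ultimately show ?thesis by simp
qed

lemma finite_marked_times:
 assumes "i < NN" shows "finite {s : {a..b}. strand L i s : M}"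
proof -
 have "{s : {a..b}. strand L i s : M} \<subseteq>
   (%(x, k). snd x + of_int k) ` (mpos \<times> {\<lfloor>a\<rfloor>..\<lfloor>b\<rfloor>})"
 proof
  fix s assume s: "s : {s : {a..b}. strand L i s : M}"
  hence "((i, frac s), \<lfloor>s\<rfloor>) : mpos \<times> {\<lfloor>a\<rfloor>..\<lfloor>b\<rfloor>}"
   using mposI assms by (auto intro: floor_mono)
  moreover have "s = (%(x, k). snd x + of_int k) ((i, frac s), \<lfloor>s\<rfloor>)" by (simp add: frac_def)
  ultimately show "s : (%(x, k). snd x + of_int k) ` (mpos \<times> {\<lfloor>a\<rfloor>..\<lfloor>b\<rfloor>})" by blast
 qed
 thus ?thesis using finite_mpos finite_subset by blast
qed

text \<open>The closed interval and the rest of the diagram are closed and cover everything. They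
  meet only in the marked end points, since a common unmarked point would have two
  positions.\<close>

lemma interval_component:
 assumes i: "i < NN" and ab: "a < b" "b <= a + 1" "strand L i a : M" "strand L i b : M"
  and un: "!!s. s : {a<..<b} ==> strand L i s ~: M"
 shows "strand L i ` {a<..<b} : components (trace L - M)"
proof (rule component_closed_pieces)
 let ?K1 = "strand L i ` {a..b}"
 let ?K2 = "strand L i ` {b..a+1} Un (\<Union>j\<in>(-{i}) Int {..<NN}. strand L j ` {0..1})"
 show "connected (strand L i ` {a<..<b})"
  by (intro connected_continuous_image cont_strand i) simp
 show "strand L i ` {a<..<b} ~= {}" using ab by simp
 show "strand L i ` {a<..<b} \<subseteq> trace L - M" using un strand_in_trace[OF i] by auto
 show "closed ?K1" by (intro compact_imp_closed compact_continuous_image cont_strand i) simp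
 show "closed ?K2" using compact_strands[of "-{i}"]
  by (intro closed_Un compact_imp_closed compact_continuous_image cont_strand i) auto
 show "trace L - M \<subseteq> ?K1 Un ?K2"
 proof
  fix z assume "z : trace L - M"
  then obtain j t where jt: "j < NN" "t : {0..1}" "z = strand L j t" unfolding trace_eq by auto
  show "z : ?K1 Un ?K2"
  proof (cases "j = i")
   case True
   hence "z : strand L i ` {a..a+1}" using strand_period[OF i, of "a+1" a] jt by auto
   then obtain s where "s : {a..a+1}" "z = strand L i s" by auto
   thus ?thesis by (cases "s <= b") auto
  next
   case False thus ?thesis using jt by (intro UnI2 UN_I[of j]) auto
  qed
 qed
 show "(trace L - M) Int ?K1 = strand L i ` {a<..<b}"
 proof -
  have "strand L i s : strand L i ` {a<..<b}" if "s : {a..b}" "strand L i s ~: M" for s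
  proof -
   have "s ~= a" "s ~= b" using that ab by auto
   thus ?thesis using that by auto
  qed
  thus ?thesis using un strand_in_trace[OF i] by fastforce
 qed
 show "(trace L - M) Int ?K1 Int ?K2 = {}"
 proof (rule ccontr)
  assume "~ ?thesis"
  then obtain z where z: "z ~: M" "z : ?K1" "z : ?K2" by auto
  from z(2) obtain s where s: "s : {a..b}" "z = strand L i s" by auto
  hence sab: "s ~= a" "s ~= b" using ab z by auto
  have zc: "z ~: CR" using z M by auto
  from z(3) consider t where "t : {b..a+1}" "z = strand L i t"
   | j t where "j < NN" "j ~= i" "z = strand L j t" by blast
  thus False
  proof cases
   case 1
   hence "frac s = frac t" using strand_inj[OF i i, of s t] s zc by auto
   then obtain k where k: "s = t + of_int k" by (rule frac_eq_int)
   \<comment> \<open>With the full period excluded, the integer k would lie strictly between -1 and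
     0.\<close>
   have "t ~= a + 1" using 1 z ab strand_int[OF i, of a 1] by auto
   hence "-1 < (of_int k :: real)" "(of_int k :: real) < 0" using k 1 s sab by auto
   thus False by (simp add: of_int_less_0_iff)
  next
   case 2 thus False using strand_inj(1)[OF i, of j s t] s zc by auto
  qed
 qed
qed

lemma arc_afterI:
 assumes "e : components (trace L - M)" "\<forall>\<^sub>F h in at_right 0. strand L (fst x) (snd x + h) : e"
 shows "arc_after L M x = e"
 unfolding arc_after_def using assms by (intro the_equality conjI assms) (elim conjE, erule arc_unique, auto)

lemma arc_beforeI:
 assumes "e : components (trace L - M)" "\<forall>\<^sub>F h in at_right 0. strand L (fst x) (snd x - h) : e"
 shows "arc_before L M x = e"
 unfolding arc_before_def using assms by (intro the_equality conjI assms) (elim conjE, erule arc_unique, auto)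

text \<open>The half-open window contains snd x + 1, where the strand is back at its marked start,
  so the minimum exists even if the curve carries no other mark.\<close>

definition next_time :: "nat \<times> real => real" where
 "next_time x = Min {s : {snd x<..snd x + 1}. strand L (fst x) s : M}"

definition nxt :: "nat \<times> real => nat \<times> real" where
 "nxt x = (fst x, frac (next_time x))"

lemma next_time:
 assumes x: "x : mpos"
 shows "snd x < next_time x" "next_time x <= snd x + 1" "strand L (fst x) (next_time x) : M"
  "s : {snd x<..<next_time x} ==> strand L (fst x) s ~: M"
proof -
 let ?A = "{s : {snd x<..snd x + 1}. strand L (fst x) s : M}"
 have i: "fst x < NN" using mposD x by auto
 have fin: "finite ?A" by (rule finite_subset[OF _ finite_marked_times[OF i, of "snd x" "snd x + 1"]]) auto
 have "snd x + 1 : ?A" using mposD(3)[OF x] strand_int[OF i, of "snd x" 1] by auto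
 hence "Min ?A : ?A" using fin by (metis (lifting) Min_in empty_iff)
 thus "snd x < next_time x" "next_time x <= snd x + 1" "strand L (fst x) (next_time x) : M"
  unfolding next_time_def by auto
 show "strand L (fst x) s ~: M" if "s : {snd x<..<next_time x}"
 proof
  assume "strand L (fst x) s : M"
  hence "s : ?A" using that \<open>next_time x <= snd x + 1\<close> by auto
  hence "next_time x <= s" unfolding next_time_def using fin by (rule Min_le[rotated])
  thus False using that by auto
 qed
qed

lemma arc_interval:
 assumes x: "x : mpos"
 shows "arc_after L M x = strand L (fst x) ` {snd x<..<next_time x}"
  and "arc_before L M (nxt x) = arc_after L M x"
  and "arc_after L M x : components (trace L - M)"
  and "nxt x : mpos" "pt L (nxt x) = strand L (fst x) (next_time x)"
  and "closure (arc_after L M x) = strand L (fst x) ` {snd x..next_time x}"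
proof -
 let ?e = "strand L (fst x) ` {snd x<..<next_time x}"
 have i: "fst x < NN" using mposD x by auto
 have comp: "?e : components (trace L - M)"
  using next_time[OF x] mposD[OF x] by (intro interval_component) auto
 have ev: "\<forall>\<^sub>F h in at_right 0. 0 < h & h < next_time x - snd x"
  unfolding eventually_at_right_field using next_time(1)[OF x]
  by (intro exI[of _ "next_time x - snd x"]) auto
 have "\<forall>\<^sub>F h in at_right 0. strand L (fst x) (snd x + h) : ?e"
  using ev by eventually_elim auto
 thus 1: "arc_after L M x = ?e" by (intro arc_afterI comp)
 thus "arc_after L M x : components (trace L - M)" using comp by simp
 have sh: "strand L (fst x) (frac (next_time x) - h) = strand L (fst x) (next_time x - h)" for h
  using strand_int[OF i, of "next_time x - h" "- \<lfloor>next_time x\<rfloor>"] by (simp add: frac_def algebra_simps)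
 have "\<forall>\<^sub>F h in at_right 0. strand L (fst (nxt x)) (snd (nxt x) - h) : ?e"
  using ev by eventually_elim (auto simp: nxt_def sh)
 thus "arc_before L M (nxt x) = arc_after L M x" unfolding 1 by (intro arc_beforeI comp)
 show "nxt x : mpos" using mposI[OF i next_time(3)[OF x]] by (simp add: nxt_def)
 show "pt L (nxt x) = strand L (fst x) (next_time x)" using strand_frac[OF i] by (simp add: nxt_def pt_def)
 show "closure (arc_after L M x) = strand L (fst x) ` {snd x..next_time x}" unfolding 1
 proof
  show "closure ?e \<subseteq> strand L (fst x) ` {snd x..next_time x}"
   by (intro closure_minimal compact_imp_closed compact_continuous_image cont_strand i) auto
  have "strand L (fst x) ` closure {snd x<..<next_time x} \<subseteq> closure ?e"
   by (intro image_closure_subset cont_strand i closure_subset) auto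
  thus "strand L (fst x) ` {snd x..next_time x} \<subseteq> closure ?e"
   using next_time(1)[OF x] by simp
 qed
qed

text \<open>Equal arcs share an unmarked point, so their parameters differ by an integer. If the
  starting parameters did not correspond, one marked start would lie in the open interval of the
  other arc.\<close>

lemma inj_arc_after: "inj_on (arc_after L M) mpos"
proof (rule inj_onI)
 fix x x' assume x: "x : mpos" and x': "x' : mpos" and eq: "arc_after L M x = arc_after L M x'"
 have i: "fst x < NN" "fst x' < NN" using mposD x x' by auto
 have "arc_after L M x ~= {}" using arc_interval(1)[OF x] next_time(1)[OF x] by simp
 then obtain s s' where s: "s : {snd x<..<next_time x}" "s' : {snd x'<..<next_time x'}"
  "strand L (fst x) s = strand L (fst x') s'"
  using eq arc_interval(1)[OF x] arc_interval(1)[OF x'] by (metis (no_types, opaque_lifting) equals0I imageE)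
 have nM: "strand L (fst x) s ~: CR" using next_time(4)[OF x s(1)] M by auto
 have ij: "fst x = fst x'" and "frac s = frac s'" using strand_inj[OF i s(3) nM] by auto
 then obtain k where k: "s = s' + of_int k" by (meson frac_eq_int)
 have sh: "strand L (fst x) (t + of_int m) : M \<longleftrightarrow> strand L (fst x) t : M" for t m
  using strand_int[OF i(1)] by simp
 have "~ snd x' + of_int k < snd x"
 proof
  assume "snd x' + of_int k < snd x"
  hence "snd x - of_int k : {snd x'<..<next_time x'}" using s k by auto
  thus False using next_time(4)[OF x', of "snd x - of_int k"] mposD(3)[OF x] sh[of "snd x" "-k"] ij by simp
 qed
 moreover have "~ snd x < snd x' + of_int k"
 proof
  assume "snd x < snd x' + of_int k"
  hence "snd x' + of_int k : {snd x<..<next_time x}" using s k by auto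
  thus False using next_time(4)[OF x] mposD(3)[OF x'] sh[of "snd x'" k] ij by simp
 qed
 ultimately have "snd x = snd x' + of_int k" by simp
 hence "\<bar>of_int k :: real\<bar> < 1" using mposD(2)[OF x] mposD(2)[OF x'] by auto
 hence "k = 0" by linarith
 thus "x = x'" using ij \<open>snd x = snd x' + of_int k\<close> by (simp add: prod_eq_iff)
qed

text \<open>On a finite set injectivity suffices: the arc before \<open>nxt x\<close> is the arc
  after x, and this arc determines x. Surjectivity provides the arc before any given mark.\<close>

lemma bij_nxt: "bij_betw nxt mpos mpos"
proof (rule bij_betw_finite_self[OF finite_mpos])
 show "inj_on nxt mpos"
  by (rule inj_onI) (metis arc_interval(2) inj_arc_after inj_on_def)
qed (use arc_interval in auto)

lemma nxtE: assumes "y : mpos" obtains x where "x : mpos" "y = nxt x"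
 using bij_nxt assms unfolding bij_betw_def by blast

lemma inj_arc_before: "inj_on (arc_before L M) mpos"
proof (rule inj_onI)
 fix y y' assume "y : mpos" "y' : mpos" and eq: "arc_before L M y = arc_before L M y'"
 then obtain x x' where "x : mpos" "y = nxt x" "x' : mpos" "y' = nxt x'" by (metis nxtE)
 thus "y = y'" using eq arc_interval(2) inj_onD[OF inj_arc_after] by metis
qed

lemma arc_before_component: "y : mpos ==> arc_before L M y : components (trace L - M)"
 by (metis nxtE arc_interval(2,3))

lemma arc_after_eventually:
 assumes "x : mpos" shows "\<forall>\<^sub>F h in at_right 0. strand L (fst x) (snd x + h) : arc_after L M x"
proof -
 have "\<forall>\<^sub>F h in at_right 0. 0 < h & h < next_time x - snd x"
  unfolding eventually_at_right_field using next_time(1)[OF assms]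
  by (intro exI[of _ "next_time x - snd x"]) auto
 thus ?thesis unfolding arc_interval(1)[OF assms] by eventually_elim auto
qed

lemma arc_before_eventually:
 assumes "y : mpos" shows "\<forall>\<^sub>F h in at_right 0. strand L (fst y) (snd y - h) : arc_before L M y"
proof -
 obtain x where x: "x : mpos" "y = nxt x" using assms nxtE by blast
 have i: "fst x < NN" using mposD x by auto
 have sh: "strand L (fst x) (frac (next_time x) - h) = strand L (fst x) (next_time x - h)" for h
  using strand_int[OF i, of "next_time x - h" "- \<lfloor>next_time x\<rfloor>"] by (simp add: frac_def algebra_simps)
 have "\<forall>\<^sub>F h in at_right 0. 0 < h & h < next_time x - snd x"
  unfolding eventually_at_right_field using next_time(1)[OF x(1)]
  by (intro exI[of _ "next_time x - snd x"]) auto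
 thus ?thesis unfolding x(2) arc_interval(2)[OF x(1)] arc_interval(1)[OF x(1)]
  by eventually_elim (auto simp: nxt_def sh)
qed

text \<open>Walk back from a point of e to the last mark on its curve; e is the arc starting there.
  A curve without marks is itself a component.\<close>

lemma component_cases:
 assumes e: "e : components (trace L - M)"
 obtains x where "x : mpos" "e = arc_after L M x"
 | i where "i < NN" "e = strand L i ` {0..1}"
proof -
 obtain p where p: "p : e" using e in_components_nonempty by blast
 have esub: "e \<subseteq> trace L - M" using e in_components_subset by blast
 then obtain i t where i: "i < NN" and pt: "p = strand L i t" using p unfolding trace_eq by auto
 have pM: "p ~: M" using p esub by auto
 show ?thesis
 proof (cases "\<exists>s. strand L i s : M")
  case True
  then obtain s0 where s0: "strand L i s0 : M" by auto
  \<comment> \<open>The translate of the mark s0 that lies within one period before t.\<close>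
  define s1 where "s1 = s0 + of_int \<lfloor>t - s0\<rfloor>"
  have s1: "s1 <= t" "t < s1 + 1" "strand L i s1 : M"
   unfolding s1_def using s0 strand_int[OF i] of_int_floor_le[of "t - s0"]
    real_of_int_floor_add_one_gt[of "t - s0"] by (linarith, linarith, simp)
  define A where "A = {s : {s1..t}. strand L i s : M}"
  have A: "finite A" "s1 : A" unfolding A_def using finite_marked_times[OF i] s1 by auto
  \<comment> \<open>The last mark not after t.\<close>
  define a where "a = Max A"
  have a: "a : A" "!!s. s : A ==> s <= a" unfolding a_def using A Max_in Max_ge by auto
  have aM: "strand L i a : M" "a <= t" using a A_def by auto
  define x where "x = (i, frac a)"
  have x: "x : mpos" unfolding x_def by (rule mposI[OF i aM(1)])
  have "t - of_int \<lfloor>a\<rfloor> : {snd x<..<next_time x}"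
  proof -
   have "t ~= a" using aM pM pt by auto
   moreover have "t < next_time x + of_int \<lfloor>a\<rfloor>"
   proof (rule ccontr)
    assume "~ ?thesis"
    moreover have "next_time x + of_int \<lfloor>a\<rfloor> > a" using next_time(1)[OF x] by (simp add: x_def frac_def)
    moreover have "strand L i (next_time x + of_int \<lfloor>a\<rfloor>) : M"
     using next_time(3)[OF x] strand_int[OF i] by (simp add: x_def)
    moreover have "s1 <= a" using a A by auto
    ultimately have "next_time x + of_int \<lfloor>a\<rfloor> : A" unfolding A_def by auto
    thus False using a(2) \<open>next_time x + of_int \<lfloor>a\<rfloor> > a\<close> by fastforce
   qed
   ultimately show ?thesis using aM by (auto simp: x_def frac_def)
  qed
  hence "strand L i (t - of_int \<lfloor>a\<rfloor>) : arc_after L M x"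
   unfolding arc_interval(1)[OF x] by (auto simp: x_def)
  hence "p : arc_after L M x" using pt strand_int[OF i, of t "- \<lfloor>a\<rfloor>"] by simp
  hence "e = arc_after L M x"
   using components_nonoverlap[OF e arc_interval(3)[OF x]] p by auto
  thus ?thesis using that(1) x by blast
 next
  case False
  have "strand L i ` {0..1} : components (trace L - M)"
  proof (rule component_closed_pieces)
   let ?K2 = "\<Union>j\<in>(-{i}) Int {..<NN}. strand L j ` {0..1}"
   show "connected (strand L i ` {0..1})" by (intro connected_continuous_image cont_strand i) simp
   show "strand L i ` {0..1} \<subseteq> trace L - M" using False strand_in_trace[OF i] by auto
   show "closed (strand L i ` {0..1})"
    by (intro compact_imp_closed compact_continuous_image cont_strand i) simp
   show "closed ?K2" using compact_strands[of "-{i}"] by (rule compact_imp_closed)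
   show "trace L - M \<subseteq> strand L i ` {0..1} Un ?K2" unfolding trace_eq by auto
   show "(trace L - M) Int strand L i ` {0..1} = strand L i ` {0..1}"
    using False strand_in_trace[OF i] by auto
   show "(trace L - M) Int strand L i ` {0..1} Int ?K2 = {}"
   proof (rule ccontr)
    assume "~ ?thesis"
    then obtain s j t where "j ~= i" "j < NN" "strand L i s = strand L j t" by blast
    thus False using strand_inj(1)[OF i, of j s t] False M(1) by blast
   qed
  qed auto
  moreover have "p : strand L i ` {0..1}" using pt strand_period[OF i, of 1 0] by auto
  ultimately have "e = strand L i ` {0..1}" using components_nonoverlap[OF e] p by blast
  thus ?thesis using that(2) i by blast
 qed
qed

lemma finite_components: "finite (components (trace L - M))"
proof (rule finite_subset)
 show "components (trace L - M) \<subseteq> arc_after L M ` mpos Un (%i. strand L i ` {0..1}) ` {..<NN}"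
  by (auto elim!: component_cases)
qed (use finite_mpos in auto)

end

section \<open>The diagram near a crossing\<close>

text \<open>Cramer's rule. The linear form Re (w * z) will be chosen positive along two prescribed
  branches at a crossing, which gives a half plane containing just these two.\<close>

lemma Re_functional:
 assumes "plane_det u v ~= 0"
 obtains w where "Re (w * u) = a" "Re (w * v) = b"
proof
 define D where "D = plane_det u v"
 let ?w = "Complex ((a * Im v - b * Im u) / D) (- ((b * Re u - a * Re v) / D))"
 have D: "D = Re u * Im v - Im u * Re v" "D ~= 0" using assms by (auto simp: D_def plane_det_def)
 have "Re (?w * u) = a * D / D" by (simp add: D(1) add_divide_distrib [symmetric] algebra_simps diff_divide_distrib [symmetric])
 thus "Re (?w * u) = a" using D by simp
 have "Re (?w * v) = b * D / D" by (simp add: D(1) add_divide_distrib [symmetric] algebra_simps diff_divide_distrib [symmetric])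
 thus "Re (?w * v) = b" using D by simp
qed

context link
begin

lemma double_pointD:
 assumes "(x, y) : double_points L"
 shows "fst x < NN" "fst y < NN" "snd x : {0..<1}" "snd y : {0..<1}" "x ~= y" "(y, x) : double_points L"
  "pt L x : CR" "pt L y = pt L x" "strand L (fst x) (snd x) = pt L x"
  "strand L (fst y) (snd y) = pt L x"
  "plane_det (tangent L x) (tangent L y) ~= 0"
proof -
 have *: "x : positions L" "y : positions L" "x ~= y" "pt L x = pt L y"
  using assms by (auto simp: double_points_def)
 thus "fst x < NN" "fst y < NN" "snd x : {0..<1}" "snd y : {0..<1}" "x ~= y" "pt L y = pt L x"
  "strand L (fst x) (snd x) = pt L x" "strand L (fst y) (snd y) = pt L x" "(y, x) : double_points L"
  by (auto simp: positions_def pt_def double_points_def)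
 show "pt L x : CR" using assms unfolding crossing_points_def by force
 show "plane_det (tangent L x) (tangent L y) ~= 0"
  using assms diag unfolding is_link_diagram_def by blast
qed

lemma double_point_third:
 assumes "(x, y) : double_points L" "z : positions L" "pt L z = pt L x"
 shows "z = x \<or> z = y"
proof (rule ccontr)
 assume *: "~ ?thesis"
 hence "(x, z) : double_points L" using assms by (auto simp: double_points_def)
 thus False using assms(1) * diag unfolding is_link_diagram_def by blast
qed

text \<open>The parameters bounded away from those of x and y form compact sets whose images miss
  the crossing point, because a third position over it is excluded.\<close>

lemma local_trace:
 assumes xy: "(x, y) : double_points L" and d: "de > 0"
 obtains r where "r > 0" "trace L Int ball (pt L x) r \<subseteq>
  strand L (fst x) ` {snd x - de<..<snd x + de} Un strand L (fst y) ` {snd y - de<..<snd y + de}"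
proof -
 note D = double_pointD[OF xy]
 let ?B = "%x. strand L (fst x) ` {snd x - de<..<snd x + de}"
 \<comment> \<open>The shifts by -1, 0 and 1 measure the distance to the parameters of x and y
   modulo the period.\<close>
 define A where "A k = {ta : {0..1}. \<forall>z\<in>{x, y}. k = fst z --> (\<forall>m\<in>{-1, 0, 1}. de <= \<bar>ta - snd z - of_int m\<bar>)}" for k
 have "compact (A k)" for k
 proof -
  have "A k = {0..1} Int (\<Inter>z\<in>{x, y}. if k = fst z then (\<Inter>m\<in>{-1::int, 0, 1}. {ta. de <= \<bar>ta - snd z - of_int m\<bar>}) else UNIV)"
   unfolding A_def by auto
  moreover have "closed {ta. de <= \<bar>ta - c - e\<bar>}" for c e :: real
   by (intro closed_Collect_le continuous_intros)
  moreover have "closed (if k = fst z then (\<Inter>m\<in>{-1::int, 0, 1}. {ta. de <= \<bar>ta - snd z - of_int m\<bar>}) else UNIV)" for z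
   using calculation(2) by (cases "k = fst z") (simp_all only: refl if_True if_False simp_thms closed_UNIV closed_INT ball_triv)
  ultimately show ?thesis by (metis (no_types, lifting) compact_Int_closed closed_INT compact_Icc)
 qed
 hence "closed (\<Union>k<NN. strand L k ` A k)"
  by (intro compact_imp_closed compact_UN compact_continuous_image cont_strand) auto
 moreover have "pt L x ~: (\<Union>k<NN. strand L k ` A k)"
 proof
  assume "pt L x : (\<Union>k<NN. strand L k ` A k)"
  then obtain k ta where k: "k < NN" "ta : A k" "strand L k ta = pt L x" by auto
  hence "(k, frac ta) = x \<or> (k, frac ta) = y"
   using double_point_third[OF xy, of "(k, frac ta)"] frac_pos strand_frac by (simp add: pt_def)
  then obtain z where z: "z : {x, y}" "k = fst z" "frac ta = snd z" by auto
  have "\<lfloor>ta\<rfloor> : {-1, 0, 1}" using k(2) by (auto simp: A_def floor_eq_iff)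
  moreover have "ta - snd z - of_int \<lfloor>ta\<rfloor> = 0" using z(3) by (simp add: frac_def)
  moreover have "\<forall>m\<in>{-1, 0, 1}. de <= \<bar>ta - snd z - of_int m\<bar>"
   using k(2) z(1,2) unfolding A_def by blast
  ultimately have "de <= \<bar>0::real\<bar>" by force
  thus False using d by simp
 qed
 ultimately obtain r where r: "r > 0" "ball (pt L x) r \<subseteq> - (\<Union>k<NN. strand L k ` A k)"
  unfolding closed_def open_contains_ball by blast
 have "trace L Int ball (pt L x) r \<subseteq> ?B x Un ?B y"
 proof
  fix p assume p: "p : trace L Int ball (pt L x) r"
  then obtain k ta where k: "k < NN" "ta : {0..1}" "p = strand L k ta" unfolding trace_eq by auto
  have "ta ~: A k"
  proof
   assume "ta : A k"
   hence "p : (\<Union>k<NN. strand L k ` A k)" using k by blast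
   thus False using p r(2) by blast
  qed
  then obtain z m where z: "z : {x, y}" "k = fst z" "m : {-1, 0, 1::int}" "\<bar>ta - snd z - of_int m\<bar> < de"
   using k(2) unfolding A_def by fastforce
  have "p = strand L (fst z) (ta - of_int m)" using k z strand_int[OF k(1), of ta "-m"] by simp
  moreover have "ta - of_int m : {snd z - de<..<snd z + de}" using z(4) by auto
  ultimately have "p : ?B z" by blast
  thus "p : ?B x Un ?B y" using z(1) by auto
 qed
 thus thesis using that r by blast
qed

lemma functional_sign:
 assumes x: "fst x < NN" and w: "Re (w * tangent L x) * s > 0"
 shows "\<exists>de>0. \<forall>h. 0 < h & h < de --> Re (w * (strand L (fst x) (snd x + h) - strand L (fst x) (snd x))) * s > 0
   & Re (w * (strand L (fst x) (snd x - h) - strand L (fst x) (snd x))) * s < 0"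
proof -
 let ?g = "%t. Re (w * (strand L (fst x) t - strand L (fst x) (snd x))) * s"
 have "((%t. Re (w * (strand L (fst x) t - strand L (fst x) (snd x)))) has_vector_derivative Re (w * tangent L x)) (at (snd x))"
 proof -
  have "bounded_linear (%z. Re (w * z))"
   by (intro bounded_linear_compose[OF bounded_linear_Re] bounded_linear_mult_right)
  moreover have "((%t. strand L (fst x) t - strand L (fst x) (snd x)) has_vector_derivative tangent L x) (at (snd x))"
   using strand_derivative(1)[OF x, of "snd x"] by (auto intro!: derivative_eq_intros simp: tangent_def)
  ultimately show ?thesis by (rule bounded_linear.has_vector_derivative)
 qed
 hence "((%t. Re (w * (strand L (fst x) t - strand L (fst x) (snd x)))) has_real_derivative Re (w * tangent L x)) (at (snd x))"
  by (simp add: has_real_derivative_iff_has_vector_derivative)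
 hence d: "(?g has_real_derivative Re (w * tangent L x) * s) (at (snd x))"
  by (rule DERIV_cmult_right)
 obtain d1 where d1: "d1 > 0" "\<forall>h>0. h < d1 --> ?g (snd x) < ?g (snd x + h)"
  using DERIV_pos_inc_right[OF d w] by blast
 obtain d2 where d2: "d2 > 0" "\<forall>h>0. h < d2 --> ?g (snd x - h) < ?g (snd x)"
  using DERIV_pos_inc_left[OF d w] by blast
 show ?thesis using d1 d2 by (intro exI[of _ "min d1 d2"]) auto
qed

end

context marked
begin

text \<open>A marked position with a direction is an end of an arc, \<open>True\<close> for the arc
  leaving and \<open>False\<close> for the arc arriving. These pairs are the ends that will be
  counted with \<open>unique_free_partner\<close>.\<close>

definition end_arc :: "nat \<times> real => bool => complex set" where
 "end_arc x b = (if b then arc_after L M x else arc_before L M x)"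

lemma end_arc_component: "x : mpos ==> end_arc x b : components (trace L - M)"
 by (simp add: end_arc_def arc_interval(3) arc_before_component)

lemma end_arc_eventually:
 assumes "x : mpos"
 shows "\<exists>de>0. \<forall>h. 0 < h & h < de --> strand L (fst x) (snd x + (if b then h else - h)) : end_arc x b"
 using arc_after_eventually[OF assms] arc_before_eventually[OF assms]
 by (auto simp: end_arc_def eventually_at_right_field)

text \<open>
 The four choices of signs give the four pairs of branches joined by the two smoothings of a
 crossing; the pair lies on one side of a line, so it can be joined off the rest of the diagram.
\<close>

lemma half_ball:
 assumes xy: "(x, y) : double_points L" and r: "r > 0"
 obtains N where "connected N" "N \<subseteq> ball (pt L x) r" "N Int trace L \<subseteq> end_arc x a Un end_arc y b"
  "N Int end_arc x a ~= {}" "N Int end_arc y b ~= {}"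
proof -
 note D = double_pointD[OF xy]
 define sg where "sg = (%c. if c then 1 else - 1 :: real)"
 \<comment> \<open>The signs make the form increase along the branch of x selected by a and that of
   y selected by b, and decrease along the two opposite branches.\<close>
 obtain w where w: "Re (w * tangent L x) = sg a" "Re (w * tangent L y) = sg b"
  using Re_functional[OF D(11)] by blast
 have mp: "x : mpos" "y : mpos" using xy D M(1) by (auto simp: mpos_def double_points_def)
 have branch: "\<exists>de>0. \<forall>h. 0 < h & h < de -->
   (\<forall>c'. (Re (w * (strand L (fst z) (snd z + sg c' * h) - pt L x)) > 0 \<longleftrightarrow> c' = c) &
    strand L (fst z) (snd z + sg c' * h) : end_arc z c')"
  if "z = x & c = a \<or> z = y & c = b" for z c
 proof -
  have z: "z : mpos" "fst z < NN" "Re (w * tangent L z) * sg c > 0" "strand L (fst z) (snd z) = pt L x"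
   using that mp D w by (auto simp: sg_def)
  obtain d1 where d1: "d1 > 0" "\<forall>h. 0 < h & h < d1 --> Re (w * (strand L (fst z) (snd z + h) - pt L x)) * sg c > 0
   & Re (w * (strand L (fst z) (snd z - h) - pt L x)) * sg c < 0"
   using functional_sign[OF z(2,3)] z(4) by auto
  obtain d2 where d2: "d2 > 0" "\<forall>h. 0 < h & h < d2 --> strand L (fst z) (snd z + (if True then h else - h)) : end_arc z True"
   using end_arc_eventually[OF z(1)] by blast
  obtain d3 where d3: "d3 > 0" "\<forall>h. 0 < h & h < d3 --> strand L (fst z) (snd z + (if False then h else - h)) : end_arc z False"
   using end_arc_eventually[OF z(1)] by blast
  show ?thesis
  proof (intro exI[of _ "min d1 (min d2 d3)"] conjI allI impI)
   fix h c' assume h: "0 < h & h < min d1 (min d2 d3)"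
   show "strand L (fst z) (snd z + sg c' * h) : end_arc z c'"
    using h d2 d3 by (cases c') (auto simp: sg_def)
   have "Re (w * (strand L (fst z) (snd z + h) - pt L x)) * sg c > 0"
    "Re (w * (strand L (fst z) (snd z - h) - pt L x)) * sg c < 0" using d1 h by auto
   thus "(Re (w * (strand L (fst z) (snd z + sg c' * h) - pt L x)) > 0) = (c' = c)"
    by (cases c; cases c') (auto simp: sg_def)
  qed (use d1 d2 d3 in auto)
 qed
 obtain da where da: "da > 0" "!!h c'. 0 < h ==> h < da ==>
   (Re (w * (strand L (fst x) (snd x + sg c' * h) - pt L x)) > 0 \<longleftrightarrow> c' = a) &
    strand L (fst x) (snd x + sg c' * h) : end_arc x c'"
  using branch[of x a] by auto
 obtain db where db: "db > 0" "!!h c'. 0 < h ==> h < db ==>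
   (Re (w * (strand L (fst y) (snd y + sg c' * h) - pt L x)) > 0 \<longleftrightarrow> c' = b) &
    strand L (fst y) (snd y + sg c' * h) : end_arc y c'"
  using branch[of y b] by auto
 define d where "d = min da db"
 have d0: "d > 0" using da db by (simp add: d_def)
 obtain r1 where r1: "r1 > 0" "trace L Int ball (pt L x) r1 \<subseteq>
  strand L (fst x) ` {snd x - d<..<snd x + d} Un strand L (fst y) ` {snd y - d<..<snd y + d}"
  using local_trace[OF xy d0] by blast
 \<comment> \<open>A half ball is convex, and near the crossing it meets only the two branches on
   its side; the crossing point itself is left out.\<close>
 define N where "N = ball (pt L x) (min r r1) Int {z. Re (w * (z - pt L x)) > 0}"
 have "convex {z. Re (w * (z - pt L x)) > 0}"
 proof -
  have "{z. Re (w * (z - pt L x)) > 0} = {z. (cnj w) \<bullet> z > Re (w * pt L x)}"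
   by (auto simp: inner_complex_def algebra_simps)
  thus ?thesis by (simp add: convex_halfspace_gt)
 qed
 hence conn: "connected N" unfolding N_def by (intro convex_connected convex_Int convex_ball)
 have meet: "N Int end_arc z c ~= {}" if "z = x & c = a \<or> z = y & c = b" for z c
 proof -
  have z: "fst z < NN" "strand L (fst z) (snd z) = pt L x" using that D by auto
  have "((%h. strand L (fst z) (snd z + sg c * h)) \<longlongrightarrow> pt L x) (at_right 0)"
  proof -
   have "((%h. snd z + sg c * h) \<longlongrightarrow> snd z) (at_right 0)" by (auto intro!: tendsto_eq_intros)
   hence "((%h. strand L (fst z) (snd z + sg c * h)) \<longlongrightarrow> strand L (fst z) (snd z)) (at_right 0)"
    using isCont_tendsto_compose[OF isCont_strand[OF z(1)]] by blast
   thus ?thesis using z by simp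
  qed
  hence "\<forall>\<^sub>F h in at_right 0. strand L (fst z) (snd z + sg c * h) : ball (pt L x) (min r r1)"
   using r r1 by (intro topological_tendstoD) auto
  moreover have "\<forall>\<^sub>F h in at_right 0. 0 < h & h < d"
   unfolding eventually_at_right_field using d0 by (intro exI[of _ d]) auto
  ultimately have "\<forall>\<^sub>F h in at_right 0. strand L (fst z) (snd z + sg c * h) : N Int end_arc z c"
  proof eventually_elim
   case (elim h)
   thus ?case using that da(2)[of h c] db(2)[of h c] by (auto simp: N_def d_def)
  qed
  thus ?thesis using eventually_happens'[OF trivial_limit_at_right_real] by blast
 qed
 have sub: "N Int trace L \<subseteq> end_arc x a Un end_arc y b"
 proof
  fix p assume p: "p : N Int trace L"
  hence "p : trace L Int ball (pt L x) r1" by (auto simp: N_def)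
  then obtain z t where z: "z = x \<or> z = y" "p = strand L (fst z) t" "t : {snd z - d<..<snd z + d}"
   using r1(2) by blast
  have pos: "Re (w * (p - pt L x)) > 0" using p by (simp add: N_def)
  have "t ~= snd z" using pos z D by auto
  define c' where "c' = (t > snd z)"
  define h where "h = \<bar>t - snd z\<bar>"
  have h: "0 < h" "h < d" "t = snd z + sg c' * h" using z(3) \<open>t ~= snd z\<close> by (auto simp: h_def c'_def sg_def)
  show "p : end_arc x a Un end_arc y b"
   using z(1) da(2)[of h c'] db(2)[of h c'] h pos z(2) by (auto simp: d_def)
 qed
 show thesis
 proof (rule that[OF conn _ sub])
  show "N \<subseteq> ball (pt L x) r" by (auto simp: N_def)
 qed (rule meet, simp)+
qed

text \<open>As \<open>arc_after\<close> and \<open>arc_before\<close> are injective, an arc between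
  marks has one end of each direction; a closed curve without marks has none.\<close>

lemma card_ends:
 assumes "e : components (trace L - M)"
 shows "card {h : mpos \<times> UNIV. (%(x, b). end_arc x b) h = e} : {0, 2}"
proof (cases "\<exists>x\<in>mpos. e = arc_after L M x")
 case True
 then obtain x where x: "x : mpos" "e = arc_after L M x" by auto
 have "(%(x, b). end_arc x b) h = e \<longleftrightarrow> h = (x, True) \<or> h = (nxt x, False)" if "h : mpos \<times> UNIV" for h
 proof -
  obtain z c where h: "h = (z, c)" "z : mpos" using \<open>h : mpos \<times> UNIV\<close> by (cases h) auto
  have "arc_after L M z = e \<longleftrightarrow> z = x"
   using inj_on_eq_iff[OF inj_arc_after h(2) x(1)] x(2) by simp
  moreover have "arc_before L M z = e \<longleftrightarrow> z = nxt x"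
   using inj_on_eq_iff[OF inj_arc_before h(2) arc_interval(4)[OF x(1)]] x(2) arc_interval(2)[OF x(1)] by simp
  ultimately show ?thesis unfolding h by (cases c) (simp_all add: end_arc_def)
 qed
 hence "{h : mpos \<times> UNIV. (%(x, b). end_arc x b) h = e} = {(x, True), (nxt x, False)}"
  using x(1) arc_interval(4)[OF x(1)] by blast
 thus ?thesis by simp
next
 case False
 have "end_arc z c ~= e" if z: "z : mpos" for z c
 proof (cases c)
  case True thus ?thesis using False z by (auto simp: end_arc_def)
 next
  case c: False
  obtain x where "x : mpos" "z = nxt x" using nxtE[OF z] by blast
  thus ?thesis using False c arc_interval(2)[of x] by (auto simp: end_arc_def)
 qed
 hence none: "{h : mpos \<times> UNIV. (%(x, b). end_arc x b) h = e} = {}" by auto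
 show ?thesis unfolding none by simp
qed

lemma closure_end_arc:
 assumes "e : components (trace L - M)" "p : closure e" "p ~: e"
 obtains x b where "x : mpos" "e = end_arc x b" "p = pt L x"
 using assms(1)
proof (cases rule: component_cases)
 case (1 x)
 then obtain t where t: "t : {snd x..next_time x}" "p = strand L (fst x) t"
  using arc_interval(6) assms(2) by auto
 hence "t = snd x \<or> t = next_time x"
  using assms(3) 1 arc_interval(1) by (metis atLeastAtMost_iff greaterThanLessThan_iff image_eqI order_le_less)
 thus ?thesis
 proof
  assume "t = snd x" thus ?thesis using that[of x True] 1 t by (simp add: end_arc_def pt_def)
 next
  assume "t = next_time x"
  thus ?thesis using that[of "nxt x" False] 1 t arc_interval[OF 1(1)] by (simp add: end_arc_def)
 qed
next
 case (2 i)
 hence "closed e" by (auto intro!: compact_imp_closed compact_continuous_image cont_strand)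
 thus ?thesis using assms by simp
qed

lemma end_in_closure:
 assumes "x : mpos" shows "pt L x : closure (end_arc x b)"
proof (cases b)
 case True
 thus ?thesis using arc_interval(6)[OF assms] next_time(1)[OF assms] by (auto simp: end_arc_def pt_def)
next
 case False
 obtain x' where "x' : mpos" "x = nxt x'" using nxtE assms by blast
 thus ?thesis using False arc_interval(2,5,6)[of x'] next_time(1)[of x'] by (auto simp: end_arc_def)
qed

lemma path_connected_closure:
 assumes "e : components (trace L - M)"
 shows "path_connected (closure e)" "compact (closure e)" "closure e \<subseteq> trace L"
proof -
 have "\<exists>i a b. i < NN & closure e = strand L i ` {a..b}"
  using assms
 proof (cases rule: component_cases)
  case (1 x) thus ?thesis using arc_interval(6) mposD by blast
 next
  case (2 i)
  hence "closed e" by (auto intro!: compact_imp_closed compact_continuous_image cont_strand)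
  thus ?thesis using 2 by auto
 qed
 then obtain i a b where i: "i < NN" "closure e = strand L i ` {a..b}" by auto
 show "path_connected (closure e)" unfolding i by (intro path_connected_continuous_image cont_strand i) simp
 show "compact (closure e)" unfolding i by (intro compact_continuous_image cont_strand i) simp
 show "closure e \<subseteq> trace L" unfolding i using strand_in_trace i by auto
qed

end

section \<open>Gluing arcs at crossings\<close>

abbreviation eqcl :: "'a rel => 'a rel" where
 "eqcl r \<equiv> (r Un r\<inverse>)\<^sup>*"

lemma eqcl_sym: "(x, y) : eqcl r ==> (y, x) : eqcl r"
 by (metis converse_Un converse_converse rtrancl_converseI sup_commute)

lemma eqcl_trans: "(x, y) : eqcl r ==> (y, z) : eqcl r ==> (x, z) : eqcl r"
 by (rule rtrancl_trans)

lemma eqcl_gen: "(x, y) : r ==> (x, y) : eqcl r"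
 by auto

lemma eqcl_mono: "r \<subseteq> s ==> eqcl r \<subseteq> eqcl s"
 by (intro rtrancl_mono) auto

lemma eqcl_induct [consumes 1, case_names refl step]:
 assumes "(x, y) : eqcl r" "P x"
  "!!y z. (x, y) : eqcl r ==> (y, z) : r \<or> (z, y) : r ==> P y ==> P z"
 shows "P y"
 using assms(1) by (induction rule: rtrancl_induct) (use assms in auto)

context link
begin

text \<open>A crossing has exactly two positions and only one of them is in
  \<open>over_positions\<close>, so both definite descriptions are meaningful.\<close>

lemma over_under_pos:
 assumes "c : CR"
 shows "(over_pos L c, under_pos L c) : double_points L" "pt L (over_pos L c) = c" "pt L (under_pos L c) = c"
  "over_pos L c ~= under_pos L c" "x : positions L ==> pt L x = c ==> x = over_pos L c \<or> x = under_pos L c"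
proof -
 obtain x y where xy: "(x, y) : double_points L" "pt L x = c"
  using assms unfolding crossing_points_def by auto
 have ov: "x : over_positions L \<longleftrightarrow> y ~: over_positions L"
  using diag xy(1) unfolding is_link_diagram_def by blast
 have *: "\<exists>x y. (x, y) : double_points L & pt L x = c & x : over_positions L & y ~: over_positions L"
 proof (cases "x : over_positions L")
  case True thus ?thesis using xy ov by blast
 next
  case False
  thus ?thesis using xy ov double_pointD(6,8)[OF xy(1)] by metis
 qed
 then obtain x y where xy: "(x, y) : double_points L" "pt L x = c" "x : over_positions L" "y ~: over_positions L"
  by blast
 have pos: "x : positions L" "y : positions L" "pt L y = c" using xy by (auto simp: double_points_def)
 have th: "z = x \<or> z = y" if "z : positions L" "pt L z = c" for z
  using double_point_third[OF xy(1)] that xy(2) by simp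
 have "over_pos L c = x" unfolding over_pos_def using xy pos th by (intro the_equality) blast+
 moreover have "under_pos L c = y" unfolding under_pos_def using xy pos th by (intro the_equality) blast+
 ultimately show "(over_pos L c, under_pos L c) : double_points L" "pt L (over_pos L c) = c" "pt L (under_pos L c) = c"
  "over_pos L c ~= under_pos L c" "x : positions L ==> pt L x = c ==> x = over_pos L c \<or> x = under_pos L c" for x
  using xy pos th double_pointD(5)[OF xy(1)] by auto
qed

lemma pos_inj_off_crossings:
 assumes "x : positions L" "y : positions L" "pt L x = pt L y" "pt L x ~: CR"
 shows "x = y"
proof (rule ccontr)
 assume "x ~= y"
 hence "(x, y) : double_points L" using assms by (auto simp: double_points_def)
 thus False using assms(4) double_pointD(7) by blast
qed

end

context marked
begin

text \<open>Over ends are glued to under ends. If \<open>si c\<close> holds, ends of equal direction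
  are glued, which is the smoothing inconsistent with the orientation; otherwise incoming ends are
  glued to outgoing ones. Restricting to a set X of crossings lets the same relation describe
  tangles.\<close>

definition srel :: "complex set => (complex => bool) => complex set rel" where
 "srel X si = (%(c, i). (end_arc (over_pos L c) i, end_arc (under_pos L c) (i = si c))) ` (X \<times> UNIV)"

lemma crossing_mpos:
 assumes "c : CR" shows "over_pos L c : mpos" "under_pos L c : mpos"
 using over_under_pos[OF assms] assms M(1) by (auto simp: mpos_def double_points_def)

lemma srelD:
 assumes "(e, f) : srel X si" "X \<subseteq> CR"
 obtains c i j where "c : X" "e = end_arc (over_pos L c) i" "f = end_arc (under_pos L c) j" "j = (i = si c)"
  "over_pos L c : mpos" "under_pos L c : mpos"
proof -
 obtain c i where "c : X" "e = end_arc (over_pos L c) i" "f = end_arc (under_pos L c) (i = si c)"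
  using assms(1) unfolding srel_def by auto
 thus thesis using that[of c i "i = si c"] crossing_mpos[of c] assms(2) by auto
qed

lemma srel_step:
 assumes "(e, f) : srel X si \<or> (f, e) : srel X si" "X \<subseteq> CR"
 obtains c i j where "c : X" "{e, f} = {end_arc (over_pos L c) i, end_arc (under_pos L c) j}"
  "c : closure e" "c : closure f"
proof -
 note goal = that
 have "thesis" if ef: "(e', f') : srel X si" "{e', f'} = {e, f}" for e' f'
 proof (rule srelD[OF ef(1) assms(2)])
  fix c i j assume c: "c : X" "e' = end_arc (over_pos L c) i" "f' = end_arc (under_pos L c) j"
   "over_pos L c : mpos" "under_pos L c : mpos"
  hence "c : closure e'" "c : closure f'"
   using end_in_closure[of "over_pos L c" i] end_in_closure[of "under_pos L c" j] over_under_pos[of c] assms(2) by auto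
  thus thesis using goal[of c i j] c(1,2,3) ef(2) by (auto simp: doubleton_eq_iff)
 qed
 thus thesis using assms(1) by (metis insert_commute)
qed

text \<open>\<open>unique_free_partner\<close> with the ends of arcs in V and two gluings for each
  crossing of X. The free ends are those at points outside X; following the strands pairs them
  off.\<close>

lemma srel_partner:
 assumes V: "V \<subseteq> components (trace L - M)" and X: "X \<subseteq> CR"
  and XV: "!!c i. c : X ==> end_arc (over_pos L c) i : V & end_arc (under_pos L c) i : V"
  and x: "x : mpos" "end_arc x b : V" "pt L x ~: X"
 shows "\<exists>!h. fst h : mpos & pt L (fst h) ~: X & case_prod end_arc h : V & h ~= (x, b)
  & (end_arc x b, case_prod end_arc h) : eqcl (srel X si)"
proof -
 define H where "H = {h : mpos \<times> UNIV. case_prod end_arc h : V}"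
 define K where "K = X \<times> (UNIV :: bool set)"
 define l where "l = (%(c, i::bool). (over_pos L c, i))"
 define r where "r = (%(c, i). (under_pos L c, i = si c))"
 have finX: "finite X" using X finite_crossings finite_subset by blast
 have pt: "pt L (over_pos L c) = c" "pt L (under_pos L c) = c" "over_pos L c ~= under_pos L c"
  "over_pos L c : mpos" "under_pos L c : mpos" if "c : X" for c
  using over_under_pos crossing_mpos X that by blast+
 have lr: "h : l ` K Un r ` K \<longleftrightarrow> pt L (fst h) : X" if "fst h : mpos" for h
 proof
  assume "h : l ` K Un r ` K"
  thus "pt L (fst h) : X" unfolding l_def r_def K_def using pt by auto
 next
  assume c: "pt L (fst h) : X"
  hence "fst h = over_pos L (pt L (fst h)) \<or> fst h = under_pos L (pt L (fst h))"
   using over_under_pos(5)[where c="pt L (fst h)" and x="fst h"] X that by (auto simp: mpos_def)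
  thus "h : l ` K Un r ` K"
  proof
   assume "fst h = over_pos L (pt L (fst h))"
   hence "h = l (pt L (fst h), snd h)" by (simp add: l_def prod_eq_iff)
   thus ?thesis using c by (auto simp: K_def)
  next
   assume "fst h = under_pos L (pt L (fst h))"
   hence "h = r (pt L (fst h), snd h = si (pt L (fst h)))" by (auto simp: r_def prod_eq_iff)
   thus ?thesis using c by (auto simp: K_def)
  qed
 qed
 have ex: "\<exists>!h'. h' : H - (l ` K Un r ` K) & h' ~= (x, b) &
   (case_prod end_arc (x, b), case_prod end_arc h') : (srel X si Un (srel X si)\<inverse>)\<^sup>*"
 proof (rule unique_free_partner)
  show "finite V" using V finite_components finite_subset by blast
  show "finite H" unfolding H_def using finite_mpos by auto
  show "finite K" unfolding K_def using finX by auto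
  show "case_prod end_arc ` H \<subseteq> V" by (auto simp: H_def)
  show "card {h : H. case_prod end_arc h = e} : {0, 2}" if "e : V" for e
  proof -
   have "{h : H. case_prod end_arc h = e} = {h : mpos \<times> UNIV. (%(x, b). end_arc x b) h = e}"
    using that by (auto simp: H_def)
   thus ?thesis using card_ends[of e] V that by auto
  qed
  show "inj_on l K"
  proof (rule inj_onI)
   fix k k' assume k: "k : K" "k' : K" "l k = l k'"
   hence "over_pos L (fst k) = over_pos L (fst k')" "snd k = snd k'"
    by (auto simp: l_def split_beta)
   moreover have "fst k = fst k'" using k calculation(1) pt(1) unfolding K_def by (metis mem_Times_iff)
   ultimately show "k = k'" by (auto simp: prod_eq_iff)
  qed
  show "inj_on r K"
  proof (rule inj_onI)
   fix k k' assume k: "k : K" "k' : K" "r k = r k'"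
   hence "under_pos L (fst k) = under_pos L (fst k')" "(snd k = si (fst k)) = (snd k' = si (fst k'))"
    by (auto simp: r_def split_beta)
   moreover have "fst k = fst k'" using k calculation(1) pt(2) unfolding K_def by (metis mem_Times_iff)
   ultimately show "k = k'" by (auto simp: prod_eq_iff)
  qed
  show "l ` K Int r ` K = {}"
  proof (rule ccontr)
   assume "~ ?thesis"
   then obtain h k k' where "k : K" "k' : K" "h = l k" "h = r k'" by blast
   then obtain c c' where "c : X" "c' : X" "over_pos L c = under_pos L c'"
    by (auto simp: l_def r_def K_def split_beta mem_Times_iff)
   thus False using pt(1,2,3) by metis
  qed
  show "l ` K Un r ` K \<subseteq> H" unfolding l_def r_def K_def H_def using XV pt by auto
  show "(x, b) : H" using x by (simp add: H_def)
  show "(x, b) ~: l ` K Un r ` K" using lr[of "(x, b)"] x by simp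
  show "srel X si = (%k. (case_prod end_arc (l k), case_prod end_arc (r k))) ` K"
   by (auto simp: srel_def l_def r_def K_def split_beta)
 qed
 have "h' : H - (l ` K Un r ` K) \<longleftrightarrow> fst h' : mpos & pt L (fst h') ~: X & case_prod end_arc h' : V" for h'
  using lr[of h'] unfolding H_def by (cases h'; cases "fst h' : mpos") auto
 thus ?thesis using ex by (simp only: case_prod_conv conj_assoc)
qed

text \<open>A closure adds only marked points, and these lie on no arc.\<close>

lemma closure_Int_arc:
 assumes "e : components (trace L - M)" "f : components (trace L - M)" "e Int closure f ~= {}"
 shows "e = f"
proof -
 obtain p where p: "p : e" "p : closure f" using assms(3) by auto
 have "p : f"
 proof (rule ccontr)
  assume "p ~: f"
  then obtain x where "x : mpos" "p = pt L x" using closure_end_arc[OF assms(2) p(2)] by metis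
  thus False using p(1) in_components_subset[OF assms(1)] by (auto simp: mpos_def)
 qed
 thus ?thesis using components_nonoverlap[OF assms(1,2)] p by auto
qed

end

section \<open>Strands on one side of a closed curve\<close>

text \<open>The directions need not alternate, and \<open>passes\<close> leaves open which side is
  entered, so that a small circle around a crossing is an instance as well.\<close>

locale cut = link +
 fixes C :: "real => complex"
 assumes simple: "simple_path C" "pathfinish C = pathstart C"
  and off: "path_image C Int crossing_points L = {}"
  and fin: "finite (trace L Int path_image C)"
  and passes: "!!x. x : positions L ==> pt L x : path_image C ==>
   \<exists>U W. {U, W} = {inside (path_image C), outside (path_image C)} &
    (\<forall>\<^sub>F h in at_right 0. strand L (fst x) (snd x - h) : U & strand L (fst x) (snd x + h) : W)"
begin

definition "MM = CR Un path_image C"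

sublocale marked L MM
proof
 show "finite (trace L Int MM)" using fin finite_crossings
  by (auto simp: MM_def Int_Un_distrib intro: finite_subset)
qed (auto simp: MM_def)

lemma mpos_iff: "x : mpos \<longleftrightarrow> x : positions L & (pt L x : CR \<or> pt L x : path_image C)"
 unfolding mpos_def by (auto simp: MM_def)

definition "is_side U \<longleftrightarrow> U = inside (path_image C) \<or> U = outside (path_image C)"

lemma sides:
 assumes "is_side U"
 shows "open U" "connected U" "frontier U = path_image C" "U Int path_image C = {}" "closure U \<subseteq> U Un path_image C"
proof -
 note J = Jordan_inside_outside[OF simple]
 show "open U" "connected U" "frontier U = path_image C" using J assms by (auto simp: is_side_def)
 thus "closure U \<subseteq> U Un path_image C" by (auto simp: frontier_def interior_open)
 show "U Int path_image C = {}" using assms inside_no_overlap[of "path_image C"] outside_no_overlap[of "path_image C"]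
  unfolding is_side_def by blast
qed

lemma arc_side:
 assumes "e : components (trace L - MM)"
 shows "e \<subseteq> inside (path_image C) \<or> e \<subseteq> outside (path_image C)" "e Int path_image C = {}"
proof -
 show *: "e Int path_image C = {}" using in_components_subset[OF assms] by (auto simp: MM_def)
 hence "e \<subseteq> inside (path_image C) Un outside (path_image C)"
  using inside_Un_outside by blast
 moreover have "open (inside (path_image C))" "open (outside (path_image C))"
  using sides(1) by (auto simp: is_side_def)
 moreover have "connected e" using assms in_components_connected by blast
 ultimately have "inside (path_image C) Int e = {} \<or> outside (path_image C) Int e = {}"
  using inside_Int_outside[of "path_image C"] unfolding connected_def by blast
 thus "e \<subseteq> inside (path_image C) \<or> e \<subseteq> outside (path_image C)"
  using \<open>e \<subseteq> _ Un _\<close> by blast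
qed

definition "bpos = {x : mpos. pt L x : path_image C}"

text \<open>By \<open>bpos_sides\<close> exactly one of the two ends at x lies on the side U, so the
  else branch again yields an arc in U.\<close>

definition barc :: "complex set => nat \<times> real => complex set" where
 "barc U x = (if end_arc x True \<subseteq> U then end_arc x True else end_arc x False)"

lemma end_arc_meets:
 assumes "x : mpos" "\<forall>\<^sub>F h in at_right 0. strand L (fst x) (snd x + (if b then h else - h)) : U"
 shows "end_arc x b Int U ~= {}"
proof -
 have "\<forall>\<^sub>F h in at_right 0. strand L (fst x) (snd x + (if b then h else - h)) : end_arc x b"
  using arc_after_eventually[OF assms(1)] arc_before_eventually[OF assms(1)] by (cases b) (simp_all add: end_arc_def)
 hence "\<forall>\<^sub>F h in at_right 0. strand L (fst x) (snd x + (if b then h else - h)) : end_arc x b Int U"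
  using assms(2) by eventually_elim simp
 thus ?thesis using eventually_happens'[OF trivial_limit_at_right_real] by blast
qed

lemma end_arc_side:
 assumes x: "x : mpos" and U: "is_side U" and "end_arc x b Int U ~= {}"
 shows "end_arc x b \<subseteq> U"
 using arc_side[OF end_arc_component[OF x, of b]] U assms(3) inside_Int_outside[of "path_image C"]
 unfolding is_side_def by blast

lemma bpos_sides:
 assumes x: "x : bpos" and U: "is_side U"
 shows "end_arc x True \<subseteq> U \<longleftrightarrow> ~ end_arc x False \<subseteq> U"
proof -
 have xm: "x : mpos" "x : positions L" "pt L x : path_image C" using x by (auto simp: bpos_def mpos_def)
 obtain A B where AB: "{A, B} = {inside (path_image C), outside (path_image C)}"
  "\<forall>\<^sub>F h in at_right 0. strand L (fst x) (snd x - h) : A & strand L (fst x) (snd x + h) : B"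
  using passes[OF xm(2,3)] by blast
 have sd: "is_side A" "is_side B" "A Int B = {}" "U = A \<or> U = B" using AB(1) U inside_Int_outside[of "path_image C"]
  unfolding is_side_def doubleton_eq_iff by blast+
 have "end_arc x False Int A ~= {}" "end_arc x True Int B ~= {}"
  by (rule end_arc_meets[OF xm(1)]; use AB(2) in eventually_elim; simp)+
 hence *: "end_arc x False \<subseteq> A" "end_arc x True \<subseteq> B" using end_arc_side[OF xm(1)] sd by blast+
 have "end_arc x False ~= {}" "end_arc x True ~= {}"
  using end_arc_component[OF xm(1)] in_components_nonempty by blast+
 thus ?thesis using * sd(3,4) by blast
qed

lemma barc:
 assumes "x : bpos" "is_side U"
 shows "barc U x \<subseteq> U" "barc U x : components (trace L - MM)" "end_arc x b \<subseteq> U \<longleftrightarrow> end_arc x b = barc U x"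
  "pt L x : closure (barc U x)"
proof -
 have x: "x : mpos" using assms by (simp add: bpos_def)
 show 1: "barc U x \<subseteq> U" using bpos_sides[OF assms] by (auto simp: barc_def)
 show "barc U x : components (trace L - MM)" using end_arc_component[OF x] by (auto simp: barc_def)
 show "pt L x : closure (barc U x)" using end_in_closure[OF x] by (auto simp: barc_def)
 show "end_arc x b \<subseteq> U \<longleftrightarrow> end_arc x b = barc U x"
  using 1 bpos_sides[OF assms] by (cases b) (auto simp: barc_def)
qed

text \<open>The strand tends to c and is eventually in the open set U; an arc does not meet the
  curve and so stays on one side.\<close>

lemma crossing_side:
 assumes c: "c : CR" "c : U" "is_side U" "x : positions L" "pt L x = c"
 shows "end_arc x b \<subseteq> U"
proof -
 have x: "x : mpos" using c by (auto simp: mpos_iff)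
 have i: "fst x < NN" using mposD x by auto
 have "((%h. strand L (fst x) (snd x + (if b then h else - h))) \<longlongrightarrow> c) (at_right 0)"
 proof -
  have "((%h. snd x + (if b then h else - h)) \<longlongrightarrow> snd x) (at_right 0)" by (cases b) (auto intro!: tendsto_eq_intros)
  hence "((%h. strand L (fst x) (snd x + (if b then h else - h))) \<longlongrightarrow> strand L (fst x) (snd x)) (at_right 0)"
   using isCont_tendsto_compose[OF isCont_strand[OF i]] by blast
  thus ?thesis using c by (simp add: pt_def)
 qed
 hence "\<forall>\<^sub>F h in at_right 0. strand L (fst x) (snd x + (if b then h else - h)) : U"
  using sides(1)[OF c(3)] c(2) by (rule topological_tendstoD)
 thus ?thesis using end_arc_meets[OF x] end_arc_side[OF x c(3)] by blast
qed

lemma crossing_side':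
 assumes "c : CR Int U" "is_side U"
 shows "end_arc (over_pos L c) b \<subseteq> U" "end_arc (under_pos L c) b \<subseteq> U"
 using crossing_side[of c U] over_under_pos[of c] assms by (auto simp: double_points_def)

lemma srel_side:
 assumes "(e, f) : eqcl (srel X si)" "X \<subseteq> CR Int U" "is_side U"
  "e : components (trace L - MM)" "e \<subseteq> U"
 shows "f : components (trace L - MM)" "f \<subseteq> U"
proof -
 have "f : components (trace L - MM) & f \<subseteq> U"
  using assms(1)
 proof (induction rule: eqcl_induct)
  case (step y z)
  have X: "X \<subseteq> CR" using assms by auto
  obtain c i j where c: "c : X" "{y, z} = {end_arc (over_pos L c) i, end_arc (under_pos L c) j}"
   using srel_step[OF step(2) X] by metis
  hence "c : CR Int U" using assms(2) by auto
  hence "end_arc (over_pos L c) i \<subseteq> U" "end_arc (under_pos L c) j \<subseteq> U"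
   "over_pos L c : mpos" "under_pos L c : mpos" using crossing_side'[OF _ assms(3)] crossing_mpos by auto
  thus ?case using c(2) end_arc_component[of "over_pos L c" i] end_arc_component[of "under_pos L c" j]
   unfolding doubleton_eq_iff by blast
 qed (use assms in auto)
 thus "f : components (trace L - MM)" "f \<subseteq> U" by auto
qed

lemma closure_boundary:
 assumes x: "x : bpos" and U: "is_side U" and e: "e : components (trace L - MM)" "e \<subseteq> U" "pt L x : closure e"
 shows "e = barc U x"
proof -
 have xp: "x : positions L" "pt L x : path_image C" using x by (auto simp: bpos_def mpos_def)
 have "pt L x ~: e" using arc_side(2)[OF e(1)] xp by auto
 then obtain x' b where x': "x' : mpos" "e = end_arc x' b" "pt L x = pt L x'"
  using closure_end_arc[OF e(1,3)] by metis
 have "pt L x ~: CR" using off xp(2) by blast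
 moreover have "x' : positions L" using x'(1) by (simp add: mpos_iff)
 ultimately have "x = x'" using pos_inj_off_crossings[OF xp(1) _ x'(3)] by blast
 thus ?thesis using barc(3)[OF x U, of b] x' e by auto
qed

text \<open>Different strands in U with interleaved ends would be disjoint connected sets P and Q,
  against \<open>Jordan_separation\<close>. As different strands still touch at crossings, P is
  taken closed, through the crossings, while Q is led past each crossing at one side.\<close>

lemma noncrossing:
 assumes U: "is_side U" and X: "X \<subseteq> CR Int U"
  and x: "x1 : bpos" "x2 : bpos" "x3 : bpos" "x4 : bpos"
  and t: "0 <= t1" "t1 < t3" "t3 < t2" "t2 < t4" "t4 < 1"
   "pt L x1 = C t1" "pt L x2 = C t2" "pt L x3 = C t3" "pt L x4 = C t4"
  and r: "(barc U x1, barc U x2) : eqcl (srel X si)" "(barc U x3, barc U x4) : eqcl (srel X si)"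
 shows "(barc U x1, barc U x3) : eqcl (srel X si)"
proof (rule ccontr)
 assume neq: "~ ?thesis"
 let ?E = "eqcl (srel X si)"
 have Xc: "X \<subseteq> CR" using X by auto
 obtain W where W: "{U, W} = {inside (path_image C), outside (path_image C)}"
  using U unfolding is_side_def by (metis insert_commute)
 define A where "A = {e. (barc U x1, e) : ?E}"
 have A: "e : components (trace L - MM)" "e \<subseteq> U" if "e : A" for e
  using srel_side[OF _ X U barc(2,1)[OF x(1) U]] that by (auto simp: A_def)
 have B: "e : components (trace L - MM)" "e \<subseteq> U" if "(barc U x3, e) : ?E" for e
  using srel_side[OF that X U barc(2,1)[OF x(3) U]] by auto
 have AB: "e Int closure f = {}" if "(barc U x3, e) : ?E" "f : A" for e f
 proof (rule ccontr)
  assume "~ ?thesis"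
  hence ef: "e = f" using closure_Int_arc[OF B(1)[OF that(1)] A(1)[OF that(2)]] by blast
  have "(barc U x1, f) : ?E" using that(2) by (simp add: A_def)
  thus False using neq eqcl_trans[OF _ eqcl_sym[OF that(1)[unfolded ef]]] by simp
 qed
 \<comment> \<open>P is a chain of closures of arcs; consecutive ones share the crossing where they
   are glued.\<close>
 have "\<exists>K. compact K & connected K & closure (barc U x1) Un closure (barc U x2) \<subseteq> K & K \<subseteq> (\<Union>e\<in>A. closure e)"
  using r(1)
 proof (induction rule: eqcl_induct)
  case refl
  have "compact (closure (barc U x1))" "connected (closure (barc U x1))"
   using path_connected_closure[OF barc(2)[OF x(1) U]] path_connected_imp_connected by blast+
  thus ?case by (intro exI[of _ "closure (barc U x1)"]) (auto simp: A_def)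
 next
  case (step e f)
  then obtain K where K: "compact K" "connected K" "closure (barc U x1) Un closure e \<subseteq> K" "K \<subseteq> (\<Union>e\<in>A. closure e)"
   by blast
  have fA: "f : A" using step by (auto simp: A_def intro: rtrancl.rtrancl_into_rtrancl)
  obtain c where c: "c : closure e" "c : closure f"
   using srel_step[OF step(2) Xc] by metis
  have "compact (closure f)" "connected (closure f)"
   using path_connected_closure[OF A(1)[OF fA]] path_connected_imp_connected by blast+
  moreover have "connected (K Un closure f)" using K(2,3) c calculation by (intro connected_Un) auto
  ultimately show ?case using K fA by (intro exI[of _ "K Un closure f"]) auto
 qed
 then obtain P where P: "compact P" "connected P" "closure (barc U x1) Un closure (barc U x2) \<subseteq> P" "P \<subseteq> (\<Union>e\<in>A. closure e)"
  by blast
 \<comment> \<open>Q consists of open arcs. At a crossing, two of them are linked by a half ball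
   that meets no other arc, so Q avoids the crossing points, which may belong to P.\<close>
 have "\<exists>K. connected K & barc U x3 Un barc U x4 \<subseteq> K & K \<subseteq> U & K Int P = {}"
  using r(2)
 proof (induction rule: eqcl_induct)
  case refl
  have "connected (barc U x3)" using barc(2)[OF x(3) U] in_components_connected by blast
  moreover have "barc U x3 Int P = {}" using AB[of "barc U x3"] P(4) by blast
  ultimately show ?case using barc(1)[OF x(3) U] by blast
 next
  case (step e f)
  then obtain K where K: "connected K" "barc U x3 Un e \<subseteq> K" "K \<subseteq> U" "K Int P = {}" by blast
  have ef: "(barc U x3, e) : ?E" "(barc U x3, f) : ?E" using step by (auto intro: rtrancl.rtrancl_into_rtrancl)
  obtain c i j where c: "c : X" "{e, f} = {end_arc (over_pos L c) i, end_arc (under_pos L c) j}"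
   using srel_step[OF step(2) Xc] by metis
  have cU: "c : CR" "c : U" using c X by auto
  obtain r where "r > 0" "ball c r \<subseteq> U" using sides(1)[OF U] cU(2) by (meson open_contains_ball_eq)
  then obtain N where N: "connected N" "N \<subseteq> U" "N Int trace L \<subseteq> e Un f" "N Int e ~= {}" "N Int f ~= {}"
  proof -
   obtain N where "connected N" "N \<subseteq> ball c r" "N Int trace L \<subseteq> end_arc (over_pos L c) i Un end_arc (under_pos L c) j"
    "N Int end_arc (over_pos L c) i ~= {}" "N Int end_arc (under_pos L c) j ~= {}"
    using half_ball[OF over_under_pos(1)[OF cU(1)] \<open>r > 0\<close>, of i j] over_under_pos(2)[OF cU(1)] by metis
   thus thesis using that[of N] c(2) \<open>ball c r \<subseteq> U\<close> unfolding doubleton_eq_iff by blast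
  qed
  have "P \<subseteq> trace L" using P(4) path_connected_closure(3) A(1) by blast
  hence "N Int P \<subseteq> (e Un f) Int P" using N(3) by blast
  also have "\<dots> = {}" using AB[OF ef(1)] AB[OF ef(2)] P(4) by blast
  finally have NP: "N Int P = {}" by blast
  have fc: "connected f" "f \<subseteq> U" using B[OF ef(2)] in_components_connected by blast+
  have "f Int P = {}" using AB[OF ef(2)] P(4) by blast
  moreover have "connected (K Un N Un f)" using K(1,2) N fc by (intro connected_Un) auto
  ultimately show ?case using K N NP fc by (intro exI[of _ "K Un N Un f"]) auto
 qed
 then obtain Q where Q: "connected Q" "barc U x3 Un barc U x4 \<subseteq> Q" "Q \<subseteq> U" "Q Int P = {}" by blast
 \<comment> \<open>A boundary point in P is adherent to an arc of the strand of x1, and by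
   \<open>closure_boundary\<close> the only such arc in U is its own.\<close>
 have notP: "pt L x ~: P" if "x : bpos" "(barc U x3, barc U x) : ?E" for x
 proof
  assume "pt L x : P"
  then obtain e where "e : A" "pt L x : closure e" using P(4) by blast
  hence "barc U x : A" using closure_boundary[OF that(1) U] A by metis
  hence "(barc U x1, barc U x) : ?E" by (simp add: A_def)
  thus False using neq eqcl_trans[OF _ eqcl_sym[OF that(2)]] by simp
 qed
 show False
 proof (rule Jordan_separation[OF simple t(1-5) W P(1,2)])
  show "C t1 : P" "C t2 : P" using P(3) barc(4)[OF x(1) U] barc(4)[OF x(2) U] t by auto
  show "C t3 ~: P" "C t4 ~: P" using notP[OF x(3)] notP[OF x(4)] r t by auto
  show "P \<subseteq> U Un path_image C"
  proof -
   have "closure e \<subseteq> U Un path_image C" if "e : A" for e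
    using closure_mono[OF A(2)[OF that]] sides(5)[OF U] by blast
   thus ?thesis using P(4) by blast
  qed
  have "closure (barc U x3) \<subseteq> closure Q" "closure (barc U x4) \<subseteq> closure Q" using Q(2) by (auto intro!: closure_mono)
  thus "C t3 : closure Q" "C t4 : closure Q" using barc(4)[OF x(3) U] barc(4)[OF x(4) U] t by auto
 qed (use Q in auto)
qed

text \<open>The crossings in U use up all ends on this side except those on the curve, so
  \<open>srel_partner\<close> pairs the boundary points.\<close>

lemma partner:
 assumes x: "x : bpos" and U: "is_side U"
 shows "\<exists>!x'. x' : bpos & x' ~= x & (barc U x, barc U x') : eqcl (srel (CR Int U) si)"
proof -
 let ?V = "{e : components (trace L - MM). e \<subseteq> U}"
 let ?X = "CR Int U"
 have xm: "x : mpos" using x by (simp add: bpos_def)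
 obtain b where b: "barc U x = end_arc x b" unfolding barc_def by (metis (full_types))
 have XV: "end_arc (over_pos L c) i : ?V & end_arc (under_pos L c) i : ?V" if "c : ?X" for c i
  using crossing_side'[OF that U] crossing_mpos[of c] that end_arc_component by blast
 have "pt L x ~: ?X" using x off by (auto simp: bpos_def)
 hence ex: "\<exists>!h. fst h : mpos & pt L (fst h) ~: ?X & case_prod end_arc h : ?V & h ~= (x, b)
  & (end_arc x b, case_prod end_arc h) : eqcl (srel ?X si)"
  using barc[OF x U] b by (intro srel_partner XV xm) auto
 \<comment> \<open>A free end in U is at a boundary point, since the ends at a crossing outside U
   lie on the other side.\<close>
 have iff: "x' : mpos & pt L x' ~: ?X & end_arc x' b' : ?V \<longleftrightarrow> x' : bpos & end_arc x' b' = barc U x'" for x' b'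
 proof
  assume *: "x' : mpos & pt L x' ~: ?X & end_arc x' b' : ?V"
  have "pt L x' : path_image C"
  proof (rule ccontr)
   assume "pt L x' ~: path_image C"
   hence c: "pt L x' : CR" using * by (auto simp: mpos_iff)
   hence nU: "pt L x' ~: U" using * by auto
   obtain W where W: "is_side W" "pt L x' : W" "U Int W = {}"
    using U \<open>pt L x' ~: path_image C\<close> nU inside_Un_outside[of "path_image C"] inside_Int_outside[of "path_image C"]
    unfolding is_side_def by (metis Compl_iff Un_iff inf_commute)
   have "end_arc x' b' \<subseteq> W" using * c W by (intro crossing_side[of "pt L x'"]) (auto simp: mpos_def)
   moreover have "end_arc x' b' ~= {}" using * end_arc_component in_components_nonempty by blast
   ultimately show False using W(3) * by blast
  qed
  hence "x' : bpos" using * by (simp add: bpos_def)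
  thus "x' : bpos & end_arc x' b' = barc U x'" using barc(3)[OF _ U, of x' b'] * by auto
 next
  assume *: "x' : bpos & end_arc x' b' = barc U x'"
  thus "x' : mpos & pt L x' ~: ?X & end_arc x' b' : ?V"
   using barc[of x' U] U off by (auto simp: bpos_def)
 qed
 \<comment> \<open>A boundary point has a single end in U, so uniqueness among ends becomes
   uniqueness among positions.\<close>
 have bu: "end_arc x' b1 = barc U x' ==> end_arc x' b2 = barc U x' ==> b1 = b2" if "x' : bpos" for x' b1 b2
  using bpos_sides[OF that U] barc(1)[OF that U] by (cases b1; cases b2) auto
 from ex obtain y c where yc: "y : bpos" "end_arc y c = barc U y" "(y, c) ~= (x, b)"
  "(end_arc x b, end_arc y c) : eqcl (srel ?X si)"
  and uniq: "!!y' c'. y' : bpos ==> end_arc y' c' = barc U y' ==> (y', c') ~= (x, b) ==>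
   (end_arc x b, end_arc y' c') : eqcl (srel ?X si) ==> y' = y"
 proof -
  let ?Q = "%h. fst h : mpos & pt L (fst h) ~: ?X & case_prod end_arc h : ?V & h ~= (x, b)
    & (end_arc x b, case_prod end_arc h) : eqcl (srel ?X si)"
  obtain h where h: "?Q h" and hu: "!!h'. ?Q h' ==> h' = h"
   using ex by (elim ex1E) blast
  obtain y c where yc: "h = (y, c)" by (cases h)
  show thesis
  proof (rule that[of y c])
   show "y' = y" if "y' : bpos" "end_arc y' c' = barc U y'" "(y', c') ~= (x, b)"
    "(end_arc x b, end_arc y' c') : eqcl (srel ?X si)" for y' c'
    using hu[of "(y', c')"] iff[of y' c'] that yc by simp
  qed (use h iff[of y c] yc in simp_all)
 qed
 show ?thesis
 proof (rule ex1I[of _ y])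
  show "y : bpos & y ~= x & (barc U x, barc U y) : eqcl (srel ?X si)"
   using yc b bu[OF x, of b c] by auto
  show "y' = y" if "y' : bpos & y' ~= x & (barc U x, barc U y') : eqcl (srel ?X si)" for y'
  proof -
   obtain c' where "barc U y' = end_arc y' c'" unfolding barc_def by (metis (full_types))
   thus ?thesis using uniq[of y' c'] that b by auto
  qed
 qed
qed

end

section \<open>Branches of a crossing on a small circle\<close>

text \<open>The squared distance has derivative 2 (f h - f 0) \<bullet> f' h, and the inner product
  is close to h times the squared speed at 0. It makes a short branch meet a small circle around the
  crossing only once.\<close>

lemma radius_increasing:
 fixes f :: "real => complex"
 assumes f: "!!h. (f has_vector_derivative f' h) (at h)" and c: "isCont f' 0" and a: "f' 0 ~= 0"
 shows "\<exists>et>0. \<forall>h h'. 0 <= h & h < h' & h' <= et --> norm (f h - f 0) < norm (f h' - f 0)"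
proof -
 define a where "a = f' 0"
 have "a ~= 0" using assms(3) by (simp add: a_def)
 hence "norm a / 4 > 0" by simp
 \<comment> \<open>Relative errors of 1/4 in position and velocity are good enough: 1 - 1/4 - 1/4 -
   1/16 is still positive.\<close>
 then obtain de where d: "de > 0" "!!h. \<bar>h\<bar> < de ==> norm (f' h - a) < norm a / 4"
  using c[unfolded continuous_at_eps_delta, rule_format, of "norm a / 4"] by (auto simp: a_def dist_norm)
 define et where "et = de / 2"
 have E: "norm (f h - f 0 - h *\<^sub>R a) <= norm a / 4 * h" if h: "0 <= h" "h <= et" for h
 proof -
  have "norm ((f h - h *\<^sub>R a) - (f 0 - 0 *\<^sub>R a)) <= norm a / 4 * norm (h - 0)"
  proof (rule differentiable_bound[of "{0..et}" "%h. f h - h *\<^sub>R a" "%x t. t *\<^sub>R (f' x - a)"])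
   show "((%h. f h - h *\<^sub>R a) has_derivative (%t. t *\<^sub>R (f' x - a))) (at x within {0..et})" for x
   proof -
    have "((%h. f h - h *\<^sub>R a) has_vector_derivative f' x - a) (at x)"
     using f[of x] by (auto intro!: derivative_eq_intros)
    thus ?thesis unfolding has_vector_derivative_def by (rule has_derivative_at_withinI)
   qed
   show "onorm (%t. t *\<^sub>R (f' x - a)) <= norm a / 4" if "x : {0..et}" for x
   proof (rule onorm_le)
    have "norm (f' x - a) <= norm a / 4"
     using that d(1) by (intro less_imp_le d(2)) (auto simp: et_def)
    thus "norm (t *\<^sub>R (f' x - a)) <= norm a / 4 * norm t" for t :: real
     using mult_left_mono[OF \<open>norm (f' x - a) <= norm a / 4\<close>, of "norm t"] by (simp add: mult_ac)
   qed
  qed (use h in auto)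
  thus ?thesis using h by (simp add: algebra_simps)
 qed
 have pos: "(f h - f 0) \<bullet> f' h > 0" if h: "0 < h" "h <= et" for h
 proof -
  define e1 e2 where "e1 = f h - f 0 - h *\<^sub>R a" and "e2 = f' h - a"
  have n1: "norm e1 <= norm a / 4 * h" using E[of h] h by (simp add: e1_def)
  have n2: "norm e2 <= norm a / 4" using d(2)[of h] h d(1) by (simp add: e2_def et_def)
  have "f h - f 0 = h *\<^sub>R a + e1" "f' h = a + e2" by (auto simp: e1_def e2_def)
  hence "(f h - f 0) \<bullet> f' h = h * (a \<bullet> a) + e1 \<bullet> a + h * (a \<bullet> e2) + e1 \<bullet> e2"
   by (simp add: inner_simps)
  moreover have "e1 \<bullet> a \<ge> - (norm a / 4 * h * norm a)"
   using Cauchy_Schwarz_ineq2[of e1 a] mult_right_mono[OF n1, of "norm a"] by simp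
  moreover have "h * (a \<bullet> e2) \<ge> - (h * (norm a * (norm a / 4)))"
  proof -
   have "\<bar>a \<bullet> e2\<bar> <= norm a * (norm a / 4)"
    using Cauchy_Schwarz_ineq2[of a e2] mult_left_mono[OF n2, of "norm a"] by simp
   thus ?thesis using h by (smt (verit) mult_left_mono mult_minus_right)
  qed
  moreover have "e1 \<bullet> e2 \<ge> - (norm a / 4 * h * (norm a / 4))"
   using Cauchy_Schwarz_ineq2[of e1 e2] mult_mono[OF n1 n2] h by simp
  moreover have "a \<bullet> a = norm a * norm a" by (simp add: power2_norm_eq_inner[symmetric] power2_eq_square)
  moreover have "h * (norm a * norm a) > 0" using h \<open>a ~= 0\<close> by simp
  ultimately show ?thesis by (simp add: algebra_simps)
 qed
 have "norm (f h - f 0) < norm (f h' - f 0)" if h: "0 <= h" "h < h'" "h' <= et" for h h'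
 proof -
  let ?g = "%t. (f t - f 0) \<bullet> (f t - f 0)"
  have der: "(?g has_real_derivative 2 * ((f t - f 0) \<bullet> f' t)) (at t)" for t
  proof -
   have "((%t. f t - f 0) has_vector_derivative f' t) (at t)"
    using f[of t] by (auto intro!: derivative_eq_intros)
   hence "(?g has_vector_derivative ((f t - f 0) \<bullet> f' t + f' t \<bullet> (f t - f 0))) (at t)"
    using bounded_bilinear.has_vector_derivative[OF bounded_bilinear_inner] by blast
   thus ?thesis by (simp add: has_real_derivative_iff_has_vector_derivative inner_commute)
  qed
  have "?g h < ?g h'"
  proof (rule DERIV_pos_imp_increasing_open[OF h(2)])
   show "\<exists>y. (?g has_real_derivative y) (at x) & y > 0" if "h < x" "x < h'" for x
    using der[of x] pos[of x] h that by (intro exI[of _ "2 * ((f x - f 0) \<bullet> f' x)"]) auto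
   show "continuous_on {h..h'} ?g"
    using der DERIV_isCont by (intro continuous_at_imp_continuous_on) blast
  qed
  thus ?thesis by (simp add: norm_eq_sqrt_inner)
 qed
 thus ?thesis using d(1) by (intro exI[of _ et]) (auto simp: et_def)
qed

lemma tendsto_sgn_derivative:
 fixes f :: "real => complex"
 assumes "(f has_vector_derivative a) (at 0)" "a ~= 0"
 shows "((%h. sgn (f h - f 0)) \<longlongrightarrow> sgn a) (at_right 0)"
proof -
 have lim: "((%h. norm (f h - f 0 - (h - 0) *\<^sub>R a) / norm (h - 0)) \<longlongrightarrow> 0) (at 0)"
  using assms(1) unfolding has_vector_derivative_def has_derivative_iff_norm by blast
 have eq: "norm (f h - f 0 - (h - 0) *\<^sub>R a) / norm (h - 0) = norm ((f h - f 0) /\<^sub>R (h - 0) - a)"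
  if "h ~= 0" for h
 proof -
  have "(f h - f 0) /\<^sub>R (h - 0) - a = (f h - f 0 - (h - 0) *\<^sub>R a) /\<^sub>R h"
   using that by (simp add: scaleR_diff_right)
  thus ?thesis by (simp add: divide_inverse)
 qed
 have "((%h. norm ((f h - f 0) /\<^sub>R (h - 0) - a)) \<longlongrightarrow> 0) (at 0)"
  by (rule Lim_transform_eventually[OF lim])
   (unfold eventually_at_filter, rule always_eventually, intro allI impI eq)
 hence "((%h. (f h - f 0) /\<^sub>R (h - 0)) \<longlongrightarrow> a) (at 0)"
  by (rule Lim_null[THEN iffD2, OF tendsto_norm_zero_cancel])
 hence "((%h. sgn ((f h - f 0) /\<^sub>R (h - 0))) \<longlongrightarrow> sgn a) (at_right 0)"
  using assms(2) by (intro tendsto_sgn) (auto intro: tendsto_within_subset)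
 moreover have "\<forall>\<^sub>F h in at_right (0::real). sgn ((f h - f 0) /\<^sub>R (h - 0)) = sgn (f h - f 0)"
  using eventually_at_right_less[of "0::real"] by eventually_elim (simp add: sgn_scaleR)
 ultimately show ?thesis by (rule Lim_transform_eventually)
qed

lemma plane_det_bound: "\<bar>plane_det a b\<bar> <= norm a * norm b"
proof -
 have "plane_det a b = Im (cnj a * b)" by (simp add: plane_det_def)
 thus ?thesis using abs_Im_le_cmod[of "cnj a * b"] by (simp add: norm_mult)
qed

lemma plane_det_add: "plane_det (a + b) c = plane_det a c + plane_det b c"
 "plane_det a (b + c) = plane_det a b + plane_det a c"
 "plane_det (- a) b = - plane_det a b" "plane_det a (- b) = - plane_det a b" "plane_det a a = 0"
 by (auto simp: plane_det_def algebra_simps)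

text \<open>
 Two crossing diameters of a circle have interleaved end points, and this persists under small
 perturbations.
\<close>

lemma interleaved_dets:
 assumes n: "norm u = 1" "norm v = 1" and D: "plane_det u v = D" and e: "0 < e" "e <= 1" "12 * e < 2 * \<bar>D\<bar>"
  and q: "norm (q1 + u) <= e" "norm (q3 - u) <= e" "norm (q2 + v) <= e" "norm (q4 - v) <= e"
 shows "plane_det (q3 - q1) (q2 - q1) * plane_det (q3 - q1) (q4 - q1) < 0"
proof -
 \<comment> \<open>q3 - q1 is nearly 2 u and q - q1 nearly w + u, so the determinant is nearly twice
   that of u and w. The errors add up to 4 e + 4 e + 4 e^2, which is at most 12 e.\<close>
 have est: "\<bar>plane_det (q3 - q1) (q - q1) - 2 * plane_det u w\<bar> <= 12 * e"
  if "norm w = 1" "norm (q - w) <= e" for q w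
 proof -
  define e1 e3 e4 where "e1 = q1 + u" and "e3 = q3 - u" and "e4 = q - w"
  have eqs: "q3 - q1 = (u + u) + (e3 - e1)" "q - q1 = (w + u) + (e4 - e1)" by (auto simp: e1_def e3_def e4_def)
  have "plane_det (q3 - q1) (q - q1) - 2 * plane_det u w =
    plane_det (u + u) (e4 - e1) + plane_det (e3 - e1) ((w + u) + (e4 - e1))"
   unfolding eqs by (simp add: plane_det_def algebra_simps)
  also have "\<bar>\<dots>\<bar> <= norm (u + u) * norm (e4 - e1) + norm (e3 - e1) * norm ((w + u) + (e4 - e1))"
   by (intro order_trans[OF abs_triangle_ineq] add_mono plane_det_bound)
  also have "\<dots> <= 2 * (2 * e) + (2 * e) * (2 + 2 * e)"
  proof -
   have 1: "norm (e4 - e1) <= 2 * e" "norm (e3 - e1) <= 2 * e"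
    using norm_triangle_ineq4[of e4 e1] norm_triangle_ineq4[of e3 e1] q that by (auto simp: e1_def e3_def e4_def)
   moreover have "norm (u + u) <= 2" "norm (w + u) <= 2"
    using norm_triangle_ineq[of u u] norm_triangle_ineq[of w u] n that by auto
   moreover have "norm ((w + u) + (e4 - e1)) <= 2 + 2 * e"
    using norm_triangle_ineq[of "w + u" "e4 - e1"] calculation by linarith
   ultimately show ?thesis using e(1) by (intro add_mono mult_mono) auto
  qed
  also have "\<dots> <= 12 * e" using e by (simp add: algebra_simps)
  finally show ?thesis .
 qed
 have "\<bar>plane_det (q3 - q1) (q4 - q1) - 2 * D\<bar> <= 12 * e" using est[of v q4] n q D by simp
 moreover have "\<bar>plane_det (q3 - q1) (q2 - q1) + 2 * D\<bar> <= 12 * e"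
  using est[of "-v" q2] n q D by (simp add: plane_det_add)
 ultimately show ?thesis using e(3) by (cases "D > 0") (auto simp: mult_less_0_iff)
qed

text \<open>Up to a common factor, the chord from z to the point of parameter s is sin (pi s) times
  the unit vector of angle pi s. The formula turns the side of a chord on which a point lies into
  the order of parameters.\<close>

lemma plane_det_circle:
 "plane_det (z * cis (2 * pi * s) - z) (z * cis (2 * pi * t) - z)
  = 4 * (norm z)\<^sup>2 * sin (pi * s) * sin (pi * t) * sin (pi * (t - s))"
proof -
 have c: "cis (2 * a) - 1 = 2 * \<i> * of_real (sin a) * cis a" for a
 proof -
  have "cis (2 * a) - 1 = (cis a - cis (- a)) * cis a" by (simp add: left_diff_distrib cis_mult)
  also have "cis a - cis (- a) = 2 * \<i> * of_real (sin a)" by (simp add: complex_eq_iff)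
  finally show ?thesis .
 qed
 have d: "z * cis (2 * pi * a) - z = (2 * \<i> * z) * of_real (sin (pi * a)) * cis (pi * a)" for a
 proof -
  have "z * cis (2 * pi * a) - z = z * (cis (2 * (pi * a)) - 1)" by (simp add: right_diff_distrib mult.assoc)
  thus ?thesis unfolding c by (simp add: mult_ac)
 qed
 have m: "plane_det (w * of_real a * x) (w * of_real b * y) = (norm w)\<^sup>2 * a * b * plane_det x y" for w x y a b
 proof -
  have det: "plane_det x y = Im (cnj x * y)" for x y by (simp add: plane_det_def)
  have "cnj (w * of_real a * x) * (w * of_real b * y) = of_real ((norm w)\<^sup>2) * (of_real (a * b) * (cnj x * y))"
   unfolding complex_norm_square by simp
  also have "\<dots> = of_real ((norm w)\<^sup>2 * a * b) * (cnj x * y)" by simp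
  finally have eq: "cnj (w * of_real a * x) * (w * of_real b * y) = of_real ((norm w)\<^sup>2 * a * b) * (cnj x * y)" .
  have "Im (of_real r * zz) = r * Im zz" for r zz by simp
  thus ?thesis unfolding det eq by blast
 qed
 have "plane_det (cis (pi * s)) (cis (pi * t)) = sin (pi * (t - s))"
  by (simp add: plane_det_def sin_diff right_diff_distrib algebra_simps)
 thus ?thesis unfolding d m by (simp add: norm_mult power_mult_distrib)
qed

section \<open>Coarse and fine arcs\<close>

text \<open>The prefix \<open>co\<close> marks the coarse arcs, ending only at crossings. In the
  presence of a cut the notions without prefix are about fine arcs, which end on C as well.\<close>

sublocale link \<subseteq> co: marked L "crossing_points L"
 by unfold_locales (use finite_crossings in auto)

context cut
begin

text \<open>As f is connected, every point of it gives the same coarse arc, so the choice does not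
  matter.\<close>

definition kap :: "complex set => complex set" where
 "kap f = connected_component_set (trace L - CR) (SOME p. p : f)"

lemma kap:
 assumes f: "f : components (trace L - MM)"
 shows "kap f : components (trace L - CR)" "f \<subseteq> kap f"
  and "e : components (trace L - CR) ==> e Int f ~= {} ==> kap f = e"
proof -
 have "f ~= {}" using f in_components_nonempty by blast
 hence p: "(SOME p. p : f) : f" by (simp add: some_in_eq)
 have sub: "f \<subseteq> trace L - CR" using in_components_subset[OF f] by (auto simp: MM_def)
 show 1: "kap f : components (trace L - CR)"
  unfolding kap_def components_def using p sub by blast
 show 2: "f \<subseteq> kap f" unfolding kap_def
  using p sub f in_components_connected by (intro connected_component_maximal) auto
 show "kap f = e" if "e : components (trace L - CR)" "e Int f ~= {}"
  using components_nonoverlap[OF 1 that(1)] that(2) 2 by auto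
qed

lemma co_mpos: "x : co.mpos ==> x : mpos"
 by (auto simp: co.mpos_def mpos_iff)

lemma eventually_meet:
 assumes "\<forall>\<^sub>F h in at_right (0::real). f h : A" "\<forall>\<^sub>F h in at_right 0. f h : B"
 shows "A Int B ~= {}"
proof -
 have "\<forall>\<^sub>F h in at_right 0. f h : A Int B" using assms by eventually_elim simp
 thus ?thesis using eventually_happens'[OF trivial_limit_at_right_real] by blast
qed

lemma kap_end_arc:
 assumes "x : co.mpos" shows "kap (end_arc x b) = co.end_arc x b"
proof (rule kap(3))
 have x: "x : mpos" using co_mpos assms .
 show "end_arc x b : components (trace L - MM)" using end_arc_component[OF x] .
 show "co.end_arc x b : components (trace L - CR)" using co.end_arc_component[OF assms] .
 show "co.end_arc x b Int end_arc x b ~= {}"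
  using eventually_meet[OF co.arc_after_eventually[OF assms] arc_after_eventually[OF x]]
   eventually_meet[OF co.arc_before_eventually[OF assms] arc_before_eventually[OF x]]
  by (cases b) (auto simp: end_arc_def co.end_arc_def)
qed

lemma kap_srel:
 assumes "(e, f) : eqcl (srel X si)" "X \<subseteq> CR"
 shows "(kap e, kap f) : eqcl (co.srel X si)"
 using assms(1)
proof (induction rule: eqcl_induct)
 case (step y z)
 have *: "(kap y, kap z) : co.srel X si" if yz: "(y, z) : srel X si" for y z
 proof -
  obtain c i where c: "c : X" "y = end_arc (over_pos L c) i" "z = end_arc (under_pos L c) (i = si c)"
   by (rule srelD[OF yz assms(2)]) blast
  hence "over_pos L c : co.mpos" "under_pos L c : co.mpos" using co.crossing_mpos assms(2) by auto
  hence "kap y = co.end_arc (over_pos L c) i" "kap z = co.end_arc (under_pos L c) (i = si c)"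
   using c kap_end_arc by auto
  thus ?thesis unfolding co.srel_def using c(1) by (intro image_eqI[of _ _ "(c, i)"]) auto
 qed
 from step(2) have "(kap y, kap z) : co.srel X si \<or> (kap z, kap y) : co.srel X si" using * by blast
 thus ?case using step(3) by (auto intro: rtrancl.rtrancl_into_rtrancl)
qed auto

end

context link
begin

definition branch :: "nat \<times> real => bool => real => complex" where
 "branch x b h = strand L (fst x) (snd x + (if b then h else - h))"

lemma branch_derivative:
 assumes "fst x < NN"
 shows "(branch x b has_vector_derivative (if b then 1 else -1) *\<^sub>R
   vector_derivative (strand L (fst x)) (at (snd x + (if b then h else - h)))) (at h)"
proof -
 have 1: "((%h. snd x + (if b then h else - h)) has_real_derivative (if b then 1 else -1)) (at h)"
  by (cases b) (auto intro!: derivative_eq_intros)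
 have "((strand L (fst x) \<circ> (%h. snd x + (if b then h else - h))) has_vector_derivative
   (if b then 1 else -1) *\<^sub>R vector_derivative (strand L (fst x)) (at (snd x + (if b then h else - h)))) (at h)"
  using 1 strand_derivative(1)[OF assms]
  by (intro vector_diff_chain_at) (simp_all add: has_real_derivative_iff_has_vector_derivative)
 thus ?thesis by (simp add: branch_def[abs_def] o_def)
qed

lemma branch_0: "branch x b 0 = pt L x"
 by (simp add: branch_def pt_def)

lemma tangent_nonzero: "fst x < NN ==> tangent L x ~= 0"
 using diag by (auto simp: is_link_diagram_def tangent_def)

lemma branch_radius:
 assumes "fst x < NN"
 shows "\<exists>et>0. \<forall>h h'. 0 <= h & h < h' & h' <= et --> norm (branch x b h - pt L x) < norm (branch x b h' - pt L x)"
proof -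
 let ?D = "%h. (if b then 1 else -1) *\<^sub>R vector_derivative (strand L (fst x)) (at (snd x + (if b then h else - h)))"
 have "isCont (%h. vector_derivative (strand L (fst x)) (at (snd x + (if b then h else - h)))) 0"
 proof (rule isCont_o2[where g = "%t. vector_derivative (strand L (fst x)) (at t)"])
  show "isCont (%h. snd x + (if b then h else - h)) 0" by (cases b) (auto intro!: continuous_intros)
  show "isCont (%t. vector_derivative (strand L (fst x)) (at t)) (snd x + (if b then 0 else - 0))"
   using strand_derivative(2)[OF assms] by (simp add: continuous_on_eq_continuous_at)
 qed
 hence "isCont ?D 0" by (intro continuous_intros)
 moreover have "?D 0 ~= 0" using tangent_nonzero[OF assms] by (simp add: tangent_def)
 ultimately show ?thesis
  using radius_increasing[of "branch x b" ?D, OF branch_derivative[OF assms]] by (simp add: branch_0)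
qed

lemma branch_direction:
 assumes "fst x < NN"
 shows "((%h. sgn (branch x b h - pt L x)) \<longlongrightarrow> (if b then 1 else -1) *\<^sub>R sgn (tangent L x)) (at_right 0)"
proof -
 have "(branch x b has_vector_derivative (if b then 1 else -1) *\<^sub>R tangent L x) (at 0)"
  using branch_derivative[OF assms, of b 0] by (cases b) (simp_all add: tangent_def)
 hence "((%h. sgn (branch x b h - branch x b 0)) \<longlongrightarrow> sgn ((if b then 1 else -1) *\<^sub>R tangent L x)) (at_right 0)"
  using tangent_nonzero[OF assms] by (intro tendsto_sgn_derivative) auto
 thus ?thesis by (cases b) (simp_all add: branch_0 sgn_minus)
qed

lemma continuous_branch: "fst x < NN ==> continuous_on A (branch x b)"
 by (intro continuous_at_imp_continuous_on ballI has_vector_derivative_continuous[OF branch_derivative])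

end

lemma plane_det_scaleR: "plane_det (a *\<^sub>R u) (b *\<^sub>R v) = a * b * plane_det u v"
 by (simp add: plane_det_def algebra_simps)

text \<open>The explicit parametrisation is what allows the order of points on the circle to be read
  off from determinants by \<open>plane_det_circle\<close>.\<close>

lemma circle_simple:
 fixes z c :: complex
 assumes "z ~= 0"
 defines "C \<equiv> %t. c + z * cis (2 * pi * t)"
 shows "simple_path C" "pathfinish C = pathstart C" "path_image C = sphere c (norm z)"
  "inside (path_image C) = ball c (norm z)" "outside (path_image C) = - cball c (norm z)"
  "w : sphere c (norm z) ==> \<exists>t. 0 <= t & t < 1 & w = C t"
proof -
 have cont: "continuous_on A C" for A unfolding C_def by (intro continuous_intros)
 have inj: "s = t \<or> s = 0 & t = 1 \<or> s = 1 & t = 0" if "s : {0..1}" "t : {0..1}" "C s = C t" for s t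
 proof -
  have "cis (2 * pi * s) = cis (2 * pi * t)" using that(3) assms(1) by (simp add: C_def)
  hence "cis (2 * pi * s) / cis (2 * pi * t) = 1" by (simp add: cis_neq_zero)
  hence "cis (2 * pi * s - 2 * pi * t) = 1" by (simp add: cis_divide)
  hence "cos (2 * pi * s - 2 * pi * t) = 1" by (metis cis.simps(1) one_complex.simps(1))
  then obtain n :: int where "2 * pi * s - 2 * pi * t = of_int n * 2 * pi" using cos_one_2pi_int by auto
  hence "pi * (s - t) = pi * of_int n" by (simp add: algebra_simps)
  hence "s - t = of_int n" by simp
  moreover hence "n : {-1, 0, 1}" using that(1,2) by auto
  ultimately show ?thesis using that(1,2) by auto
 qed
 show "simple_path C" unfolding simple_path_def path_def loop_free_def using cont inj by blast
 show "pathfinish C = pathstart C" by (simp add: pathfinish_def pathstart_def C_def)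
 show surj: "\<exists>t. 0 <= t & t < 1 & w = C t" if "w : sphere c (norm z)" for w
 proof -
  define u where "u = (w - c) / z"
  have u: "norm u = 1" "w = c + z * u" using that assms(1) by (auto simp: u_def norm_divide dist_norm norm_minus_commute)
  define t where "t = Arg2pi u / (2 * pi)"
  have "u = cis (Arg2pi u)" using Arg2pi[of u] u(1) unfolding is_Arg_def cis_conv_exp by simp
  hence "w = C t" using u(2) by (simp add: C_def t_def)
  moreover have "0 <= t" "t < 1" using Arg2pi[of u] by (auto simp: t_def field_simps)
  ultimately show ?thesis by blast
 qed
 show im: "path_image C = sphere c (norm z)"
 proof
  show "path_image C \<subseteq> sphere c (norm z)" by (auto simp: path_image_def C_def dist_norm norm_mult)
  show "sphere c (norm z) \<subseteq> path_image C" using surj unfolding path_image_def by fastforce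
 qed
 have fr: "path_image C = frontier (cball c (norm z))" using im by simp
 show "inside (path_image C) = ball c (norm z)"
  unfolding fr by (subst inside_frontier_eq_interior) auto
 show "outside (path_image C) = - cball c (norm z)"
  unfolding fr by (subst outside_frontier_eq_complement_closure) auto
qed

context link
begin

text \<open>Outside a small circle around c the hypotheses join the two over branches to each other,
  and likewise the two under branches. Since the tangents are transversal, these pairs are
  interleaved on the circle, so \<open>noncrossing\<close> puts both into one class.\<close>

lemma crossing_separates:
 assumes c: "c : CR"
  and X: "(co.end_arc (over_pos L c) False, co.end_arc (over_pos L c) True) : eqcl (co.srel (CR - {c}) si)"
  and Y: "(co.end_arc (under_pos L c) False, co.end_arc (under_pos L c) True) : eqcl (co.srel (CR - {c}) si)"
 shows "(co.end_arc (over_pos L c) False, co.end_arc (under_pos L c) False) : eqcl (co.srel (CR - {c}) si)"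
proof (rule ccontr)
 assume neg: "~ ?thesis"
 let ?E = "eqcl (co.srel (CR - {c}) si)"
 define x where "x = over_pos L c"
 define y where "y = under_pos L c"
 have xy: "(x, y) : double_points L" "pt L x = c" "pt L y = c" "x ~= y"
  using over_under_pos[OF c] by (auto simp: x_def y_def)
 have mp: "x : co.mpos" "y : co.mpos" using co.crossing_mpos[OF c] by (auto simp: x_def y_def)
 have NNz: "fst x < NN" "fst y < NN" using co.mposD mp by auto
 define s where "s = (%b. if b then 1 else - 1 :: real)"
 define D where "D = plane_det (sgn (tangent L x)) (sgn (tangent L y))"
 have tn: "tangent L x ~= 0" "tangent L y ~= 0" using tangent_nonzero NNz by auto
 have "D ~= 0" using double_pointD(11)[OF xy(1)] tn by (simp add: D_def sgn_div_norm plane_det_scaleR)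
 \<comment> \<open>12 e is at most the absolute value of D, hence less than twice it, as
   \<open>interleaved_dets\<close> requires.\<close>
 define e where "e = min 1 (\<bar>D\<bar> / 12)"
 have e: "0 < e" "e <= 1" "12 * e < 2 * \<bar>D\<bar>" using \<open>D ~= 0\<close> by (auto simp: e_def min_def)
 \<comment> \<open>Up to time et the branch moves strictly away from c, stays on its arc and keeps
   the direction of its tangent up to e.\<close>
 define P where "P z b et \<longleftrightarrow> (\<forall>h h'. 0 <= h & h < h' & h' <= et --> norm (branch z b h - c) < norm (branch z b h' - c)) &
   (\<forall>h. 0 < h & h < et --> branch z b h : co.end_arc z b &
    norm (sgn (branch z b h - c) - s b *\<^sub>R sgn (tangent L z)) <= e)" for z b et
 have Pex: "\<exists>et>0. P z b et" if "z = x \<or> z = y" for z b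
 proof -
  have z: "z : co.mpos" "fst z < NN" "pt L z = c" using that mp NNz xy by auto
  obtain d1 where d1: "d1 > 0" "\<forall>h h'. 0 <= h & h < h' & h' <= d1 --> norm (branch z b h - c) < norm (branch z b h' - c)"
   using branch_radius[OF z(2)] z(3) by blast
  obtain d2 where d2: "d2 > 0" "\<forall>h. 0 < h & h < d2 --> branch z b h : co.end_arc z b"
   using co.end_arc_eventually[OF z(1)] unfolding branch_def by blast
  have "\<forall>\<^sub>F h in at_right 0. dist (sgn (branch z b h - c)) (s b *\<^sub>R sgn (tangent L z)) < e"
   using branch_direction[OF z(2), of b] z(3) e(1) unfolding s_def by (metis tendstoD)
  then obtain d3 where d3: "d3 > 0" "\<forall>h. 0 < h & h < d3 --> norm (sgn (branch z b h - c) - s b *\<^sub>R sgn (tangent L z)) <= e"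
   unfolding eventually_at_right_field dist_norm by (metis less_imp_le)
  show ?thesis unfolding P_def using d1 d2 d3 by (intro exI[of _ "min d1 (min d2 d3)"]) auto
 qed
 have Pmono: "P z b et'" if "P z b et" "et' <= et" for z b et et'
  using that unfolding P_def by auto
 have "\<exists>et>0. \<forall>z\<in>{x, y}. \<forall>b. P z b et"
 proof -
  obtain a1 a2 a3 a4 where a: "a1 > 0" "P x True a1" "a2 > 0" "P x False a2" "a3 > 0" "P y True a3" "a4 > 0" "P y False a4"
   using Pex by metis
  have "P z b (min (min a1 a2) (min a3 a4))" if "z : {x, y}" for z b
   using that a by (cases b) (auto intro: Pmono)
  moreover have "min (min a1 a2) (min a3 a4) > 0" using a by simp
  ultimately show ?thesis by blast
 qed
 then obtain et where et: "et > 0" "!!z b. z : {x, y} ==> P z b et" by blast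
 have mono: "norm (branch z b h - c) < norm (branch z b h' - c)" if "z : {x, y}" "0 <= h" "h < h'" "h' <= et" for z b h h'
  using et(2)[OF that(1), of b] that unfolding P_def by blast
 have inarc: "branch z b h : co.end_arc z b" and dir: "norm (sgn (branch z b h - c) - s b *\<^sub>R sgn (tangent L z)) <= e"
  if "z : {x, y}" "0 < h" "h < et" for z b h
  using et(2)[OF that(1), of b] that unfolding P_def by blast+
 have br0: "branch z b 0 = c" if "z : {x, y}" for z b using that xy branch_0 by auto
 obtain r where r: "r > 0" "trace L Int ball c r \<subseteq>
  strand L (fst x) ` {snd x - et<..<snd x + et} Un strand L (fst y) ` {snd y - et<..<snd y + et}"
  using local_trace[OF xy(1) et(1)] xy(2) by metis
 have loc: "\<exists>z\<in>{x, y}. \<exists>b h. 0 <= h & h < et & p = branch z b h" if p: "p : trace L Int ball c r" for p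
 proof -
  obtain z t where z: "z : {x, y}" "p = strand L (fst z) t" "t : {snd z - et<..<snd z + et}"
   using p r(2) by blast
  have "p = branch z (t \<ge> snd z) \<bar>t - snd z\<bar>" using z(2) by (auto simp: branch_def)
  moreover have "\<bar>t - snd z\<bar> < et" using z(3) by auto
  ultimately show ?thesis using z(1) by (metis abs_ge_zero)
 qed
 define R where "R z b = norm (branch z b (et / 2) - c)" for z b
 have Rpos: "R z b > 0" if "z : {x, y}" for z b
  using mono[OF that, of 0 "et / 2" b] et(1) br0[OF that] by (simp add: R_def)
 \<comment> \<open>Below r, so that the circle sees only the four branches, and not above the
   distance any of them has reached at time et / 2, so that it meets each of them.\<close>
 define de where "de = min (r / 2) (min (min (R x True) (R x False)) (min (R y True) (R y False)))"
 have de: "de > 0" "de < r" using r(1) Rpos by (auto simp: de_def)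
 have deR: "de <= R z b" if "z : {x, y}" for z b using that by (cases b) (auto simp: de_def)
 \<comment> \<open>The time at which a branch meets the circle: it exists by the intermediate value
   theorem and is unique by monotonicity.\<close>
 define hh where "hh z b = (SOME h. 0 < h & h <= et / 2 & norm (branch z b h - c) = de)" for z b
 have hh: "0 < hh z b" "hh z b <= et / 2" "norm (branch z b (hh z b) - c) = de" "hh z b < et" if z: "z : {x, y}" for z b
 proof -
  have "\<exists>h\<ge>0. h <= et / 2 & norm (branch z b h - c) = de"
  proof (rule IVT')
   have "fst z < NN" using z NNz by auto
   thus "continuous_on {0..et / 2} (%h. norm (branch z b h - c))"
    by (intro continuous_intros continuous_branch)
  qed (use br0[OF z] de deR[OF z] et(1) in "auto simp: R_def")
  then obtain h where h: "0 <= h" "h <= et / 2" "norm (branch z b h - c) = de" by auto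
  have "h ~= 0"
  proof
   assume "h = 0"
   thus False using h(3) br0[OF z, of b] de(1) by simp
  qed
  with h have "0 < h & h <= et / 2 & norm (branch z b h - c) = de" by simp
  hence "0 < hh z b & hh z b <= et / 2 & norm (branch z b (hh z b) - c) = de"
   unfolding hh_def by (rule someI)
  thus "0 < hh z b" "hh z b <= et / 2" "norm (branch z b (hh z b) - c) = de" "hh z b < et"
   using et(1) by auto
 qed
 define Q where "Q z b = branch z b (hh z b)" for z b
 define q where "q z b = (fst z, frac (snd z + (if b then hh z b else - hh z b)))" for z b
 have Q: "norm (Q z b - c) = de" "Q z b : co.end_arc z b" if "z : {x, y}" for z b
  using hh[OF that] inarc[OF that] by (auto simp: Q_def)
 have q: "q z b : positions L" "pt L (q z b) = Q z b" "fst (q z b) = fst z" if "z : {x, y}" for z b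
  using frac_pos strand_frac that NNz by (auto simp: q_def Q_def branch_def pt_def)
 have qsh: "strand L (fst (q z b)) (snd (q z b) + t) = branch z b (hh z b + (if b then t else - t))"
  if "z : {x, y}" for z b t
 proof -
  have "fst z < NN" using that NNz by auto
  thus ?thesis
   using strand_int[of "fst z" "snd z + (if b then hh z b else - hh z b) + t" "- \<lfloor>snd z + (if b then hh z b else - hh z b)\<rfloor>"]
   by (cases b) (simp_all add: q_def branch_def frac_def algebra_simps)
 qed
 have near: "p : ball c de Un sphere c de ==> p : trace L ==> p ~= c ==>
   \<exists>z\<in>{x, y}. \<exists>b h. 0 < h & h < et & p = branch z b h" for p
 proof -
  assume p: "p : ball c de Un sphere c de" "p : trace L" "p ~= c"
  hence "p : trace L Int ball c r" using de(2) by auto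
  then obtain z b h where z: "z : {x, y}" "0 <= h" "h < et" "p = branch z b h" using loc by blast
  hence "h ~= 0" using br0[OF z(1), of b] p(3) by auto
  thus ?thesis using z by (metis order_le_less)
 qed
 have sph: "\<exists>z\<in>{x, y}. \<exists>b. p = Q z b" if p: "p : trace L" "p : sphere c de" for p
 proof -
  have "p ~= c" using p(2) de(1) by auto
  then obtain z b h where z: "z : {x, y}" "0 < h" "h < et" "p = branch z b h" using near[of p] p by blast
  have n: "norm (branch z b h - c) = de" using p(2) z(4) by (simp add: dist_norm norm_minus_commute)
  have "h = hh z b"
  proof (rule linorder_cases[of h "hh z b"])
   assume "h < hh z b" thus ?thesis using mono[OF z(1), of h "hh z b" b] hh[OF z(1), of b] n z by simp
  next
   assume "hh z b < h" thus ?thesis using mono[OF z(1), of "hh z b" h b] hh[OF z(1), of b] n z by simp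
  qed
  thus ?thesis using z by (auto simp: Q_def)
 qed
 have Qtr: "Q z b : trace L" "Q z b ~: CR" if "z : {x, y}" for z b
  using Q(2)[OF that, of b] in_components_subset[OF co.end_arc_component[of z b]] mp that by auto
 define w where "w = Q x False - c"
 have w: "norm w = de" "w ~= 0" using Q(1)[of x False] de(1) by (auto simp: w_def)
 define C where "C = (%t. c + w * cis (2 * pi * t))"
 note circ = circle_simple[OF w(2), where c = c, folded C_def, unfolded w(1)]
 have posq: "p = q z b" if "z : {x, y}" "p : positions L" "pt L p = Q z b" for p z b
  using pos_inj_off_crossings[OF that(2) q(1)[OF that(1)]] q(2)[OF that(1)] that(3) Qtr(2)[OF that(1)] by simp
 interpret K: cut L C
 proof
  show "simple_path C" "pathfinish C = pathstart C" using circ by auto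
  show "path_image C Int CR = {}"
  proof (rule ccontr)
   assume "~ ?thesis"
   then obtain p where p: "p : sphere c de" "p : CR" unfolding circ(3) by blast
   have "p : trace L" using p(2) by (auto simp: crossing_points_def double_points_def trace_def)
   thus False using sph[OF _ p(1)] p(2) Qtr(2) by blast
  qed
  show "finite (trace L Int path_image C)"
  proof (rule finite_subset)
   show "trace L Int path_image C \<subseteq> (%(z, b). Q z b) ` ({x, y} \<times> UNIV)" using sph circ(3) by force
  qed auto
  show "\<exists>U W. {U, W} = {inside (path_image C), outside (path_image C)} &
    (\<forall>\<^sub>F h in at_right 0. strand L (fst p) (snd p - h) : U & strand L (fst p) (snd p + h) : W)"
   if p: "p : positions L" "pt L p : path_image C" for p
  proof -
   have "pt L p : trace L" using p(1) by (auto simp: trace_def)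
   then obtain z b where z: "z : {x, y}" "pt L p = Q z b" using sph p(2) circ(3) by blast
   have pq: "p = q z b" using posq z p by blast
   have "\<forall>\<^sub>F h in at_right 0. 0 < h & h < min (hh z b) (et - hh z b)"
    unfolding eventually_at_right_field using hh[OF z(1), of b]
    by (intro exI[of _ "min (hh z b) (et - hh z b)"]) auto
   hence ev: "\<forall>\<^sub>F h in at_right 0. branch z b (hh z b - h) : ball c de & branch z b (hh z b + h) : - cball c de"
   proof eventually_elim
    case (elim h)
    have "norm (branch z b (hh z b - h) - c) < norm (branch z b (hh z b) - c)"
     "norm (branch z b (hh z b) - c) < norm (branch z b (hh z b + h) - c)"
     by (rule mono[OF z(1)]; use elim hh[OF z(1), of b] in auto)+
    thus ?case using hh(3)[OF z(1), of b] by (simp add: dist_norm norm_minus_commute)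
   qed
   show ?thesis
   proof (cases b)
    case True
    have "\<forall>\<^sub>F h in at_right 0. strand L (fst p) (snd p - h) : ball c de & strand L (fst p) (snd p + h) : - cball c de"
     using ev by eventually_elim (use qsh[OF z(1), of b] True pq in "simp add: diff_conv_add_uminus del: add_uminus_conv_diff")
    thus ?thesis using circ(4,5) by (intro exI[of _ "ball c de"] exI[of _ "- cball c de"]) simp
   next
    case False
    have "\<forall>\<^sub>F h in at_right 0. strand L (fst p) (snd p - h) : - cball c de & strand L (fst p) (snd p + h) : ball c de"
     using ev by eventually_elim (use qsh[OF z(1), of b] False pq in "simp add: diff_conv_add_uminus del: add_uminus_conv_diff")
    thus ?thesis using circ(4,5) by (intro exI[of _ "- cball c de"] exI[of _ "ball c de"]) auto
   qed
  qed
 qed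
 \<comment> \<open>The side away from c, where the four points are joined by the strands of the
   diagram with c removed.\<close>
 define U where "U = outside (path_image C)"
 have U: "K.is_side U" by (simp add: K.is_side_def U_def)
 have Ueq: "U = - cball c de" using circ(5) by (simp add: U_def)
 have XU: "CR Int U = CR - {c}"
 proof -
  have "p : U" if p: "p : CR" "p ~= c" for p
  proof (rule ccontr)
   assume "p ~: U"
   hence "p : ball c de Un sphere c de" using Ueq by auto
   moreover have "p : trace L" using p(1) by (auto simp: crossing_points_def double_points_def trace_def)
   ultimately obtain z b h where z: "z : {x, y}" "0 < h" "h < et" "p = branch z b h" using near p(2) by blast
   hence "p : co.end_arc z b" using inarc by auto
   thus False using in_components_subset[OF co.end_arc_component[of z b]] mp z(1) p(1) by auto
  qed
  moreover have "c ~: U" using Ueq de(1) by auto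
  ultimately show ?thesis by blast
 qed
 have qb: "q z b : K.bpos" if "z : {x, y}" for z b
  using q[OF that] Q(1)[OF that] circ(3) by (auto simp: K.bpos_def K.mpos_iff dist_norm norm_minus_commute)
 have bq: "\<exists>z\<in>{x, y}. \<exists>b. p = q z b" if "p : K.bpos" for p
 proof -
  have p: "p : positions L" "pt L p : sphere c de" "pt L p : trace L"
   using that circ(3) by (auto simp: K.bpos_def K.mpos_iff trace_def)
  thus ?thesis using sph posq by blast
 qed
 have out: "\<forall>\<^sub>F h in at_right 0. strand L (fst (q z b)) (snd (q z b) + (if b then h else - h)) : U Int co.end_arc z b"
  if z: "z : {x, y}" for z b
 proof -
  have "\<forall>\<^sub>F h in at_right 0. 0 < h & h < et - hh z b"
   unfolding eventually_at_right_field using hh[OF z(1), of b] by (intro exI[of _ "et - hh z b"]) auto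
  thus ?thesis
  proof eventually_elim
   case (elim h)
   have "norm (branch z b (hh z b) - c) < norm (branch z b (hh z b + h) - c)"
    by (rule mono[OF z(1)]; use elim hh[OF z(1), of b] in auto)
   hence "branch z b (hh z b + h) : U" using hh(3)[OF z(1), of b] Ueq by (simp add: dist_norm norm_minus_commute)
   moreover have "branch z b (hh z b + h) : co.end_arc z b" using elim hh[OF z(1), of b] by (intro inarc[OF z]) auto
   ultimately show ?case using qsh[OF z, of b h] qsh[OF z, of b "- h"] by (cases b) auto
  qed
 qed
 have qm: "q z b : K.mpos" if "z : {x, y}" for z b using qb[OF that] by (simp add: K.bpos_def)
 have barc: "K.barc U (q z b) = K.end_arc (q z b) b" if z: "z : {x, y}" for z b
 proof -
  have "K.end_arc (q z b) b Int U ~= {}"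
   by (rule K.end_arc_meets[OF qm[OF z]], rule eventually_mono[OF out[OF z, of b]], blast)
  hence "K.end_arc (q z b) b \<subseteq> U" by (rule K.end_arc_side[OF qm[OF z] U])
  thus ?thesis using K.barc(3)[OF qb[OF z] U] by auto
 qed
 have kap: "K.kap (K.barc U (q z b)) = co.end_arc z b" if z: "z : {x, y}" for z b
 proof (rule K.kap(3))
  show "K.barc U (q z b) : components (trace L - K.MM)" using K.barc(2)[OF qb[OF z] U] .
  show "co.end_arc z b : components (trace L - CR)" using co.end_arc_component[of z b] mp z by auto
  have "\<forall>\<^sub>F h in at_right 0. strand L (fst (q z b)) (snd (q z b) + (if b then h else - h)) : K.end_arc (q z b) b"
   using K.arc_after_eventually[OF qm[OF z]] K.arc_before_eventually[OF qm[OF z]]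
   by (cases b) (simp_all add: K.end_arc_def)
  thus "co.end_arc z b Int K.barc U (q z b) ~= {}"
   unfolding barc[OF z] using K.eventually_meet[OF out[OF z]] by blast
 qed
 have down: "(co.end_arc z b, co.end_arc z' b') : ?E"
  if "z : {x, y}" "z' : {x, y}" "(K.barc U (q z b), K.barc U (q z' b')) : eqcl (K.srel (CR Int U) si)" for z z' b b'
  using K.kap_srel[OF that(3)] kap that XU by auto
 have xyE: "(co.end_arc x b, co.end_arc y b') ~: ?E" for b b'
 proof
  assume *: "(co.end_arc x b, co.end_arc y b') : ?E"
  have "(co.end_arc x False, co.end_arc x b) : ?E" using X by (cases b) (auto simp: x_def)
  moreover have "(co.end_arc y b', co.end_arc y False) : ?E" using eqcl_sym[OF Y] by (cases b') (auto simp: y_def)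
  ultimately have "(co.end_arc x False, co.end_arc y False) : ?E" using * by (meson eqcl_trans)
  thus False using neg by (simp add: x_def y_def)
 qed
 let ?F = "eqcl (K.srel (CR Int U) si)"
 \<comment> \<open>The partner of the incoming point of z is one of the other three;
   \<open>xyE\<close> excludes the two points of the other strand, so it is the outgoing point of
   z.\<close>
 have pair: "(K.barc U (q z False), K.barc U (q z True)) : ?F" if z: "z : {x, y}" for z
 proof -
  obtain p where p: "p : K.bpos" "p ~= q z False" "(K.barc U (q z False), K.barc U p) : ?F"
   using K.partner[OF qb[OF z] U] by blast
  obtain z' b where z': "z' : {x, y}" "p = q z' b" using bq[OF p(1)] by blast
  have "(co.end_arc z False, co.end_arc z' b) : ?E" using down[OF z z'(1)] p(3) z'(2) by simp
  hence "z' = z" using xyE[of False b] xyE[of b False] z z'(1) eqcl_sym[of "co.end_arc y False" "co.end_arc x b"]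
   by auto
  moreover have "b" using p(2) z' calculation by (cases b) auto
  ultimately show ?thesis using p(3) z' by simp
 qed
 \<comment> \<open>Parameters on the circle. It was based at the incoming over point, which
   therefore has parameter 0.\<close>
 define t where "t z b = (SOME t. 0 <= t & t < 1 & Q z b = C t)" for z b
 have t: "0 <= t z b" "t z b < 1" "Q z b = C (t z b)" if "z : {x, y}" for z b
 proof -
  have "\<exists>t. 0 <= t & t < 1 & Q z b = C t"
   using circ(6)[of "Q z b"] Q(1)[OF that, of b] by (simp add: C_def dist_norm norm_minus_commute)
  hence "0 <= t z b & t z b < 1 & Q z b = C (t z b)" unfolding t_def by (rule someI_ex)
  thus "0 <= t z b" "t z b < 1" "Q z b = C (t z b)" by auto
 qed
 define n where "n z b = (1 / de) *\<^sub>R (Q z b - c)" for z b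
 have n: "norm (n z b - s b *\<^sub>R sgn (tangent L z)) <= e" if z: "z : {x, y}" for z b
 proof -
  have "n z b = sgn (branch z b (hh z b) - c)"
   using hh(3)[OF z, of b] by (simp add: n_def Q_def sgn_div_norm divide_inverse)
  thus ?thesis using dir[OF z] hh[OF z, of b] by simp
 qed
 \<comment> \<open>The under points lie on different sides of the chord between the over
   points.\<close>
 have "plane_det (n x True - n x False) (n y False - n x False) * plane_det (n x True - n x False) (n y True - n x False) < 0"
 proof (rule interleaved_dets[OF _ _ _ e])
  show "plane_det (sgn (tangent L x)) (sgn (tangent L y)) = D" by (simp add: D_def)
  show "norm (n x False + sgn (tangent L x)) <= e" "norm (n x True - sgn (tangent L x)) <= e"
   "norm (n y False + sgn (tangent L y)) <= e" "norm (n y True - sgn (tangent L y)) <= e"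
   using n[of x False] n[of x True] n[of y False] n[of y True] by (simp_all add: s_def)
 qed (use tn in "auto simp: norm_sgn")
 moreover have nd: "plane_det (n x True - n x False) (n y b - n x False) =
   4 * sin (pi * t x True) * sin (pi * t y b) * sin (pi * (t y b - t x True))" for b
 proof -
  have "n z b - n x False = (1 / de) *\<^sub>R (w * cis (2 * pi * t z b) - w)" if "z : {x, y}" for z b
  proof -
   have "n z b - n x False = (1 / de) *\<^sub>R ((Q z b - c) - w)"
    by (simp only: n_def w_def scaleR_diff_right[symmetric])
   also have "Q z b - c = w * cis (2 * pi * t z b)" using t(3)[OF that, of b] by (simp add: C_def)
   finally show ?thesis .
  qed
  thus ?thesis using plane_det_circle[of w] w(1) de(1)
   by (simp add: plane_det_scaleR power2_eq_square)
 qed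
 \<comment> \<open>All factors before the last two sines are nonnegative, so the parameters of the
   under points lie on different sides of that of the outgoing over point.\<close>
 ultimately have neg: "16 * (sin (pi * t x True))\<^sup>2 * (sin (pi * t y False) * sin (pi * t y True)) *
   (sin (pi * (t y False - t x True)) * sin (pi * (t y True - t x True))) < 0"
  unfolding nd by (simp add: power2_eq_square mult_ac)
 have sin0: "0 <= sin (pi * t z b)" if "z : {x, y}" for z b
  using t(1,2)[OF that, of b] by (intro sin_ge_zero) (auto simp: mult_le_cancel_left1)
 have tpos: "0 < t y b" for b
 proof (rule ccontr)
  assume "~ 0 < t y b"
  hence "t y b = 0" using t(1)[of y b] by auto
  thus False using neg by (cases b) auto
 qed
 have "sin (pi * (t y False - t x True)) * sin (pi * (t y True - t x True)) < 0"
 proof (rule ccontr)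
  assume "~ ?thesis"
  hence "0 <= sin (pi * (t y False - t x True)) * sin (pi * (t y True - t x True))" by simp
  hence "0 <= 16 * (sin (pi * t x True))\<^sup>2 * (sin (pi * t y False) * sin (pi * t y True)) *
   (sin (pi * (t y False - t x True)) * sin (pi * (t y True - t x True)))"
   using sin0[of y False] sin0[of y True] by (intro mult_nonneg_nonneg[OF _ \<open>0 <= sin _ * sin _\<close>]) auto
  thus False using neg by linarith
 qed
 moreover have sg: "sin (pi * a) > 0 \<longleftrightarrow> a > 0" "sin (pi * a) < 0 \<longleftrightarrow> a < 0" if "\<bar>a\<bar> < 1" for a
 proof -
  have p: "0 < sin (pi * a)" if "0 < a" "a < 1" for a using that by (intro sin_gt_zero) auto
  have "a > 0 \<or> a = 0 \<or> a < 0" by linarith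
  thus "sin (pi * a) > 0 \<longleftrightarrow> a > 0" "sin (pi * a) < 0 \<longleftrightarrow> a < 0"
   using p[of a] p[of "- a"] that by auto
 qed
 moreover have "\<bar>t y b - t x True\<bar> < 1" for b using t(1,2)[of y b] t(1,2)[of x True] by auto
 ultimately have ord: "t y False < t x True & t x True < t y True \<or> t y True < t x True & t x True < t y False"
  by (auto simp: mult_less_0_iff)
 have C0: "Q x False = C 0" by (simp add: C_def w_def)
 have X': "CR Int U \<subseteq> CR Int U" by simp
 have "(K.barc U (q x False), K.barc U (q y b)) : ?F" if b: "t y b < t x True" "t x True < t y (~ b)" for b
 proof (rule K.noncrossing[OF U X' qb qb qb qb])
  show "(K.barc U (q y b), K.barc U (q y (~ b))) : ?F" using pair[of y] eqcl_sym[OF pair[of y]] by (cases b) auto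
  show "pt L (q x False) = C 0" "pt L (q x True) = C (t x True)" "pt L (q y b) = C (t y b)" "pt L (q y (~ b)) = C (t y (~ b))"
   using q(2) t(3) C0 by auto
  show "t y (~ b) < 1" using t(2)[of y] by simp
 qed (use b tpos pair[of x] in auto)
 hence "\<exists>b. (K.barc U (q x False), K.barc U (q y b)) : ?F"
  using ord by (metis (full_types))
 thus False using down[of x y] xyE by blast
qed

end

section \<open>Classes of generated equivalence relations and their merging\<close>

lemma eqcl_equiv: "equiv UNIV (eqcl r)"
 by (intro equivI) (auto simp: refl_on_def intro: symI transI eqcl_sym eqcl_trans)

lemma eqcl_subset:
 assumes "r \<subseteq> eqcl s" shows "eqcl r \<subseteq> eqcl s"
proof -
 have "(x, y) : eqcl s" if xy: "(x, y) : r Un r\<inverse>" for x y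
 proof -
  from xy consider "(x, y) : r" | "(y, x) : r" by blast
  thus ?thesis
  proof cases
   case 1 thus ?thesis by (rule subsetD[OF assms])
  next
   case 2
   hence "(y, x) : eqcl s" by (rule subsetD[OF assms])
   thus ?thesis by (rule eqcl_sym)
  qed
 qed
 hence "r Un r\<inverse> \<subseteq> eqcl s" by (rule subrelI)
 thus ?thesis by (rule rtrancl_subset_rtrancl)
qed

lemma eqcl_eqI: "r \<subseteq> eqcl s ==> s \<subseteq> eqcl r ==> eqcl r = eqcl s"
 using eqcl_subset by blast

lemma class_eq: "(x, y) : eqcl r ==> eqcl r `` {x} = eqcl r `` {y}"
 by (rule equiv_class_eq[OF eqcl_equiv])

lemma class_eq_iff: "eqcl r `` {x} = eqcl r `` {y} \<longleftrightarrow> (x, y) : eqcl r"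
 by (rule eq_equiv_class_iff[OF eqcl_equiv UNIV_I UNIV_I])

lemma quotient_class_mem: "z : V // eqcl r ==> x : z ==> z = eqcl r `` {x}"
proof (elim quotientE)
 fix x' assume "x : z" "z = eqcl r `` {x'}"
 thus "z = eqcl r `` {x}" using class_eq[of x' x r] by simp
qed

lemma quotient_disjoint: "z : V // eqcl r ==> z' : V // eqcl r ==> z Int z' ~= {} ==> z = z'"
 by (metis disjoint_iff quotient_class_mem)

lemma eqcl_closed:
 assumes "r \<subseteq> V \<times> V" "(x, y) : eqcl r" "x : V" shows "y : V"
 using assms(2) by (induction rule: eqcl_induct) (use assms in auto)

lemma quotient_sub: "r \<subseteq> V \<times> V ==> z : V // eqcl r ==> z \<subseteq> V"
proof
 fix y assume r: "r \<subseteq> V \<times> V" and z: "z : V // eqcl r" and y: "y : z"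
 from z obtain x where x: "x : V" "z = eqcl r `` {x}" by (elim quotientE)
 hence "(x, y) : eqcl r" using y by simp
 thus "y : V" by (rule eqcl_closed[OF r _ x(1)])
qed

lemma quotient_nonempty: "z : V // eqcl r ==> z ~= {}"
 by (elim quotientE) auto

text \<open>The elements e and f record where the merging happens. In a disjoint family they
  determine it, so parallel edges of a square can be compared.\<close>

definition merges :: "'a set set => 'a set set => 'a => 'a => bool" where
 "merges S S' e f \<longleftrightarrow> (\<exists>z1\<in>S. \<exists>z2\<in>S. z1 ~= z2 & e : z1 & f : z2 & S' = S - {z1, z2} Un {z1 Un z2})"

lemma eqcl_insert:
 "(x, y) : eqcl (insert (e, f) r) \<longleftrightarrow> (x, y) : eqcl r \<or>
  (x : eqcl r `` {e} Un eqcl r `` {f} & y : eqcl r `` {e} Un eqcl r `` {f})"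
proof
 assume "(x, y) : eqcl (insert (e, f) r)"
 thus "(x, y) : eqcl r \<or> (x : eqcl r `` {e} Un eqcl r `` {f} & y : eqcl r `` {e} Un eqcl r `` {f})"
 proof (induction rule: eqcl_induct)
  case (step y z)
  consider "(y, z) : r \<or> (z, y) : r" | "y = e & z = f \<or> y = f & z = e" using step(2) by auto
  thus ?case
  proof cases
   case 1
   hence "(y, z) : eqcl r" by auto
   thus ?thesis using step(3) by (auto intro: eqcl_trans)
  next
   case 2
   hence "x : eqcl r `` {e} Un eqcl r `` {f}" using step(3) by (auto intro: eqcl_sym)
   thus ?thesis using 2 by auto
  qed
 qed auto
next
 have m: "(u, v) : eqcl (insert (e, f) r)" if "(u, v) : eqcl r" for u v
  using that eqcl_mono[of r "insert (e, f) r"] by auto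
 have ef: "(e, f) : eqcl (insert (e, f) r)" by auto
 assume "(x, y) : eqcl r \<or> (x : eqcl r `` {e} Un eqcl r `` {f} & y : eqcl r `` {e} Un eqcl r `` {f})"
 thus "(x, y) : eqcl (insert (e, f) r)"
 proof
  assume "x : eqcl r `` {e} Un eqcl r `` {f} & y : eqcl r `` {e} Un eqcl r `` {f}"
  moreover have "(e, u) : eqcl (insert (e, f) r)" if "u : eqcl r `` {e} Un eqcl r `` {f}" for u
   using that m[of e u] m[of f u] eqcl_trans[OF ef, of u] by fast
  ultimately have "(e, x) : eqcl (insert (e, f) r)" "(e, y) : eqcl (insert (e, f) r)"
   by blast+
  thus ?thesis using eqcl_sym eqcl_trans by meson
 qed (rule m)
qed

lemma merges_insert:
 assumes e: "e : V" "f : V" and ne: "(e, f) ~: eqcl r"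
 shows "merges (V // eqcl r) (V // eqcl (insert (e, f) r)) e f"
proof -
 let ?R = "eqcl r" and ?R' = "eqcl (insert (e, f) r)"
 let ?z1 = "?R `` {e}" and ?z2 = "?R `` {f}"
 have z: "?z1 : V // ?R" "?z2 : V // ?R" "?z1 ~= ?z2"
  by (rule quotientI[OF e(1)], rule quotientI[OF e(2)], use ne class_eq_iff in blast)
 have cl1: "?R' `` {x} = ?z1 Un ?z2" if x: "x : ?z1 Un ?z2" for x
 proof -
  have "(x, y) : ?R' \<longleftrightarrow> y : ?z1 Un ?z2" for y
  proof
   assume "(x, y) : ?R'"
   then consider "(x, y) : ?R" | "y : ?z1 Un ?z2" unfolding eqcl_insert by blast
   thus "y : ?z1 Un ?z2"
   proof cases
    case 1
    from x show ?thesis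
    proof
     assume "x : ?z1" hence "(e, y) : ?R" using 1 by (simp add: eqcl_trans[of e x])
     thus ?thesis by simp
    next
     assume "x : ?z2" hence "(f, y) : ?R" using 1 by (simp add: eqcl_trans[of f x])
     thus ?thesis by simp
    qed
   qed
  next
   assume "y : ?z1 Un ?z2" thus "(x, y) : ?R'" unfolding eqcl_insert using x by blast
  qed
  thus ?thesis by (intro set_eqI) (simp only: Image_singleton_iff)
 qed
 have cl2: "?R' `` {x} = ?R `` {x}" if x: "x ~: ?z1 Un ?z2" for x
 proof -
  have "(x, y) : ?R' \<longleftrightarrow> (x, y) : ?R" for y unfolding eqcl_insert using x by blast
  thus ?thesis by (intro set_eqI) (simp only: Image_singleton_iff)
 qed
 have eq: "V // ?R' = V // ?R - {?z1, ?z2} Un {?z1 Un ?z2}"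
 proof (intro equalityI subsetI)
  fix z assume "z : V // ?R'"
  then obtain x where x: "x : V" "z = ?R' `` {x}" by (auto elim: quotientE)
  show "z : V // ?R - {?z1, ?z2} Un {?z1 Un ?z2}"
  proof (cases "x : ?z1 Un ?z2")
   case True thus ?thesis using x cl1 by auto
  next
   case False
   have "z ~= ?z1" "z ~= ?z2" using False x by auto
   thus ?thesis using x cl2[OF False] by (auto intro: quotientI)
  qed
 next
  fix z assume z: "z : V // ?R - {?z1, ?z2} Un {?z1 Un ?z2}"
  show "z : V // ?R'"
  proof (cases "z = ?z1 Un ?z2")
   case True
   hence "z = ?R' `` {e}" using cl1[of e] by auto
   thus ?thesis using e by (auto intro: quotientI)
  next
   case False
   hence z': "z : V // ?R" "z ~= ?z1" "z ~= ?z2" using z by blast+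
   obtain x where x: "x : V" "z = ?R `` {x}" using z'(1) by (rule quotientE)
   have "x ~: ?z1 Un ?z2" using x z' class_eq[of e x r] class_eq[of f x r] by auto
   thus ?thesis using x cl2 by (metis quotientI)
  qed
 qed
 show ?thesis unfolding merges_def
 proof (intro bexI conjI)
  show "e : ?z1" "f : ?z2" by simp_all
 qed (rule z eq)+
qed

context marked
begin

lemma srel_cong: "(!!c. c : X ==> si c = si' c) ==> srel X si = srel X si'"
 unfolding srel_def by (intro image_cong) auto

lemma srel_insert: "srel (insert c X) si = srel X si \<union>
  {(end_arc (over_pos L c) False, end_arc (under_pos L c) (False = si c)),
  (end_arc (over_pos L c) True, end_arc (under_pos L c) (True = si c))}"
 by (auto simp: srel_def UNIV_bool)

lemma srel_components:
 assumes "X \<subseteq> CR"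
 shows "srel X si \<subseteq> components (trace L - M) \<times> components (trace L - M)"
proof (rule subrelI)
 fix e f assume "(e, f) : srel X si"
 then obtain c i j where "e = end_arc (over_pos L c) i" "f = end_arc (under_pos L c) j"
  "over_pos L c : mpos" "under_pos L c : mpos" by (rule srelD[OF _ assms]) blast
 thus "(e, f) : components (trace L - M) \<times> components (trace L - M)"
  using end_arc_component by blast
qed

text \<open>The link between the record and the geometry. It holds for the diagram of L, with M the
  crossings, and for the tangles, with the cut added to M, so one description of the smoothings
  covers both.\<close>

definition is_cut_diagram :: "(complex, complex set, 'm) diagram_scheme => bool" where
 "is_cut_diagram D \<longleftrightarrow> (\<forall>c\<in>crossings D.
  over_in D c = end_arc (over_pos L c) False & over_out D c = end_arc (over_pos L c) True &
  under_in D c = end_arc (under_pos L c) False & under_out D c = end_arc (under_pos L c) True)"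

lemma eqcl_smoothing_rel:
 assumes D: "is_cut_diagram D"
 shows "eqcl (smoothing_rel D al) = eqcl (joins D Un srel (crossings D) (%c. (c : al) = positive D c))"
proof (rule eqcl_eqI)
 let ?si = "%c. (c : al) = positive D c"
 let ?s = "joins D Un srel (crossings D) ?si"
 have g: "(end_arc (over_pos L c) i, end_arc (under_pos L c) (i = ?si c)) : ?s" if "c : crossings D" for c i
  unfolding srel_def by (rule UnI2, rule image_eqI[of _ _ "(c, i)"]) (use that in auto)
 have sub: "(if ?si c then {(over_in D c, under_in D c), (over_out D c, under_out D c)}
   else {(over_in D c, under_out D c), (under_in D c, over_out D c)}) \<subseteq> eqcl ?s" if c: "c : crossings D" for c
 proof -
  have D: "over_in D c = end_arc (over_pos L c) False" "over_out D c = end_arc (over_pos L c) True"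
  "under_in D c = end_arc (under_pos L c) False" "under_out D c = end_arc (under_pos L c) True"
   using D c by (auto simp: is_cut_diagram_def)
  show ?thesis
   using eqcl_gen[OF g[OF c, of False]] eqcl_gen[OF g[OF c, of True]] eqcl_sym[OF eqcl_gen[OF g[OF c, of True]]]
   unfolding D by (cases "?si c") auto
 qed
 have "joins D \<subseteq> eqcl ?s" by auto
 thus "smoothing_rel D al \<subseteq> eqcl ?s" unfolding smoothing_rel_def using sub by blast
 have sub2: "(end_arc (over_pos L c) i, end_arc (under_pos L c) (i = ?si c)) : eqcl (smoothing_rel D al)"
  if c: "c : crossings D" for c i
 proof -
  have D: "over_in D c = end_arc (over_pos L c) False" "over_out D c = end_arc (over_pos L c) True"
  "under_in D c = end_arc (under_pos L c) False" "under_out D c = end_arc (under_pos L c) True"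
   using D c by (auto simp: is_cut_diagram_def)
  have "(if ?si c then {(over_in D c, under_in D c), (over_out D c, under_out D c)}
   else {(over_in D c, under_out D c), (under_in D c, over_out D c)}) \<subseteq> smoothing_rel D al"
   unfolding smoothing_rel_def using c by blast
  thus ?thesis unfolding D by (cases "?si c"; cases i) (auto intro: eqcl_sym eqcl_gen)
 qed
 have "joins D \<subseteq> eqcl (smoothing_rel D al)" by (auto simp: smoothing_rel_def)
 thus "?s \<subseteq> eqcl (smoothing_rel D al)" using sub2 unfolding srel_def by auto
qed

end

section \<open>What changing one smoothing does to the circles\<close>

context link
begin

lemma diagram_of_simps:
 "arcs (diagram_of L) = components (trace L - CR)" "joins (diagram_of L) = {}"
 "crossings (diagram_of L) = CR" "positive (diagram_of L) = positive_crossing L"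
 "co.is_cut_diagram (diagram_of L)"
 by (auto simp: diagram_of_def Let_def co.is_cut_diagram_def co.end_arc_def)

lemma circles_diagram_of:
 "circles (diagram_of L) al = components (trace L - CR) //
  eqcl (co.srel CR (%c. (c : al) = positive_crossing L c))"
 unfolding circles_def co.eqcl_smoothing_rel[OF diagram_of_simps(5)] by (simp add: diagram_of_simps)

text \<open>With c removed its four ends are free, and \<open>srel_partner\<close> pairs them. By
  \<open>crossing_separates\<close> the pairs cannot be over with over and under with under, so each
  over end goes with an under end.\<close>

lemma crossing_pairing:
 fixes c :: complex and si :: "complex => bool"
 assumes c: "c : CR"
 defines "r \<equiv> co.srel (CR - {c}) si" and "x \<equiv> over_pos L c" and "y \<equiv> under_pos L c"
 obtains j where "(co.end_arc x False, co.end_arc y j) : eqcl r" "(co.end_arc x True, co.end_arc y (~ j)) : eqcl r"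
  "(co.end_arc x False, co.end_arc x True) ~: eqcl r"
proof -
 let ?V = "components (trace L - CR)" and ?X = "CR - {c}"
 have mp: "x : co.mpos" "y : co.mpos" using co.crossing_mpos[OF c] by (auto simp: x_def y_def)
 have pt: "pt L x = c" "pt L y = c" "x ~= y" using over_under_pos[OF c] by (auto simp: x_def y_def)
 have free: "z : co.mpos & pt L z ~: ?X \<longleftrightarrow> z = x \<or> z = y" for z
  using mp pt over_under_pos(5)[OF c, of z] by (auto simp: co.mpos_def x_def y_def)
 have part: "\<exists>!h. (fst h = x \<or> fst h = y) & h ~= (z, b) & (co.end_arc z b, case_prod co.end_arc h) : eqcl r"
  if z: "z = x \<or> z = y" for z b
 proof -
  have zz: "z : co.mpos" "pt L z ~: ?X" using free[of z] z by auto
  have "\<exists>!h. fst h : co.mpos & pt L (fst h) ~: ?X & case_prod co.end_arc h : ?V & h ~= (z, b)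
   & (co.end_arc z b, case_prod co.end_arc h) : eqcl (co.srel ?X si)"
   using zz co.end_arc_component co.crossing_mpos by (intro co.srel_partner) auto
  moreover have "fst h : co.mpos & pt L (fst h) ~: ?X & case_prod co.end_arc h : ?V & h ~= (z, b)
   & (co.end_arc z b, case_prod co.end_arc h) : eqcl (co.srel ?X si) \<longleftrightarrow>
   (fst h = x \<or> fst h = y) & h ~= (z, b) & (co.end_arc z b, case_prod co.end_arc h) : eqcl r" for h
   using free[of "fst h"] co.end_arc_component[of "fst h"] by (cases h) (auto simp: r_def)
  ultimately show ?thesis by simp
 qed
 have ex: "\<exists>z' b'. (z' = x \<or> z' = y) & (z', b') ~= (z, b) & (co.end_arc z b, co.end_arc z' b') : eqcl r"
  if z: "z = x \<or> z = y" for z b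
 proof -
  obtain h where h: "(fst h = x \<or> fst h = y) & h ~= (z, b) & (co.end_arc z b, case_prod co.end_arc h) : eqcl r"
   using ex1_implies_ex[OF part[OF z, of b]] by (rule exE)
  thus ?thesis by (intro exI[of _ "fst h"] exI[of _ "snd h"]) (simp add: split_beta)
 qed
 have un: "(z1, b1) = (z2, b2)"
  if u: "z = x \<or> z = y" "z1 = x \<or> z1 = y" "z2 = x \<or> z2 = y" "(z1, b1) ~= (z, b)" "(z2, b2) ~= (z, b)"
   "(co.end_arc z b, co.end_arc z1 b1) : eqcl r" "(co.end_arc z b, co.end_arc z2 b2) : eqcl r" for z z1 z2 b b1 b2
 proof -
  let ?Q = "%h. (fst h = x \<or> fst h = y) & h ~= (z, b) & (co.end_arc z b, case_prod co.end_arc h) : eqcl r"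
  have "?Q (z1, b1)" "?Q (z2, b2)" using u by simp_all
  moreover obtain h where "!!h'. ?Q h' ==> h' = h" using part[OF u(1), of b] by (rule ex1E) blast
  ultimately show ?thesis by metis
 qed
 \<comment> \<open>If the over ends formed a pair, so would the under ends, and
   \<open>crossing_separates\<close> would put both pairs into one class, against uniqueness of the
   partner.\<close>
 have not: "(co.end_arc x False, co.end_arc x True) ~: eqcl r"
 proof
  assume xx: "(co.end_arc x False, co.end_arc x True) : eqcl r"
  obtain z' b' where z': "z' = x \<or> z' = y" "(z', b') ~= (y, False)" "(co.end_arc y False, co.end_arc z' b') : eqcl r"
   using ex[of y False] by blast
  have "z' = y"
  proof (rule ccontr)
   assume "z' ~= y"
   hence "z' = x" using z'(1) by auto
   hence "(co.end_arc y False, co.end_arc x b') : eqcl r" using z'(3) by simp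
   hence yx: "(co.end_arc x b', co.end_arc y False) : eqcl r" by (rule eqcl_sym)
   have "(co.end_arc x False, co.end_arc x b') : eqcl r" using xx by (cases b') simp_all
   hence "(co.end_arc x False, co.end_arc y False) : eqcl r" using yx by (rule eqcl_trans)
   thus False using un[of x x y True False False] xx pt(3) by simp
  qed
  hence "(co.end_arc y False, co.end_arc y True) : eqcl r" using z' by (cases b') auto
  hence "(co.end_arc x False, co.end_arc y False) : eqcl r"
   using crossing_separates[OF c] xx unfolding r_def x_def y_def by blast
  thus False using un[of x x y True False False] xx pt(3) by simp
 qed
 obtain z' j where z': "z' = x \<or> z' = y" "(z', j) ~= (x, False)" "(co.end_arc x False, co.end_arc z' j) : eqcl r"
  using ex[of x False] by blast
 have 1: "z' = y" using z' not by (cases j) auto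
 obtain z'' k where z'': "z'' = x \<or> z'' = y" "(z'', k) ~= (x, True)" "(co.end_arc x True, co.end_arc z'' k) : eqcl r"
  using ex[of x True] by blast
 have 2: "z'' = y" using z'' not eqcl_sym[of "co.end_arc x True" "co.end_arc x False" r] by (cases k) auto
 have "k = (~ j)"
 proof (rule ccontr)
  assume "k ~= (~ j)"
  hence "k = j" by simp
  hence "(co.end_arc x False, co.end_arc x True) : eqcl r"
   using z'(3) z''(3) 1 2 eqcl_trans[OF _ eqcl_sym[of "co.end_arc x True" "co.end_arc y j" r]] by simp
  thus False using not by simp
 qed
 thus thesis using that[of j] z'(3) z''(3) 1 2 not by simp
qed

text \<open>A small circle around the crossing is an admissible cut, so planarity excludes one circle becoming one circle.\<close>

lemma merge_or_split:
 assumes c: "c : CR" "c ~: al"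
 defines "D \<equiv> diagram_of L"
 shows "merges (circles D al) (circles D (insert c al)) (over_in D c) (over_out D c) \<or>
    merges (circles D (insert c al)) (circles D al) (over_in D c) (over_out D c)"
proof -
 let ?X = "CR - {c}" and ?V = "components (trace L - CR)"
 define si where "si al c \<longleftrightarrow> (c : al) = positive_crossing L c" for al :: "complex set" and c
 define r where "r = co.srel ?X (si al)"
 define x where "x = over_pos L c"
 define y where "y = under_pos L c"
 obtain j where j: "(co.end_arc x False, co.end_arc y j) : eqcl r" "(co.end_arc x True, co.end_arc y (~ j)) : eqcl r"
  "(co.end_arc x False, co.end_arc x True) ~: eqcl r"
  using crossing_pairing[OF c(1), of "si al"] unfolding r_def x_def y_def by blast
 have Xc: "insert c ?X = CR" using c by auto
 have circ: "circles D bet = ?V // eqcl (r Un {(co.end_arc x False, co.end_arc y (False = si bet c)),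
   (co.end_arc x True, co.end_arc y (True = si bet c))})" if "bet = al \<or> bet = insert c al" for bet
 proof -
  have "co.srel ?X (si bet) = r" unfolding r_def by (rule co.srel_cong) (use that in "auto simp: si_def")
  hence "co.srel CR (si bet) = r Un {(co.end_arc x False, co.end_arc y (False = si bet c)),
   (co.end_arc x True, co.end_arc y (True = si bet c))}"
   using co.srel_insert[of c ?X "si bet"] unfolding Xc x_def y_def by simp
  thus ?thesis unfolding D_def circles_diagram_of si_def by simp
 qed
 have mp: "x : co.mpos" using co.crossing_mpos[OF c(1)] by (auto simp: x_def)
 have V: "co.end_arc x b : ?V" for b by (rule co.end_arc_component[OF mp])
 \<comment> \<open>The smoothing that follows the pairing adds nothing to the classes and leaves two
   circles at c; the other one, treated next, joins these two.\<close>
 have same: "eqcl (r Un {(co.end_arc x False, co.end_arc y j), (co.end_arc x True, co.end_arc y (~ j))}) = eqcl r"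
  by (rule eqcl_eqI) (use j in auto)
 have join: "eqcl (r Un {(co.end_arc x False, co.end_arc y (~ j)), (co.end_arc x True, co.end_arc y j)})
   = eqcl (insert (co.end_arc x False, co.end_arc x True) r)" (is "eqcl ?A = eqcl ?B")
 proof (rule eqcl_eqI)
  have m: "eqcl r \<subseteq> eqcl ?A" "eqcl r \<subseteq> eqcl ?B" by (rule eqcl_mono; auto)+
  have A: "(co.end_arc x False, co.end_arc y (~ j)) : eqcl ?A" by auto
  have B: "(co.end_arc x False, co.end_arc x True) : eqcl ?B" by auto
  have "(co.end_arc y (~ j), co.end_arc x True) : eqcl ?A"
   by (rule eqcl_sym, rule subsetD[OF m(1) j(2)])
  with A have "(co.end_arc x False, co.end_arc x True) : eqcl ?A" by (rule eqcl_trans)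
  thus "?B \<subseteq> eqcl ?A" by auto
  have "(co.end_arc x False, co.end_arc y (~ j)) : eqcl ?B" "(co.end_arc x True, co.end_arc y j) : eqcl ?B"
   by (rule eqcl_trans[OF B subsetD[OF m(2) j(2)]], rule eqcl_trans[OF eqcl_sym[OF B] subsetD[OF m(2) j(1)]])
  thus "?A \<subseteq> eqcl ?B" by auto
 qed
 have jj: "circles D bet = ?V // eqcl r" if "bet = al \<or> bet = insert c al" "(False = si bet c) = j" for bet
 proof -
  have "(True = si bet c) = (~ j)" using that(2) by auto
  thus ?thesis using circ[OF that(1)] same that(2) by simp
 qed
 have nj: "circles D bet = ?V // eqcl (insert (co.end_arc x False, co.end_arc x True) r)"
  if "bet = al \<or> bet = insert c al" "(False = si bet c) = (~ j)" for bet
 proof -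
  have "(True = si bet c) = j" using that(2) by auto
  thus ?thesis using circ[OF that(1)] join that(2) by simp
 qed
 have m: "merges (?V // eqcl r) (?V // eqcl (insert (co.end_arc x False, co.end_arc x True) r)) (over_in D c) (over_out D c)"
  using merges_insert[OF V V j(3)] by (simp add: D_def diagram_of_def Let_def co.end_arc_def x_def)
 have "si (insert c al) c = (~ si al c)" using c(2) by (auto simp: si_def)
 thus ?thesis using jj nj m by (cases "(False = si al c) = j") auto
qed

end

lemma even_card_involution:
 fixes m :: "'a => 'a"
 assumes "finite A" "!!x. x : A ==> m x : A & m (m x) = x & m x ~= x"
 shows "even (card A)"
 using assms
proof (induction "card A" arbitrary: A rule: less_induct)
 case less
 show ?case
 proof (cases "A = {}")
  case False
  then obtain x where x: "x : A" by auto
  let ?B = "A - {x, m x}"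
  have mx: "m x : A" "m x ~= x" using less(3) x by auto
  have "card A = card ?B + card {x, m x}"
   using less(2) x mx by (metis (no_types, lifting) card_Diff_subset card_mono empty_subsetI finite.emptyI finite.insertI insert_subset le_add_diff_inverse2)
  hence cA: "card A = card ?B + 2" using mx by simp
  moreover have "even (card ?B)"
  proof (rule less(1))
   show "m y : ?B & m (m y) = y & m y ~= y" if "y : ?B" for y
    using that less(3)[of y] less(3)[OF x] by auto
  qed (use cA less(2) in auto)
  ultimately show ?thesis by simp
 qed simp
qed

section \<open>Non crossing matchings\<close>

text \<open>
 The points \<open>a\<^sub>i\<close>, \<open>b\<^sub>i\<close> have the indices \<open>2i - 2\<close>, \<open>2i - 1\<close>, and \<open>b\<^sub>i\<close> is matched with
 \<open>a\<^sub>j\<close> for \<open>j = p i\<close>.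
\<close>

locale noncrossing_matching =
 fixes m :: "nat => nat" and n :: nat
 assumes m: "!!k. k < 2 * n ==> m k < 2 * n & m (m k) = k & m k ~= k"
  and nc: "!!k l. l < 2 * n ==> k < l ==> l < m k ==> m l <= m k"
begin

text \<open>\<open>nc\<close> bounds partners only from above; applied at the partner of l it also
  excludes that this partner lies below k.\<close>

lemma between:
 assumes "k < 2 * n" "k < l" "l < m k" shows "k < m l" "m l < m k"
proof -
 have l: "l < 2 * n" using assms m[of k] by auto
 have "m l ~= m k" "m l ~= k" using assms m[OF l] m[of k] by auto
 thus "m l < m k" using nc[OF l assms(2,3)] by auto
 show "k < m l"
 proof (rule ccontr)
  assume "~ k < m l"
  hence lt: "m l < k" using \<open>m l ~= k\<close> by auto
  moreover have "k < m (m l)" using m[OF l] assms by auto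
  ultimately have "m k <= m (m l)" using nc[of k "m l"] assms(1) by auto
  thus False using m[OF l] assms by auto
 qed
qed

text \<open>The points strictly between k and its partner are matched among themselves, so their
  number is even. Hence a point b is always matched with a point a.\<close>

lemma parity: assumes "k < 2 * n" shows "odd (m k) \<longleftrightarrow> even k"
proof -
 have *: "odd (m k) \<longleftrightarrow> even k" if k: "k < 2 * n" "k < m k" for k
 proof -
  have "even (card {k<..<m k})"
   by (rule even_card_involution[of _ m]) (use between[OF k(1)] k m m[OF k(1)] in auto)
  moreover have "card {k<..<m k} = m k - k - 1" by simp
  ultimately have "even (m k - k - 1)" by simp
  thus ?thesis using k(2) by presburger
 qed
 show ?thesis
 proof (cases "k < m k")
  case True thus ?thesis using * assms by blast
 next
  case False
  hence "m k < m (m k)" using m[OF assms] by auto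
  thus ?thesis using *[of "m k"] m[OF assms] by auto
 qed
qed

definition p :: "nat => nat" where "p i = m (2 * i - 1) div 2 + 1"

lemma p: assumes "i : {1..n}" shows "p i : {1..n}" "m (2 * i - 1) = 2 * p i - 2"
proof -
 have "2 * i - 1 < 2 * n" using assms by auto
 hence "even (m (2 * i - 1))" "m (2 * i - 1) < 2 * n" using parity[of "2 * i - 1"] m[of "2 * i - 1"] assms by auto
 thus "p i : {1..n}" "m (2 * i - 1) = 2 * p i - 2" by (auto simp: p_def elim!: evenE)
qed

lemma inj_p: "inj_on p {1..n}"
proof (rule inj_onI)
 fix i j assume ij: "i : {1..n}" "j : {1..n}" "p i = p j"
 have "2 * i - 1 < 2 * n" "2 * j - 1 < 2 * n" using ij by auto
 moreover have "m (2 * i - 1) = m (2 * j - 1)" using p(2) ij by auto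
 ultimately have "2 * i - 1 = 2 * j - 1" using m by metis
 thus "i = j" using ij by auto
qed

text \<open>The graph of the permutation p; the classes it generates, called \<open>blocks\<close>,
  are the orbits of p.\<close>

definition G :: "(nat \<times> nat) set" where "G = (%i. (i, p i)) ` {1..n}"

definition blocks :: "nat set set" where "blocks = {1..n} // eqcl G"

lemma G_sub: "G \<subseteq> {1..n} \<times> {1..n}" using p by (auto simp: G_def)

text \<open>An injective map of a finite set into itself is onto, so S is also stable under
  preimages and thus a union of orbits.\<close>

lemma invariant:
 assumes "S \<subseteq> {1..n}" "p ` S \<subseteq> S" "(x, y) : eqcl G" "x : S" shows "y : S"
 using assms(3)
proof (induction rule: eqcl_induct)
 case (step y z)
 have fin: "finite S" using assms(1) finite_subset by blast
 have "inj_on p S" using inj_p assms(1) inj_on_subset by blast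
 hence pS: "p ` S = S" using endo_inj_surj[OF fin assms(2)] by blast
 from step(2) show ?case
 proof
  assume "(y, z) : G" thus ?thesis using step(3) assms(2) by (auto simp: G_def)
 next
  assume "(z, y) : G"
  hence zy: "z : {1..n}" "y = p z" by (auto simp: G_def)
  then obtain s where s: "s : S" "p s = p z" using pS step(3) by (metis imageE)
  hence "s = z" using inj_onD[OF inj_p s(2)] zy(1) assms(1) by blast
  thus ?thesis using s by simp
 qed
qed (rule assms)

text \<open>The chord from b_i, index 2 i - 1, to a_(p i), index 2 p i - 2, encloses a_j and b_j
  exactly for i < j < p i, so these j are permuted among themselves.\<close>

lemma gap_up: assumes "i : {1..n}" "i < p i" "j : {i<..<p i}" shows "p j : {i<..<p i}"
proof -
 have j: "j : {1..n}" using assms p[OF assms(1)] by auto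
 have k: "2 * i - 1 < 2 * n" using assms(1) by auto
 have "2 * i - 1 < m (2 * j - 1)" "m (2 * j - 1) < m (2 * i - 1)"
  using between[OF k, of "2 * j - 1"] assms p(2)[OF assms(1)] by auto
 thus ?thesis using p[OF j] p[OF assms(1)] by auto
qed

text \<open>Now the indices from 2 p i - 2 to 2 i - 1 cover a_j and b_j for p i <= j <= i, both ends
  included, so it is the closed interval that is preserved.\<close>

lemma gap_down: assumes "i : {1..n}" "p i <= i" "j : {p i..i}" shows "p j : {p i..i}"
proof (cases "j = i")
 case False
 have j: "j : {1..n}" using assms p[OF assms(1)] by auto
 let ?k = "2 * p i - 2"
 have "2 * i - 1 < 2 * n" using assms(1) by auto
 hence k: "?k < 2 * n" "m ?k = 2 * i - 1" using m[of "2 * i - 1"] p[OF assms(1)] by auto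
 have "?k < m (2 * j - 1)" "m (2 * j - 1) < m ?k"
  using between[OF k(1), of "2 * j - 1"] k assms p[OF assms(1)] False j by auto
 hence "2 * p i - 2 < 2 * p j - 2" "2 * p j - 2 < 2 * i - 1" using p(2)[OF j] k(2) by simp_all
 hence "p i <= p j & p j <= i" by linarith
 thus ?thesis by simp
qed (use assms in auto)

lemma block_mem: assumes "S : blocks" "i : S" shows "i : {1..n}" "p i : S" "S = eqcl G `` {i}"
proof -
 show 1: "i : {1..n}" using quotient_sub[OF G_sub assms(1)[unfolded blocks_def]] assms(2) by blast
 show 2: "S = eqcl G `` {i}" by (rule quotient_class_mem[OF assms(1)[unfolded blocks_def] assms(2)])
 have "(i, p i) : eqcl G" using 1 by (intro eqcl_gen) (auto simp: G_def)
 thus "p i : S" using 2 by auto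
qed

text \<open>The gap is a union of orbits that does not contain i. So p i is the next element of the
  block.\<close>

lemma block_up: assumes "S : blocks" "i : S" "i < p i" shows "S Int {i<..<p i} = {}"
proof (rule ccontr)
 assume "~ ?thesis"
 then obtain j where j: "j : S" "j : {i<..<p i}" by blast
 note i = block_mem[OF assms(1,2)]
 have "(j, i) : eqcl G" using block_mem(3)[OF assms(1) j(1)] assms(2) by auto
 moreover have "{i<..<p i} \<subseteq> {1..n}" using p[OF i(1)] by auto
 moreover have "p ` {i<..<p i} \<subseteq> {i<..<p i}" using gap_up[OF i(1) assms(3)] by blast
 ultimately have "i : {i<..<p i}" using invariant j(2) by blast
 thus False by simp
qed

text \<open>The whole orbit of i stays in the interval. So i is the greatest element of its block
  and p i the least.\<close>

lemma block_down: assumes "S : blocks" "i : S" "p i <= i" shows "S \<subseteq> {p i..i}"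
proof
 fix j assume "j : S"
 note i = block_mem[OF assms(1,2)]
 have "(i, j) : eqcl G" using i(3) \<open>j : S\<close> by auto
 moreover have "{p i..i} \<subseteq> {1..n}" using p[OF i(1)] i(1) by auto
 moreover have "p ` {p i..i} \<subseteq> {p i..i}" using gap_down[OF i(1) assms(3)] by blast
 ultimately show "j : {p i..i}" using invariant[of "{p i..i}" i j] assms(3) by auto
qed

text \<open>On a block p moves to the next larger element and from the greatest back to the least,
  which is the rule for chords. Thus the chords of the partition join the same boundary points as
  the strands do.\<close>

lemma chords_blocks: "chords blocks = G"
proof -
 have nx: "(if {k : S. i < k} = {} then Min S else Min {k : S. i < k}) = p i" if S: "S : blocks" "i : S" for S i
 proof -
  note i = block_mem[OF S]
  have finS: "finite S" using quotient_sub[OF G_sub, of S] S finite_subset by (metis blocks_def finite_atLeastAtMost)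
  show ?thesis
  proof (cases "i < p i")
   case True
   hence "p i : {k : S. i < k}" using i by auto
   moreover have "Min {k : S. i < k} = p i"
   proof (rule Min_eqI)
    show "finite {k : S. i < k}" using finS by simp
    show "p i <= k" if "k : {k : S. i < k}" for k
     using that block_up[OF S True] by (metis (lifting) disjoint_iff greaterThanLessThan_iff leI mem_Collect_eq)
    show "p i : {k : S. i < k}" using True i by simp
   qed
   ultimately show ?thesis by auto
  next
   case False
   hence sub: "S \<subseteq> {p i..i}" using block_down[OF S] by simp
   hence "{k : S. i < k} = {}" by auto
   moreover have "Min S = p i" by (rule Min_eqI) (use sub i finS in auto)
   ultimately show ?thesis by simp
  qed
 qed
 have "chords blocks = {(i, p i) | i S. S : blocks & i : S}" unfolding chords_def using nx by (auto; metis)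
 also have "\<dots> = G"
 proof -
  have "(\<exists>S. S : blocks & i : S) \<longleftrightarrow> i : {1..n}" for i
   using block_mem(1)[of _ i] quotientI[of i "{1..n}" "eqcl G"] unfolding blocks_def by blast
  thus ?thesis unfolding G_def by blast
 qed
 finally show ?thesis .
qed

lemma partition_blocks: "partition_on {1..n} blocks"
proof (rule partition_onI)
 show "\<Union> blocks = {1..n}"
 proof
  show "\<Union> blocks \<subseteq> {1..n}" using block_mem(1) by blast
  show "{1..n} \<subseteq> \<Union> blocks"
  proof
   fix i assume "i : {1..n}"
   hence "eqcl G `` {i} : blocks" unfolding blocks_def by (rule quotientI)
   moreover have "i : eqcl G `` {i}" by simp
   ultimately show "i : \<Union> blocks" by blast
  qed
 qed
 show "disjnt S S'" if "S : blocks" "S' : blocks" "S ~= S'" for S S'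
  unfolding disjnt_def using quotient_disjoint[OF that(1,2)[unfolded blocks_def]] that(3) by blast
 show "{} ~: blocks" unfolding blocks_def using quotient_nonempty by blast
qed

text \<open>A gap of S is a union of orbits, so it contains all of S' as soon as it contains one
  point of it. If no gap does, S' lies outside the interval from the least to the greatest element
  of S.\<close>

lemma separating_interval:
 assumes S: "S : blocks" "S' : blocks" "S ~= S'"
 obtains a b where "1 <= a" "a <= b" "b <= n"
  "S \<subseteq> {a..b} & S' \<subseteq> {1..n} - {a..b} \<or> S' \<subseteq> {a..b} & S \<subseteq> {1..n} - {a..b}"
proof -
 have sub: "S \<subseteq> {1..n}" "S' \<subseteq> {1..n}" using block_mem S by blast+
 obtain y where y: "y : S'" using quotient_nonempty[OF S(2)[unfolded blocks_def]] by blast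
 have yS': "S' = eqcl G `` {y}" "y ~: S" using block_mem[OF S(2) y] block_mem(3)[OF S(1)] S(3) by auto
 show thesis
 proof (cases "\<exists>u\<in>S. u < y & y < p u")
  case True
  then obtain u where u: "u : S" "u < y" "y < p u" by auto
  note i = block_mem[OF S(1) u(1)]
  have "p ` {u<..<p u} \<subseteq> {u<..<p u}" using gap_up[OF i(1)] u(2,3) by (meson image_subsetI less_trans)
  moreover have "{u<..<p u} \<subseteq> {1..n}" using p[OF i(1)] by auto
  moreover have "y : {u<..<p u}" using u by simp
  ultimately have "S' \<subseteq> {u<..<p u}" using invariant[of "{u<..<p u}" y] unfolding yS'(1) by blast
  moreover have "S Int {u<..<p u} = {}" using block_up[OF S(1) u(1)] u by simp
  moreover have eq: "{u<..<p u} = {u + 1..p u - 1}" by auto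
  ultimately have "S' \<subseteq> {u + 1..p u - 1} & S \<subseteq> {1..n} - {u + 1..p u - 1}" using sub by blast
  thus thesis using u p(1)[OF i(1)] by (intro that[of "u + 1" "p u - 1"]) auto
 next
  case False
  have finS: "finite S" "S ~= {}"
   using sub finite_subset quotient_nonempty[OF S(1)[unfolded blocks_def]] by blast+
  define i where "i = Max S"
  have iS: "i : S" "p i <= i" using finS block_mem(2)[OF S(1)] by (auto simp: i_def)
  note i = block_mem[OF S(1) iS(1)]
  have Ssub: "S \<subseteq> {p i..i}" by (rule block_down[OF S(1) iS])
  have "y ~: {p i..i}"
  proof
   assume "y : {p i..i}"
   hence yy: "p i < y" "y < i" using yS'(2) i iS by (auto simp: le_less)
   \<comment> \<open>The last element of S before y. It cannot move up, as y would lie in the gap or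
     p u would be a later such element. If it does not move up, it is the greatest element of S,
     against u < y < i.\<close>
   define u where "u = Max {k : S. k < y}"
   have ne: "{k : S. k < y} ~= {}" "finite {k : S. k < y}" using i yy finS by auto
   hence u: "u : S" "u < y" using Max_in[OF ne(2,1)] by (auto simp: u_def)
   note pu = block_mem[OF S(1) u(1)]
   have umax: "k <= u" if "k : S" "k < y" for k using that ne by (auto simp: u_def)
   have "p u ~= y" using pu(2) yS'(2) by auto
   have "p u <= u"
   proof (rule ccontr)
    assume "~ p u <= u"
    thus False using False u umax[of "p u"] pu(2) \<open>p u ~= y\<close> by force
   qed
   hence "S \<subseteq> {p u..u}" using block_down[OF S(1) u(1)] by simp
   thus False using iS u yy by auto
  qed
  moreover have "p ` {p i..i} \<subseteq> {p i..i}" using gap_down[OF i(1) iS(2)] by blast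
  moreover have inn: "{p i..i} \<subseteq> {1..n}" using p[OF i(1)] i(1) by auto
  ultimately have "S' Int {p i..i} = {}"
   using invariant[of "{p i..i}" _ y] yS'(1) eqcl_sym[of y _ G] by blast
  hence "S \<subseteq> {p i..i} & S' \<subseteq> {1..n} - {p i..i}" using Ssub sub by blast
  thus thesis using iS(2) p(1)[OF i(1)] i(1) by (intro that[of "p i" i]) auto
 qed
qed

end

text \<open>On the circle, the numbers from a to b are those within angle 2 pi h / n of the midpoint
  muh, and a line orthogonal to the direction of the midpoint cuts them off.\<close>

lemma cos_separation:
 assumes ab: "1 <= a" "a <= b" "b <= n" and m: "m : {1..n}"
 defines "muh \<equiv> (real a + real b) / 2" and "h \<equiv> (real b - real a) / 2"
 shows "cos (2 * pi * (real m - muh) / n) \<ge> cos (2 * pi * h / n) \<longleftrightarrow> m : {a..b}"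
proof -
 have n: "real n > 0" using ab by auto
 define d where "d = \<bar>real m - muh\<bar>"
 have c: "cos (2 * pi * (real m - muh) / n) = cos (2 * pi * d / n)"
 proof (cases "real m - muh \<ge> 0")
  case False
  hence "d = - (real m - muh)" by (simp add: d_def)
  hence "2 * pi * d / n = - (2 * pi * (real m - muh) / n)"
   by (simp only: mult_minus_right minus_divide_left)
  thus ?thesis by (metis cos_minus)
 qed (simp add: d_def)
 have h: "0 <= h" "2 * h <= real n - 1" using ab by (auto simp: h_def)
 have hp: "0 <= 2 * pi * h / n" "2 * pi * h / n <= pi" using h n by (auto simp: field_simps)
 show ?thesis
 proof (cases "m : {a..b}")
  case True
  hence "d <= h" "0 <= d" by (auto simp: d_def muh_def h_def abs_if field_simps)
  hence "cos (2 * pi * h / n) <= cos (2 * pi * d / n)"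
   using hp n by (intro cos_monotone_0_pi_le) (auto simp: divide_right_mono mult_left_mono)
  thus ?thesis using True c by simp
 next
  case False
  \<comment> \<open>The upper bound, from 1 <= m <= n, keeps the point away from the interval also
    when the angle is measured the other way round the circle.\<close>
  hence d: "d > h" "d < n - h" using m ab by (auto simp: d_def muh_def h_def abs_if field_simps)
  have "cos (2 * pi * d / n) < cos (2 * pi * h / n)"
  proof (cases "2 * pi * d / n <= pi")
   case True
   have "2 * pi * h / n < 2 * pi * d / n" using d n by (simp add: divide_strict_right_mono)
   thus ?thesis using True hp by (intro cos_monotone_0_pi) auto
  next
   case False
   have e: "cos (2 * pi * d / n) = cos (2 * pi - 2 * pi * d / n)" by (simp add: cos_diff)
   have "2 * pi * h < 2 * pi * (n - d)" using d by (intro mult_strict_left_mono) auto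
   hence "2 * pi * h / n < 2 * pi * (n - d) / n" using n by (rule divide_strict_right_mono)
   also have "\<dots> = 2 * pi - 2 * pi * d / n" using n by (simp add: field_simps)
   finally show ?thesis unfolding e using False hp by (intro cos_monotone_0_pi) auto
  qed
  thus ?thesis using False c by simp
 qed
qed

lemma hulls_disjoint:
 assumes ab: "1 <= a" "a <= b" "b <= n" and S: "S \<subseteq> {a..b}" "S' \<subseteq> {1..n} - {a..b}"
 defines "f \<equiv> %m. cis (2 * pi * real m / real n)"
 shows "convex hull (f ` S) Int convex hull (f ` S') = {}"
proof -
 define muh where "muh = (real a + real b) / 2"
 define h where "h = (real b - real a) / 2"
 define w where "w = cis (2 * pi * muh / n)"
 have inn: "w \<bullet> f m = cos (2 * pi * (real m - muh) / n)" for m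
  by (simp add: inner_complex_def w_def f_def right_diff_distrib diff_divide_distrib cos_diff mult_ac)
 note sep = cos_separation[OF ab, folded muh_def h_def]
 have "convex hull (f ` S) \<subseteq> {z. w \<bullet> z \<ge> cos (2 * pi * h / n)}"
 proof (rule hull_minimal)
  show "f ` S \<subseteq> {z. w \<bullet> z \<ge> cos (2 * pi * h / n)}"
  proof safe
   fix m assume "m : S"
   hence "m : {a..b}" "m : {1..n}" using S ab by auto
   thus "cos (2 * pi * h / n) <= w \<bullet> f m" using sep[of m] inn by simp
  qed
 qed (rule convex_halfspace_ge)
 moreover have "convex hull (f ` S') \<subseteq> {z. w \<bullet> z < cos (2 * pi * h / n)}"
 proof (rule hull_minimal)
  show "f ` S' \<subseteq> {z. w \<bullet> z < cos (2 * pi * h / n)}"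
  proof safe
   fix m assume "m : S'"
   hence "m ~: {a..b}" "m : {1..n}" using S by auto
   hence "~ cos (2 * pi * h / n) <= w \<bullet> f m" unfolding inn using sep[of m] by blast
   thus "w \<bullet> f m < cos (2 * pi * h / n)" by simp
  qed
 qed (rule convex_halfspace_lt)
 ultimately show ?thesis by force
qed

lemma (in noncrossing_matching) blocks_NC: "blocks : NC n"
 unfolding NC_def
proof (intro CollectI conjI ballI impI partition_blocks)
 fix S S' assume S: "S : blocks" "S' : blocks" "S ~= S'"
 let ?f = "%m. cis (2 * pi * real m / real n)"
 obtain a b where ab: "1 <= a" "a <= b" "b <= n"
  "S \<subseteq> {a..b} & S' \<subseteq> {1..n} - {a..b} \<or> S' \<subseteq> {a..b} & S \<subseteq> {1..n} - {a..b}"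
  using separating_interval[OF S] by metis
 from ab(4) show "convex hull (?f ` S) Int convex hull (?f ` S') = {}"
  using hulls_disjoint[OF ab(1-3), of S S'] hulls_disjoint[OF ab(1-3), of S' S] by blast
qed

text \<open>Going round once, the sign changes N times and returns to itself.\<close>

lemma alternating_even:
 fixes d :: "nat => real"
 assumes "!!k. k < N ==> d k : {1, -1}" "!!k. k < N ==> d k ~= d (Suc k mod N)"
 shows "even N"
proof (cases "N = 0")
 case False
 have *: "k < N ==> d k = (-1) ^ k * d 0" for k
 proof (induction k)
  case (Suc k)
  hence "d k ~= d (Suc k)" using assms(2)[of k] by simp
  thus ?case using Suc assms(1)[of k] assms(1)[of "Suc k"] by auto
 qed simp
 have "d (N - 1) ~= d 0" using assms(2)[of "N - 1"] False by simp
 hence "~ even (N - 1)"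
 proof (rule contrapos_nn)
  assume "even (N - 1)"
  hence "(- 1 :: real) ^ (N - 1) = 1" by (simp only: neg_one_even_power)
  thus "d (N - 1) = d 0" using *[of "N - 1"] False by simp
 qed
 thus ?thesis using False by simp
qed simp

section \<open>Boundary points, tangles and matchings of an admissible cut\<close>

locale tangle_cut = link +
 fixes C :: "real => complex" and R1 R2 :: "complex set"
 assumes adm: "admissible_cut L C" and discs: "cut_discs L C R1 R2"
begin

abbreviation "ts \<equiv> cut_times L C"
abbreviation "n \<equiv> cut_number L C"

lemma adm': "simple_path C" "pathfinish C = pathstart C" "pathstart C ~: trace L"
 "path_image C Int CR = {}" "finite {t : {0<..<1}. C t : trace L}"
 "!!t. t : {0<..<1} ==> C t : trace L ==> cut_direction L C t ~= 0"
 "!!k. k < length ts ==> cut_direction L C (ts ! k) ~= cut_direction L C (ts ! (Suc k mod length ts))"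
 using adm unfolding admissible_cut_def Let_def by blast+

lemma set_ts: "set ts = {t : {0<..<1}. C t : trace L}"
 using adm'(5) by (simp add: cut_times_def)

lemma ts_less: "k < l ==> l < length ts ==> ts ! k < ts ! l"
 using strict_sorted_list_of_set[of "{t : {0<..<1}. C t : trace L}"]
 by (simp add: cut_times_def sorted_wrt_nth_less)

lemma length_ts: "length ts = 2 * n"
proof -
 have "even (length ts)"
 proof (rule alternating_even[of _ "%k. cut_direction L C (ts ! k)"])
  fix k assume k: "k < length ts"
  hence "ts ! k : set ts" by simp
  hence "cut_direction L C (ts ! k) ~= 0" using set_ts adm'(6) by auto
  thus "cut_direction L C (ts ! k) : {1, -1}"
   unfolding cut_direction_def sgn_real_def by (auto split: if_splits)
  show "cut_direction L C (ts ! k) ~= cut_direction L C (ts ! (Suc k mod length ts))" using adm'(7) k .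
 qed
 thus ?thesis by (simp add: cut_number_def)
qed

lemma ts_nth: assumes "k < 2 * n" shows "0 < ts ! k" "ts ! k < 1" "C (ts ! k) : trace L" "C (ts ! k) : path_image C"
proof -
 have "ts ! k : set ts" using assms length_ts by simp
 thus "0 < ts ! k" "ts ! k < 1" "C (ts ! k) : trace L" using set_ts by auto
 thus "C (ts ! k) : path_image C" by (auto simp: path_image_def)
qed

lemma cut_pointE:
 assumes "z : trace L" "z : path_image C"
 obtains k where "k < 2 * n" "z = C (ts ! k)"
proof -
 obtain t where t: "t : {0..1}" "z = C t" using assms by (auto simp: path_image_def)
 have "t ~= 0" "t ~= 1" using t assms(1) adm'(2,3) by (auto simp: pathstart_def pathfinish_def)
 hence "t : set ts" using t assms set_ts by auto
 then obtain k where "k < length ts" "ts ! k = t" by (auto simp: in_set_conv_nth)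
 thus thesis using that t length_ts by auto
qed

lemma pos_of:
 assumes "x : positions L" "pt L x ~: CR" shows "pos_of L (pt L x) = x"
 unfolding pos_of_def using assms pos_inj_off_crossings by (intro the_equality) auto

text \<open>\<open>cut_discs\<close> speaks of closed discs and of the points a_i and b_i. By
  \<open>length_ts\<close> these are all the intersection points, and close to them the strand is
  off C, so it passes between the open sides.\<close>

lemma sub_cut: "cut L C"
proof
 show "simple_path C" "pathfinish C = pathstart C" "path_image C Int CR = {}" using adm' by auto
 show fin: "finite (trace L Int path_image C)"
 proof (rule finite_subset)
  show "trace L Int path_image C \<subseteq> (%k. C (ts ! k)) ` {..<2 * n}" using cut_pointE by blast
 qed auto
 interpret mk: marked L "CR Un path_image C"
  by unfold_locales (use fin finite_crossings in "auto simp: Int_Un_distrib intro: finite_subset")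
 fix x assume x: "x : positions L" "pt L x : path_image C"
 have tr: "pt L x : trace L" using x by (auto simp: trace_def)
 then obtain k where k: "k < 2 * n" "pt L x = C (ts ! k)" using cut_pointE x by blast
 define i where "i = k div 2 + 1"
 have i: "i : {1..n}" using k by (auto simp: i_def)
 have ab: "pt L x = a_point L C i \<or> pt L x = b_point L C i"
 proof (cases "even k")
  case True hence "2 * i - 2 = k" by (auto simp: i_def)
  thus ?thesis using k by (simp add: a_point_def)
 next
  case False hence "2 * i - 1 = k" by (auto simp: i_def elim!: oddE)
  thus ?thesis using k by (simp add: b_point_def)
 qed
 have "pt L x ~: CR" using x(2) adm'(4) by blast
 hence px: "pos_of L (pt L x) = x" using pos_of x by blast
 have "passes_from_to L R2 R1 (pt L x) \<or> passes_from_to L R1 R2 (pt L x)"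
 proof -
  have "passes_from_to L R2 R1 (a_point L C i) & passes_from_to L R1 R2 (b_point L C i)"
   using i discs unfolding cut_discs_def by blast
  thus ?thesis using ab by metis
 qed
 hence "\<exists>A B. {A, B} = {R1, R2} & passes_from_to L A B (pt L x)"
 proof
  assume "passes_from_to L R2 R1 (pt L x)"
  thus ?thesis by (intro exI[of _ R2] exI[of _ R1] conjI insert_commute)
 next
  assume "passes_from_to L R1 R2 (pt L x)"
  thus ?thesis by (intro exI[of _ R1] exI[of _ R2] conjI refl)
 qed
 then obtain A B where AB: "{A, B} = {R1, R2}" "passes_from_to L A B (pt L x)" by (elim exE conjE)
 have "{R1, R2} = {inside (path_image C) Un path_image C, outside (path_image C) Un path_image C}"
  using discs unfolding cut_discs_def by (elim conjE)
 hence "(A = inside (path_image C) Un path_image C & B = outside (path_image C) Un path_image C) \<or>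
   (A = outside (path_image C) Un path_image C & B = inside (path_image C) Un path_image C)"
  unfolding AB(1)[symmetric] doubleton_eq_iff .
 hence "\<exists>U W. {U, W} = {inside (path_image C), outside (path_image C)} & A = U Un path_image C & B = W Un path_image C"
 proof
  assume "A = inside (path_image C) Un path_image C & B = outside (path_image C) Un path_image C"
  thus ?thesis by (intro exI[of _ "inside (path_image C)"] exI[of _ "outside (path_image C)"] conjI refl) simp_all
 next
  assume "A = outside (path_image C) Un path_image C & B = inside (path_image C) Un path_image C"
  thus ?thesis by (intro exI[of _ "outside (path_image C)"] exI[of _ "inside (path_image C)"] conjI insert_commute) simp_all
 qed
 then obtain U W where UW: "{U, W} = {inside (path_image C), outside (path_image C)}"
  "A = U Un path_image C" "B = W Un path_image C" by (elim exE conjE)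
 have xm: "x : mk.mpos" using x by (auto simp: mk.mpos_def)
 have off: "mk.end_arc x b Int path_image C = {}" for b
  using in_components_subset[OF mk.end_arc_component[OF xm, of b]] by auto
 have "\<forall>\<^sub>F h in at_right 0. strand L (fst x) (snd x - h) : A & strand L (fst x) (snd x + h) : B"
  using AB(2) unfolding passes_from_to_def px .
 hence "\<forall>\<^sub>F h in at_right 0. strand L (fst x) (snd x - h) : U & strand L (fst x) (snd x + h) : W"
  using mk.arc_after_eventually[OF xm] mk.arc_before_eventually[OF xm]
 proof eventually_elim
  case (elim h)
  thus ?case using off[of True] off[of False] UW(2,3) by (auto simp: mk.end_arc_def)
 qed
 thus "\<exists>U W. {U, W} = {inside (path_image C), outside (path_image C)} &
    (\<forall>\<^sub>F h in at_right 0. strand L (fst x) (snd x - h) : U & strand L (fst x) (snd x + h) : W)"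
  using UW(1) by blast
qed

sublocale cut by (rule sub_cut)

definition bp :: "nat => nat \<times> real" where "bp k = pos_of L (C (ts ! k))"

lemma bp: assumes "k < 2 * n" shows "bp k : bpos" "pt L (bp k) = C (ts ! k)"
proof -
 obtain x where x: "x : positions L" "pt L x = C (ts ! k)" using ts_nth[OF assms] by (auto simp: trace_def)
 have "C (ts ! k) ~: CR" using ts_nth[OF assms] off by blast
 hence "bp k = x" unfolding bp_def using pos_of[OF x(1)] x(2) by simp
 thus "bp k : bpos" "pt L (bp k) = C (ts ! k)" using x ts_nth[OF assms] by (auto simp: bpos_def mpos_iff)
qed

lemma bp_inj: assumes "k < 2 * n" "l < 2 * n" "bp k = bp l" shows "k = l"
proof -
 have "C (ts ! k) = C (ts ! l)" using bp assms by metis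
 hence "ts ! k = ts ! l"
  using adm'(1) ts_nth[OF assms(1)] ts_nth[OF assms(2)] unfolding simple_path_def loop_free_def by fastforce
 thus ?thesis using ts_less[of k l] ts_less[of l k] assms length_ts by (metis linorder_neqE_nat order_less_irrefl)
qed

lemma bpE: assumes "x : bpos" obtains k where "k < 2 * n" "x = bp k"
proof -
 have x: "x : positions L" "pt L x : path_image C" using assms by (auto simp: bpos_def mpos_iff)
 then obtain k where k: "k < 2 * n" "pt L x = C (ts ! k)" using cut_pointE by (metis imageI trace_def)
 have "pt L x ~: CR" using x off by blast
 hence "x = bp k" unfolding bp_def using pos_of x k by metis
 thus thesis using that k by blast
qed

definition sigma :: "complex set => complex => bool" where
 "sigma al c \<longleftrightarrow> (c : al) = positive_crossing L c"

text \<open>\<open>partner\<close> provides m and \<open>noncrossing\<close> the inequality: a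
  violation would put two different strands into one class.\<close>

lemma matching:
 assumes U: "is_side U"
 obtains m where "noncrossing_matching m n"
  "!!k l. k < 2 * n ==> l < 2 * n ==>
   (barc U (bp k), barc U (bp l)) : eqcl (srel (CR Int U) si) \<longleftrightarrow> l = k \<or> l = m k"
proof -
 let ?E = "eqcl (srel (CR Int U) si)"
 define m where "m k = (THE l. l < 2 * n & l ~= k & (barc U (bp k), barc U (bp l)) : ?E)" for k
 have ex1: "\<exists>!l. l < 2 * n & l ~= k & (barc U (bp k), barc U (bp l)) : ?E" if k: "k < 2 * n" for k
 proof -
  obtain x where x: "x : bpos" "x ~= bp k" "(barc U (bp k), barc U x) : ?E"
   and ux: "!!y. y : bpos ==> y ~= bp k ==> (barc U (bp k), barc U y) : ?E ==> y = x"
   using partner[OF bp(1)[OF k] U, of si] by (elim ex1E) blast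
  obtain l where l: "l < 2 * n" "x = bp l" using bpE x(1) by blast
  show ?thesis
  proof (rule ex1I[of _ l])
   show "l < 2 * n & l ~= k & (barc U (bp k), barc U (bp l)) : ?E" using l x by auto
   show "l' = l" if "l' < 2 * n & l' ~= k & (barc U (bp k), barc U (bp l')) : ?E" for l'
   proof -
    have "bp l' = x" using that bp bp_inj k by (intro ux) blast+
    thus ?thesis using bp_inj l that by blast
   qed
  qed
 qed
 have mk: "m k < 2 * n" "m k ~= k" "(barc U (bp k), barc U (bp (m k))) : ?E" if "k < 2 * n" for k
  using theI'[OF ex1[OF that]] by (auto simp: m_def)
 have mu: "l = m k" if "k < 2 * n" "l < 2 * n" "l ~= k" "(barc U (bp k), barc U (bp l)) : ?E" for k l
  using ex1[OF that(1)] mk[OF that(1)] that by blast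
 have iff: "(barc U (bp k), barc U (bp l)) : ?E \<longleftrightarrow> l = k \<or> l = m k" if "k < 2 * n" "l < 2 * n" for k l
  using mu[OF that] mk[OF that(1)] by auto
 have mm: "m (m k) = k" if "k < 2 * n" for k
  using mu[of "m k" k] mk[OF that] that eqcl_sym by fastforce
 have "noncrossing_matching m n"
 proof
  show "m k < 2 * n & m (m k) = k & m k ~= k" if "k < 2 * n" for k using mk mm that by auto
  fix k l assume kl: "l < 2 * n" "k < l" "l < m k"
  have k: "k < 2 * n" using kl by auto
  show "m l <= m k"
  proof (rule ccontr)
   assume "~ m l <= m k"
   hence lt: "m k < m l" by simp
   have b: "m k < length ts" "m l < length ts" "l < length ts" using mk k kl length_ts by auto
   have "(barc U (bp k), barc U (bp l)) : ?E"
   proof (rule noncrossing[OF U subset_refl bp(1)[OF k] bp(1) bp(1)[OF kl(1)] bp(1), of "m k" "m l" "ts ! k" "ts ! l" "ts ! m k" "ts ! m l"])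
    show "ts ! k < ts ! l" "ts ! l < ts ! m k" "ts ! m k < ts ! m l" using ts_less kl lt b by auto
   qed (use mk k kl ts_nth bp in "auto intro: less_imp_le")
   thus False using iff k kl by auto
  qed
 qed
 thus thesis using that iff by blast
qed

definition tang :: "complex set => (complex, complex set) tangle" where
 "tang U = tangle_in L C (U Un path_image C)"

definition side_arcs :: "complex set => complex set set" where
 "side_arcs U = {e : components (trace L - MM). e \<subseteq> U}"

lemma tang_simps:
 assumes U: "is_side U"
 shows "arcs (tang U) = side_arcs U" "joins (tang U) = {}" "crossings (tang U) = CR Int U"
  "positive (tang U) = positive_crossing L" "half_ends (tang U) = n"
  "i : {1..n} ==> a_arc (tang U) i = barc U (bp (2 * i - 2))"
  "i : {1..n} ==> b_arc (tang U) i = barc U (bp (2 * i - 1))"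
  "is_cut_diagram (tang U)"
proof -
 have arcs: "{e : components (trace L - MM). e \<subseteq> U Un path_image C} = side_arcs U"
  using arc_side(2) unfolding side_arcs_def by blast
 have the: "(THE e. e : side_arcs U & C (ts ! k) : closure e) = barc U (bp k)" if k: "k < 2 * n" for k
 proof (rule the_equality)
  show "barc U (bp k) : side_arcs U & C (ts ! k) : closure (barc U (bp k))"
   using barc[OF bp(1)[OF k] U] bp(2)[OF k] by (auto simp: side_arcs_def)
  show "e = barc U (bp k)" if "e : side_arcs U & C (ts ! k) : closure e" for e
   using that bp(2)[OF k] by (intro closure_boundary[OF bp(1)[OF k] U]) (auto simp: side_arcs_def)
 qed
 have the': "(THE e. e : components (trace L - MM) & e \<subseteq> U Un path_image C & C (ts ! k) : closure e) = barc U (bp k)"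
  if k: "k < 2 * n" for k
 proof -
  have "e : components (trace L - MM) & e \<subseteq> U Un path_image C & C (ts ! k) : closure e \<longleftrightarrow>
   e : side_arcs U & C (ts ! k) : closure e" for e using arcs by blast
  thus ?thesis using the[OF k] by simp
 qed
 note d = tang_def tangle_in_def Let_def MM_def[symmetric] arcs
 show "arcs (tang U) = side_arcs U" "joins (tang U) = {}"
  "positive (tang U) = positive_crossing L" "half_ends (tang U) = n" by (simp_all add: d)
 show "crossings (tang U) = CR Int U" using off by (auto simp: d)
 show "a_arc (tang U) i = barc U (bp (2 * i - 2))" "b_arc (tang U) i = barc U (bp (2 * i - 1))" if "i : {1..n}" for i
 proof -
  have "2 * i - 2 < 2 * n" "2 * i - 1 < 2 * n" using that by auto
  thus "a_arc (tang U) i = barc U (bp (2 * i - 2))" "b_arc (tang U) i = barc U (bp (2 * i - 1))"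
   using the'[of "2 * i - 2"] the'[of "2 * i - 1"]
  by (simp_all add: tang_def tangle_in_def Let_def MM_def[symmetric] a_point_def b_point_def conj_assoc)
 qed
 show "is_cut_diagram (tang U)" by (simp add: is_cut_diagram_def d end_arc_def)
qed

end

section \<open>Comparing fine arcs with the arcs of L\<close>

context cut
begin

text \<open>The gluings across the curve, by which the fine arcs are put together to the arcs of L
  again.\<close>

definition jrel :: "complex set rel" where
 "jrel = (%x. (end_arc x False, end_arc x True)) ` bpos"

text \<open>Near a point of C there is a connected piece of the strand free of crossings, and it
  meets the arcs on both sides.\<close>

lemma jrel_kap: assumes "x : bpos" shows "kap (end_arc x False) = kap (end_arc x True)"
proof -
 have x: "x : mpos" "x : positions L" "pt L x : path_image C" using assms by (auto simp: bpos_def mpos_iff)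
 have i: "fst x < NN" using mposD x by auto
 have nc: "strand L (fst x) (snd x) ~: CR" using x off by (auto simp: pt_def)
 have "\<forall>\<^sub>F t in nhds (snd x). strand L (fst x) t : - CR"
 proof -
  have "open (- CR)" using finite_crossings by (simp add: finite_imp_closed open_Compl)
  thus ?thesis using isCont_strand[OF i, of "snd x"] nc
   unfolding isCont_def tendsto_at_iff_tendsto_nhds by (intro topological_tendstoD) auto
 qed
 then obtain e where e: "e > 0" "!!t. dist t (snd x) < e ==> strand L (fst x) t ~: CR"
  unfolding eventually_nhds_metric by auto
 define I where "I = strand L (fst x) ` {snd x - e<..<snd x + e}"
 have I: "connected I" "I \<subseteq> trace L - CR"
  unfolding I_def using e strand_in_trace[OF i]
  by (auto intro!: connected_continuous_image cont_strand i simp: dist_real_def abs_less_iff)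
 have "strand L (fst x) (snd x) : I" unfolding I_def using e by auto
 then obtain k where k: "k : components (trace L - CR)" "I \<subseteq> k"
  using exists_component_superset[OF I(2) _ I(1)] I by blast
 have "kap (end_arc x b) = k" for b
 proof (rule kap(3)[OF end_arc_component[OF x(1)] k(1)])
  have "\<forall>\<^sub>F h in at_right 0. 0 < h & h < e"
   unfolding eventually_at_right_field using e by (intro exI[of _ e]) auto
  hence "\<forall>\<^sub>F h in at_right 0. strand L (fst x) (snd x + (if b then h else - h)) : k"
  proof eventually_elim
   case (elim h)
   hence "strand L (fst x) (snd x + (if b then h else - h)) : I" unfolding I_def by (cases b) auto
   thus ?case using k by blast
  qed
  moreover have "\<forall>\<^sub>F h in at_right 0. strand L (fst x) (snd x + (if b then h else - h)) : end_arc x b"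
   using arc_after_eventually[OF x(1)] arc_before_eventually[OF x(1)] by (cases b) (simp_all add: end_arc_def)
  ultimately show "k Int end_arc x b ~= {}" by (rule eventually_meet)
 qed
 thus ?thesis by simp
qed

lemma closure_arcs_cover:
 assumes "p : trace L" "p ~: CR"
 obtains f where "f : components (trace L - MM)" "p : closure f"
proof (cases "p : path_image C")
 case True
 obtain x where x: "x : positions L" "p = pt L x" using assms by (auto simp: trace_def)
 hence "x : mpos" using True by (simp add: mpos_iff)
 thus thesis using that end_arc_component end_in_closure x by blast
next
 case False
 hence "p : trace L - MM" using assms by (auto simp: MM_def)
 then obtain f where "f : components (trace L - MM)" "p : f" by (metis Union_components Union_iff)
 thus thesis using that closure_subset by blast
qed

text \<open>The closures of the fine arcs linked to f across C, and those of the others, are two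
  closed sets covering the coarse arc. A common point off the crossings would be a point of C where
  the two arcs are glued. Connectedness leaves only the former.\<close>

lemma kap_sub_closures:
 assumes f: "f : components (trace L - MM)"
 shows "kap f \<subseteq> (\<Union>g\<in>{g : components (trace L - MM). (f, g) : eqcl jrel}. closure g)"
proof (rule connected_subset_closed)
 let ?V = "components (trace L - MM)"
 let ?K2 = "\<Union>g\<in>{g : ?V. (f, g) ~: eqcl jrel}. closure g"
 let ?K1 = "\<Union>g\<in>{g : ?V. (f, g) : eqcl jrel}. closure g"
 have k: "kap f : components (trace L - CR)" "f \<subseteq> kap f" using kap[OF f] by auto
 have ksub: "kap f \<subseteq> trace L - CR" using in_components_subset[OF k(1)] .
 show "connected (kap f)" using in_components_connected[OF k(1)] .
 show "closed ?K1" "closed ?K2" using finite_components by (auto intro!: closed_UN)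
 show "kap f \<subseteq> ?K1 Un ?K2"
 proof
  fix p assume "p : kap f"
  then obtain g where "g : ?V" "p : closure g" using ksub closure_arcs_cover[of p] by blast
  thus "p : ?K1 Un ?K2" by blast
 qed
 have "f ~= {}" using f in_components_nonempty by blast
 moreover have "f \<subseteq> ?K1" using f closure_subset by auto
 ultimately show "kap f Int ?K1 ~= {}" using k(2) by blast
 show "kap f Int ?K1 Int ?K2 = {}"
 proof (rule ccontr)
  assume "~ ?thesis"
  then obtain p g g' where p: "p : kap f" "g : ?V" "(f, g) : eqcl jrel" "p : closure g"
   "g' : ?V" "(f, g') ~: eqcl jrel" "p : closure g'" by blast
  have ne: "g ~= g'" using p by auto
  have "p ~: g" using closure_Int_arc[OF p(2,5)] p ne by blast
  then obtain x b where x: "x : mpos" "g = end_arc x b" "p = pt L x" using closure_end_arc[OF p(2,4)] by metis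
  have "p ~: g'" using closure_Int_arc[OF p(5,2)] p ne by blast
  then obtain x' b' where x': "x' : mpos" "g' = end_arc x' b'" "p = pt L x'" using closure_end_arc[OF p(5,7)] by metis
  have pn: "p ~: CR" using p ksub by auto
  have xx: "x = x'"
  proof (rule pos_inj_off_crossings)
   show "x : positions L" "x' : positions L" using x(1) x'(1) by (simp_all add: mpos_iff)
   show "pt L x = pt L x'" using x(3) x'(3) by (rule trans[OF sym])
   show "pt L x ~: CR" using pn unfolding x(3) .
  qed
  have xb: "x : bpos" using x(1) pn unfolding x(3) bpos_def mpos_iff by blast
  have "(end_arc x False, end_arc x True) : jrel" using xb by (auto simp: jrel_def)
  hence "(end_arc x False, end_arc x True) : eqcl jrel" by (rule eqcl_gen)
  hence "(g, g') : eqcl jrel" using x(2) x'(2) xx ne eqcl_sym[of "end_arc x False" "end_arc x True" jrel]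
   by (cases b; cases b') auto
  thus False using p(6) eqcl_trans[OF p(3)] by blast
 qed
qed

lemma kap_eq_imp:
 assumes "f : components (trace L - MM)" "g : components (trace L - MM)" "kap f = kap g"
 shows "(f, g) : eqcl jrel"
proof -
 have "g \<subseteq> kap f" using kap(2)[OF assms(2)] assms(3) by simp
 moreover have "g ~= {}" using assms(2) in_components_nonempty by blast
 ultimately obtain p h where p: "p : g" "h : components (trace L - MM)" "(f, h) : eqcl jrel" "p : closure h"
  using kap_sub_closures[OF assms(1)] by blast
 have "g = h" using closure_Int_arc[OF assms(2) p(2)] p by blast
 thus ?thesis using p by simp
qed

text \<open>No gluing across C starts at f, so the union of closures in
  \<open>kap_sub_closures\<close> is just the closure of f.\<close>

lemma kap_isolated:
 assumes f: "f : components (trace L - MM)" and no: "!!x b. x : bpos ==> f ~= end_arc x b"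
 shows "kap f = f"
proof
 show "f \<subseteq> kap f" by (rule kap(2)[OF f])
 show "kap f \<subseteq> f"
 proof
  fix p assume p: "p : kap f"
  have cls: "g = f" if "(f, g) : eqcl jrel" for g
   using that by (induction rule: eqcl_induct) (use no in "auto simp: jrel_def")
  obtain g where g: "(f, g) : eqcl jrel" "p : closure g" using kap_sub_closures[OF f] p by blast
  hence pf: "p : closure f" using cls by blast
  show "p : f"
  proof (rule ccontr)
   assume "p ~: f"
   then obtain x b where x: "x : mpos" "f = end_arc x b" "p = pt L x" using closure_end_arc[OF f pf] by metis
   have "p ~: CR" using p in_components_subset[OF kap(1)[OF f]] by auto
   hence "x : bpos" using x(1) unfolding x(3) bpos_def mpos_iff by blast
   thus False using no x(2) by blast
  qed
 qed
qed

lemma kap_surj: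
 assumes e: "e : components (trace L - CR)"
 obtains f where "f : components (trace L - MM)" "kap f = e"
proof -
 obtain p where p: "p : e" using e in_components_nonempty by blast
 have "p : trace L" "p ~: CR" using p in_components_subset[OF e] by auto
 then obtain i t where i: "i < NN" "p = strand L i t" unfolding trace_eq by auto
 show thesis
 proof (cases "p : path_image C")
  case False
  hence "p : trace L - MM" using p in_components_subset[OF e] by (auto simp: MM_def)
  then obtain f where f: "f : components (trace L - MM)" "p : f" by (metis Union_components Union_iff)
  thus thesis using that kap(3)[OF f(1) e] p by blast
 next
  \<comment> \<open>The chosen point lies on C. It is in the closure of the fine arc after it, and
    the part of this closure off the crossings is still connected.\<close>
  case True
  obtain x where x: "x : positions L" "p = pt L x" using \<open>p : trace L\<close> by (auto simp: trace_def)
  hence xm: "x : mpos" using True by (simp add: mpos_iff)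
  hence xb: "x : bpos" using True x by (simp add: bpos_def)
  have comp: "end_arc x True : components (trace L - MM)" by (rule end_arc_component[OF xm])
  let ?f = "end_arc x True"
  have "closure ?f Int (trace L - CR) \<subseteq> kap ?f"
  proof -
   have "connected (closure ?f Int (trace L - CR))"
   proof (rule connected_intermediate_closure)
    show "connected ?f" by (rule in_components_connected[OF comp])
    have "?f \<subseteq> trace L - CR" using in_components_subset[OF comp] by (auto simp: MM_def)
    thus "?f \<subseteq> closure ?f Int (trace L - CR)" using closure_subset[of ?f] by blast
   qed blast
   moreover have "?f ~= {}" using comp in_components_nonempty by blast
   moreover have "?f \<subseteq> trace L - CR" using in_components_subset[OF comp] by (auto simp: MM_def)
   ultimately show ?thesis
    using components_maximal[OF kap(1)[OF comp]] kap(2)[OF comp] closure_subset[of ?f] by blast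
  qed
  moreover have "p : closure ?f" using end_in_closure[OF xm, of True] x by simp
  ultimately have "p : kap ?f" using p in_components_subset[OF e] by blast
  hence "kap ?f = e" using components_nonoverlap[OF kap(1)[OF comp] e] p by blast
  thus thesis using that comp by blast
 qed
qed

lemma crossings_split:
 assumes "{U, W} = {inside (path_image C), outside (path_image C)}"
 shows "CR = (CR Int U) Un (CR Int W)"
  "CR Int U Int W = {}" "U Int W = {}"
proof -
 have UW: "U Int W = {}" "U Un W = - path_image C"
  using assms inside_Int_outside[of "path_image C"] inside_Un_outside[of "path_image C"]
  unfolding doubleton_eq_iff by blast+
 thus "CR = (CR Int U) Un (CR Int W)"
  "CR Int U Int W = {}" "U Int W = {}" using off by blast+
qed

text \<open>A gluing at a crossing lifts to the fine arcs at the same ends, and fine arcs in one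
  coarse arc are linked across C. So the circles of L are those of the fine arcs with
  \<open>jrel\<close> added.\<close>

lemma kap_eqcl:
 assumes f: "f : components (trace L - MM)" and g: "g : components (trace L - MM)"
 shows "(kap f, kap g) : eqcl (co.srel CR si) \<longleftrightarrow>
  (f, g) : eqcl (srel CR si Un jrel)"
proof
 let ?F = "srel CR si Un jrel"
 have j: "eqcl jrel \<subseteq> eqcl ?F" "eqcl (srel CR si) \<subseteq> eqcl ?F" by (rule eqcl_mono; auto)+
 assume "(kap f, kap g) : eqcl (co.srel CR si)"
 hence "\<exists>h\<in>components (trace L - MM). kap h = kap g & (f, h) : eqcl ?F"
 proof (induction rule: eqcl_induct)
  case refl thus ?case using f by auto
 next
  case (step y z)
  then obtain h where h: "h : components (trace L - MM)" "kap h = y" "(f, h) : eqcl ?F" by blast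
  have mp: "over_pos L c : co.mpos" "under_pos L c : co.mpos" if "c : CR" for c
   using co.crossing_mpos that by auto
  have "\<exists>u v. u : components (trace L - MM) & v : components (trace L - MM) & kap u = y & kap v = z
   & (u, v) : eqcl (srel CR si)"
  proof -
   have *: "\<exists>u v. u : components (trace L - MM) & v : components (trace L - MM) & kap u = y & kap v = z
    & (u, v) : srel CR si" if yz: "(y, z) : co.srel CR si" for y z
   proof -
    obtain c i j where c: "c : CR" "y = co.end_arc (over_pos L c) i"
     "z = co.end_arc (under_pos L c) j" "j = (i = si c)"
     using yz by (rule co.srelD[OF _ subset_refl]) blast
    have "(end_arc (over_pos L c) i, end_arc (under_pos L c) j) : srel CR si"
     unfolding srel_def using c(1,4) by (intro image_eqI[of _ _ "(c, i)"]) auto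
    thus ?thesis using c mp[OF c(1)] co_mpos kap_end_arc end_arc_component by metis
   qed
   show ?thesis using step(2)
   proof
    assume "(y, z) : co.srel CR si"
    thus ?thesis using *[of y z] eqcl_gen by metis
   next
    assume "(z, y) : co.srel CR si"
    then obtain u v where "u : components (trace L - MM)" "v : components (trace L - MM)" "kap u = z" "kap v = y"
     "(u, v) : eqcl (srel CR si)" using *[of z y] eqcl_gen by metis
    thus ?thesis using eqcl_sym by metis
   qed
  qed
  then obtain u v where uv: "u : components (trace L - MM)" "v : components (trace L - MM)" "kap u = y" "kap v = z"
   "(u, v) : eqcl (srel CR si)" by blast
  have "(h, u) : eqcl jrel" using kap_eq_imp[OF h(1) uv(1)] h(2) uv(3) by simp
  hence "(f, u) : eqcl ?F" using eqcl_trans[OF h(3)] j(1) by blast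
  moreover have "(u, v) : eqcl ?F" using uv(5) j(2) by blast
  ultimately have "(f, v) : eqcl ?F" by (rule eqcl_trans)
  thus ?case using uv by blast
 qed
 then obtain h where h: "h : components (trace L - MM)" "kap h = kap g" "(f, h) : eqcl ?F" by blast
 have "(h, g) : eqcl ?F" using kap_eq_imp[OF h(1) g h(2)] j(1) by blast
 with h(3) show "(f, g) : eqcl ?F" by (rule eqcl_trans)
next
 assume "(f, g) : eqcl (srel CR si Un jrel)"
 thus "(kap f, kap g) : eqcl (co.srel CR si)"
 proof (induction rule: eqcl_induct)
  case (step y z)
  have "(kap y, kap z) : eqcl (co.srel CR si)" if yz: "(y, z) : srel CR si Un jrel" for y z
  proof (cases "(y, z) : jrel")
   case True thus ?thesis using jrel_kap by (auto simp: jrel_def)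
  next
   case False
   hence "(y, z) : eqcl (srel CR si)" using yz by blast
   thus ?thesis by (rule kap_srel[OF _ subset_refl])
  qed
  hence "(kap y, kap z) : eqcl (co.srel CR si)" using step(2) eqcl_sym by metis
  with step(3) show ?case by (rule eqcl_trans)
 qed simp
qed

end

section \<open>The cube of a diagram\<close>

definition signs :: "int set" where "signs = {1, -1}"

definition agree :: "'a set => ('a => int) => ('a => int) => bool" where
 "agree I ep et \<longleftrightarrow> (\<forall>z\<in>I. ep z = et z)"

lemma mult_coeff_commute: "mult_coeff a b c = mult_coeff b a c"
 unfolding mult_coeff_def
 by (rule arg_cong[where f = of_bool]) (simp only: insert_iff empty_iff prod.inject, blast)

lemma comult_coeff_commute: "comult_coeff a b c = comult_coeff a c b"
 unfolding comult_coeff_def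
 by (rule arg_cong[where f = of_bool]) (simp only: insert_iff empty_iff prod.inject, blast)

section \<open>Edge maps and the commuting squares of the Frobenius algebra\<close>

lemma edge_coeff_merge:
 assumes "x ~= y" "x ~: I" "y ~: I" "w ~: I" "w ~= x" "w ~= y"
 shows "edge_coeff (I Un {x, y}) ep (I Un {w}) et = (if agree I ep et then mult_coeff (ep x) (ep y) (et w) else 0)"
proof -
 let ?S = "I Un {x, y}" and ?S' = "I Un {w}"
 have d: "?S Int ?S' = I" "?S - ?S' = {x, y}" "?S' - ?S = {w}" using assms by auto
 have ex: "\<exists>z1 z2 z. z1 ~= z2 & {x, y} = {z1, z2} & {w} = {z}" using assms(1) by blast
 have the: "(THE k. \<exists>z1 z2 z. z1 ~= z2 & {x, y} = {z1, z2} & {w} = {z} & k = mult_coeff (ep z1) (ep z2) (et z)) =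
  mult_coeff (ep x) (ep y) (et w)"
 proof (rule the_equality)
  show "\<exists>z1 z2 z. z1 ~= z2 & {x, y} = {z1, z2} & {w} = {z} &
    mult_coeff (ep x) (ep y) (et w) = mult_coeff (ep z1) (ep z2) (et z)" using assms(1) by blast
  fix k assume "\<exists>z1 z2 z. z1 ~= z2 & {x, y} = {z1, z2} & {w} = {z} & k = mult_coeff (ep z1) (ep z2) (et z)"
  then obtain z1 z2 z where "{x, y} = {z1, z2}" "{w} = {z}" "k = mult_coeff (ep z1) (ep z2) (et z)" by blast
  thus "k = mult_coeff (ep x) (ep y) (et w)"
   using mult_coeff_commute[of "ep x" "ep y"] by (auto simp: doubleton_eq_iff)
 qed
 show ?thesis unfolding edge_coeff_def d using ex the by (auto simp: agree_def)
qed

lemma edge_coeff_split: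
 assumes "x ~= y" "x ~: I" "y ~: I" "w ~: I" "w ~= x" "w ~= y"
 shows "edge_coeff (I Un {w}) ep (I Un {x, y}) et = (if agree I ep et then comult_coeff (ep w) (et x) (et y) else 0)"
proof -
 let ?S' = "I Un {x, y}" and ?S = "I Un {w}"
 have d: "?S Int ?S' = I" "?S' - ?S = {x, y}" "?S - ?S' = {w}" using assms by auto
 have nex: "~ (\<exists>z1 z2 z. z1 ~= z2 & {w} = {z1, z2} & {x, y} = {z})" using assms(1) by auto
 have ex: "\<exists>z z1 z2. z1 ~= z2 & {w} = {z} & {x, y} = {z1, z2}" using assms(1) by blast
 have the: "(THE k. \<exists>z z1 z2. z1 ~= z2 & {w} = {z} & {x, y} = {z1, z2} & k = comult_coeff (ep z) (et z1) (et z2)) =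
  comult_coeff (ep w) (et x) (et y)"
 proof (rule the_equality)
  show "\<exists>z z1 z2. z1 ~= z2 & {w} = {z} & {x, y} = {z1, z2} &
    comult_coeff (ep w) (et x) (et y) = comult_coeff (ep z) (et z1) (et z2)" using assms(1) by blast
  fix k assume "\<exists>z z1 z2. z1 ~= z2 & {w} = {z} & {x, y} = {z1, z2} & k = comult_coeff (ep z) (et z1) (et z2)"
  then obtain z z1 z2 where "{x, y} = {z1, z2}" "{w} = {z}" "k = comult_coeff (ep z) (et z1) (et z2)" by blast
  thus "k = comult_coeff (ep w) (et x) (et y)"
   using comult_coeff_commute[of "ep w" "et x"] by (auto simp: doubleton_eq_iff)
 qed
 show ?thesis unfolding edge_coeff_def d using ex the nex by (auto simp: agree_def)
qed

lemma labellings_finite: "finite S ==> finite (labellings S)"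
 unfolding labellings_def by (intro finite_PiE) auto

lemma labellingsD: "ep : labellings S ==> z : S ==> ep z : signs"
 by (auto simp: labellings_def signs_def)

text \<open>A coefficient vanishes unless the labels of the untouched circles agree, so the sum over
  labellings of the middle vertex reduces to a sum over the label of the new circle.\<close>

lemma sum_merge:
 assumes xy: "x ~= y" "x ~: I" "y ~: I" "w ~: I" "w ~= x" "w ~= y" and fin: "finite I" and ep: "ep : labellings (I Un {x, y})"
 shows "(\<Sum>et\<in>labellings (I Un {w}). edge_coeff (I Un {x, y}) ep (I Un {w}) et * G et) =
  (\<Sum>k\<in>signs. mult_coeff (ep x) (ep y) k * G (\<lambda>z\<in>I Un {w}. if z = w then k else ep z))"
proof -
 define g where "g k = (\<lambda>z\<in>I Un {w}. if z = w then k else ep z)" for k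
 have gw: "g k w = k" for k by (simp add: g_def)
 have inj: "inj_on g signs" by (rule inj_onI) (metis gw)
 have sub: "g ` signs \<subseteq> labellings (I Un {w})"
  using ep by (intro image_subsetI) (simp add: g_def labellings_def signs_def PiE_iff)
 have ag: "agree I ep (g k)" for k using xy(4) by (auto simp: agree_def g_def)
 have zero: "edge_coeff (I Un {x, y}) ep (I Un {w}) et * G et = 0" if et: "et : labellings (I Un {w}) - g ` signs" for et
 proof -
  have "~ agree I ep et"
  proof
   assume "agree I ep et"
   hence "et = g (et w)" using et unfolding g_def agree_def labellings_def
    by (intro ext) (auto simp: PiE_def extensional_def)
   moreover have "et w : signs" using et labellingsD[of et "I Un {w}" w] by auto
   ultimately show False using et by blast
  qed
  thus ?thesis by (simp only: edge_coeff_merge[OF xy] if_False mult_zero_left)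
 qed
 have "(\<Sum>et\<in>labellings (I Un {w}). edge_coeff (I Un {x, y}) ep (I Un {w}) et * G et) =
   (\<Sum>et\<in>g ` signs. edge_coeff (I Un {x, y}) ep (I Un {w}) et * G et)"
  by (rule sum.mono_neutral_right) (use fin sub zero in "simp_all add: labellings_finite")
 also have "\<dots> = (\<Sum>k\<in>signs. edge_coeff (I Un {x, y}) ep (I Un {w}) (g k) * G (g k))"
  by (simp add: sum.reindex[OF inj])
 also have "\<dots> = (\<Sum>k\<in>signs. mult_coeff (ep x) (ep y) k * G (g k))"
  by (intro sum.cong refl) (simp only: edge_coeff_merge[OF xy] ag if_True, simp add: g_def)
 finally show ?thesis by (simp add: g_def)
qed

lemma sum_split:
 assumes xy: "x ~= y" "x ~: I" "y ~: I" "w ~: I" "w ~= x" "w ~= y" and fin: "finite I" and ep: "ep : labellings (I Un {w})"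
 shows "(\<Sum>et\<in>labellings (I Un {x, y}). edge_coeff (I Un {w}) ep (I Un {x, y}) et * G et) =
  (\<Sum>k\<in>signs. \<Sum>l\<in>signs. comult_coeff (ep w) k l * G (\<lambda>z\<in>I Un {x, y}. if z = x then k else if z = y then l else ep z))"
proof -
 define g where "g = (%(k, l). (\<lambda>z\<in>I Un {x, y}. if z = x then k else if z = y then l else ep z))"
 have gx: "g kl x = fst kl" "g kl y = snd kl" for kl using xy(1) by (auto simp: g_def split_beta)
 have inj: "inj_on g (signs \<times> signs)" by (rule inj_onI) (metis gx prod_eq_iff)
 have sub: "g ` (signs \<times> signs) \<subseteq> labellings (I Un {x, y})"
  using ep by (intro image_subsetI) (auto simp: g_def labellings_def signs_def PiE_iff mem_Times_iff split_beta)
 have ag: "agree I ep (g kl)" for kl using xy(2,3) by (auto simp: agree_def g_def split_beta)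
 have zero: "edge_coeff (I Un {w}) ep (I Un {x, y}) et * G et = 0" if et: "et : labellings (I Un {x, y}) - g ` (signs \<times> signs)" for et
 proof -
  have "~ agree I ep et"
  proof
   assume "agree I ep et"
   hence "et = g (et x, et y)" using et unfolding g_def agree_def labellings_def
    by (intro ext) (auto simp: PiE_def extensional_def)
   moreover have "et x : signs" "et y : signs"
    using et labellingsD[of et "I Un {x, y}" x] labellingsD[of et "I Un {x, y}" y] by auto
   ultimately show False using et by blast
  qed
  thus ?thesis by (simp only: edge_coeff_split[OF xy] if_False mult_zero_left)
 qed
 have "(\<Sum>et\<in>labellings (I Un {x, y}). edge_coeff (I Un {w}) ep (I Un {x, y}) et * G et) =
   (\<Sum>et\<in>g ` (signs \<times> signs). edge_coeff (I Un {w}) ep (I Un {x, y}) et * G et)"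
  by (rule sum.mono_neutral_right) (use fin sub zero in "simp_all add: labellings_finite")
 also have "\<dots> = (\<Sum>kl\<in>signs \<times> signs. edge_coeff (I Un {w}) ep (I Un {x, y}) (g kl) * G (g kl))"
  by (simp add: sum.reindex[OF inj])
 also have "\<dots> = (\<Sum>kl\<in>signs \<times> signs. comult_coeff (ep w) (fst kl) (snd kl) * G (g kl))"
  by (intro sum.cong refl) (simp only: edge_coeff_split[OF xy] ag if_True gx)
 also have "\<dots> = (\<Sum>k\<in>signs. \<Sum>l\<in>signs. comult_coeff (ep w) k l * G (g (k, l)))"
  by (simp add: sum.cartesian_product split_beta)
 finally show ?thesis by (simp add: g_def)
qed

text \<open>The matrix entry of a composite of two edge maps; S' is the middle vertex of a path
  through a square.\<close>

definition comp :: "'e set set => ('e set => int) => 'e set set => 'e set set => ('e set => int) => rat" where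
 "comp S ep S' S'' tht = (\<Sum>et\<in>labellings S'. edge_coeff S ep S' et * edge_coeff S' et S'' tht)"

lemma sum_signs: "(\<Sum>k\<in>signs. f k) = f 1 + f (-1)"
 by (simp add: signs_def)

lemma mult_values:
 "mult_coeff 1 1 1 = 1" "mult_coeff 1 1 (-1) = 0" "mult_coeff 1 (-1) 1 = 0" "mult_coeff 1 (-1) (-1) = 1"
 "mult_coeff (-1) 1 1 = 0" "mult_coeff (-1) 1 (-1) = 1" "mult_coeff (-1) (-1) 1 = 0" "mult_coeff (-1) (-1) (-1) = 0"
 by (simp_all add: mult_coeff_def)

lemma comult_values:
 "comult_coeff 1 1 1 = 0" "comult_coeff 1 1 (-1) = 1" "comult_coeff 1 (-1) 1 = 1" "comult_coeff 1 (-1) (-1) = 0"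
 "comult_coeff (-1) 1 1 = 0" "comult_coeff (-1) 1 (-1) = 0" "comult_coeff (-1) (-1) 1 = 0" "comult_coeff (-1) (-1) (-1) = 1"
 by (simp_all add: comult_coeff_def)

lemma agree_cong: "(!!z. z : I ==> ep z = ep' z) ==> (!!z. z : I ==> et z = et' z) ==> agree I ep et = agree I ep' et'"
 by (simp add: agree_def)

lemma agree_insert: "agree (insert x I) ep et \<longleftrightarrow> ep x = et x & agree I ep et"
 by (auto simp: agree_def)

lemma agree_upd:
 assumes "I \<subseteq> S" "w ~: I"
 shows "agree I (\<lambda>z\<in>S. if z = w then k else ep z) tht = agree I ep tht"
 using assms by (intro agree_cong) auto

lemma agree_upd2:
 assumes "I \<subseteq> S" "w ~: I" "w' ~: I"
 shows "agree I (\<lambda>z\<in>S. if z = w then k else if z = w' then l else ep z) tht = agree I ep tht"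
 using assms by (intro agree_cong) auto

lemma signsE: "k : signs ==> (k = 1 ==> P) ==> (k = -1 ==> P) ==> P"
 by (auto simp: signs_def)

text \<open>Associativity of m: the circles a, b, d become one in either order, with u, v, w
  standing for the merged circles.\<close>

lemma face_assoc:
 assumes d: "distinct [a, b, d, u, v, w]" and I: "set [a, b, d, u, v, w] Int I = {}" and fin: "finite I"
  and ep: "ep : labellings (I Un {a, b, d})" and tht: "tht : labellings (I Un {w})"
 shows "comp (I Un {a, b, d}) ep (I Un {u, d}) (I Un {w}) tht = comp (I Un {a, b, d}) ep (I Un {a, v}) (I Un {w}) tht"
proof -
 note d = d distinct_rev[THEN iffD2, OF d]
 have s: "ep a : signs" "ep b : signs" "ep d : signs" "tht w : signs" using labellingsD ep tht by blast+
 have e1: "I Un {a, b, d} = insert d I Un {a, b}" "I Un {u, d} = insert d I Un {u}"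
  "I Un {a, b, d} = insert a I Un {b, d}" "I Un {a, v} = insert a I Un {v}" by auto
 have "comp (I Un {a, b, d}) ep (I Un {u, d}) (I Un {w}) tht =
  (\<Sum>k\<in>signs. mult_coeff (ep a) (ep b) k *
   edge_coeff (I Un {u, d}) (\<lambda>z\<in>insert d I Un {u}. if z = u then k else ep z) (I Un {w}) tht)"
  unfolding comp_def e1(1,2) using d I fin ep by (intro sum_merge) (simp_all add: insert_commute)
 also have "\<dots> = (\<Sum>k\<in>signs. mult_coeff (ep a) (ep b) k * (if agree I ep tht then mult_coeff k (ep d) (tht w) else 0))"
  using d I by (intro sum.cong refl arg_cong2[where f = "(*)"]) (subst edge_coeff_merge, simp_all add: agree_upd subset_insertI2)
 finally have l: "comp (I Un {a, b, d}) ep (I Un {u, d}) (I Un {w}) tht = \<dots>" .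
 have "comp (I Un {a, b, d}) ep (I Un {a, v}) (I Un {w}) tht =
  (\<Sum>k\<in>signs. mult_coeff (ep b) (ep d) k *
   edge_coeff (I Un {a, v}) (\<lambda>z\<in>insert a I Un {v}. if z = v then k else ep z) (I Un {w}) tht)"
  unfolding comp_def e1(3,4) using d I fin ep by (intro sum_merge) (simp_all add: insert_commute)
 also have "\<dots> = (\<Sum>k\<in>signs. mult_coeff (ep b) (ep d) k * (if agree I ep tht then mult_coeff (ep a) k (tht w) else 0))"
  using d I by (intro sum.cong refl arg_cong2[where f = "(*)"]) (subst edge_coeff_merge, simp_all add: agree_upd subset_insertI2)
 finally show ?thesis unfolding l sum_signs
  using s by (elim signsE) (simp_all only: mult_values, simp_all)
qed

text \<open>The two merges act on different tensor factors.\<close>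

lemma face_merge_merge:
 assumes d: "distinct [a, b, d, e, u, v]" and I: "set [a, b, d, e, u, v] Int I = {}" and fin: "finite I"
  and ep: "ep : labellings (I Un {a, b, d, e})" and tht: "tht : labellings (I Un {u, v})"
 shows "comp (I Un {a, b, d, e}) ep (I Un {u, d, e}) (I Un {u, v}) tht = comp (I Un {a, b, d, e}) ep (I Un {a, b, v}) (I Un {u, v}) tht"
proof -
 note d = d distinct_rev[THEN iffD2, OF d]
 have s: "tht u : signs" "tht v : signs" using labellingsD tht by blast+
 have e1: "I Un {a, b, d, e} = insert d (insert e I) Un {a, b}" "I Un {u, d, e} = insert d (insert e I) Un {u}"
  "I Un {a, b, d, e} = insert a (insert b I) Un {d, e}" "I Un {a, b, v} = insert a (insert b I) Un {v}" by auto
 have e2: "I Un {u, d, e} = insert u I Un {d, e}" "I Un {u, v} = insert u I Un {v}"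
  "I Un {a, b, v} = insert v I Un {a, b}" "I Un {u, v} = insert v I Un {u}" by auto
 have "comp (I Un {a, b, d, e}) ep (I Un {u, d, e}) (I Un {u, v}) tht =
  (\<Sum>k\<in>signs. mult_coeff (ep a) (ep b) k *
   edge_coeff (insert u I Un {d, e}) (\<lambda>z\<in>insert d (insert e I) Un {u}. if z = u then k else ep z) (insert u I Un {v}) tht)"
  unfolding comp_def e1(1) e2(1,2)[symmetric] unfolding e1(2) using d I fin ep by (intro sum_merge) (simp_all add: insert_commute)
 also have "\<dots> = (\<Sum>k\<in>signs. mult_coeff (ep a) (ep b) k * (if k = tht u & agree I ep tht then mult_coeff (ep d) (ep e) (tht v) else 0))"
  using d I by (intro sum.cong refl arg_cong2[where f = "(*)"]) (subst edge_coeff_merge, simp_all add: agree_insert agree_upd subset_insertI2)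
 finally have l: "comp (I Un {a, b, d, e}) ep (I Un {u, d, e}) (I Un {u, v}) tht = \<dots>" .
 have "comp (I Un {a, b, d, e}) ep (I Un {a, b, v}) (I Un {u, v}) tht =
  (\<Sum>k\<in>signs. mult_coeff (ep d) (ep e) k *
   edge_coeff (insert v I Un {a, b}) (\<lambda>z\<in>insert a (insert b I) Un {v}. if z = v then k else ep z) (insert v I Un {u}) tht)"
  unfolding comp_def e1(3) e2(3,4)[symmetric] unfolding e1(4) using d I fin ep by (intro sum_merge) (simp_all add: insert_commute)
 also have "\<dots> = (\<Sum>k\<in>signs. mult_coeff (ep d) (ep e) k * (if k = tht v & agree I ep tht then mult_coeff (ep a) (ep b) (tht u) else 0))"
  using d I by (intro sum.cong refl arg_cong2[where f = "(*)"]) (subst edge_coeff_merge, simp_all add: agree_insert agree_upd subset_insertI2)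
 finally show ?thesis unfolding l sum_signs
  using s by (elim signsE) (simp_all add: mult.commute)
qed

lemma face_merge_split:
 assumes d: "distinct [a, b, g, g1, g2, u]" and I: "set [a, b, g, g1, g2, u] Int I = {}" and fin: "finite I"
  and ep: "ep : labellings (I Un {a, b, g})" and tht: "tht : labellings (I Un {u, g1, g2})"
 shows "comp (I Un {a, b, g}) ep (I Un {u, g}) (I Un {u, g1, g2}) tht = comp (I Un {a, b, g}) ep (I Un {a, b, g1, g2}) (I Un {u, g1, g2}) tht"
proof -
 note d = d distinct_rev[THEN iffD2, OF d]
 have s: "tht u : signs" "tht g1 : signs" "tht g2 : signs" using labellingsD tht by blast+
 have e1: "I Un {a, b, g} = insert g I Un {a, b}" "I Un {u, g} = insert g I Un {u}"
  "I Un {u, g} = insert u I Un {g}" "I Un {u, g1, g2} = insert u I Un {g1, g2}" by auto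
 have e2: "I Un {a, b, g} = insert a (insert b I) Un {g}" "I Un {a, b, g1, g2} = insert a (insert b I) Un {g1, g2}"
  "I Un {a, b, g1, g2} = insert g1 (insert g2 I) Un {a, b}" "I Un {u, g1, g2} = insert g1 (insert g2 I) Un {u}" by auto
 have "comp (I Un {a, b, g}) ep (I Un {u, g}) (I Un {u, g1, g2}) tht =
  (\<Sum>k\<in>signs. mult_coeff (ep a) (ep b) k *
   edge_coeff (insert u I Un {g}) (\<lambda>z\<in>insert g I Un {u}. if z = u then k else ep z) (insert u I Un {g1, g2}) tht)"
  unfolding comp_def e1(1) e1(3,4)[symmetric] unfolding e1(2) using d I fin ep by (intro sum_merge) (simp_all add: insert_commute)
 also have "\<dots> = (\<Sum>k\<in>signs. mult_coeff (ep a) (ep b) k * (if k = tht u & agree I ep tht then comult_coeff (ep g) (tht g1) (tht g2) else 0))"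
  using d I by (intro sum.cong refl arg_cong2[where f = "(*)"]) (subst edge_coeff_split, simp_all add: agree_insert agree_upd subset_insertI2)
 finally have l: "comp (I Un {a, b, g}) ep (I Un {u, g}) (I Un {u, g1, g2}) tht = \<dots>" .
 have "comp (I Un {a, b, g}) ep (I Un {a, b, g1, g2}) (I Un {u, g1, g2}) tht =
  (\<Sum>k\<in>signs. \<Sum>l\<in>signs. comult_coeff (ep g) k l *
   edge_coeff (insert g1 (insert g2 I) Un {a, b})
    (\<lambda>z\<in>insert a (insert b I) Un {g1, g2}. if z = g1 then k else if z = g2 then l else ep z) (insert g1 (insert g2 I) Un {u}) tht)"
  unfolding comp_def e2(1) e2(3,4)[symmetric] unfolding e2(2) using d I fin ep by (intro sum_split) (simp_all add: insert_commute)
 also have "\<dots> = (\<Sum>k\<in>signs. \<Sum>l\<in>signs. comult_coeff (ep g) k l *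
   (if k = tht g1 & l = tht g2 & agree I ep tht then mult_coeff (ep a) (ep b) (tht u) else 0))"
  using d I by (intro sum.cong refl arg_cong2[where f = "(*)"]) (subst edge_coeff_merge, simp_all add: agree_insert agree_upd2 subset_insertI2)
 finally show ?thesis unfolding l sum_signs
  using s by (elim signsE) (simp_all add: mult.commute)
qed

text \<open>The Frobenius relation: multiplying g by b before splitting amounts to splitting g and
  multiplying one part by b.\<close>

lemma face_frobenius:
 assumes d: "distinct [g, b, w, a1, a2, v]" and I: "set [g, b, w, a1, a2, v] Int I = {}" and fin: "finite I"
  and ep: "ep : labellings (I Un {g, b})" and tht: "tht : labellings (I Un {a1, v})"
 shows "comp (I Un {g, b}) ep (I Un {w}) (I Un {a1, v}) tht = comp (I Un {g, b}) ep (I Un {a1, a2, b}) (I Un {a1, v}) tht"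
proof -
 note d = d distinct_rev[THEN iffD2, OF d]
 have s: "ep g : signs" "ep b : signs" "tht a1 : signs" "tht v : signs" using labellingsD ep tht by blast+
 have e2: "I Un {g, b} = insert b I Un {g}" "I Un {a1, a2, b} = insert b I Un {a1, a2}"
  "I Un {a1, a2, b} = insert a1 I Un {a2, b}" "I Un {a1, v} = insert a1 I Un {v}" by auto
 have "comp (I Un {g, b}) ep (I Un {w}) (I Un {a1, v}) tht =
  (\<Sum>k\<in>signs. mult_coeff (ep g) (ep b) k *
   edge_coeff (I Un {w}) (\<lambda>z\<in>I Un {w}. if z = w then k else ep z) (I Un {a1, v}) tht)"
  unfolding comp_def using d I fin ep by (intro sum_merge) simp_all
 also have "\<dots> = (\<Sum>k\<in>signs. mult_coeff (ep g) (ep b) k * (if agree I ep tht then comult_coeff k (tht a1) (tht v) else 0))"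
  using d I by (intro sum.cong refl arg_cong2[where f = "(*)"]) (subst edge_coeff_split, simp_all add: agree_upd subset_insertI2)
 finally have l: "comp (I Un {g, b}) ep (I Un {w}) (I Un {a1, v}) tht = \<dots>" .
 have "comp (I Un {g, b}) ep (I Un {a1, a2, b}) (I Un {a1, v}) tht =
  (\<Sum>k\<in>signs. \<Sum>l\<in>signs. comult_coeff (ep g) k l *
   edge_coeff (insert a1 I Un {a2, b})
    (\<lambda>z\<in>insert b I Un {a1, a2}. if z = a1 then k else if z = a2 then l else ep z) (insert a1 I Un {v}) tht)"
  unfolding comp_def e2(1) e2(3,4)[symmetric] unfolding e2(2) using d I fin ep by (intro sum_split) (simp_all add: insert_commute)
 also have "\<dots> = (\<Sum>k\<in>signs. \<Sum>l\<in>signs. comult_coeff (ep g) k l *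
   (if k = tht a1 & agree I ep tht then mult_coeff l (ep b) (tht v) else 0))"
  using d I by (intro sum.cong refl arg_cong2[where f = "(*)"]) (subst edge_coeff_merge, simp_all add: agree_insert agree_upd2 subset_insertI2)
 finally show ?thesis unfolding l sum_signs
  using s by (elim signsE) (simp_all add: mult_values comult_values)
qed

text \<open>The composite of m with \<Delta> on a single circle. The right side does not mention the
  intermediate circles g1 and g2, which is what \<open>comp_smsm\<close> exploits.\<close>

lemma bubble:
 assumes d: "distinct [g, g1, g2]" and I: "set [g, g1, g2] Int I = {}" and fin: "finite I" and ep: "ep : labellings (I Un {g})"
 shows "comp (I Un {g}) ep (I Un {g1, g2}) (I Un {g}) tht =
  (\<Sum>k\<in>signs. \<Sum>l\<in>signs. comult_coeff (ep g) k l * (if agree I ep tht then mult_coeff k l (tht g) else 0))"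
proof -
 note d = d distinct_rev[THEN iffD2, OF d]
 have "comp (I Un {g}) ep (I Un {g1, g2}) (I Un {g}) tht =
  (\<Sum>k\<in>signs. \<Sum>l\<in>signs. comult_coeff (ep g) k l *
   edge_coeff (I Un {g1, g2}) (\<lambda>z\<in>I Un {g1, g2}. if z = g1 then k else if z = g2 then l else ep z) (I Un {g}) tht)"
  unfolding comp_def using d I fin ep by (intro sum_split) simp_all
 also have "\<dots> = (\<Sum>k\<in>signs. \<Sum>l\<in>signs. comult_coeff (ep g) k l * (if agree I ep tht then mult_coeff k l (tht g) else 0))"
  using d I by (intro sum.cong refl arg_cong2[where f = "(*)"]) (subst edge_coeff_merge, simp_all add: agree_upd2 subset_insertI2)
 finally show ?thesis .
qed

section \<open>Merging circles in families of disjoint sets\<close>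

definition fam :: "'a set set => bool" where
 "fam S \<longleftrightarrow> finite S & {} ~: S & (\<forall>z\<in>S. \<forall>z'\<in>S. z Int z' ~= {} --> z = z')"

lemma famD: "fam S ==> z : S ==> z' : S ==> e : z ==> e : z' ==> z = z'"
 unfolding fam_def by blast

text \<open>Disjointness and nonemptiness let a union determine its subfamily. This yields that
  merged circles are new and that different merges give different circles.\<close>

lemma fam_Union_mono:
 assumes S: "fam S" and A: "A \<subseteq> S" and B: "B \<subseteq> S" and U: "\<Union>A \<subseteq> \<Union>B" shows "A \<subseteq> B"
proof
 fix z assume z: "z : A"
 hence zS: "z : S" using A by (rule subsetD[rotated])
 hence "z ~= {}" using S by (simp add: fam_def) (rule notI, simp)
 then obtain e where e: "e : z" by blast
 then obtain z' where z': "z' : B" "e : z'" using U z by blast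
 have "z = z'" using famD[OF S _ _ e z'(2)] z z'(1) A B by blast
 thus "z : B" using z' by simp
qed

lemma fam_Union_inj:
 assumes "fam S" "A \<subseteq> S" "B \<subseteq> S" "\<Union>A = \<Union>B" shows "A = B"
 using fam_Union_mono[OF assms(1-3)] fam_Union_mono[OF assms(1,3,2)] assms(4) by blast

lemma union2_notin:
 assumes S: "fam S" and x: "x : S" "y : S" "x ~= y" shows "x Un y ~: S"
proof
 assume "x Un y : S"
 hence "{x, y} = {x Un y}" using x by (intro fam_Union_inj[OF S]) simp_all
 hence "x = y" by (metis insertCI singletonD)
 thus False using x(3) by simp
qed

lemma union3_notin:
 assumes S: "fam S" and x: "x : S" "y : S" "z : S" "x ~= y" shows "x Un y Un z ~: S"
proof
 assume "x Un y Un z : S"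
 hence "{x, y, z} = {x Un y Un z}" using x by (intro fam_Union_inj[OF S]) (simp_all add: Un_assoc)
 hence "x = y" by (metis insertCI singletonD)
 thus False using x(4) by simp
qed

lemma union_ne:
 assumes S: "fam S" and A: "set xs \<subseteq> S" "set ys \<subseteq> S" and ne: "set xs ~= set ys"
 shows "\<Union>(set xs) ~= \<Union>(set ys)"
 by (rule notI) (erule notE[OF ne fam_Union_inj[OF S A]])

lemma mergesE:
 assumes "merges S S' e f"
 obtains x y where "x : S" "y : S" "x ~= y" "e : x" "f : y" "S' = (S - {x, y}) Un {x Un y}"
 using assms unfolding merges_def by blast

lemma merges_det:
 assumes S: "fam S" and m: "merges S S' e f" and z: "z1 : S" "z2 : S" "e : z1" "f : z2"
 shows "z1 ~= z2 & S' = (S - {z1, z2}) Un {z1 Un z2}"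
proof -
 from m obtain x y where xy: "x : S" "y : S" "x ~= y" "e : x" "f : y" "S' = (S - {x, y}) Un {x Un y}" by (rule mergesE)
 have "x = z1" "y = z2" using famD[OF S] xy z by blast+
 thus ?thesis using xy by simp
qed

lemma card_merges:
 assumes S: "fam S" and m: "merges S S' e f" shows "card S = Suc (card S')"
proof -
 from m obtain x y where xy: "x : S" "y : S" "x ~= y" "S' = (S - {x, y}) Un {x Un y}" by (rule mergesE)
 have f: "finite S" using S by (simp add: fam_def)
 have "card {x, y} <= card S" using xy f by (intro card_mono) auto
 moreover have "card S' = Suc (card (S - {x, y}))" using xy f union2_notin[OF S xy(1-3)] by simp
 moreover have "card (S - {x, y}) = card S - 2" using xy f by (simp add: card_Diff_subset)
 ultimately show ?thesis using xy(3) by simp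
qed

lemma merge_local:
 assumes S: "fam S" and xy: "x : S" "y : S" "x ~= y"
 shows "S = (S - {x, y}) Un {x, y}" "x ~: S - {x, y}" "y ~: S - {x, y}" "x Un y ~: S - {x, y}" "x Un y ~= x" "x Un y ~= y"
  "finite (S - {x, y})"
proof -
 have n: "x Un y ~: S" by (rule union2_notin[OF S xy])
 show "S = (S - {x, y}) Un {x, y}" using xy(1,2) by blast
 show "x ~: S - {x, y}" "y ~: S - {x, y}" by simp_all
 show "x Un y ~: S - {x, y}" using n by simp
 show "x Un y ~= x" "x Un y ~= y" using n xy(1,2) by (intro notI; simp)+
 show "finite (S - {x, y})" using S by (simp add: fam_def)
qed

text \<open>Exchanging v_+ and v_- turns m into the transpose of \<Delta>, the self-duality of the
  Frobenius algebra. It reduces squares of splits to squares of merges.\<close>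

definition ng :: "'e set set => ('e set => int) => 'e set => int" where
 "ng S ep = (\<lambda>z\<in>S. - ep z)"

lemma ng_labellings: "ep : labellings S ==> ng S ep : labellings S"
 by (auto simp: ng_def labellings_def PiE_iff)

lemma ng_ng: "ep : labellings S ==> ng S (ng S ep) = ep"
 by (rule ext) (auto simp: ng_def labellings_def PiE_iff extensional_def)

lemma mult_comult: "mult_coeff a b c = comult_coeff (- c) (- a) (- b)"
proof -
 have "(a, b, c) : {(1, 1, 1), (1, -1, -1), (-1, 1, -1)} \<longleftrightarrow>
   (- c, - a, - b) : {(1, 1, -1), (1, -1, 1), (-1, -1, -1::int)}"
  by (simp only: insert_iff empty_iff prod.inject minus_equation_iff[of _ 1] minus_equation_iff[of _ "-1"] minus_minus) (simp, blast)
 thus ?thesis unfolding mult_coeff_def comult_coeff_def by (rule arg_cong)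
qed

lemma edge_coeff_dual:
 assumes S: "fam S" and m: "merges S S' e f"
 shows "edge_coeff S' et S ep = edge_coeff S (ng S ep) S' (ng S' et)"
proof -
 from m obtain x y where xy: "x : S" "y : S" "x ~= y" "S' = (S - {x, y}) Un {x Un y}" by (rule mergesE)
 note l = merge_local[OF S xy(1-3)]
 define I where "I = S - {x, y}"
 have S': "S = I Un {x, y}" "S' = I Un {x Un y}" using l(1) xy(4) by (simp_all add: I_def)
 have a: "agree I (ng S ep) (ng S' et) \<longleftrightarrow> agree I et ep" unfolding agree_def S' ng_def by auto
 have v: "ng S ep x = - ep x" "ng S ep y = - ep y" "ng S' et (x Un y) = - et (x Un y)" unfolding S' ng_def by simp_all
 show ?thesis using edge_coeff_split[of x y I "x Un y" et ep] edge_coeff_merge[of x y I "x Un y" "ng S ep" "ng S' et"]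
  l(2-6) xy(3) unfolding I_def[symmetric] v a unfolding S'[symmetric]
  by (simp add: mult_comult)
qed

lemma bij_ng: "bij_betw (ng S) (labellings S) (labellings S)"
 by (rule bij_betw_byWitness[where f' = "ng S"]) (use ng_ng ng_labellings in auto)

text \<open>Both m and \<Delta> lower the degree by 1, which the shift by the number of 1-smoothings
  will compensate.\<close>

lemma edge_coeff_degree:
 assumes S: "fam S" and m: "merges S S' e f" and ep: "ep : labellings S" and et: "et : labellings S'"
 shows "edge_coeff S ep S' et ~= 0 ==> sum et S' = sum ep S - 1" "edge_coeff S' et S ep ~= 0 ==> sum ep S = sum et S' - 1"
proof -
 from m obtain x y where xy: "x : S" "y : S" "x ~= y" "S' = (S - {x, y}) Un {x Un y}" by (rule mergesE)
 note l = merge_local[OF S xy(1-3)]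
 define I where "I = S - {x, y}"
 have S': "S = I Un {x, y}" "S' = I Un {x Un y}" using l(1) xy(4) by (simp_all add: I_def)
 have f: "finite I" "x ~: I" "y ~: I" "x Un y ~: I" using l by (simp_all add: I_def)
 have s: "sum ep S = ep x + ep y + sum ep I" "sum et S' = et (x Un y) + sum et I"
  unfolding S' using f xy(3) by (simp_all)
 have c: "sum ep I = sum et I" if "agree I ep et" using that by (intro sum.cong) (auto simp: agree_def)
 have cm: "edge_coeff S ep S' et = (if agree I ep et then mult_coeff (ep x) (ep y) (et (x Un y)) else 0)"
  unfolding S' by (rule edge_coeff_merge) (use l xy(3) I_def in simp_all)
 have cs: "edge_coeff S' et S ep = (if agree I et ep then comult_coeff (et (x Un y)) (ep x) (ep y) else 0)"
  unfolding S' by (rule edge_coeff_split) (use l xy(3) I_def in simp_all)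
 show "sum et S' = sum ep S - 1" if n: "edge_coeff S ep S' et ~= 0"
 proof -
  have "agree I ep et" "mult_coeff (ep x) (ep y) (et (x Un y)) ~= 0" using n unfolding cm by (auto split: if_splits)
  hence "agree I ep et" "et (x Un y) = ep x + ep y - 1"
   unfolding mult_coeff_def of_bool_eq_0_iff not_not by auto
  thus ?thesis unfolding s using c by simp
 qed
 show "sum ep S = sum et S' - 1" if n: "edge_coeff S' et S ep ~= 0"
 proof -
  have "agree I ep et" "comult_coeff (et (x Un y)) (ep x) (ep y) ~= 0" using n unfolding cs by (auto simp: agree_def split: if_splits)
  hence "agree I ep et" "ep x + ep y = et (x Un y) - 1"
   unfolding comult_coeff_def of_bool_eq_0_iff not_not by auto
  thus ?thesis unfolding s using c by simp
 qed
qed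

lemma comp_assoc:
 assumes S: "fam S" and m: "a : S" "b : S" "d : S" "a ~= b" "a ~= d" "b ~= d"
  and S1: "S1 = (S - {a, b}) Un {a Un b}" and S2: "S2 = (S - {b, d}) Un {b Un d}"
  and S3: "S3 = (S - {a, b, d}) Un {a Un b Un d}"
  and ep: "ep : labellings S" and tht: "tht : labellings S3"
 shows "comp S ep S1 S3 tht = comp S ep S2 S3 tht"
proof -
 define I where "I = S - {a, b, d}"
 have e: "S = I Un {a, b, d}" "S1 = I Un {a Un b, d}" "S2 = I Un {a, b Un d}" "S3 = I Un {a Un b Un d}"
  unfolding I_def S1 S2 S3 using m by blast+
 have n: "a Un b ~: S" "b Un d ~: S" "a Un b Un d ~: S" using union2_notin[OF S] union3_notin[OF S] m by blast+
 have ne: "a Un b ~= b Un d" "a Un b ~= a Un b Un d" "b Un d ~= a Un b Un d"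
  using union_ne[OF S, of "[a, b]" "[b, d]"] union_ne[OF S, of "[a, b]" "[a, b, d]"] union_ne[OF S, of "[b, d]" "[a, b, d]"] m
  by (simp_all add: Un_assoc doubleton_eq_iff) (metis insertCI insertE singletonD)+
 have dd: "distinct [a, b, d, a Un b, b Un d, a Un b Un d]"
 proof -
  have "z ~= w" if "z : S" "w ~: S" for z w :: "'a set" using that by blast
  thus ?thesis using m n ne by simp
 qed
 have di: "set [a, b, d, a Un b, b Un d, a Un b Un d] Int I = {}" using n unfolding I_def by auto
 have fi: "finite I" using S by (simp add: fam_def I_def)
 show ?thesis unfolding e(2-4) using face_assoc[OF dd di fi] ep tht unfolding e by blast
qed

lemma comp_merge_merge:
 assumes S: "fam S" and m: "x : S" "y : S" "x' : S" "y' : S" "distinct [x, y, x', y']"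
  and S1: "S1 = (S - {x, y}) Un {x Un y}" and S2: "S2 = (S - {x', y'}) Un {x' Un y'}"
  and S3: "S3 = (S - {x, y, x', y'}) Un {x Un y, x' Un y'}"
  and ep: "ep : labellings S" and tht: "tht : labellings S3"
 shows "comp S ep S1 S3 tht = comp S ep S2 S3 tht"
proof -
 define I where "I = S - {x, y, x', y'}"
 have e: "S = I Un {x, y, x', y'}" "S1 = I Un {x Un y, x', y'}" "S2 = I Un {x, y, x' Un y'}" "S3 = I Un {x Un y, x' Un y'}"
  unfolding I_def S1 S2 S3 using m by auto
 have n: "x Un y ~: S" "x' Un y' ~: S" using union2_notin[OF S] m by auto
 have ne: "x Un y ~= x' Un y'"
  using union_ne[OF S, of "[x, y]" "[x', y']"] m by (simp add: doubleton_eq_iff)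
 have dd: "distinct [x, y, x', y', x Un y, x' Un y']"
 proof -
  have "z ~= w" if "z : S" "w ~: S" for z w :: "'a set" using that by blast
  thus ?thesis using m n ne by simp
 qed
 have di: "set [x, y, x', y', x Un y, x' Un y'] Int I = {}" using n unfolding I_def by auto
 have fi: "finite I" using S by (simp add: fam_def I_def)
 show ?thesis unfolding e(2-4) using face_merge_merge[OF dd di fi] ep tht unfolding e by blast
qed

text \<open>The two pairs to be merged cannot coincide, since after the merge at e, f the arcs e',
  f' still lie on different circles. They share one circle, which is associativity, or none, and the
  merges are independent.\<close>

lemma comp_mmmm:
 assumes S: "fam S" "fam S1" "fam S2"
  and m: "merges S S1 e f" "merges S S2 e' f'" "merges S1 S3 e' f'"
  and ep: "ep : labellings S" and tht: "tht : labellings S3"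
 shows "comp S ep S1 S3 tht = comp S ep S2 S3 tht"
proof -
 from m(1) obtain x y where xy: "x : S" "y : S" "x ~= y" "e : x" "f : y" "S1 = (S - {x, y}) Un {x Un y}" by (rule mergesE)
 from m(2) obtain x' y' where xy': "x' : S" "y' : S" "x' ~= y'" "e' : x'" "f' : y'" "S2 = (S - {x', y'}) Un {x' Un y'}" by (rule mergesE)
 have n: "x Un y ~: S" by (rule union2_notin[OF S(1) xy(1-3)])
 have in1: "x Un y : S1" "!!z. z : S ==> z ~= x ==> z ~= y ==> z : S1" unfolding xy(6) by auto
 have ne: "~ (x' : {x, y} & y' : {x, y})"
 proof
  assume "x' : {x, y} & y' : {x, y}"
  hence "e' : x Un y" "f' : x Un y" using xy' by auto
  thus False using merges_det[OF S(2) m(3) in1(1) in1(1)] by blast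
 qed
 have mid: "comp S ep S1 S3 tht = comp S ep S2 S3 tht"
  if h: "a : S" "b : S" "d : S" "a ~= b" "a ~= d" "b ~= d" "{x, y} = {a, b}" "{x', y'} = {b, d}" for a b d
 proof -
  have u: "x Un y = a Un b" "x' Un y' = b Un d" using h(7,8) by (auto simp: doubleton_eq_iff)
  have d1: "d : S1" using in1(2)[OF h(3)] h by auto
  have ef: "e' : a Un b & f' : d \<or> e' : d & f' : a Un b" using h(8) xy' by (auto simp: doubleton_eq_iff)
  have "S3 = (S1 - {a Un b, d}) Un {a Un b Un d}"
  proof (use ef in "elim disjE conjE")
   assume "e' : a Un b" "f' : d"
   thus ?thesis using merges_det[OF S(2) m(3) in1(1) d1] u by simp
  next
   assume "e' : d" "f' : a Un b"
   thus ?thesis using merges_det[OF S(2) m(3) d1 in1(1)] u by (simp add: insert_commute Un_commute)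
  qed
  also have "\<dots> = (S - {a, b, d}) Un {a Un b Un d}" unfolding xy(6) h(7) u using n u by auto
  finally have S3: "S3 = (S - {a, b, d}) Un {a Un b Un d}" .
  show ?thesis by (rule comp_assoc[OF S(1) h(1-6) _ _ S3 ep tht]) (simp_all add: xy(6) xy'(6) u h)
 qed
 consider "x' : {x, y}" "y' ~: {x, y}" | "y' : {x, y}" "x' ~: {x, y}" | "x' ~: {x, y}" "y' ~: {x, y}" using ne by blast
 thus ?thesis
 proof cases
  case 1
  define a where "a = (if x' = x then y else x)"
  show ?thesis by (rule mid[of a x' y']) (use 1 xy(1-3) xy'(1-3) a_def in "auto split: if_splits")
 next
  case 2
  define a where "a = (if y' = x then y else x)"
  show ?thesis by (rule mid[of a y' x']) (use 2 xy(1-3) xy'(1-3) a_def in "auto split: if_splits")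
 next
  case 3
  have d: "distinct [x, y, x', y']" using 3 xy(3) xy'(3) by auto
  have i: "x' : S1" "y' : S1" using in1(2) 3 xy'(1,2) by auto
  have "S3 = (S1 - {x', y'}) Un {x' Un y'}" using merges_det[OF S(2) m(3) i xy'(4,5)] by blast
  also have "\<dots> = (S - {x, y, x', y'}) Un {x Un y, x' Un y'}" unfolding xy(6) using n xy'(1,2) by auto
  finally show ?thesis using comp_merge_merge[OF S(1) xy(1,2) xy'(1,2) d xy(6) xy'(6) _ ep tht] by blast
 qed
qed

lemma comp_dual:
 assumes S: "fam S1" "fam S2" and m: "merges S1 S e f" "merges S2 S1 e' f'"
  and ep: "ep : labellings S" and tht: "tht : labellings S2"
 shows "comp S ep S1 S2 tht = comp S2 (ng S2 tht) S1 S (ng S ep)"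
proof -
 have "comp S ep S1 S2 tht = (\<Sum>et\<in>labellings S1. edge_coeff S2 (ng S2 tht) S1 (ng S1 et) * edge_coeff S1 (ng S1 et) S (ng S ep))"
  unfolding comp_def edge_coeff_dual[OF S(1) m(1)] edge_coeff_dual[OF S(2) m(2)] by (simp add: mult.commute)
 also have "\<dots> = comp S2 (ng S2 tht) S1 S (ng S ep)" unfolding comp_def by (rule sum.reindex_bij_betw[OF bij_ng])
 finally show ?thesis .
qed

text \<open>By duality this is \<open>comp_mmmm\<close> read backwards from S3.\<close>

lemma comp_ssss:
 assumes S: "fam S1" "fam S2" "fam S3"
  and m: "merges S1 S e f" "merges S2 S e' f'" "merges S3 S1 e' f'" "merges S3 S2 e f"
  and ep: "ep : labellings S" and tht: "tht : labellings S3"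
 shows "comp S ep S1 S3 tht = comp S ep S2 S3 tht"
 unfolding comp_dual[OF S(1,3) m(1,3) ep tht] comp_dual[OF S(2,3) m(2,4) ep tht]
 by (rule comp_mmmm[OF S(3,1,2) m(3,4,1)]) (use ng_labellings ep tht in auto)

text \<open>The arcs e' and f' lie on two circles before the merge at e, f and on one after it. So
  the merge at e', f' joins the same two circles, and the two middle vertices coincide.\<close>

lemma comp_msms:
 assumes S: "fam S" "fam S1"
  and m: "merges S S1 e f" "merges S3 S1 e' f'" "merges S S2 e' f'"
 shows "S1 = S2"
proof -
 from m(1) obtain x y where xy: "x : S" "y : S" "x ~= y" "e : x" "f : y" "S1 = (S - {x, y}) Un {x Un y}" by (rule mergesE)
 from m(3) obtain x' y' where xy': "x' : S" "y' : S" "x' ~= y'" "e' : x'" "f' : y'" "S2 = (S - {x', y'}) Un {x' Un y'}" by (rule mergesE)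
 from m(2) obtain p q where pq: "p Un q : S1" "e' : p Un q" "f' : p Un q" by (elim mergesE) blast
 have nS: "p Un q ~: S"
 proof
  assume h: "p Un q : S"
  have "x' = p Un q" by (rule famD[OF S(1) xy'(1) h xy'(4) pq(2)])
  moreover have "y' = p Un q" by (rule famD[OF S(1) xy'(2) h xy'(5) pq(3)])
  ultimately show False using xy'(3) by simp
 qed
 have u: "p Un q = x Un y" using pq(1) nS unfolding xy(6) by simp
 have "e' : x \<or> e' : y" "f' : x \<or> f' : y" using pq u by blast+
 hence "x' = x \<or> x' = y" "y' = x \<or> y' = y"
  using famD[OF S(1) xy'(1) _ xy'(4)] famD[OF S(1) xy'(2) _ xy'(5)] xy(1,2) by metis+
 hence "x' = x & y' = y \<or> x' = y & y' = x" using xy'(3) by metis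
 thus ?thesis unfolding xy(6) xy'(6) by (elim disjE conjE) (simp_all add: Un_commute insert_commute)
qed

lemma comp_frobenius:
 assumes S: "fam S2" and m: "a1 : S2" "a2 : S2" "b : S2" "a1 ~= a2" "a1 ~= b" "a2 ~= b"
  and S0: "S = (S2 - {a1, a2}) Un {a1 Un a2}" and S1: "S1 = (S2 - {a1, a2, b}) Un {a1 Un a2 Un b}"
  and S3: "S3 = (S2 - {a2, b}) Un {a2 Un b}"
  and ep: "ep : labellings S" and tht: "tht : labellings S3"
 shows "comp S ep S1 S3 tht = comp S ep S2 S3 tht"
proof -
 define I where "I = S2 - {a1, a2, b}"
 have e: "S = I Un {a1 Un a2, b}" "S1 = I Un {a1 Un a2 Un b}" "S2 = I Un {a1, a2, b}" "S3 = I Un {a1, a2 Un b}"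
  unfolding I_def S1 S0 S3 using m by blast+
 have n: "a1 Un a2 ~: S2" "a2 Un b ~: S2" "a1 Un a2 Un b ~: S2" using union2_notin[OF S] union3_notin[OF S] m by blast+
 have ne: "a1 Un a2 ~= a2 Un b" "a1 Un a2 ~= a1 Un a2 Un b" "a2 Un b ~= a1 Un a2 Un b"
  using union_ne[OF S, of "[a1, a2]" "[a2, b]"] union_ne[OF S, of "[a1, a2]" "[a1, a2, b]"] union_ne[OF S, of "[a2, b]" "[a1, a2, b]"] m
  by (simp_all add: Un_assoc doubleton_eq_iff) (metis insertCI insertE singletonD)+
 have dd: "distinct [a1 Un a2, b, a1 Un a2 Un b, a1, a2, a2 Un b]"
 proof -
  have "z ~= w & w ~= z" if "z : S2" "w ~: S2" for z w :: "'a set" using that by blast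
  thus ?thesis using m n ne ne[symmetric] by simp
 qed
 have di: "set [a1 Un a2, b, a1 Un a2 Un b, a1, a2, a2 Un b] Int I = {}" using n unfolding I_def by auto
 have fi: "finite I" using S by (simp add: fam_def I_def)
 show ?thesis using face_frobenius[OF dd di fi] ep tht unfolding e by blast
qed

lemma comp_merge_split:
 assumes S: "fam S2" and m: "u : S2" "v : S2" "p : S2" "q : S2" "distinct [u, v, p, q]"
  and S0: "S = (S2 - {p, q}) Un {p Un q}" and S1: "S1 = (S2 - {u, v, p, q}) Un {u Un v, p Un q}"
  and S3: "S3 = (S2 - {u, v}) Un {u Un v}"
  and ep: "ep : labellings S" and tht: "tht : labellings S3"
 shows "comp S ep S1 S3 tht = comp S ep S2 S3 tht"
proof -
 define I where "I = S2 - {u, v, p, q}"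
 have e: "S = I Un {u, v, p Un q}" "S1 = I Un {u Un v, p Un q}" "S2 = I Un {u, v, p, q}" "S3 = I Un {u Un v, p, q}"
  unfolding I_def S1 S0 S3 using m by auto
 have n: "u Un v ~: S2" "p Un q ~: S2" using union2_notin[OF S] m by auto
 have ne: "u Un v ~= p Un q"
  using union_ne[OF S, of "[u, v]" "[p, q]"] m by (simp add: doubleton_eq_iff)
 have dd: "distinct [u, v, p Un q, p, q, u Un v]"
 proof -
  have "z ~= w & w ~= z" if "z : S2" "w ~: S2" for z w :: "'a set" using that by blast
  thus ?thesis using m n ne ne[symmetric] by simp
 qed
 have di: "set [u, v, p Un q, p, q, u Un v] Int I = {}" using n unfolding I_def by auto
 have fi: "finite I" using S by (simp add: fam_def I_def)
 show ?thesis using face_merge_split[OF dd di fi] ep tht unfolding e by blast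
qed

text \<open>S2 is the finest of the four families, and all circles are expressed through it. The
  circles involved in the split and in the merge overlap in one, which is the Frobenius relation, or
  in none.\<close>

lemma comp_mssm:
 assumes S: "fam S" "fam S2"
  and m: "merges S S1 e f" "merges S2 S e' f'" "merges S2 S3 e f"
  and ep: "ep : labellings S" and tht: "tht : labellings S3"
 shows "comp S ep S1 S3 tht = comp S ep S2 S3 tht"
proof -
 from m(2) obtain x y where xy: "x : S2" "y : S2" "x ~= y" "e' : x" "f' : y" "S = (S2 - {x, y}) Un {x Un y}" by (rule mergesE)
 from m(3) obtain x' y' where xy': "x' : S2" "y' : S2" "x' ~= y'" "e : x'" "f : y'" "S3 = (S2 - {x', y'}) Un {x' Un y'}" by (rule mergesE)
 have n: "x Un y ~: S2" by (rule union2_notin[OF S(2) xy(1-3)])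
 have in1: "x Un y : S" "!!z. z : S2 ==> z ~= x ==> z ~= y ==> z : S" unfolding xy(6) by auto
 have ne: "~ (x' : {x, y} & y' : {x, y})"
 proof
  assume "x' : {x, y} & y' : {x, y}"
  hence "e : x Un y" "f : x Un y" using xy' by auto
  thus False using merges_det[OF S(1) m(1) in1(1) in1(1)] by blast
 qed
 have mid: "comp S ep S1 S3 tht = comp S ep S2 S3 tht"
  if h: "a : S2" "b : S2" "d : S2" "a ~= b" "a ~= d" "b ~= d" "{x, y} = {a, b}" "{x', y'} = {b, d}" for a b d
 proof -
  have u: "x Un y = a Un b" "x' Un y' = b Un d" using h(7,8) by (auto simp: doubleton_eq_iff)
  have d1: "d : S" using in1(2)[OF h(3)] h by auto
  have ef: "e : a Un b & f : d \<or> e : d & f : a Un b" using h(8) xy' by (auto simp: doubleton_eq_iff)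
  have "S1 = (S - {a Un b, d}) Un {a Un b Un d}"
  proof (use ef in "elim disjE conjE")
   assume "e : a Un b" "f : d"
   thus ?thesis using merges_det[OF S(1) m(1) in1(1) d1] u by simp
  next
   assume "e : d" "f : a Un b"
   thus ?thesis using merges_det[OF S(1) m(1) d1 in1(1)] u by (simp add: insert_commute Un_commute)
  qed
  also have "\<dots> = (S2 - {a, b, d}) Un {a Un b Un d}" unfolding xy(6) h(7) u using n u by auto
  finally have S1: "S1 = (S2 - {a, b, d}) Un {a Un b Un d}" .
  show ?thesis by (rule comp_frobenius[OF S(2) h(1-6) _ S1 _ ep tht]) (simp_all add: xy(6) xy'(6) u h)
 qed
 consider "x' : {x, y}" "y' ~: {x, y}" | "y' : {x, y}" "x' ~: {x, y}" | "x' ~: {x, y}" "y' ~: {x, y}" using ne by blast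
 thus ?thesis
 proof cases
  case 1
  define a where "a = (if x' = x then y else x)"
  show ?thesis by (rule mid[of a x' y']) (use 1 xy(1-3) xy'(1-3) a_def in "auto split: if_splits")
 next
  case 2
  define a where "a = (if y' = x then y else x)"
  show ?thesis by (rule mid[of a y' x']) (use 2 xy(1-3) xy'(1-3) a_def in "auto split: if_splits")
 next
  case 3
  have d: "distinct [x', y', x, y]" using 3 xy(3) xy'(3) by auto
  have i: "x' : S" "y' : S" using in1(2) 3 xy'(1,2) by auto
  have "S1 = (S - {x', y'}) Un {x' Un y'}" using merges_det[OF S(1) m(1) i xy'(4,5)] by blast
  also have "\<dots> = (S2 - {x', y', x, y}) Un {x' Un y', x Un y}" unfolding xy(6) using n xy'(1,2) by auto
  finally show ?thesis using comp_merge_split[OF S(2) xy'(1,2) xy(1,2) d xy(6) _ xy'(6) ep tht] by blast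
 qed
qed

text \<open>One circle is split and its parts are merged again, in two ways. The last vertex is S
  itself, and by \<open>bubble\<close> the composite does not depend on how the circle was
  split.\<close>

lemma comp_smsm:
 assumes S: "fam S" "fam S1" "fam S2"
  and m: "merges S1 S e f" "merges S1 S3 e' f'" "merges S2 S e' f'"
  and ep: "ep : labellings S" and tht: "tht : labellings S3"
 shows "comp S ep S1 S3 tht = comp S ep S2 S3 tht"
proof -
 from m(1) obtain x y where xy: "x : S1" "y : S1" "x ~= y" "e : x" "f : y" "S = (S1 - {x, y}) Un {x Un y}" by (rule mergesE)
 from m(3) obtain p q where pq: "p : S2" "q : S2" "p ~= q" "e' : p" "f' : q" "S = (S2 - {p, q}) Un {p Un q}" by (rule mergesE)
 have ef: "p Un q : S" "e' : p Un q" "f' : p Un q" using pq by auto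
 have "p Un q ~: S1" using merges_det[OF S(2) m(2) _ _ ef(2,3)] by blast
 hence u: "p Un q = x Un y" using ef(1) unfolding xy(6) by simp
 from m(2) obtain x' y' where xy': "x' : S1" "y' : S1" "x' ~= y'" "e' : x'" "f' : y'" "S3 = (S1 - {x', y'}) Un {x' Un y'}" by (rule mergesE)
 have "e' : x \<or> e' : y" "f' : x \<or> f' : y" using ef u by blast+
 hence "x' = x \<or> x' = y" "y' = x \<or> y' = y"
  using famD[OF S(2) xy'(1) _ xy'(4)] famD[OF S(2) xy'(2) _ xy'(5)] xy(1,2) by metis+
 hence "x' = x & y' = y \<or> x' = y & y' = x" using xy'(3) by metis
 hence S3: "S3 = S" unfolding xy(6) xy'(6) by (elim disjE conjE) (simp_all add: Un_commute insert_commute)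
 define I where "I = S - {x Un y}"
 have n: "x Un y ~: S1" "p Un q ~: S2" using union2_notin[OF S(2) xy(1-3)] union2_notin[OF S(3) pq(1-3)] by simp_all
 have rm: "(A Un {w}) - {w} = A" if "w ~: A" for w and A :: "'a set set" using that by simp
 have "I = S1 - {x, y}" unfolding I_def xy(6) by (rule rm) (use n(1) in simp)
 moreover have "I = S2 - {p, q}" unfolding I_def u[symmetric] pq(6) by (rule rm) (use n(2) in simp)
 ultimately have I1: "I = S1 - {x, y}" "I = S2 - {p, q}" by simp_all
 have e: "S = I Un {x Un y}" "S1 = I Un {x, y}" "S2 = I Un {p, q}"
 proof -
  have "x Un y : S" using ef(1) u by simp
  thus "S = I Un {x Un y}" unfolding I_def by blast
  show "S1 = I Un {x, y}" unfolding I1(1) using xy(1,2) by blast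
  show "S2 = I Un {p, q}" unfolding I1(2) using pq(1,2) by blast
 qed
 have d1: "distinct [x Un y, x, y]" using merge_local(5,6)[OF S(2) xy(1-3)] xy(3) by simp
 have d2: "distinct [x Un y, p, q]" using merge_local(5,6)[OF S(3) pq(1-3)] pq(3) u by simp
 have i1: "set [x Un y, x, y] Int I = {}" using n(1) unfolding I1(1) by auto
 have i2: "set [x Un y, p, q] Int I = {}" using n(2) u unfolding I1(2) by auto
 have fi: "finite I" using S by (simp add: fam_def I_def)
 have ep': "ep : labellings (I Un {x Un y})" using ep e(1) by simp
 show ?thesis unfolding S3 using bubble[OF d1 i1 fi ep'] bubble[OF d2 i2 fi ep'] unfolding e[symmetric] by simp
qed

text \<open>The two paths through a square change the number of circles by the same amount, which
  leaves six of the sixteen patterns of merges and splits.\<close>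

lemma face_cases:
 fixes n n1 n2 n3 :: nat
 assumes "A & n = Suc n1 \<or> A' & n1 = Suc n" "B & n2 = Suc n3 \<or> B' & n3 = Suc n2"
  "C & n = Suc n2 \<or> C' & n2 = Suc n" "D & n1 = Suc n3 \<or> D' & n3 = Suc n1"
 shows "(A & D & C & B) \<or> (A' & D' & C' & B') \<or> (A & D' & C & B') \<or> (A & D' & C' & B) \<or>
  (A' & D & C & B') \<or> (A' & D & C' & B)"
 using assms by (elim disjE conjE) simp_all

lemma comp_face:
 assumes S: "fam S" "fam S1" "fam S2" "fam S3"
  and c: "merges S S1 e f \<or> merges S1 S e f" "merges S2 S3 e f \<or> merges S3 S2 e f"
  and c': "merges S S2 e' f' \<or> merges S2 S e' f'" "merges S1 S3 e' f' \<or> merges S3 S1 e' f'"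
  and ep: "ep : labellings S" and tht: "tht : labellings S3"
 shows "comp S ep S1 S3 tht = comp S ep S2 S3 tht"
proof -
 have k: "merges S S1 e f & card S = Suc (card S1) \<or> merges S1 S e f & card S1 = Suc (card S)"
  "merges S2 S3 e f & card S2 = Suc (card S3) \<or> merges S3 S2 e f & card S3 = Suc (card S2)"
  "merges S S2 e' f' & card S = Suc (card S2) \<or> merges S2 S e' f' & card S2 = Suc (card S)"
  "merges S1 S3 e' f' & card S1 = Suc (card S3) \<or> merges S3 S1 e' f' & card S3 = Suc (card S1)"
  by ((use c(1) in "elim disjE; simp add: card_merges[OF S(1)] card_merges[OF S(2)]"),
   (use c(2) in "elim disjE; simp add: card_merges[OF S(3)] card_merges[OF S(4)]"),
   (use c'(1) in "elim disjE; simp add: card_merges[OF S(1)] card_merges[OF S(3)]"),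
   (use c'(2) in "elim disjE; simp add: card_merges[OF S(2)] card_merges[OF S(4)]"))
 consider
   (mmmm) "merges S S1 e f" "merges S1 S3 e' f'" "merges S S2 e' f'" "merges S2 S3 e f"
  | (ssss) "merges S1 S e f" "merges S3 S1 e' f'" "merges S2 S e' f'" "merges S3 S2 e f"
  | (msms) "merges S S1 e f" "merges S3 S1 e' f'" "merges S S2 e' f'" "merges S3 S2 e f"
  | (mssm) "merges S S1 e f" "merges S3 S1 e' f'" "merges S2 S e' f'" "merges S2 S3 e f"
  | (smms) "merges S1 S e f" "merges S1 S3 e' f'" "merges S S2 e' f'" "merges S3 S2 e f"
  | (smsm) "merges S1 S e f" "merges S1 S3 e' f'" "merges S2 S e' f'" "merges S2 S3 e f"
  using face_cases[OF k] by (elim disjE conjE) (rule that; assumption)+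
 thus ?thesis
 proof cases
  case mmmm show ?thesis by (rule comp_mmmm[OF S(1-3) mmmm(1,3,2) ep tht])
 next
  case ssss show ?thesis by (rule comp_ssss[OF S(2-4) ssss(1,3,2,4) ep tht])
 next
  case msms show ?thesis using comp_msms[OF S(1,2) msms(1-3)] by simp
 next
  case mssm show ?thesis by (rule comp_mssm[OF S(1,3) mssm(1,3,4) ep tht])
 next
  case smms show ?thesis by (rule comp_mssm[OF S(1,2) smms(3,1,2) ep tht, symmetric])
 next
  case smsm show ?thesis by (rule comp_smsm[OF S(1-3) smsm(1-3) ep tht])
 qed
qed

section \<open>Signs of the cube and the square of the differential\<close>

definition weight :: "'c rel => 'c set => 'c => rat" where
 "weight ord al c = (- 1) ^ card {b : al. (b, c) : ord}"

lemma weight_insert: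
 assumes "finite al" "c ~: al"
 shows "weight ord (insert c al) c' = weight ord al c' * (if (c, c') : ord then - 1 else 1)"
proof -
 have "{b : insert c al. (b, c') : ord} = (if (c, c') : ord then insert c {b : al. (b, c') : ord} else {b : al. (b, c') : ord})"
  by auto
 thus ?thesis using assms by (simp add: weight_def)
qed

lemma sum_antisym:
 fixes h :: "'a => 'a => rat"
 assumes "!!c c'. c : A ==> c' : A ==> h c c' = - h c' c"
 shows "(\<Sum>c\<in>A. \<Sum>c'\<in>A. h c c') = 0"
proof -
 have "(\<Sum>c\<in>A. \<Sum>c'\<in>A. h c c') = (\<Sum>c\<in>A. \<Sum>c'\<in>A. h c' c)" by (rule sum.swap)
 also have "\<dots> = - (\<Sum>c\<in>A. \<Sum>c'\<in>A. h c c')" by (simp add: sum_negf[symmetric]) (intro sum.cong refl assms)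
 finally show ?thesis by simp
qed

text \<open>The arcs in \<open>edge\<close> depend on the crossing and not on the state, so parallel
  edges of a square carry the same pair of arcs, as \<open>comp_face\<close> demands.\<close>

locale cube =
 fixes D :: "('c, 'e, 'm) diagram_scheme"
 assumes finite_crossings: "finite (crossings D)"
  and fam: "!!al. fam (circles D al)"
  and edge: "!!c al. c : crossings D ==> c ~: al ==>
   merges (circles D al) (circles D (insert c al)) (over_in D c) (over_out D c) \<or>
   merges (circles D (insert c al)) (circles D al) (over_in D c) (over_out D c)"
begin

lemma finite_generators: "finite (generators D)"
proof -
 have "generators D = Sigma (Pow (crossings D)) (%al. labellings (circles D al))" by (auto simp: generators_def)
 moreover have "finite (labellings (circles D al))" for al by (intro labellings_finite) (use fam in "simp add: fam_def")
 ultimately show ?thesis using finite_crossings by simp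
qed

lemma kh_coeff_weight:
 "kh_coeff D ord (bet, et) (al, ep) = (\<Sum>c\<in>crossings D - al. if bet = insert c al
  then weight ord al c * edge_coeff (circles D al) ep (circles D bet) et else 0)"
 unfolding kh_coeff_def weight_def by (simp only: prod.case)

lemma sum_generators: "(\<Sum>y\<in>generators D. f y) = (\<Sum>al\<in>Pow (crossings D). \<Sum>ep\<in>labellings (circles D al). f (al, ep))"
proof -
 have "generators D = Sigma (Pow (crossings D)) (%al. labellings (circles D al))" by (auto simp: generators_def)
 moreover have "finite (labellings (circles D al))" for al by (intro labellings_finite) (use fam in "simp add: fam_def")
 ultimately show ?thesis using finite_crossings by (simp add: sum.Sigma)
qed

lemma face_commute:
 assumes "c : crossings D - al" "c' : crossings D - al" "c ~= c'"
  and "ep : labellings (circles D al)" "tht : labellings (circles D (insert c' (insert c al)))"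
 shows "comp (circles D al) ep (circles D (insert c al)) (circles D (insert c' (insert c al))) tht =
  comp (circles D al) ep (circles D (insert c' al)) (circles D (insert c' (insert c al))) tht"
proof -
 have i: "insert c' (insert c al) = insert c (insert c' al)" by auto
 show ?thesis
  by (rule comp_face[OF fam fam fam fam, where e = "over_in D c" and f = "over_out D c" and e' = "over_in D c'" and f' = "over_out D c'"])
   (use assms edge[of c al] edge[of c' al] edge[of c "insert c' al"] edge[of c' "insert c al"] in "simp_all add: i")
qed

text \<open>The two paths that change c and c' have equal composites by \<open>face_commute\<close>
  and opposite signs, so the sum over ordered pairs of crossings is antisymmetric.\<close>

lemma square_zero:
 assumes ord: "linear_order_on (crossings D) ord" and x: "x : generators D" and z: "z : generators D"
 shows "(\<Sum>y\<in>generators D. kh_coeff D ord z y * kh_coeff D ord y x) = 0"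
proof -
 obtain al ep where x': "x = (al, ep)" "al \<subseteq> crossings D" "ep : labellings (circles D al)" using x by (auto simp: generators_def)
 obtain ga tht where z': "z = (ga, tht)" "ga \<subseteq> crossings D" "tht : labellings (circles D ga)" using z by (auto simp: generators_def)
 define A where "A = crossings D - al"
 have fA: "finite A" "finite al" using finite_crossings x'(2) finite_subset by (auto simp: A_def)
 define h where "h c c' = (if c ~= c' & ga = insert c' (insert c al) then weight ord al c * weight ord (insert c al) c' *
   comp (circles D al) ep (circles D (insert c al)) (circles D ga) tht else 0)" for c c'
 have "(\<Sum>y\<in>generators D. kh_coeff D ord z y * kh_coeff D ord y x) =
  (\<Sum>bet\<in>Pow (crossings D). \<Sum>et\<in>labellings (circles D bet). \<Sum>c\<in>A. kh_coeff D ord (ga, tht) (bet, et) *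
    (if bet = insert c al then weight ord al c * edge_coeff (circles D al) ep (circles D bet) et else 0))"
  unfolding sum_generators x' z' kh_coeff_weight[of _ _ _ al] A_def[symmetric] by (simp add: sum_distrib_left)
 also have "\<dots> = (\<Sum>c\<in>A. \<Sum>bet\<in>Pow (crossings D). \<Sum>et\<in>labellings (circles D bet). kh_coeff D ord (ga, tht) (bet, et) *
    (if bet = insert c al then weight ord al c * edge_coeff (circles D al) ep (circles D bet) et else 0))"
  by (subst sum.swap[of _ A]) (intro sum.cong refl sum.swap)
 also have "\<dots> = (\<Sum>c\<in>A. \<Sum>et\<in>labellings (circles D (insert c al)). kh_coeff D ord (ga, tht) (insert c al, et) *
    (weight ord al c * edge_coeff (circles D al) ep (circles D (insert c al)) et))"
 proof (intro sum.cong refl)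
  fix c assume c: "c : A"
  have "(\<Sum>bet\<in>Pow (crossings D). \<Sum>et\<in>labellings (circles D bet). kh_coeff D ord (ga, tht) (bet, et) *
    (if bet = insert c al then weight ord al c * edge_coeff (circles D al) ep (circles D bet) et else 0)) =
   (\<Sum>bet\<in>Pow (crossings D). if bet = insert c al then \<Sum>et\<in>labellings (circles D bet). kh_coeff D ord (ga, tht) (bet, et) *
    (weight ord al c * edge_coeff (circles D al) ep (circles D bet) et) else 0)"
   by (intro sum.cong refl) simp
  also have "\<dots> = (\<Sum>et\<in>labellings (circles D (insert c al)). kh_coeff D ord (ga, tht) (insert c al, et) *
    (weight ord al c * edge_coeff (circles D al) ep (circles D (insert c al)) et))"
   using c x'(2) finite_crossings unfolding A_def by (simp add: sum.delta)
  finally show "(\<Sum>bet\<in>Pow (crossings D). \<Sum>et\<in>labellings (circles D bet). kh_coeff D ord (ga, tht) (bet, et) *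
    (if bet = insert c al then weight ord al c * edge_coeff (circles D al) ep (circles D bet) et else 0)) = \<dots>" .
 qed
 also have "\<dots> = (\<Sum>c\<in>A. \<Sum>c'\<in>A. h c c')"
 proof (intro sum.cong refl)
  fix c assume c: "c : A"
  have Ac: "crossings D - insert c al = A - {c}" by (auto simp: A_def)
  have "(\<Sum>et\<in>labellings (circles D (insert c al)). kh_coeff D ord (ga, tht) (insert c al, et) *
    (weight ord al c * edge_coeff (circles D al) ep (circles D (insert c al)) et)) =
   (\<Sum>et\<in>labellings (circles D (insert c al)). \<Sum>c'\<in>A - {c}. (if ga = insert c' (insert c al) then weight ord (insert c al) c' *
    edge_coeff (circles D (insert c al)) et (circles D ga) tht else 0) *
    (weight ord al c * edge_coeff (circles D al) ep (circles D (insert c al)) et))"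
   unfolding kh_coeff_weight Ac by (simp add: sum_distrib_right)
  also have "\<dots> = (\<Sum>c'\<in>A - {c}. \<Sum>et\<in>labellings (circles D (insert c al)). (if ga = insert c' (insert c al) then weight ord (insert c al) c' *
    edge_coeff (circles D (insert c al)) et (circles D ga) tht else 0) *
    (weight ord al c * edge_coeff (circles D al) ep (circles D (insert c al)) et))" by (rule sum.swap)
  also have "\<dots> = (\<Sum>c'\<in>A - {c}. h c c')"
   by (intro sum.cong refl) (auto simp: h_def comp_def sum_distrib_left mult.assoc mult.left_commute mult.commute)
  also have "\<dots> = (\<Sum>c'\<in>A. h c c')" using fA(1) c by (intro sum.mono_neutral_left) (auto simp: h_def)
  finally show "(\<Sum>et\<in>labellings (circles D (insert c al)). kh_coeff D ord (ga, tht) (insert c al, et) *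
    (weight ord al c * edge_coeff (circles D al) ep (circles D (insert c al)) et)) = \<dots>" .
 qed
 also have "\<dots> = 0"
 proof (rule sum_antisym)
  fix c c' assume c: "c : A" "c' : A"
  show "h c c' = - h c' c"
  proof (cases "c ~= c' & ga = insert c' (insert c al)")
   case True
   have i: "insert c' (insert c al) = insert c (insert c' al)" by auto
   have o: "(c, c') : ord \<longleftrightarrow> (c', c) ~: ord"
    using ord c True unfolding linear_order_on_def partial_order_on_def antisym_def total_on_def A_def by blast
   \<comment> \<open>Exactly one of c and c' precedes the other, so inserting one of them changes
     the weight of the other in only one of the two orders of insertion.\<close>
   have "weight ord al c * weight ord (insert c al) c' = - (weight ord al c' * weight ord (insert c' al) c)"
    using c fA(2) o unfolding A_def by (simp add: weight_insert)
   moreover have "comp (circles D al) ep (circles D (insert c al)) (circles D ga) tht = comp (circles D al) ep (circles D (insert c' al)) (circles D ga) tht"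
    using face_commute[of c al c' ep tht] c True x'(3) z'(3) unfolding A_def by simp
   ultimately show ?thesis using True i unfolding h_def by auto
  next
   case False
   hence "~ (c' ~= c & ga = insert c (insert c' al))" by (auto simp: insert_commute)
   with False show ?thesis unfolding h_def by (simp only: if_False minus_zero)
  qed
 qed
 finally show ?thesis .
qed

lemma kh_coeff_nonzero:
 assumes x: "x : generators D" and y: "y : generators D" and ne: "kh_coeff D ord y x ~= 0"
 obtains al ep c et where "x = (al, ep)" "c : crossings D - al" "y = (insert c al, et)"
  "edge_coeff (circles D al) ep (circles D (insert c al)) et ~= 0" "sum et (circles D (insert c al)) = sum ep (circles D al) - 1"
proof -
 obtain al ep where x': "x = (al, ep)" "ep : labellings (circles D al)" using x by (auto simp: generators_def)
 obtain bet et where y': "y = (bet, et)" "et : labellings (circles D bet)" using y by (auto simp: generators_def)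
 obtain c where c: "c : crossings D - al" "bet = insert c al" "edge_coeff (circles D al) ep (circles D (insert c al)) et ~= 0"
 proof (rule ccontr)
  assume h: "~ thesis"
  have "kh_coeff D ord y x = 0" unfolding x'(1) y'(1) kh_coeff_weight
  proof (rule sum.neutral, intro ballI)
   fix c assume "c : crossings D - al"
   hence "bet = insert c al ==> edge_coeff (circles D al) ep (circles D (insert c al)) et = 0" using h that by blast
   thus "(if bet = insert c al then weight ord al c * edge_coeff (circles D al) ep (circles D bet) et else 0) = 0" by simp
  qed
  thus False using ne by simp
 qed
 have "sum et (circles D (insert c al)) = sum ep (circles D al) - 1"
  using edge[of c al] c x'(2) y'(2) edge_coeff_degree[OF fam] by blast
 thus thesis using that[OF x'(1) c(1) _ c(3)] y'(1) c(2) by simp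
qed

end

context link
begin

sublocale kh: cube "diagram_of L"
proof
 show "finite (crossings (diagram_of L))" using diag by (simp add: diagram_of_simps crossing_points_def is_link_diagram_def)
 fix al
 let ?r = "co.srel CR (%c. (c : al) = positive_crossing L c)"
 have "finite (components (trace L - CR) // eqcl ?r)"
  unfolding quotient_def using co.finite_components by simp
 thus "fam (circles (diagram_of L) al)" unfolding fam_def circles_diagram_of
  using quotient_nonempty quotient_disjoint by blast
 fix c assume "c : crossings (diagram_of L)" "c ~: al"
 thus "merges (circles (diagram_of L) al) (circles (diagram_of L) (insert c al)) (over_in (diagram_of L) c) (over_out (diagram_of L) c) \<or>
   merges (circles (diagram_of L) (insert c al)) (circles (diagram_of L) al) (over_in (diagram_of L) c) (over_out (diagram_of L) c)"
  using merge_or_split[of c al] by (simp add: diagram_of_simps)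
qed

end

lemma eqcl_step: "(x, y) : eqcl r ==> (y, z) : r ==> (x, z) : eqcl r"
 by (erule eqcl_trans) (rule eqcl_gen)

lemma eqcl_step': "(x, y) : eqcl r ==> (z, y) : r ==> (x, z) : eqcl r"
 by (erule eqcl_trans) (rule eqcl_sym, rule eqcl_gen)

lemma class_refl: "x : eqcl r `` {x}" by simp

lemma odd_index: assumes "odd k" "k < 2 * n" obtains i where "k = 2 * i - 1" "i : {1..n :: nat}"
proof -
 obtain j where "k = 2 * j + 1" using assms(1) by (rule oddE)
 thus thesis using that[of "j + 1"] assms(2) by simp
qed

section \<open>Gluing along a cut\<close>

text \<open>VU and VW are the fine arcs on the two sides, rU and rW the smoothings, and bU k, bW k
  the arcs at the k-th boundary point. The latter may coincide for different k, since an arc can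
  have both ends on the cut.\<close>

locale gluing = noncrossing_matching m n for m :: "nat => nat" and n :: nat +
 fixes VU VW :: "'a set" and rU rW :: "'a rel" and bU bW :: "nat => 'a"
 assumes disj: "VU Int VW = {}" and rU: "rU \<subseteq> VU \<times> VU" and rW: "rW \<subseteq> VW \<times> VW"
  and bU: "!!k. k < 2 * n ==> bU k : VU" and bW: "!!k. k < 2 * n ==> bW k : VW"
  and match: "!!k l. k < 2 * n ==> l < 2 * n ==> (bU k, bU l) : eqcl rU \<longleftrightarrow> l = k \<or> l = m k"
begin

text \<open>J crosses the cut, and E yields the circles of the whole diagram. The relation
  \<open>ch\<close> is the matching of U drawn by chords between arcs of W, and \<open>fl\<close> is
  the full closing of U.\<close>

definition J :: "'a rel" where "J = {(bU k, bW k) | k. k < 2 * n}"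
definition E :: "'a rel" where "E = eqcl (rU Un rW Un J)"
definition ch :: "'a rel" where "ch = {(bW k, bW (m k)) | k. k < 2 * n}"
definition fl :: "'a rel" where "fl = {(bU (2 * i - 1), bU (2 * i - 2)) | i. i : {1..n}}"
definition fcl :: "'a set set" where "fcl = (VU Un VW) // E"
definition lift :: "'a set => 'a set" where
 "lift w = w Un {g : VU. \<exists>k<2 * n. bW k : w & (bU k, g) : eqcl rU}"

lemma ch_sub: "rW Un ch \<subseteq> VW \<times> VW" using rW bW m by (auto simp: ch_def)
lemma E_trans: "(x, y) : E ==> (y, z) : E ==> (x, z) : E" unfolding E_def by (rule eqcl_trans)
lemma E_sym: "(x, y) : E ==> (y, x) : E" unfolding E_def by (rule eqcl_sym)
lemma E_J: "k < 2 * n ==> (bU k, bW k) : E" unfolding E_def by (rule eqcl_gen) (auto simp: J_def)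
lemma E_U: "(x, y) : eqcl rU ==> (x, y) : E" unfolding E_def using eqcl_mono[of rU "rU Un rW Un J"] by blast
lemma E_W: "(x, y) : eqcl rW ==> (x, y) : E" unfolding E_def using eqcl_mono[of rW "rU Un rW Un J"] by blast
lemma E_sub: "rU Un rW Un J \<subseteq> (VU Un VW) \<times> (VU Un VW)" using rU rW bU bW by (auto simp: J_def)

lemma E_ch: assumes "(x, y) : eqcl (rW Un ch)" shows "(x, y) : E"
proof -
 have "rW Un ch \<subseteq> E"
 proof
  fix z assume z: "z : rW Un ch"
  show "z : E"
  proof (cases "z : rW")
   case True thus ?thesis using E_W[OF eqcl_gen] by (cases z) auto
  next
   case False
   then obtain k where k: "z = (bW k, bW (m k))" "k < 2 * n" using z by (auto simp: ch_def)
   have mk: "m k < 2 * n" using m[OF k(2)] by simp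
   have "(bU k, bU (m k)) : E" using E_U match[OF k(2) mk] by simp
   thus ?thesis unfolding k(1) by (rule E_trans[OF E_sym[OF E_J[OF k(2)]] E_trans[OF _ E_J[OF mk]]])
  qed
 qed
 thus ?thesis using eqcl_subset[of "rW Un ch" "rU Un rW Un J"] assms unfolding E_def by blast
qed

text \<open>An excursion of a path into U enters and leaves through k and m k, or returns through
  the same point, so a chord can replace it. One induction carries both claims, for the path being
  in W and in U.\<close>

lemma glue:
 assumes f: "f : VW" and fg: "(f, g) : E"
 shows "g : VW ==> (f, g) : eqcl (rW Un ch)"
  "g : VU ==> \<exists>k<2 * n. (f, bW k) : eqcl (rW Un ch) & (bU k, g) : eqcl rU"
proof -
 let ?P = "%g. (g : VW --> (f, g) : eqcl (rW Un ch)) &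
  (g : VU --> (\<exists>k<2 * n. (f, bW k) : eqcl (rW Un ch) & (bU k, g) : eqcl rU))"
 have "?P g" using fg unfolding E_def
 proof (induction rule: eqcl_induct)
  case refl
  thus ?case using f disj by auto
 next
  case (step y z)
  have PU: "(\<exists>k<2 * n. (f, bW k) : eqcl (rW Un ch) & (bU k, y) : eqcl rU)" if "y : VU" using step(3) that by blast
  have PW: "(f, y) : eqcl (rW Un ch)" if "y : VW" using step(3) that by blast
  consider (U) "(y, z) : rU \<or> (z, y) : rU" | (W) "(y, z) : rW \<or> (z, y) : rW" | (J) "(y, z) : J" | (J') "(z, y) : J"
   using step(2) by blast
  thus ?case
  proof cases
   case U
   hence V: "y : VU" "z : VU" using rU by blast+
   then obtain k where k: "k < 2 * n" "(f, bW k) : eqcl (rW Un ch)" "(bU k, y) : eqcl rU" using PU by blast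
   have "(bU k, z) : eqcl rU" using U eqcl_step[OF k(3)] eqcl_step'[OF k(3)] by blast
   thus ?thesis using k V disj by blast
  next
   case W
   hence V: "y : VW" "z : VW" using rW by blast+
   have "(y, z) : rW Un ch \<or> (z, y) : rW Un ch" using W by blast
   hence "(f, z) : eqcl (rW Un ch)" using eqcl_step[OF PW[OF V(1)]] eqcl_step'[OF PW[OF V(1)]] by blast
   thus ?thesis using V disj by blast
  next
   case J
   then obtain k where k: "k < 2 * n" "y = bU k" "z = bW k" by (auto simp: J_def)
   obtain l where l: "l < 2 * n" "(f, bW l) : eqcl (rW Un ch)" "(bU l, y) : eqcl rU" using PU bU k by blast
   \<comment> \<open>The path entered U at l and leaves at k: it either turns back or uses one
     chord.\<close>
   have "k = l \<or> k = m l" using l(3) match[OF l(1) k(1)] k(2) by simp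
   moreover have "(bW l, bW (m l)) : rW Un ch" using l(1) by (auto simp: ch_def)
   ultimately have "(f, z) : eqcl (rW Un ch)" using eqcl_step[OF l(2)] l(2) k(3) by blast
   thus ?thesis using bW k disj by blast
  next
   case J'
   then obtain k where k: "k < 2 * n" "z = bU k" "y = bW k" by (auto simp: J_def)
   have "(f, bW k) : eqcl (rW Un ch)" using PW bW k by blast
   thus ?thesis using k bU disj by blast
  qed
 qed
 thus "g : VW ==> (f, g) : eqcl (rW Un ch)"
  "g : VU ==> \<exists>k<2 * n. (f, bW k) : eqcl (rW Un ch) & (bU k, g) : eqcl rU" by blast+
qed

lemma fine_W: assumes f: "f : VW" shows "E `` {f} Int VW = eqcl (rW Un ch) `` {f}"
proof
 show "E `` {f} Int VW \<subseteq> eqcl (rW Un ch) `` {f}" using glue(1)[OF f] by blast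
 show "eqcl (rW Un ch) `` {f} \<subseteq> E `` {f} Int VW" using E_ch eqcl_closed[OF ch_sub _ f] by blast
qed

lemma fine_sub: "Z : fcl ==> Z \<subseteq> VU Un VW" unfolding fcl_def E_def by (rule quotient_sub[OF E_sub])
lemma fine_mem: "Z : fcl ==> f : Z ==> Z = E `` {f}" unfolding fcl_def E_def by (rule quotient_class_mem)

lemma circles_W: "VW // eqcl (rW Un ch) = {Z Int VW | Z. Z : fcl} - {{}}"
proof (intro equalityI subsetI)
 fix w assume "w : VW // eqcl (rW Un ch)"
 then obtain f where f: "f : VW" "w = eqcl (rW Un ch) `` {f}" by (auto simp: quotient_def)
 have "E `` {f} : fcl" using f(1) unfolding fcl_def by (intro quotientI) simp
 moreover have "w = E `` {f} Int VW" using fine_W f by simp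
 moreover have "w ~= {}" using class_refl unfolding f(2) by blast
 ultimately show "w : {Z Int VW | Z. Z : fcl} - {{}}" by blast
next
 fix w assume "w : {Z Int VW | Z. Z : fcl} - {{}}"
 then obtain Z f where Z: "Z : fcl" "w = Z Int VW" "f : Z" "f : VW" by blast
 have "w = eqcl (rW Un ch) `` {f}" unfolding Z(2) fine_mem[OF Z(1,3)] by (rule fine_W[OF Z(4)])
 thus "w : VW // eqcl (rW Un ch)" using Z(4) by (simp add: quotientI)
qed

lemma lift: assumes Z: "Z : fcl" "Z Int VW ~= {}" shows "lift (Z Int VW) = Z"
proof -
 obtain f where f: "f : Z" "f : VW" using Z(2) by blast
 note Zf = fine_mem[OF Z(1) f(1)]
 have iff: "bW k : Z \<longleftrightarrow> (f, bW k) : eqcl (rW Un ch)" if "k < 2 * n" for k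
  using glue(1)[OF f(2)] E_ch bW[OF that] unfolding Zf by blast
 have "g : Z \<longleftrightarrow> (\<exists>k<2 * n. bW k : Z & (bU k, g) : eqcl rU)" if g: "g : VU" for g
 proof
  assume "g : Z"
  thus "\<exists>k<2 * n. bW k : Z & (bU k, g) : eqcl rU" using glue(2)[OF f(2) _ g] iff unfolding Zf by blast
 next
  assume "\<exists>k<2 * n. bW k : Z & (bU k, g) : eqcl rU"
  then obtain k where k: "k < 2 * n" "bW k : Z" "(bU k, g) : eqcl rU" by blast
  have "(f, bW k) : E" using k(2) unfolding Zf by simp
  hence "(f, g) : E" by (rule E_trans[OF _ E_trans[OF E_sym[OF E_J[OF k(1)]] E_U[OF k(3)]]])
  thus "g : Z" unfolding Zf by simp
 qed
 hence "{g : VU. \<exists>k<2 * n. bW k : Z Int VW & (bU k, g) : eqcl rU} = Z Int VU" using bW by blast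
 thus ?thesis unfolding lift_def using fine_sub[OF Z(1)] by blast
qed

text \<open>Gluings attached at boundary arcs cannot reach a class without boundary arcs. This and
  its converse show that inner circles are the same for every closing.\<close>

lemma isolated_iff:
 assumes "Z : VU // eqcl s" "rU \<subseteq> s" "Z Int bU ` {..<2 * n} = {}"
  and ends: "!!x y. (x, y) : s - rU ==> x : VU ==> x : bU ` {..<2 * n}" "!!x y. (x, y) : s - rU ==> y : VU ==> y : bU ` {..<2 * n}"
  and all: "!!x y. (x, y) : s ==> (x, y) : rU \<or> x : bU ` {..<2 * n} \<or> y : bU ` {..<2 * n} \<or> x ~: VU & y ~: VU"
 shows "Z : VU // eqcl rU"
proof -
 obtain f where f: "f : VU" "Z = eqcl s `` {f}" using assms(1) by (auto simp: quotient_def)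
 have "eqcl rU `` {f} \<subseteq> Z" unfolding f(2) using eqcl_mono[OF assms(2)] by blast
 hence "eqcl rU `` {f} Int bU ` {..<2 * n} = {}" using assms(3) by blast
 have "eqcl s `` {f} \<subseteq> eqcl rU `` {f}"
 proof
  fix g assume "g : eqcl s `` {f}"
  hence "(f, g) : eqcl s" by simp
  hence "(f, g) : eqcl rU"
  proof (induction rule: eqcl_induct)
   case (step y z)
   have y: "y : VU" using eqcl_closed[OF rU step(3) f(1)] .
   have yb: "y ~: bU ` {..<2 * n}" using \<open>eqcl rU `` {f} Int bU ` {..<2 * n} = {}\<close> step(3) by blast
   have "(y, z) : rU \<or> (z, y) : rU" using step(2) ends y yb by blast
   thus ?case using eqcl_step[OF step(3)] eqcl_step'[OF step(3)] by blast
  qed simp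
  thus "g : eqcl rU `` {f}" by simp
 qed
 hence "Z = eqcl rU `` {f}" using \<open>eqcl rU `` {f} \<subseteq> Z\<close> f(2) by blast
 thus ?thesis using f(1) by (simp add: quotientI)
qed

lemma isolated:
 assumes "Z : VU // eqcl rU" "rU \<subseteq> s" "Z Int bU ` {..<2 * n} = {}"
  and ends: "!!x y. (x, y) : s - rU ==> x : VU ==> x : bU ` {..<2 * n}" "!!x y. (x, y) : s - rU ==> y : VU ==> y : bU ` {..<2 * n}"
 shows "Z : VU // eqcl s"
proof -
 obtain f where f: "f : VU" "Z = eqcl rU `` {f}" using assms(1) by (auto simp: quotient_def)
 have "eqcl s `` {f} \<subseteq> eqcl rU `` {f}"
 proof
  fix g assume "g : eqcl s `` {f}"
  hence "(f, g) : eqcl s" by simp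
  hence "(f, g) : eqcl rU"
  proof (induction rule: eqcl_induct)
   case (step y z)
   have y: "y : VU" using eqcl_closed[OF rU step(3) f(1)] .
   have yb: "y ~: bU ` {..<2 * n}" using assms(3) step(3) unfolding f(2) by blast
   have "(y, z) : rU \<or> (z, y) : rU" using step(2) ends y yb by blast
   thus ?case using eqcl_step[OF step(3)] eqcl_step'[OF step(3)] by blast
  qed simp
  thus "g : eqcl rU `` {f}" by simp
 qed
 hence "Z = eqcl s `` {f}" using eqcl_mono[OF assms(2)] f(2) by blast
 thus ?thesis using f(1) by (simp add: quotientI)
qed

definition inner :: "'a set set" where "inner = {Z : VU // eqcl rU. Z Int bU ` {..<2 * n} = {}}"

lemma inner_full: "{Z : VU // eqcl (rU Un fl). Z Int bU ` {..<2 * n} = {}} = inner"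
proof -
 have lt: "2 * i - 1 < 2 * n" "2 * i - 2 < 2 * n" if "i : {1..n}" for i using that by auto
 have e: "x : bU ` {..<2 * n} & y : bU ` {..<2 * n}" if "(x, y) : rU Un fl - rU" for x y
  using that lt by (auto simp: fl_def)
 have "Z : VU // eqcl rU" if "Z : VU // eqcl (rU Un fl)" "Z Int bU ` {..<2 * n} = {}" for Z
  by (rule isolated_iff[OF that(1) _ that(2)]) (use e in blast)+
 moreover have "Z : VU // eqcl (rU Un fl)" if "Z : VU // eqcl rU" "Z Int bU ` {..<2 * n} = {}" for Z
  by (rule isolated[OF that(1) _ that(2)]) (use e in blast)+
 ultimately show ?thesis unfolding inner_def by blast
qed

lemma inner_fine: "inner = {Z : fcl. Z Int VW = {}}"
proof -
 have e: "x : bU ` {..<2 * n}" "y : VU ==> y : bU ` {..<2 * n}" if "(x, y) : rU Un rW Un J - rU" "x : VU" for x y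
  using that rW disj bW by (auto simp: J_def)
 have e': "x : bU ` {..<2 * n}" if "(x, y) : rU Un rW Un J - rU" "x : VU" for x y
  using that rW disj by (auto simp: J_def)
 have e'': "y : bU ` {..<2 * n}" if "(x, y) : rU Un rW Un J - rU" "y : VU" for x y
  using that rW disj bW by (auto simp: J_def)
 have all: "(x, y) : rU \<or> x : bU ` {..<2 * n} \<or> y : bU ` {..<2 * n} \<or> x ~: VU & y ~: VU" if "(x, y) : rU Un rW Un J" for x y
  using that rW disj by (auto simp: J_def)
 show ?thesis
 proof (intro equalityI subsetI)
  fix Z assume Z: "Z : inner"
  hence Z': "Z : VU // eqcl rU" "Z Int bU ` {..<2 * n} = {}" by (auto simp: inner_def)
  have "Z : VU // E" unfolding E_def by (rule isolated[OF Z'(1) _ Z'(2)]) (use e' e'' in blast)+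
  hence "Z : fcl" unfolding fcl_def quotient_def by blast
  moreover have "Z \<subseteq> VU" using quotient_sub[OF rU Z'(1)] .
  ultimately show "Z : {Z : fcl. Z Int VW = {}}" using disj by blast
 next
  fix Z assume "Z : {Z : fcl. Z Int VW = {}}"
  hence Z: "Z : fcl" "Z Int VW = {}" by auto
  then obtain f where f: "f : VU Un VW" "Z = E `` {f}" by (auto simp: fcl_def quotient_def)
  have fZ: "f : Z" unfolding f(2) E_def by (rule class_refl)
  hence ZV: "Z : VU // E" using f Z(2) by (auto intro: quotientI)
  have no: "Z Int bU ` {..<2 * n} = {}"
  proof (rule ccontr)
   assume "Z Int bU ` {..<2 * n} ~= {}"
   then obtain k where k: "k < 2 * n" "bU k : Z" by blast
   have "bW k : Z" using E_trans[OF _ E_J[OF k(1)], of f] k(2) unfolding f(2) by blast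
   thus False using Z(2) bW[OF k(1)] by blast
  qed
  have "Z : VU // eqcl rU"
   by (rule isolated_iff[of Z "rU Un rW Un J", OF _ _ no e' e'' all]) (use ZV in "auto simp: E_def")
  thus "Z : inner" using no by (simp add: inner_def)
 qed
qed

text \<open>In the full closing one walks from a_r over a chord to b_r and along the strand to a_(p
  r), so the circles through the boundary correspond to the orbits of p.\<close>

lemma full_G:
 assumes r: "r : {1..n}" and s: "s : {1..n}"
 shows "(bU (2 * r - 2), bU (2 * s - 2)) : eqcl (rU Un fl) \<longleftrightarrow> (r, s) : eqcl G"
proof -
 let ?F = "eqcl (rU Un fl)"
 have lt: "2 * i - 1 < 2 * n" "2 * i - 2 < 2 * n" if "i : {1..n}" for i using that by auto
 have mp: "(bU (2 * i - 1), bU (2 * p i - 2)) : eqcl rU" if i: "i : {1..n}" for i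
  using match[OF lt(1)[OF i] lt(2)[OF p(1)[OF i]]] p(2)[OF i] by simp
 have fi: "(bU (2 * i - 1), bU (2 * i - 2)) : rU Un fl" if "i : {1..n}" for i using that by (auto simp: fl_def)
 have step: "(bU (2 * i - 2), bU (2 * p i - 2)) : ?F" if i: "i : {1..n}" for i
 proof (rule eqcl_trans)
  show "(bU (2 * i - 2), bU (2 * i - 1)) : ?F" by (rule eqcl_sym, rule eqcl_gen, rule fi[OF i])
  show "(bU (2 * i - 1), bU (2 * p i - 2)) : ?F" using eqcl_mono[of rU "rU Un fl"] mp[OF i] by blast
 qed
 show ?thesis
 proof
  assume "(r, s) : eqcl G"
  thus "(bU (2 * r - 2), bU (2 * s - 2)) : ?F"
  proof (induction rule: eqcl_induct)
   case (step y z)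
   have "(bU (2 * y - 2), bU (2 * z - 2)) : ?F"
    using step(2)
   proof
    assume "(y, z) : G"
    hence "y : {1..n}" "z = p y" by (auto simp: G_def)
    thus ?thesis using \<open>!!i. i : {1..n} ==> (bU (2 * i - 2), bU (2 * p i - 2)) : ?F\<close> by simp
   next
    assume "(z, y) : G"
    hence "z : {1..n}" "y = p z" by (auto simp: G_def)
    hence "(bU (2 * z - 2), bU (2 * y - 2)) : ?F"
     using \<open>!!i. i : {1..n} ==> (bU (2 * i - 2), bU (2 * p i - 2)) : ?F\<close> by simp
    thus ?thesis by (rule eqcl_sym)
   qed
   thus ?case by (rule eqcl_trans[OF step(3)])
  qed simp
 next
  assume h: "(bU (2 * r - 2), bU (2 * s - 2)) : ?F"
  \<comment> \<open>The invariant of the walk: f lies on a strand ending at a boundary point whose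
    number is in the class of r.\<close>
  define Q where "Q f \<longleftrightarrow> (\<exists>k<2 * n. (f, bU k) : eqcl rU & (r, k div 2 + 1) : eqcl G)" for f
  have idx: "(2 * i - 1) div 2 + 1 = i" "(2 * i - 2) div 2 + 1 = i" if "i : {1..n}" for i using that by auto
  have mG: "(k div 2 + 1, m k div 2 + 1) : eqcl G" if k: "k < 2 * n" for k
  proof (cases "odd k")
   case True
   obtain i where i: "k = 2 * i - 1" "i : {1..n}" by (rule odd_index[OF True k])
   have "(i, p i) : G" using i(2) by (auto simp: G_def)
   thus ?thesis unfolding i(1) p(2)[OF i(2)] idx(1)[OF i(2)] idx(2)[OF p(1)[OF i(2)]] by (rule eqcl_gen)
  next
   case False
   hence o: "odd (m k)" using parity[OF k] by simp
   have mk: "m k < 2 * n" "m (m k) = k" using m[OF k] by auto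
   obtain i where i: "m k = 2 * i - 1" "i : {1..n}" by (rule odd_index[OF o mk(1)])
   have "k = 2 * p i - 2" using p(2)[OF i(2)] i(1) mk(2) by simp
   moreover have "(i, p i) : G" using i(2) by (auto simp: G_def)
   ultimately have "(m k div 2 + 1, k div 2 + 1) : G" unfolding i(1) using idx(1)[OF i(2)] idx(2)[OF p(1)[OF i(2)]] by simp
   thus ?thesis by (rule eqcl_sym[OF eqcl_gen])
  qed
  \<comment> \<open>The strand through bU k ends at k and m k, and both numbers belong to the same
    orbit.\<close>
  have Qb: "(r, k div 2 + 1) : eqcl G" if k: "k < 2 * n" and q: "Q (bU k)" for k
  proof -
   obtain l where l: "l < 2 * n" "(bU k, bU l) : eqcl rU" "(r, l div 2 + 1) : eqcl G" using q by (auto simp: Q_def)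
   have "l = k \<or> l = m k" using l(2) match[OF k l(1)] by simp
   thus ?thesis
   proof
    assume "l = k" thus ?thesis using l(3) by simp
   next
    assume "l = m k"
    thus ?thesis using l(3) by (intro eqcl_trans[OF _ eqcl_sym[OF mG[OF k]]]) simp
   qed
  qed
  have Qi: "Q (bU k)" if "k < 2 * n" "(r, k div 2 + 1) : eqcl G" for k unfolding Q_def using that by blast
  from h have "Q (bU (2 * s - 2))"
  proof (induction rule: eqcl_induct)
   case refl
   show ?case using Qi[OF lt(2)[OF r]] idx(2)[OF r] by simp
  next
   case (step y z)
   consider (U) "(y, z) : rU \<or> (z, y) : rU" | (F) i where "i : {1..n}" "{y, z} = {bU (2 * i - 1), bU (2 * i - 2)}"
    using step(2) by (auto simp: fl_def)
   thus ?case
   proof cases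
    case U
    obtain k where k: "k < 2 * n" "(y, bU k) : eqcl rU" "(r, k div 2 + 1) : eqcl G" using step(3) by (auto simp: Q_def)
    have "(z, y) : eqcl rU" using U eqcl_gen eqcl_sym by metis
    hence "(z, bU k) : eqcl rU" using k(2) by (rule eqcl_trans)
    thus ?thesis using k by (auto simp: Q_def)
   next
    case F
    hence "Q (bU (2 * i - 1)) \<or> Q (bU (2 * i - 2))" using step(3) by (auto simp: doubleton_eq_iff)
    hence "(r, i) : eqcl G" using Qb lt[OF F(1)] idx[OF F(1)] by metis
    hence "Q (bU (2 * i - 1)) & Q (bU (2 * i - 2))" using Qi lt[OF F(1)] idx[OF F(1)] by metis
    thus ?thesis using F(2) by (auto simp: doubleton_eq_iff)
   qed
  qed
  thus "(r, s) : eqcl G" using Qb[OF lt(2)[OF s]] idx(2)[OF s] by simp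
 qed
qed

text \<open>\<open>chords\<close> lists each chord once, from b to a, that is from odd to even
  index, while \<open>ch\<close> contains both directions.\<close>

lemma chord_joins: "eqcl ({(bW (2 * i - 1), bW (2 * j - 2)) | i j. (i, j) : chords blocks} Un rW) = eqcl (rW Un ch)"
proof (rule eqcl_eqI)
 have lt: "2 * i - 1 < 2 * n" if "i : {1..n}" for i using that by auto
 show "{(bW (2 * i - 1), bW (2 * j - 2)) | i j. (i, j) : chords blocks} Un rW \<subseteq> eqcl (rW Un ch)"
 proof
  fix z assume "z : {(bW (2 * i - 1), bW (2 * j - 2)) | i j. (i, j) : chords blocks} Un rW"
  hence "z : rW Un ch" unfolding chords_blocks using p(2) lt by (auto simp: G_def ch_def)
  thus "z : eqcl (rW Un ch)" by (cases z) (auto intro: eqcl_gen)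
 qed
 let ?j = "{(bW (2 * i - 1), bW (2 * j - 2)) | i j. (i, j) : chords blocks} Un rW"
 have od: "(bW k, bW (m k)) : ?j" if k: "k < 2 * n" "odd k" for k
 proof -
  obtain i where i: "k = 2 * i - 1" "i : {1..n}" by (rule odd_index[OF k(2,1)])
  have "(i, p i) : chords blocks" unfolding chords_blocks using i(2) by (auto simp: G_def)
  hence "(bW (2 * i - 1), bW (2 * p i - 2)) : ?j" by blast
  thus ?thesis unfolding i(1) p(2)[OF i(2)] .
 qed
 show "rW Un ch \<subseteq> eqcl ?j"
 proof
  fix z assume z: "z : rW Un ch"
  show "z : eqcl ?j"
  proof (cases "z : rW")
   case True thus ?thesis by (cases z) (auto intro: eqcl_gen)
  next
   case False
   then obtain k where k: "k < 2 * n" "z = (bW k, bW (m k))" using z by (auto simp: ch_def)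
   show ?thesis
   proof (cases "odd k")
    case True show ?thesis unfolding k(2) by (rule eqcl_gen[OF od[OF k(1) True]])
   next
    case False
    hence "odd (m k)" using parity[OF k(1)] by simp
    hence "(bW (m k), bW k) : ?j" using od[of "m k"] m[OF k(1)] by simp
    thus ?thesis unfolding k(2) by (rule eqcl_sym[OF eqcl_gen])
   qed
  qed
 qed
qed

end

lemma chords_full: "chords (full n) = {(i, i) | i. i : {1..n}}"
proof -
 have "chords (full n) = {(i, if {k : {i}. i < k} = {} then Min {i} else Min {k : {i}. i < k}) | i. i : {1..n}}"
  unfolding chords_def full_def by blast
 thus ?thesis by auto
qed

section \<open>Circles of L and circles of the closed tangles\<close>

text \<open>The roles of U and W can be interchanged, so each statement serves both descriptions of
  the double complex.\<close>

locale two_sides = tangle_cut L C R1 R2 for L C R1 R2 +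
 fixes U W :: "complex set"
 assumes UW: "{U, W} = {inside (path_image C), outside (path_image C)}"
begin

lemma side: "is_side U" "is_side W" "U Int W = {}"
proof -
 have "U = inside (path_image C) & W = outside (path_image C) \<or> U = outside (path_image C) & W = inside (path_image C)"
  using UW by (auto simp: doubleton_eq_iff)
 thus "is_side U" "is_side W" "U Int W = {}"
  using inside_Int_outside[of "path_image C"] by (elim disjE conjE; simp add: is_side_def Int_commute)+
qed

abbreviation "R \<equiv> U Un path_image C"
abbreviation "R' \<equiv> W Un path_image C"
abbreviation "V \<equiv> components (trace L - MM)"

lemma off_cut: "CR Int path_image C = {}" using adm'(4) by blast

lemma split_arcs: "V = side_arcs U Un side_arcs W" "side_arcs U Int side_arcs W = {}"
proof -
 have "e \<subseteq> U \<or> e \<subseteq> W" if "e : V" for e using arc_side(1)[OF that] UW by (auto simp: doubleton_eq_iff)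
 thus "V = side_arcs U Un side_arcs W" unfolding side_arcs_def by blast
 have "e ~= {}" if "e : V" for e using that in_components_nonempty by blast
 thus "side_arcs U Int side_arcs W = {}" using side(3) unfolding side_arcs_def by blast
qed

definition rel :: "complex set => complex set => complex set rel" where
 "rel Y al = srel (CR Int Y) (sigma al)"

lemma rel_cong: "al Int (Y Un path_image C) = bet Int (Y Un path_image C) ==> rel Y al = rel Y bet"
 unfolding rel_def by (rule srel_cong) (auto simp: sigma_def)

lemma rel_sub: assumes Y: "is_side Y" shows "rel Y al \<subseteq> side_arcs Y \<times> side_arcs Y"
proof
 fix z assume z: "z : rel Y al"
 obtain e f where ef: "z = (e, f)" by (cases z)
 have sr: "(e, f) : srel (CR Int Y) (sigma al)" using z unfolding ef rel_def .
 obtain c i j where c: "c : CR Int Y" "e = end_arc (over_pos L c) i" "f = end_arc (under_pos L c) j"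
  "j = (i = sigma al c)" "over_pos L c : mpos" "under_pos L c : mpos"
  by (rule srelD[OF sr Int_lower1])
 show "z : side_arcs Y \<times> side_arcs Y"
  unfolding ef side_arcs_def c(2,3)
  by (intro SigmaI CollectI conjI crossing_side'[OF c(1) Y] end_arc_component[OF c(5)] end_arc_component[OF c(6)])
qed

definition mt :: "complex set => nat => nat" where
 "mt al = (SOME m. noncrossing_matching m n & (\<forall>k l. k < 2 * n --> l < 2 * n -->
   ((barc U (bp k), barc U (bp l)) : eqcl (rel U al) \<longleftrightarrow> l = k \<or> l = m k)))"

lemma glueing: "gluing (mt al) n (side_arcs U) (side_arcs W) (rel U al) (rel W al) (%k. barc U (bp k)) (%k. barc W (bp k))"
proof -
 have ex: "\<exists>m. noncrossing_matching m n & (\<forall>k l. k < 2 * n --> l < 2 * n -->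
   ((barc U (bp k), barc U (bp l)) : eqcl (rel U al) \<longleftrightarrow> l = k \<or> l = m k))"
  using matching[OF side(1), of "sigma al"] unfolding rel_def by metis
 note someI_ex[OF ex, folded mt_def]
 moreover have "barc Y (bp k) : side_arcs Y" if "k < 2 * n" "is_side Y" for k Y
  using barc(1,2)[OF bp(1)[OF that(1)] that(2)] by (simp add: side_arcs_def)
 ultimately show ?thesis
  using split_arcs(2) rel_sub[OF side(1)] rel_sub[OF side(2)] side(1,2)
  by (intro gluing.intro gluing_axioms.intro) simp_all
qed

text \<open>Circles as sets of fine arcs, the common refinement in which L and the two tangles are
  compared.\<close>

definition FC :: "complex set => complex set set set" where
 "FC al = V // eqcl (srel CR (sigma al) Un jrel)"

lemma FC_fcl: "FC al = gluing.fcl n (side_arcs U) (side_arcs W) (rel U al) (rel W al) (%k. barc U (bp k)) (%k. barc W (bp k))"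
proof -
 interpret g: gluing "mt al" n "side_arcs U" "side_arcs W" "rel U al" "rel W al" "%k. barc U (bp k)" "%k. barc W (bp k)" by (rule glueing)
 have s: "srel CR (sigma al) = rel U al Un rel W al"
 proof -
  have "CR \<times> UNIV = (CR Int U) \<times> UNIV Un (CR Int W) \<times> (UNIV :: bool set)"
   using crossings_split[OF UW] by blast
  thus ?thesis unfolding rel_def srel_def by (simp add: image_Un)
 qed
 have j: "(end_arc x False, end_arc x True) = (barc U x, barc W x) \<or> (end_arc x False, end_arc x True) = (barc W x, barc U x)"
  if x: "x : bpos" for x
 proof -
  have ne: "end_arc x True ~= {}"
   using end_arc_component[of x True] x in_components_nonempty unfolding bpos_def by blast
  have "end_arc x b \<subseteq> U \<or> end_arc x b \<subseteq> W" for b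
   using arc_side(1)[OF end_arc_component[of x b]] x UW unfolding bpos_def by (auto simp: doubleton_eq_iff)
  hence "end_arc x True \<subseteq> U \<or> end_arc x True \<subseteq> W" by blast
  thus ?thesis
  proof
   assume h: "end_arc x True \<subseteq> U"
   hence "~ end_arc x True \<subseteq> W" using ne side(3) by blast
   thus ?thesis using h by (simp add: barc_def)
  next
   assume h: "end_arc x True \<subseteq> W"
   hence "~ end_arc x True \<subseteq> U" using ne side(3) by blast
   thus ?thesis using h by (simp add: barc_def)
  qed
 qed
 have "eqcl (srel CR (sigma al) Un jrel) = g.E" unfolding g.E_def s
 proof (rule eqcl_eqI)
  show "rel U al Un rel W al Un jrel \<subseteq> eqcl (rel U al Un rel W al Un g.J)"
  proof
   fix z assume z: "z : rel U al Un rel W al Un jrel"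
   show "z : eqcl (rel U al Un rel W al Un g.J)"
   proof (cases "z : jrel")
    case True
    then obtain x where x: "x : bpos" "z = (end_arc x False, end_arc x True)" by (auto simp: jrel_def)
    obtain k where "k < 2 * n" "x = bp k" by (rule bpE[OF x(1)])
    hence b: "(barc U x, barc W x) : rel U al Un rel W al Un g.J" unfolding g.J_def by blast
    show ?thesis using j[OF x(1)] x(2) eqcl_gen[OF b] eqcl_sym[OF eqcl_gen[OF b]] by metis
   next
    case False
    hence "z : rel U al Un rel W al Un g.J" using z by blast
    thus ?thesis by (cases z) (simp only: eqcl_gen)
   qed
  qed
  show "rel U al Un rel W al Un g.J \<subseteq> eqcl (rel U al Un rel W al Un jrel)"
  proof
   fix z assume z: "z : rel U al Un rel W al Un g.J"
   show "z : eqcl (rel U al Un rel W al Un jrel)"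
   proof (cases "z : g.J")
    case True
    then obtain k where k: "k < 2 * n" "z = (barc U (bp k), barc W (bp k))" by (auto simp: g.J_def)
    have "(end_arc (bp k) False, end_arc (bp k) True) : rel U al Un rel W al Un jrel" unfolding jrel_def using bp(1)[OF k(1)] by blast
    from eqcl_gen[OF this] eqcl_sym[OF eqcl_gen[OF this]] show ?thesis using j[OF bp(1)[OF k(1)]] k(2) by auto
   next
    case False
    hence "z : rel U al Un rel W al Un jrel" using z by blast
    thus ?thesis by (cases z) (simp only: eqcl_gen)
   qed
  qed
 qed
 thus ?thesis unfolding FC_def g.fcl_def split_arcs(1) by simp
qed

lemma closing_circles:
 assumes Y: "is_side Y" and A: "chords A \<subseteq> {1..n} \<times> {1..n}"
 shows "circles (closing (tang Y) A) (al Int (Y Un path_image C)) =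
  side_arcs Y // eqcl ({(barc Y (bp (2 * i - 1)), barc Y (bp (2 * j - 2))) | i j. (i, j) : chords A} Un rel Y al)"
proof -
 note t = tang_simps[OF Y]
 let ?T = "closing (tang Y) A"
 have d: "is_cut_diagram ?T" using t(8) unfolding is_cut_diagram_def by (simp add: closing_def)
 have j: "joins ?T = {(barc Y (bp (2 * i - 1)), barc Y (bp (2 * j - 2))) | i j. (i, j) : chords A}"
 proof -
  have "b_arc (tang Y) i = barc Y (bp (2 * i - 1))" "a_arc (tang Y) j = barc Y (bp (2 * j - 2))" if "(i, j) : chords A" for i j
   using t(6,7) that A by blast+
  hence "(\<exists>i j. z = (b_arc (tang Y) i, a_arc (tang Y) j) & (i, j) : chords A) \<longleftrightarrow>
    (\<exists>i j. z = (barc Y (bp (2 * i - 1)), barc Y (bp (2 * j - 2))) & (i, j) : chords A)" for z by metis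
  thus ?thesis unfolding closing_def using t(2) by simp
 qed
 have c: "crossings ?T = CR Int Y" "positive ?T = positive_crossing L" "arcs ?T = side_arcs Y"
  using t by (simp_all add: closing_def)
 have "srel (crossings ?T) (%c. (c : al Int (Y Un path_image C)) = positive ?T c) = rel Y al"
  unfolding rel_def c by (rule srel_cong) (simp add: sigma_def)
 thus ?thesis unfolding circles_def eqcl_smoothing_rel[OF d] j c(3) by simp
qed

lemma full_circles:
 "circles (full_closing (tang U)) (al Int R) = side_arcs U // eqcl (rel U al \<union>
  gluing.fl n (%k. barc U (bp k)))"
proof -
 interpret g: gluing "mt al" n "side_arcs U" "side_arcs W" "rel U al" "rel W al" "%k. barc U (bp k)" "%k. barc W (bp k)" by (rule glueing)
 have e: "{(barc U (bp (2 * i - 1)), barc U (bp (2 * j - 2))) | i j. (i, j) : chords (full n)} = g.fl"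
  unfolding chords_full g.fl_def by blast
 have c: "chords (full n) \<subseteq> {1..n} \<times> {1..n}" unfolding chords_full by blast
 show ?thesis unfolding full_closing_def tang_simps(5)[OF side(1)] closing_circles[OF side(1) c] e by (simp only: Un_commute)
qed

definition part :: "complex set => nat set set" where "part al = noncrossing_matching.blocks (mt al) n"

lemma part_NC: "part al : NC n"
proof -
 interpret g: gluing "mt al" n "side_arcs U" "side_arcs W" "rel U al" "rel W al" "%k. barc U (bp k)" "%k. barc W (bp k)" by (rule glueing)
 show ?thesis unfolding part_def by (rule g.blocks_NC)
qed

lemma state_part: "state_partition (tang U) (al Int R) = part al"
proof -
 interpret g: gluing "mt al" n "side_arcs U" "side_arcs W" "rel U al" "rel W al" "%k. barc U (bp k)" "%k. barc W (bp k)" by (rule glueing)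
 let ?F = "eqcl (rel U al Un g.fl)"
 have iff: "(\<exists>z\<in>circles (full_closing (tang U)) (al Int R). a_arc (tang U) r : z & a_arc (tang U) s : z) \<longleftrightarrow> (r, s) : eqcl g.G"
  if rs: "r : {1..n}" "s : {1..n}" for r s
 proof -
  note t = tang_simps(6)[OF side(1)]
  have lt: "2 * r - 2 < 2 * n" "2 * s - 2 < 2 * n" using rs by auto
  have "(\<exists>z\<in>side_arcs U // ?F. barc U (bp (2 * r - 2)) : z & barc U (bp (2 * s - 2)) : z) \<longleftrightarrow>
    (barc U (bp (2 * r - 2)), barc U (bp (2 * s - 2))) : ?F"
  proof
   assume "\<exists>z\<in>side_arcs U // ?F. barc U (bp (2 * r - 2)) : z & barc U (bp (2 * s - 2)) : z"
   then obtain z where z: "z : side_arcs U // ?F" "barc U (bp (2 * r - 2)) : z" "barc U (bp (2 * s - 2)) : z" by blast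
   show "(barc U (bp (2 * r - 2)), barc U (bp (2 * s - 2))) : ?F" using z(3) quotient_class_mem[OF z(1,2)] by blast
  next
   assume h: "(barc U (bp (2 * r - 2)), barc U (bp (2 * s - 2))) : ?F"
   show "\<exists>z\<in>side_arcs U // ?F. barc U (bp (2 * r - 2)) : z & barc U (bp (2 * s - 2)) : z"
    by (rule bexI[of _ "?F `` {barc U (bp (2 * r - 2))}"]) (use h g.bU[OF lt(1)] in "simp_all add: quotientI")
  qed
  thus ?thesis unfolding full_circles t[OF rs(1)] t[OF rs(2)] g.full_G[OF rs] .
 qed
 have "{(r, s). r : {1..n} & s : {1..n} &
    (\<exists>z\<in>circles (full_closing (tang U)) (al Int R). a_arc (tang U) r : z & a_arc (tang U) s : z)} =
   {(r, s). r : {1..n} & s : {1..n} & (r, s) : eqcl g.G}" using iff by blast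
 hence "state_partition (tang U) (al Int R) = {1..n} // {(r, s). r : {1..n} & s : {1..n} & (r, s) : eqcl g.G}"
  unfolding state_partition_def tang_simps(5)[OF side(1)] by simp
 also have "\<dots> = {1..n} // eqcl g.G"
 proof -
  have "{(r, s). r : {1..n} & s : {1..n} & (r, s) : eqcl g.G} `` {r} = eqcl g.G `` {r}" if "r : {1..n}" for r
   using eqcl_closed[OF g.G_sub _ that] that by blast
  thus ?thesis unfolding quotient_def by simp
 qed
 finally show ?thesis unfolding part_def g.blocks_def .
qed

lemma inner_eq: "inner_circles (tang U) (al Int R) = {Z : FC al. Z Int side_arcs W = {}}"
proof -
 interpret g: gluing "mt al" n "side_arcs U" "side_arcs W" "rel U al" "rel W al" "%k. barc U (bp k)" "%k. barc W (bp k)" by (rule glueing)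
 have "(\<forall>r\<in>{1..n}. a_arc (tang U) r ~: z & b_arc (tang U) r ~: z) \<longleftrightarrow> z Int (%k. barc U (bp k)) ` {..<2 * n} = {}" for z
 proof -
  have "(\<forall>r\<in>{1..n}. a_arc (tang U) r ~: z & b_arc (tang U) r ~: z) \<longleftrightarrow>
    (\<forall>r\<in>{1..n}. barc U (bp (2 * r - 2)) ~: z & barc U (bp (2 * r - 1)) ~: z)"
   by (intro ball_cong refl) (simp only: tang_simps(6,7)[OF side(1)])
  also have "\<dots> \<longleftrightarrow> (\<forall>k<2 * n. barc U (bp k) ~: z)"
  proof
   assume h: "\<forall>r\<in>{1..n}. barc U (bp (2 * r - 2)) ~: z & barc U (bp (2 * r - 1)) ~: z"
   show "\<forall>k<2 * n. barc U (bp k) ~: z"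
   proof (intro allI impI)
    fix k assume k: "k < 2 * n"
    have r: "k div 2 + 1 : {1..n}" using k by auto
    have "k = 2 * (k div 2 + 1) - 2 \<or> k = 2 * (k div 2 + 1) - 1" by presburger
    thus "barc U (bp k) ~: z" using bspec[OF h r] by metis
   qed
  next
   assume h: "\<forall>k<2 * n. barc U (bp k) ~: z"
   show "\<forall>r\<in>{1..n}. barc U (bp (2 * r - 2)) ~: z & barc U (bp (2 * r - 1)) ~: z"
    by (intro ballI conjI; rule h[rule_format]) auto
  qed
  finally show ?thesis by blast
 qed
 hence "inner_circles (tang U) (al Int R) = {Z : side_arcs U // eqcl (rel U al Un g.fl). Z Int (%k. barc U (bp k)) ` {..<2 * n} = {}}"
  unfolding inner_circles_def full_circles tang_simps(5)[OF side(1)] by simp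
 thus ?thesis unfolding g.inner_full g.inner_fine FC_fcl .
qed

text \<open>The chords of the partition reconnect W as the strands in U do, so the circles of the
  closure are the nonempty traces on W of the circles of L.\<close>

lemma outer_eq: "circles (closing (tang W) (part al)) (al Int R') = {Z Int side_arcs W | Z. Z : FC al} - {{}}"
proof -
 interpret g: gluing "mt al" n "side_arcs U" "side_arcs W" "rel U al" "rel W al" "%k. barc U (bp k)" "%k. barc W (bp k)" by (rule glueing)
 have A: "chords (part al) \<subseteq> {1..n} \<times> {1..n}" unfolding part_def g.chords_blocks by (rule g.G_sub)
 show ?thesis unfolding closing_circles[OF side(2) A] unfolding part_def g.chord_joins g.circles_W FC_fcl ..
qed

text \<open>A circle can be recovered from its part in \<open>W\<close> and the smoothing in \<open>U\<close> alone.\<close>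

definition lf :: "complex set => complex set set => complex set set" where
 "lf al w = w Un {g : side_arcs U. \<exists>k<2 * n. barc W (bp k) : w & (barc U (bp k), g) : eqcl (rel U al)}"

lemma lf: assumes "Z : FC al" "Z Int side_arcs W ~= {}" shows "lf al (Z Int side_arcs W) = Z"
proof -
 interpret g: gluing "mt al" n "side_arcs U" "side_arcs W" "rel U al" "rel W al" "%k. barc U (bp k)" "%k. barc W (bp k)" by (rule glueing)
 show ?thesis using g.lift assms unfolding lf_def g.lift_def FC_fcl by blast
qed

lemma FC_sub: "Z : FC al ==> Z \<subseteq> V"
proof -
 interpret g: gluing "mt al" n "side_arcs U" "side_arcs W" "rel U al" "rel W al" "%k. barc U (bp k)" "%k. barc W (bp k)" by (rule glueing)
 show "Z : FC al ==> Z \<subseteq> V" unfolding FC_fcl split_arcs(1) by (rule g.fine_sub)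
qed

lemma circles_sigma: "circles (diagram_of L) al = components (trace L - CR) // eqcl (co.srel CR (sigma al))"
 unfolding circles_diagram_of by (simp add: sigma_def[abs_def])

lemma kap_class:
 assumes f: "f : V"
 shows "eqcl (co.srel CR (sigma al)) `` {kap f} = kap ` (eqcl (srel CR (sigma al) Un jrel) `` {f})"
proof -
 let ?c = "eqcl (co.srel CR (sigma al))" and ?f = "eqcl (srel CR (sigma al) Un jrel)"
 have inF: "?f `` {f} : FC al" unfolding FC_def using f by (rule quotientI)
 have "?c `` {kap f} \<subseteq> kap ` (?f `` {f})"
 proof
  fix e assume "e : ?c `` {kap f}"
  hence e: "(kap f, e) : ?c" by simp
  have "e : components (trace L - CR)"
   by (rule eqcl_closed[OF co.srel_components[OF subset_refl] e kap(1)[OF f]])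
  then obtain g where g: "g : V" "kap g = e" by (rule kap_surj)
  have "(f, g) : ?f" using kap_eqcl[OF f g(1)] e g(2) by blast
  thus "e : kap ` (?f `` {f})" using g(2) by blast
 qed
 moreover have "kap ` (?f `` {f}) \<subseteq> ?c `` {kap f}"
 proof
  fix e assume "e : kap ` (?f `` {f})"
  then obtain g where g: "(f, g) : ?f" "e = kap g" by blast
  have "g : V" using FC_sub[OF inF] g(1) by blast
  thus "e : ?c `` {kap f}" using kap_eqcl[OF f] g by blast
 qed
 ultimately show ?thesis by blast
qed

lemma circles_FC: "circles (diagram_of L) al = (%Z. kap ` Z) ` FC al"
proof (intro equalityI subsetI)
 fix z assume "z : circles (diagram_of L) al"
 then obtain e where e: "e : components (trace L - CR)" "z = eqcl (co.srel CR (sigma al)) `` {e}"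
  unfolding circles_sigma by (auto simp: quotient_def)
 obtain f where f: "f : V" "kap f = e" by (rule kap_surj[OF e(1)])
 show "z : (%Z. kap ` Z) ` FC al" unfolding e(2) f(2)[symmetric] kap_class[OF f(1)] FC_def using f(1) by (intro imageI quotientI)
next
 fix z assume "z : (%Z. kap ` Z) ` FC al"
 then obtain f where f: "f : V" "z = kap ` (eqcl (srel CR (sigma al) Un jrel) `` {f})" by (auto simp: FC_def quotient_def)
 show "z : circles (diagram_of L) al" unfolding f(2) kap_class[OF f(1), symmetric] circles_sigma using kap(1)[OF f(1)] by (rule quotientI)
qed

lemma kap_mem: assumes Z: "Z : FC al" and g: "g : V" "kap g : kap ` Z" shows "g : Z"
proof -
 obtain f where f: "f : Z" "kap g = kap f" using g(2) by blast
 have fV: "f : V" using FC_sub[OF Z] f(1) by blast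
 have "(f, g) : eqcl jrel" using kap_eq_imp[OF fV g(1)] f(2) by simp
 hence "(f, g) : eqcl (srel CR (sigma al) Un jrel)" using eqcl_mono[of jrel] by blast
 thus ?thesis using quotient_class_mem[OF Z[unfolded FC_def] f(1)] by blast
qed

text \<open>Two states are allowed because the circles at both ends of an arrow have to be told
  apart.\<close>

lemma kap_image_inj:
 assumes "Z : FC al" "Z' : FC bet" "kap ` Z = kap ` Z'" shows "Z = Z'"
proof -
 have sub: "Z \<subseteq> Z'" if "Z : FC al" "Z' : FC bet" "kap ` Z \<subseteq> kap ` Z'" for Z Z' al bet
 proof
  fix f assume f: "f : Z"
  show "f : Z'" by (rule kap_mem[OF that(2) subsetD[OF FC_sub[OF that(1)] f] subsetD[OF that(3) imageI[OF f]]])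
 qed
 show ?thesis by (intro equalityI sub[OF assms(1,2)] sub[OF assms(2,1)]) (simp_all add: assms(3))
qed

text \<open>No arc of an inner circle ends on C, so each is already an arc of L; the circle is
  literally the same set in L and in the tangle.\<close>

lemma kap_inner:
 assumes Z: "Z : FC al" "Z Int side_arcs W = {}" shows "kap ` Z = Z"
proof -
 interpret g: gluing "mt al" n "side_arcs U" "side_arcs W" "rel U al" "rel W al" "%k. barc U (bp k)" "%k. barc W (bp k)" by (rule glueing)
 have "Z : g.inner" using Z unfolding g.inner_fine FC_fcl by blast
 hence no: "Z Int (%k. barc U (bp k)) ` {..<2 * n} = {}" unfolding g.inner_def by blast
 have "kap f = f" if f: "f : Z" for f
 proof (rule kap_isolated)
  show fV: "f : V" using FC_sub[OF Z(1)] f by blast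
  fix x b assume x: "x : bpos"
  obtain k where k: "k < 2 * n" "x = bp k" by (rule bpE[OF x])
  have "f : side_arcs U" using fV f Z(2) unfolding split_arcs(1) by blast
  hence fU: "f \<subseteq> U" by (simp add: side_arcs_def)
  show "f ~= end_arc x b"
  proof
   assume "f = end_arc x b"
   hence "f = barc U x" using barc(3)[OF x side(1), of b] fU by simp
   thus False using no f k by blast
  qed
 qed
 thus ?thesis by simp
qed

text \<open>\<open>split_gen\<close> identifies circles by their intersection with the open disc.
  Arcs in U and points on C lie outside it, so this intersection is the union of the fine arcs in
  W.\<close>

lemma kap_region: assumes Z: "Z : FC al" shows "\<Union>(kap ` Z) Int (R' - R) = \<Union>(Z Int side_arcs W)"
proof -
 have RW: "R' - R = W" using side(3) sides(4)[OF side(2)] by blast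
 show ?thesis unfolding RW
 proof (intro equalityI subsetI)
  fix p assume "p : \<Union>(kap ` Z) Int W"
  then obtain f where f: "f : Z" "p : kap f" "p : W" by blast
  have fV: "f : V" using FC_sub[OF Z] f(1) by blast
  obtain g where g: "g : V" "(f, g) : eqcl jrel" "p : closure g" using kap_sub_closures[OF fV] f(2) by blast
  have "(f, g) : eqcl (srel CR (sigma al) Un jrel)" using g(2) eqcl_mono[of jrel] by blast
  hence gZ: "g : Z" using quotient_class_mem[OF Z[unfolded FC_def] f(1)] by blast
  have "p : trace L - CR" using f(2) kap(1)[OF fV] in_components_subset by blast
  hence "p : trace L - MM" using f(3) sides(4)[OF side(2)] by (auto simp: MM_def)
  then obtain e where e: "e : V" "p : e" using Union_components[of "trace L - MM"] by blast
  have "e = g" using closure_Int_arc[OF e(1) g(1)] e(2) g(3) by blast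
  hence "g \<subseteq> W" using e f(3) arc_side(1)[OF g(1)] UW side(3) by (auto simp: doubleton_eq_iff)
  thus "p : \<Union>(Z Int side_arcs W)" using gZ g(1) e \<open>e = g\<close> by (auto simp: side_arcs_def)
 next
  fix p assume "p : \<Union>(Z Int side_arcs W)"
  then obtain g where g: "g : Z" "g : V" "g \<subseteq> W" "p : g" by (auto simp: side_arcs_def)
  thus "p : \<Union>(kap ` Z) Int W" using kap(2)[OF g(2)] by blast
 qed
qed

text \<open>The circle of L with the given part in W. The state enters only through its part in U,
  so both ends of an arrow at a crossing in W share the same map.\<close>

definition tau :: "complex set => complex set set => complex set set" where "tau al w = kap ` lf al w"

lemma tau_cong: "al Int R = bet Int R ==> tau al = tau bet"
 using rel_cong[of al U bet] by (simp add: tau_def[abs_def] lf_def)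

lemma part_cong: "al Int R = bet Int R ==> part al = part bet"
 using state_part by metis

abbreviation "inn al \<equiv> inner_circles (tang U) (al Int R)"
abbreviation "out al \<equiv> circles (closing (tang W) (part al)) (al Int R')"

lemma outE: assumes "w : out al" obtains Z where "Z : FC al" "w = Z Int side_arcs W" "w ~= {}" "tau al w = kap ` Z"
 using assms lf unfolding outer_eq tau_def by blast

lemma circles_split: "circles (diagram_of L) al = inn al Un tau al ` out al"
proof (intro equalityI subsetI)
 fix z assume "z : circles (diagram_of L) al"
 then obtain Z where Z: "Z : FC al" "z = kap ` Z" unfolding circles_FC by blast
 show "z : inn al Un tau al ` out al"
 proof (cases "Z Int side_arcs W = {}")
  case True thus ?thesis using Z kap_inner[OF Z(1) True] unfolding inner_eq by simp
 next
  case False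
  hence "Z Int side_arcs W : out al" unfolding outer_eq using Z(1) by blast
  moreover have "tau al (Z Int side_arcs W) = z" unfolding tau_def lf[OF Z(1) False] Z(2) ..
  ultimately show ?thesis by blast
 qed
next
 fix z assume "z : inn al Un tau al ` out al"
 thus "z : circles (diagram_of L) al"
 proof
  assume "z : inn al"
  hence z: "z : FC al" "z Int side_arcs W = {}" unfolding inner_eq by auto
  thus ?thesis unfolding circles_FC using kap_inner[OF z] by (metis imageI)
 next
  assume "z : tau al ` out al"
  then obtain w where w: "w : out al" "z = tau al w" by blast
  obtain Z where "Z : FC al" "tau al w = kap ` Z" by (rule outE[OF w(1)])
  thus ?thesis unfolding circles_FC w(2) by blast
 qed
qed

lemma tau_inj: assumes ab: "al Int R = bet Int R" shows "inj_on (tau al) (out al Un out bet)"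
proof -
 have ex: "\<exists>ga Z. Z : FC ga & w = Z Int side_arcs W & tau al w = kap ` Z" if "w : out al Un out bet" for w
  using that
 proof
  assume "w : out al" thus ?thesis by (rule outE) blast
 next
  assume "w : out bet" thus ?thesis unfolding tau_cong[OF ab] by (rule outE) blast
 qed
 show ?thesis
 proof (rule inj_onI)
  fix w w' assume w: "w : out al Un out bet" "w' : out al Un out bet" "tau al w = tau al w'"
  obtain ga Z where Z: "Z : FC ga" "w = Z Int side_arcs W" "tau al w = kap ` Z" using ex[OF w(1)] by blast
  obtain ga' Z' where Z': "Z' : FC ga'" "w' = Z' Int side_arcs W" "tau al w' = kap ` Z'" using ex[OF w(2)] by blast
  have "Z = Z'" using kap_image_inj[OF Z(1) Z'(1)] Z(3) Z'(3) w(3) by simp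
  thus "w = w'" using Z(2) Z'(2) by simp
 qed
qed

lemma inner_tau_disjoint: assumes ab: "al Int R = bet Int R" shows "inn al Int tau al ` (out al Un out bet) = {}"
proof -
 have "z ~: inn ga" if z: "z : tau ga ` out ga" for z ga
 proof
  assume "z : inn ga"
  hence i: "z : FC ga" "z Int side_arcs W = {}" unfolding inner_eq by auto
  obtain w where w: "w : out ga" "z = tau ga w" using z by blast
  obtain Z where Z: "Z : FC ga" "w = Z Int side_arcs W" "w ~= {}" "tau ga w = kap ` Z" by (rule outE[OF w(1)])
  have "Z = z" using kap_image_inj[OF Z(1) i(1)] kap_inner[OF i] Z(4) w(2) by simp
  thus False using i(2) Z(2,3) by simp
 qed
 hence "inn al Int tau al ` out al = {}" "inn bet Int tau bet ` out bet = {}" by blast+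
 moreover from this have "inn al Int tau al ` out bet = {}" unfolding ab tau_cong[OF ab] by blast
 ultimately show ?thesis unfolding image_Un Int_Un_distrib by blast
qed

text \<open>Two circles of L with the same nonempty part in W have a fine arc in common and hence
  coincide.\<close>

lemma the_tau: assumes w: "w : out al"
 shows "(THE z. z : circles (diagram_of L) al & \<Union>z Int (R' - R) = \<Union>w) = tau al w"
proof (rule the_equality)
 obtain Z where Z: "Z : FC al" "w = Z Int side_arcs W" "w ~= {}" "tau al w = kap ` Z" by (rule outE[OF w])
 show "tau al w : circles (diagram_of L) al & \<Union>(tau al w) Int (R' - R) = \<Union>w"
 proof
  show "tau al w : circles (diagram_of L) al" unfolding Z(4) circles_FC by (rule imageI[OF Z(1)])
  show "\<Union>(tau al w) Int (R' - R) = \<Union>w" unfolding Z(4) kap_region[OF Z(1)] by (simp only: Z(2))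
 qed
 fix z assume z: "z : circles (diagram_of L) al & \<Union>z Int (R' - R) = \<Union>w"
 then obtain Z' where Z': "Z' : FC al" "z = kap ` Z'" unfolding circles_FC by blast
 have u: "\<Union>(Z' Int side_arcs W) = \<Union>(Z Int side_arcs W)" using z kap_region[OF Z'(1)] unfolding Z'(2) Z(2) by simp
 obtain f where f: "f : Z" "f : side_arcs W" using Z(2,3) by blast
 have fV: "f : V" using f(2) by (simp add: side_arcs_def)
 then obtain q where q: "q : f" using in_components_nonempty by blast
 hence "q : \<Union>(Z' Int side_arcs W)" using u f by blast
 then obtain g where g: "g : Z'" "g : side_arcs W" "q : g" by blast
 have "g : V" using g(2) by (simp add: side_arcs_def)
 hence "g = f" using components_nonoverlap[OF fV] q g(3) by blast
 hence "Z = Z'" using quotient_disjoint[OF Z(1)[unfolded FC_def] Z'(1)[unfolded FC_def]] f(1) g(1) by blast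
 thus "z = tau al w" using Z'(2) Z(4) by simp
qed

end

section \<open>Renaming circles, and comparing orders of crossings\<close>

lemma edge_coeff_cong:
 assumes "!!z. z : S ==> ep z = ep' z" "!!z. z : S' ==> et z = et' z"
 shows "edge_coeff S ep S' et = edge_coeff S ep' S' et'"
proof -
 have a: "(\<exists>z\<in>S Int S'. ep z ~= et z) \<longleftrightarrow> (\<exists>z\<in>S Int S'. ep' z ~= et' z)" using assms by auto
 have b: "(z1 ~= z2 & S - S' = {z1, z2} & S' - S = {z} & k = mult_coeff (ep z1) (ep z2) (et z)) \<longleftrightarrow>
   (z1 ~= z2 & S - S' = {z1, z2} & S' - S = {z} & k = mult_coeff (ep' z1) (ep' z2) (et' z))" for z1 z2 z k
 proof -
  have "S - S' = {z1, z2} ==> z1 : S & z2 : S" "S' - S = {z} ==> z : S'" by blast+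
  thus ?thesis using assms by metis
 qed
 have c: "(z1 ~= z2 & S - S' = {z} & S' - S = {z1, z2} & k = comult_coeff (ep z) (et z1) (et z2)) \<longleftrightarrow>
   (z1 ~= z2 & S - S' = {z} & S' - S = {z1, z2} & k = comult_coeff (ep' z) (et' z1) (et' z2))" for z1 z2 z k
 proof -
  have "S' - S = {z1, z2} ==> z1 : S' & z2 : S'" "S - S' = {z} ==> z : S" by blast+
  thus ?thesis using assms by metis
 qed
 show ?thesis unfolding edge_coeff_def a b c ..
qed

lemma pair_single:
 "(\<exists>z1 z2 z. z1 ~= z2 & X = {z1, z2} & Y = {z}) \<longleftrightarrow> card X = 2 & card Y = 1"
 "(\<exists>z z1 z2. z1 ~= z2 & X = {z} & Y = {z1, z2}) \<longleftrightarrow> card X = 1 & card Y = 2"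
 unfolding One_nat_def card_2_iff card_1_singleton_iff by metis+

text \<open>An injective renaming preserves whether an edge is a merge, a split or neither. The
  spectators in I only contribute the condition that their labels agree.\<close>

lemma edge_coeff_image:
 assumes inj: "inj_on ta (C Un C')" and dis: "I Int ta ` (C Un C') = {}"
 shows "edge_coeff (I Un ta ` C) ep (I Un ta ` C') et =
  (if agree I ep et then edge_coeff C (%w. ep (ta w)) C' (%w. et (ta w)) else 0)"
proof -
 let ?S = "I Un ta ` C" and ?S' = "I Un ta ` C'"
 have im: "ta ` (C Int C') = ta ` C Int ta ` C'" "ta ` (C - C') = ta ` C - ta ` C'" "ta ` (C' - C) = ta ` C' - ta ` C"
  using inj by (auto dest: inj_onD)
 have d: "?S - ?S' = ta ` (C - C')" "?S' - ?S = ta ` (C' - C)" "?S Int ?S' = I Un ta ` (C Int C')"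
  unfolding im using dis by blast+
 have ag: "(\<exists>z\<in>?S Int ?S'. ep z ~= et z) \<longleftrightarrow> ~ agree I ep et \<or> (\<exists>w\<in>C Int C'. ep (ta w) ~= et (ta w))"
  unfolding d(3) agree_def by blast
 have ij: "inj_on ta (C - C')" "inj_on ta (C' - C)" using inj by (auto intro: inj_on_subset)
 have cc: "card (?S - ?S') = card (C - C')" "card (?S' - ?S) = card (C' - C)"
  unfolding d using card_image[OF ij(1)] card_image[OF ij(2)] by simp_all
 consider (M) x y w where "x ~= y" "C - C' = {x, y}" "C' - C = {w}" | (S) x y w where "x ~= y" "C - C' = {w}" "C' - C = {x, y}"
  | (N) "~ (card (C - C') = 2 & card (C' - C) = 1)" "~ (card (C - C') = 1 & card (C' - C) = 2)"
  unfolding One_nat_def card_2_iff card_1_singleton_iff by metis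
 thus ?thesis
 proof cases
  case M
  define I' where "I' = C Int C'"
  have C: "C = I' Un {x, y}" "C' = I' Un {w}" "x ~: I'" "y ~: I'" "w ~: I'" "w ~= x" "w ~= y" using M unfolding I'_def by blast+
  define J where "J = I Un ta ` I'"
  have S: "?S = J Un {ta x, ta y}" "?S' = J Un {ta w}" unfolding J_def C(1,2) by auto
  have U: "C Un C' = I' Un {x, y, w}" unfolding C(1,2) by blast
  have ninj: "ta a ~: J" if "a : {x, y, w}" for a
  proof
   assume "ta a : J"
   then consider "ta a : I" | b where "b : I'" "ta a = ta b" unfolding J_def by blast
   thus False
   proof cases
    case 1 thus False using dis that U by blast
   next
    case 2
    hence "a = b" using inj_on_eq_iff[OF inj, of a b] that unfolding U by blast
    thus False using 2(1) that C(3-5) by blast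
   qed
  qed
  have ne: "ta x ~= ta y" "ta w ~= ta x" "ta w ~= ta y"
   using inj_on_eq_iff[OF inj, of x y] inj_on_eq_iff[OF inj, of w x] inj_on_eq_iff[OF inj, of w y] M(1) C(6,7) unfolding U by simp_all
  have "edge_coeff ?S ep ?S' et = (if agree J ep et then mult_coeff (ep (ta x)) (ep (ta y)) (et (ta w)) else 0)"
   unfolding S by (rule edge_coeff_merge[of "ta x" "ta y" J "ta w"]) (use ne ninj in simp_all)
  moreover have "edge_coeff C (%w. ep (ta w)) C' (%w. et (ta w)) =
    (if agree I' (%w. ep (ta w)) (%w. et (ta w)) then mult_coeff (ep (ta x)) (ep (ta y)) (et (ta w)) else 0)"
   using edge_coeff_merge[OF M(1) C(3-7), of "%w. ep (ta w)" "%w. et (ta w)"] unfolding C(1,2)[symmetric] .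
  moreover have "agree J ep et \<longleftrightarrow> agree I ep et & agree I' (%w. ep (ta w)) (%w. et (ta w))" unfolding J_def agree_def by blast
  ultimately show ?thesis by simp
 next
  case S
  define I' where "I' = C Int C'"
  have C: "C' = I' Un {x, y}" "C = I' Un {w}" "x ~: I'" "y ~: I'" "w ~: I'" "w ~= x" "w ~= y" using S unfolding I'_def by blast+
  define J where "J = I Un ta ` I'"
  have SS: "?S' = J Un {ta x, ta y}" "?S = J Un {ta w}" unfolding J_def C(1,2) by auto
  have U: "C Un C' = I' Un {x, y, w}" unfolding C(1,2) by blast
  have ninj: "ta a ~: J" if "a : {x, y, w}" for a
  proof
   assume "ta a : J"
   then consider "ta a : I" | b where "b : I'" "ta a = ta b" unfolding J_def by blast
   thus False
   proof cases
    case 1 thus False using dis that U by blast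
   next
    case 2
    hence "a = b" using inj_on_eq_iff[OF inj, of a b] that unfolding U by blast
    thus False using 2(1) that C(3-5) by blast
   qed
  qed
  have ne: "ta x ~= ta y" "ta w ~= ta x" "ta w ~= ta y"
   using inj_on_eq_iff[OF inj, of x y] inj_on_eq_iff[OF inj, of w x] inj_on_eq_iff[OF inj, of w y] S(1) C(6,7) unfolding U by simp_all
  have "edge_coeff ?S ep ?S' et = (if agree J ep et then comult_coeff (ep (ta w)) (et (ta x)) (et (ta y)) else 0)"
   unfolding SS by (rule edge_coeff_split[of "ta x" "ta y" J "ta w"]) (use ne ninj in simp_all)
  moreover have "edge_coeff C (%w. ep (ta w)) C' (%w. et (ta w)) =
    (if agree I' (%w. ep (ta w)) (%w. et (ta w)) then comult_coeff (ep (ta w)) (et (ta x)) (et (ta y)) else 0)"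
   using edge_coeff_split[OF S(1) C(3-7), of "%w. ep (ta w)" "%w. et (ta w)"] unfolding C(1,2)[symmetric] .
  moreover have "agree J ep et \<longleftrightarrow> agree I ep et & agree I' (%w. ep (ta w)) (%w. et (ta w))" unfolding J_def agree_def by blast
  ultimately show ?thesis by simp
 next
  case N
  have n1: "~ (\<exists>z1 z2 z. z1 ~= z2 & C - C' = {z1, z2} & C' - C = {z})" "~ (\<exists>z z1 z2. z1 ~= z2 & C - C' = {z} & C' - C = {z1, z2})"
   using N unfolding pair_single by simp_all
  have n2: "~ (\<exists>z1 z2 z. z1 ~= z2 & ?S - ?S' = {z1, z2} & ?S' - ?S = {z})" "~ (\<exists>z z1 z2. z1 ~= z2 & ?S - ?S' = {z} & ?S' - ?S = {z1, z2})"
   using N cc unfolding pair_single by simp_all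
  have "edge_coeff ?S ep ?S' et = 0" unfolding edge_coeff_def using n2 by (simp only: if_False if_cancel)
  moreover have "edge_coeff C (%w. ep (ta w)) C' (%w. et (ta w)) = 0" unfolding edge_coeff_def using n1 by (simp only: if_False if_cancel)
  ultimately show ?thesis by simp
 qed
qed

text \<open>The sign of the permutation between two total orders on a state; it intertwines the signs of the two cubes.\<close>

definition disorder :: "'c rel => 'c rel => 'c set => rat" where
 "disorder r r' al = (- 1) ^ card {(b, c). b : al & c : al & b ~= c & (b, c) : r & (b, c) ~: r'}"

lemma disorder_square: "disorder r r' al * disorder r r' al = 1"
 by (simp add: disorder_def power_mult_distrib[symmetric])

text \<open>The new inversions are those of c with A1 and A2, the crossings that change sides of c
  between the two orders. Those in A3 precede c in both and contribute equally to both
  weights.\<close>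

lemma disorder_insert:
 assumes fin: "finite al" and c: "c ~: al"
  and tot: "!!b. b : al ==> (b, c) : r \<longleftrightarrow> (c, b) ~: r" "!!b. b : al ==> (b, c) : r' \<longleftrightarrow> (c, b) ~: r'"
 shows "weight r al c = disorder r r' (insert c al) * disorder r r' al * weight r' al c"
proof -
 define A1 where "A1 = {b : al. (b, c) : r & (b, c) ~: r'}"
 define A2 where "A2 = {b : al. (b, c) ~: r & (b, c) : r'}"
 define A3 where "A3 = {b : al. (b, c) : r & (b, c) : r'}"
 define S where "S = {(b, c). b : al & c : al & b ~= c & (b, c) : r & (b, c) ~: r'}"
 have f: "finite A1" "finite A2" "finite A3" "finite S"
  unfolding A1_def A2_def A3_def S_def using fin by (auto intro: finite_subset[of _ "al \<times> al"])
 have s: "{(b, c'). b : insert c al & c' : insert c al & b ~= c' & (b, c') : r & (b, c') ~: r'} =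
   S Un ((%b. (b, c)) ` A1 Un Pair c ` A2)"
  unfolding S_def A1_def A2_def using c tot by auto
 have i: "card ((%b. (b, c)) ` A1) = card A1" "card (Pair c ` A2) = card A2" by (auto intro!: card_image inj_onI)
 have "card (S Un ((%b. (b, c)) ` A1 Un Pair c ` A2)) = card S + (card A1 + card A2)"
  unfolding i[symmetric] using f c by (subst card_Un_disjoint; (subst card_Un_disjoint)?) (auto simp: S_def A1_def A2_def)
 hence d: "disorder r r' (insert c al) = (- 1) ^ card S * ((- 1) ^ card A1 * (- 1) ^ card A2)"
  unfolding disorder_def s by (simp add: power_add)
 have d0: "disorder r r' al = (- 1) ^ card S" unfolding disorder_def S_def ..
 have "{b : al. (b, c) : r} = A1 Un A3" "{b : al. (b, c) : r'} = A2 Un A3" unfolding A1_def A2_def A3_def by auto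
 moreover have "card (A1 Un A3) = card A1 + card A3" "card (A2 Un A3) = card A2 + card A3"
  using f by (auto intro!: card_Un_disjoint simp: A1_def A2_def A3_def)
 ultimately have w: "weight r al c = (- 1) ^ card A1 * (- 1) ^ card A3" "weight r' al c = (- 1) ^ card A2 * (- 1) ^ card A3"
  unfolding weight_def by (simp_all add: power_add)
 have sq: "((- 1) ^ k * (- 1) ^ k :: rat) = 1" for k :: nat by (simp add: power_mult_distrib[symmetric])
 have "disorder r r' (insert c al) * disorder r r' al * weight r' al c =
   ((- 1) ^ card A1 * (- 1) ^ card A3) * ((- 1) ^ card S * (- 1) ^ card S) * ((- 1) ^ card A2 * (- 1) ^ card A2)"
  unfolding d d0 w by (simp only: mult_ac)
 thus ?thesis unfolding w sq by simp
qed

section \<open>Filtered and bigraded complexes\<close>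

abbreviation lin :: "(('a => rat) => ('b => rat)) => bool" where
 "lin f \<equiv> Vector_Spaces.linear fscale fscale f"

lemma linI: "(!!x y. f (x + y) = f x + f y) ==> (!!c x. f (fscale c x) = fscale c (f x)) ==> lin f"
 by (simp add: Vector_Spaces.linear_iff fun_vs.vector_space_axioms)

lemma linD:
 assumes "lin f"
 shows "f (x + y) = f x + f y" "f (fscale c x) = fscale c (f x)" "f 0 = 0" "f (x - y) = f x - f y" "f (- x) = - f x"
proof -
 show a: "f (x + y) = f x + f y" "f (fscale c x) = fscale c (f x)" for x y c
  using assms by (simp_all add: Vector_Spaces.linear_iff)
 have z: "fscale 0 y = 0" for y :: "'c => rat" by (auto simp: fscale_def fun_eq_iff)
 show "f 0 = 0" using a(2)[of 0 0] by (simp only: z)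
 have m: "fscale (-1) y = - y" for y :: "'c => rat" by (auto simp: fscale_def fun_eq_iff)
 show n: "f (- x) = - f x" for x using a(2)[of "-1" x] by (simp only: m)
 show "f (x - y) = f x - f y" using a(1)[of x "- y"] n[of y] by simp
qed

lemma lin_id: "lin (%x. x)" by (rule linI) auto

lemma lin_compose: "lin f ==> lin g ==> lin (%x. g (f x))"
 by (rule linI) (simp_all only: linD(1)[of f] linD(1)[of g] linD(2)[of f] linD(2)[of g])

lemma subspaceI:
 "0 : S ==> (!!x y. x : S ==> y : S ==> x + y : S) ==> (!!c x. x : S ==> fscale c x : S) ==> fun_vs.subspace S"
 by (simp add: fun_vs.subspace_def)

lemma subspaceD:
 assumes "fun_vs.subspace S"
 shows "0 : S" "x : S ==> y : S ==> x + y : S" "x : S ==> fscale c x : S"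
  "x : S ==> y : S ==> x - y : S" "x : S ==> - x : S"
 using fun_vs.subspace_0[OF assms] fun_vs.subspace_add[OF assms] fun_vs.subspace_scale[OF assms]
  fun_vs.subspace_diff[OF assms] fun_vs.subspace_neg[OF assms] by simp_all

lemma subspace_Z: "lin d ==> fun_vs.subspace A ==> fun_vs.subspace B ==> fun_vs.subspace {x : A. d x : B}"
proof (intro subspaceI)
 assume d: "lin d" and A: "fun_vs.subspace A" and B: "fun_vs.subspace B"
 show "0 : {x : A. d x : B}" by (simp only: mem_Collect_eq linD(3)[OF d] subspaceD(1)[OF A] subspaceD(1)[OF B])
 show "x + y : {x : A. d x : B}" if "x : {x : A. d x : B}" "y : {x : A. d x : B}" for x y
  using that subspaceD(2)[OF A, of x y] subspaceD(2)[OF B, of "d x" "d y"] by (simp only: mem_Collect_eq linD(1)[OF d])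
 show "fscale c x : {x : A. d x : B}" if "x : {x : A. d x : B}" for c x
  using that subspaceD(3)[OF A, of x c] subspaceD(3)[OF B, of "d x" c] by (simp only: mem_Collect_eq linD(2)[OF d])
qed

lemma subspace_image: "lin d ==> fun_vs.subspace A ==> fun_vs.subspace (d ` A)"
proof (intro subspaceI)
 assume d: "lin d" and A: "fun_vs.subspace A"
 show "0 : d ` A" using linD(3)[OF d] subspaceD(1)[OF A] by (metis imageI)
 show "x + y : d ` A" if xy: "x : d ` A" "y : d ` A" for x y
 proof -
  obtain a b where "a : A" "b : A" "x = d a" "y = d b" using xy by blast
  thus ?thesis using linD(1)[OF d, of a b] subspaceD(2)[OF A, of a b] by (metis imageI)
 qed
 show "fscale c x : d ` A" if x: "x : d ` A" for c x
 proof -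
  obtain a where "a : A" "x = d a" using x by blast
  thus ?thesis using linD(2)[OF d, of c a] subspaceD(3)[OF A, of a c] by (metis imageI)
 qed
qed

lemma subspace_plus:
 assumes A: "fun_vs.subspace A" and B: "fun_vs.subspace B"
 shows "fun_vs.subspace {x + y | x y. x : A & y : B}"
proof (intro subspaceI)
 let ?S = "{x + y | x y. x : A & y : B}"
 have "0 + 0 : ?S" using subspaceD(1)[OF A] subspaceD(1)[OF B] by blast
 thus "0 : ?S" by (simp only: add_0)
 show "u + v : ?S" if uv: "u : ?S" "v : ?S" for u v
 proof -
  obtain x y x' y' where *: "u = x + y" "v = x' + y'" "x : A" "y : B" "x' : A" "y' : B" using uv by blast
  hence "u + v = (x + x') + (y + y')" by (simp add: algebra_simps)
  thus ?thesis using * subspaceD(2)[OF A] subspaceD(2)[OF B] by blast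
 qed
 show "fscale c u : ?S" if u: "u : ?S" for c u
 proof -
  obtain x y where *: "u = x + y" "x : A" "y : B" using u by blast
  hence "fscale c u = fscale c x + fscale c y" by (simp add: fscale_def fun_eq_iff algebra_simps)
  thus ?thesis using * subspaceD(3)[OF A] subspaceD(3)[OF B] by blast
 qed
qed

lemma subq_isomorphicI:
 assumes "subquotient Q" "subquotient Q'" "lin f" "!!x. x : fst Q ==> f x : fst Q'" "!!x. x : snd Q ==> f x : snd Q'"
  "!!z. z : fst Q ==> f z : snd Q' ==> z : snd Q" "!!z'. z' : fst Q' ==> \<exists>z\<in>fst Q. z' - f z : snd Q'"
 shows "Q \<cong>\<^sub>\<rat> Q'"
proof -
 have "induces_iso f Q Q'" unfolding induces_iso_def induces_map_def using assms by blast
 thus ?thesis unfolding subq_isomorphic_def using assms by blast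
qed

lemma subq_isomorphic_trans:
 assumes "Q \<cong>\<^sub>\<rat> Q'" "Q' \<cong>\<^sub>\<rat> Q''" shows "Q \<cong>\<^sub>\<rat> Q''"
proof -
 obtain f g where f: "induces_iso f Q Q'" and g: "induces_iso g Q' Q''"
  and s: "subquotient Q" "subquotient Q'" "subquotient Q''" using assms unfolding subq_isomorphic_def by blast
 have l: "lin f" "lin g" using f g by (simp_all add: induces_iso_def induces_map_def)
 have F: "!!x. x : fst Q ==> f x : fst Q'" "!!x. x : snd Q ==> f x : snd Q'"
  "!!z. z : fst Q ==> f z : snd Q' ==> z : snd Q" "!!z'. z' : fst Q' ==> \<exists>z\<in>fst Q. z' - f z : snd Q'"
  using f unfolding induces_iso_def induces_map_def by blast+
 have G: "!!x. x : fst Q' ==> g x : fst Q''" "!!x. x : snd Q' ==> g x : snd Q''"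
  "!!z. z : fst Q' ==> g z : snd Q'' ==> z : snd Q'" "!!z'. z' : fst Q'' ==> \<exists>z\<in>fst Q'. z' - g z : snd Q''"
  using g unfolding induces_iso_def induces_map_def by blast+
 show ?thesis
 proof (rule subq_isomorphicI[OF s(1,3) lin_compose[OF l]])
  fix z' assume "z' : fst Q''"
  then obtain y where y: "y : fst Q'" "z' - g y : snd Q''" using G(4) by blast
  obtain x where x: "x : fst Q" "y - f x : snd Q'" using F(4)[OF y(1)] by blast
  have "z' - g (f x) = (z' - g y) + g (y - f x)" by (simp add: linD(4)[OF l(2)])
  moreover have "fun_vs.subspace (snd Q'')" using s by (simp add: subquotient_def)
  ultimately have "z' - g (f x) : snd Q''" using y(2) G(2)[OF x(2)] subspaceD(2) by metis
  thus "\<exists>z\<in>fst Q. z' - g (f z) : snd Q''" using x(1) by blast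
 qed (use F G in blast)+
qed

lemma subquotient_middle:
 assumes "lin f" "lin g" "subquotient P" "subquotient Q" "subquotient R"
  "!!x. x : fst P ==> f x : fst Q" "!!x. x : snd Q ==> g x : snd R" "!!x. x : fst P ==> g (f x) : snd R"
 shows "subquotient (middle_cohomology f g P Q R)"
proof -
 have s: "fun_vs.subspace (fst P)" "fun_vs.subspace (fst Q)" "fun_vs.subspace (snd Q)" "fun_vs.subspace (snd R)" "snd Q \<subseteq> fst Q"
  using assms by (auto simp: subquotient_def)
 have eq: "{f w + b | w b. w : fst P & b : snd Q} = {x + y | x y. x : f ` fst P & y : snd Q}" by blast
 have "{f w + b | w b. w : fst P & b : snd Q} \<subseteq> {z : fst Q. g z : snd R}"
 proof
  fix z assume "z : {f w + b | w b. w : fst P & b : snd Q}"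
  then obtain w b where *: "z = f w + b" "w : fst P" "b : snd Q" by blast
  have "z : fst Q" unfolding *(1) using assms(6) * s subspaceD(2)[OF s(2)] by blast
  moreover have "g z : snd R" unfolding *(1) linD(1)[OF assms(2)]
   using assms(7,8) * subspaceD(2)[OF s(4)] by blast
  ultimately show "z : {z : fst Q. g z : snd R}" by blast
 qed
 thus ?thesis unfolding subquotient_def middle_cohomology_def fst_conv snd_conv
  using s assms(1,2) by (intro conjI) (simp_all only: eq subspace_Z subspace_plus subspace_image)
qed

section \<open>The spectral sequence of a bounded filtration\<close>

text \<open>The filtration is decreasing, with n the total and j the internal degree. The bounds pa
  and pb are uniform in both, so the pages at a position become stationary for all j at
  once.\<close>

locale filtered_complex =
 fixes F :: "int => int => int => ('b => rat) set" and d :: "('b => rat) => ('b => rat)" and pa pb :: int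
 assumes sub: "fun_vs.subspace (F p n j)" and mono: "p <= p' ==> F p' n j \<subseteq> F p n j" and d: "lin d"
  and dF: "x : F p n j ==> d x : F p (n + 1) j" and dd: "x : F p n j ==> d (d x) = 0"
  and low: "p <= pa ==> F p n j = F pa n j" and high: "pb <= p ==> F p n j = {0}"
begin

text \<open>The usual approximate cycles, whose differential is r steps up, and approximate
  boundaries: cycles one step higher together with differentials from r - 1 steps below. Every page
  differential is induced by the same d.\<close>

definition "Z r p n j = {x : F p n j. d x : F (p + r) (n + 1) j}"
definition "Bd r p n j = {x + y | x y. x : Z (r - 1) (p + 1) n j & y : d ` Z (r - 1) (p - r + 1) (n - 1) j}"

definition pages :: "'b pages" where "pages r p q j = (Z (int r) p (p + q) j, Bd (int r) p (p + q) j)"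
definition page_maps :: "'b page_maps" where "page_maps r p q j = d"

definition H :: "int => int => 'b subq" where
 "H n j = ({x : F pa n j. d x = 0}, d ` F pa (n - 1) j)"

lemma ZD: "x : Z r p n j ==> x : F p n j" "x : Z r p n j ==> d x : F (p + r) (n + 1) j"
 by (auto simp: Z_def)

lemma subspace_Z': "fun_vs.subspace (Z r p n j)"
 unfolding Z_def by (intro subspace_Z d sub)

lemma subspace_Bd: "fun_vs.subspace (Bd r p n j)"
 unfolding Bd_def by (intro subspace_plus subspace_image d subspace_Z')

lemma mem_F: "x : F p' n j ==> p <= p' ==> x : F p n j"
 using mono by blast

lemma Bd_sub: "r \<ge> 1 ==> Bd r p n j \<subseteq> Z r p n j"
proof
 fix z assume r: "r \<ge> 1" and "z : Bd r p n j"
 then obtain x y where *: "z = x + d y" "x : Z (r - 1) (p + 1) n j" "y : Z (r - 1) (p - r + 1) (n - 1) j"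
  unfolding Bd_def by blast
 have x: "x : F p n j" "d x : F (p + r) (n + 1) j" using ZD[OF *(2)] mem_F by (auto intro: mem_F)
 have y: "d y : F p n j" "d (d y) = 0" using ZD[OF *(3)] dd by auto
 have "z : F p n j" using *(1) x(1) y(1) subspaceD(2)[OF sub] by blast
 moreover have "d z = d x" using *(1) y(2) linD(1)[OF d] by simp
 ultimately show "z : Z r p n j" using x(2) by (simp add: Z_def)
qed

lemma subquotient_pages: "r \<ge> 1 ==> subquotient (pages r p q j)"
 unfolding subquotient_def pages_def using subspace_Z' subspace_Bd Bd_sub[of "int r"] by auto

lemma d_page:
 assumes "z : Z r p n j" "r \<ge> 1"
 shows "d z : Z r' (p + r) (n + 1) j"
proof -
 have "d (d z) = 0" using ZD(1)[OF assms(1)] dd by blast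
 thus ?thesis using ZD(2)[OF assms(1)] subspaceD(1)[OF sub] by (simp add: Z_def)
qed

lemma BdI1: "x : Z (r - 1) (p + 1) n j ==> x : Bd r p n j"
proof -
 assume "x : Z (r - 1) (p + 1) n j"
 moreover have "0 : d ` Z (r - 1) (p - r + 1) (n - 1) j"
  using subspaceD(1)[OF subspace_image[OF d subspace_Z']] .
 moreover have "x = x + 0" by simp
 ultimately show ?thesis unfolding Bd_def by blast
qed

lemma BdI2: "y : Z (r - 1) (p - r + 1) (n - 1) j ==> d y : Bd r p n j"
proof -
 assume "y : Z (r - 1) (p - r + 1) (n - 1) j"
 moreover have "0 : Z (r - 1) (p + 1) n j" using subspaceD(1)[OF subspace_Z'] .
 moreover have "d y = 0 + d y" by simp
 ultimately show ?thesis unfolding Bd_def by blast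
qed

lemma BdE:
 assumes "z : Bd r p n j"
 obtains x y where "z = x + d y" "x : Z (r - 1) (p + 1) n j" "y : Z (r - 1) (p - r + 1) (n - 1) j"
 using assms unfolding Bd_def by blast

lemma BdE1:
 assumes "z : Bd (r + 1) p n j"
 obtains x y where "z = x + d y" "x : Z r (p + 1) n j" "y : Z r (p - r) (n - 1) j"
proof (rule BdE[OF assms])
 fix x y assume "z = x + d y" "x : Z (r + 1 - 1) (p + 1) n j" "y : Z (r + 1 - 1) (p - (r + 1) + 1) (n - 1) j"
 thus thesis using that[of x y] by simp
qed

lemma d_Bd:
 assumes "z : Bd r p n j" "r \<ge> 1" shows "d z : Bd r (p + r) (n + 1) j"
proof -
 obtain x y where *: "z = x + d y" "x : Z (r - 1) (p + 1) n j" "y : Z (r - 1) (p - r + 1) (n - 1) j"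
  using assms(1) by (rule BdE)
 have "d (d y) = 0" using ZD(1)[OF *(3)] dd by blast
 hence "d z = d x" using *(1) linD(1)[OF d] by simp
 moreover have "d x : Bd r (p + r) (n + 1) j" using *(2) by (intro BdI2) simp
 ultimately show ?thesis by simp
qed

text \<open>The identity induces the isomorphism of page r + 1 with the cohomology of page r, so
  only numerators and denominators have to be compared.\<close>

lemma spectral: "spectral_sequence pages page_maps"
 unfolding spectral_sequence_def
proof (intro allI impI conjI)
 fix r :: nat and p q j assume r: "2 <= r"
 let ?r = "int r"
 have r1: "?r \<ge> 1" "r \<ge> 1" using r by auto
 have nn: "p + ?r + (q - ?r + 1) = p + q + 1" "p - ?r + (q + ?r - 1) = p + q - 1" "p + 2 * ?r + (q - 2 * ?r + 2) = p + q + 2"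
  by auto
 show sq: "subquotient (pages r p q j)" for p q j using subquotient_pages r1 by blast
 have dfst: "d z : fst (pages r (p + ?r) (q - ?r + 1) j)" if "z : fst (pages r p q j)" for z p q
  using d_page[of z ?r p "p + q" j ?r] that r1 by (simp add: pages_def add.assoc)
 have dsnd: "d z : snd (pages r (p + ?r) (q - ?r + 1) j)" if "z : snd (pages r p q j)" for z p q
  using d_Bd[of z ?r p "p + q" j] that r1 by (simp add: pages_def add.assoc)
 have dd0: "d (d z) = 0" if "z : fst (pages r p q j)" for z p q
  using that dd[OF ZD(1)] by (simp only: pages_def fst_conv)
 show "induces_map (page_maps r p q j) (pages r p q j) (pages r (p + ?r) (q - ?r + 1) j)"
  unfolding induces_map_def page_maps_def using dfst dsnd d by blast
 show "induces_zero (page_maps r (p + ?r) (q - ?r + 1) j \<circ> page_maps r p q j) (pages r p q j) (pages r (p + 2 * ?r) (q - 2 * ?r + 2) j)"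
 proof -
  have "0 : snd (pages r (p + 2 * ?r) (q - 2 * ?r + 2) j)" using sq by (simp add: subquotient_def subspaceD(1))
  thus ?thesis unfolding induces_zero_def page_maps_def using dd0 by auto
 qed
 let ?P = "pages r (p - ?r) (q + ?r - 1) j" and ?Q = "pages r p q j" and ?R = "pages r (p + ?r) (q - ?r + 1) j"
 have dP: "d w : fst ?Q" if "w : fst ?P" for w
  using d_page[of w ?r "p - ?r" "p + q - 1" j ?r] that r1 by (simp add: pages_def nn)
 have ddP: "d (d w) : snd ?R" if "w : fst ?P" for w
 proof -
  have "d (d w) = 0" using that dd[OF ZD(1)] by (simp only: pages_def fst_conv)
  thus ?thesis using sq by (simp add: subquotient_def subspaceD(1))
 qed
 show "pages (Suc r) p q j \<cong>\<^sub>\<rat> middle_cohomology (page_maps r (p - ?r) (q + ?r - 1) j) (page_maps r p q j) ?P ?Q ?R"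
  unfolding page_maps_def
 proof (rule subq_isomorphicI[of _ _ "%x. x"])
  show "subquotient (pages (Suc r) p q j)" by (rule subquotient_pages) simp
  show "subquotient (middle_cohomology d d ?P ?Q ?R)"
   by (rule subquotient_middle[OF d d sq sq sq dP dsnd ddP])
  show "lin (%x. x)" by (rule lin_id)
  have f1: "fst (pages (Suc r) p q j) = Z (?r + 1) p (p + q) j" "snd (pages (Suc r) p q j) = Bd (?r + 1) p (p + q) j"
   by (simp_all add: pages_def add.commute)
  have f2: "fst (middle_cohomology d d ?P ?Q ?R) = {z : Z ?r p (p + q) j. d z : Bd ?r (p + ?r) (p + q + 1) j}"
   "snd (middle_cohomology d d ?P ?Q ?R) = {d w + b | w b. w : Z ?r (p - ?r) (p + q - 1) j & b : Bd ?r p (p + q) j}"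
   by (simp_all add: middle_cohomology_def pages_def nn)
  show "x : fst (middle_cohomology d d ?P ?Q ?R)" if "x : fst (pages (Suc r) p q j)" for x
  proof -
   have xZ: "x : Z (?r + 1) p (p + q) j" using that f1 by simp
   have x: "x : F p (p + q) j" "d x : F (p + ?r + 1) (p + q + 1) j"
    using ZD[OF xZ] by (simp_all add: add.assoc)
   have "x : Z ?r p (p + q) j" using x mem_F[OF x(2), of "p + ?r"] by (simp add: Z_def)
   moreover have "d x : Z (?r - 1) (p + ?r + 1) (p + q + 1) j"
    using x dd[OF x(1)] subspaceD(1)[OF sub] by (simp add: Z_def)
   ultimately show ?thesis unfolding f2 using BdI1 by blast
  qed
  show "x : snd (middle_cohomology d d ?P ?Q ?R)" if "x : snd (pages (Suc r) p q j)" for x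
  proof -
   have xB: "x : Bd (?r + 1) p (p + q) j" using that f1 by simp
   obtain u y where *: "x = u + d y" "u : Z ?r (p + 1) (p + q) j" "y : Z ?r (p - ?r) (p + q - 1) j"
    by (rule BdE1[OF xB])
   have "u : Z (?r - 1) (p + 1) (p + q) j" using ZD[OF *(2)] mem_F[of "d u" "p + 1 + ?r" "p + q + 1" j "p + ?r"] by (simp add: Z_def)
   hence "u : Bd ?r p (p + q) j" by (rule BdI1)
   moreover have "x = d y + u" using *(1) by simp
   ultimately show ?thesis unfolding f2 using *(3) by blast
  qed
  \<comment> \<open>Both boundary terms are collected in w + y. The remainder x has the same
    differential as z, which lies r + 1 steps up.\<close>
  show "z : snd (pages (Suc r) p q j)" if z: "z : fst (pages (Suc r) p q j)" "z : snd (middle_cohomology d d ?P ?Q ?R)" for z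
  proof -
   obtain w b where wb: "z = d w + b" "w : Z ?r (p - ?r) (p + q - 1) j" "b : Bd ?r p (p + q) j" using z(2) unfolding f2 by blast
   obtain x y where xy: "b = x + d y" "x : Z (?r - 1) (p + 1) (p + q) j" "y : Z (?r - 1) (p - ?r + 1) (p + q - 1) j"
    using wb(3) by (rule BdE)
   have y: "y : Z ?r (p - ?r) (p + q - 1) j"
    using ZD[OF xy(3)] mem_F[of y "p - ?r + 1" _ j "p - ?r"] by (simp add: Z_def)
   have wy: "w + y : Z ?r (p - ?r) (p + q - 1) j" using subspaceD(2)[OF subspace_Z' wb(2) y] .
   have zx: "z = x + d (w + y)" using wb(1) xy(1) linD(1)[OF d, of w y] by (simp add: algebra_simps)
   have "d (d (w + y)) = 0" using ZD(1)[OF wy] dd by blast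
   hence "d z = d x" using zx linD(1)[OF d] by simp
   hence "x : Z ?r (p + 1) (p + q) j" using ZD(1)[OF xy(2)] ZD(2)[of z "?r + 1" p "p + q" j] z(1) f1
    by (simp add: Z_def algebra_simps)
   thus ?thesis unfolding f1 Bd_def using zx wy by (auto simp: algebra_simps)
  qed
  \<comment> \<open>Subtracting y removes the part d y of d z'; y comes from filtration p + 1 and is
    zero on page r.\<close>
  show "\<exists>z\<in>fst (pages (Suc r) p q j). z' - z : snd (middle_cohomology d d ?P ?Q ?R)" if "z' : fst (middle_cohomology d d ?P ?Q ?R)" for z'
  proof -
   have z': "z' : Z ?r p (p + q) j" "d z' : Bd ?r (p + ?r) (p + q + 1) j" using that f2 by auto
   obtain x y where xy: "d z' = x + d y" "x : Z (?r - 1) (p + ?r + 1) (p + q + 1) j" "y : Z (?r - 1) (p + 1) (p + q) j"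
   proof (rule BdE[OF z'(2)])
    fix x y assume "d z' = x + d y" "x : Z (?r - 1) (p + ?r + 1) (p + q + 1) j"
     "y : Z (?r - 1) (p + ?r - ?r + 1) (p + q + 1 - 1) j"
    thus thesis using that[of x y] by simp
   qed
   have "z' - y : F p (p + q) j" using ZD(1)[OF z'(1)] mem_F[OF ZD(1)[OF xy(3)], of p] subspaceD(4)[OF sub] by simp
   moreover have "d (z' - y) = x" using xy(1) linD(4)[OF d] by simp
   ultimately have "z' - y : Z (?r + 1) p (p + q) j" using ZD(1)[OF xy(2)] by (simp add: Z_def algebra_simps)
   moreover have "z' - (z' - y) : snd (middle_cohomology d d ?P ?Q ?R)"
   proof -
    have "z' - (z' - y) = d 0 + y" using linD(3)[OF d] by simp
    thus ?thesis unfolding f2 using BdI1[OF xy(3)] subspaceD(1)[OF subspace_Z'] by blast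
   qed
   ultimately show ?thesis unfolding f1 by blast
  qed
 qed
qed

lemma converges: "converges_to pages page_maps H"
proof -
 \<comment> \<open>The induced filtration of the cohomology: classes with a representing cycle in F
   p.\<close>
 define G where "G p n j = {x + y | x y. x : {x : F p n j. d x = 0} & y : d ` F pa (n - 1) j}" for p n j
 have all: "F p n j \<subseteq> F pa n j" for p n j
 proof (cases "p <= pa")
  case True thus ?thesis using low[OF True, of n j] by blast
 next
  case False thus ?thesis using mono[of pa p n j] by simp
 qed
 have subK: "fun_vs.subspace {x : F p n j. d x = 0}" for p n j
  using subspace_Z[OF d sub fun_vs.subspace_single_0, of p n j] by (simp only: singleton_iff)
 have subI: "fun_vs.subspace (d ` F pa (n - 1) j)" for n j by (intro subspace_image d sub)
 have subG: "fun_vs.subspace (G p n j)" for p n j unfolding G_def by (intro subspace_plus subK subI)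
 have imF: "d y : F pa n j" "d (d y) = 0" if "y : F pa (n - 1) j" for y n j using dF[OF that] dd[OF that] by auto
 have GI: "x : F p n j ==> d x = 0 ==> y : F pa (n - 1) j ==> x + d y : G p n j" for x y p n j
  unfolding G_def by blast
 have Glow: "G p n j = fst (H n j)" if "p <= pa" for p n j
 proof
  show "G p n j \<subseteq> fst (H n j)"
  proof
   fix z assume "z : G p n j"
   then obtain x y where *: "z = x + d y" "x : F p n j" "d x = 0" "y : F pa (n - 1) j" unfolding G_def by blast
   have "z : F pa n j" unfolding *(1) using *(2) all imF(1)[OF *(4)] by (intro subspaceD(2)[OF sub]) blast+
   moreover have "d z = 0" unfolding *(1) linD(1)[OF d] using *(3) imF(2)[OF *(4)] by simp
   ultimately show "z : fst (H n j)" by (simp add: H_def)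
  qed
  show "fst (H n j) \<subseteq> G p n j"
  proof
   fix z assume z: "z : fst (H n j)"
   have "z + d 0 : G p n j"
   proof (rule GI)
    show "z : F p n j" using z low[OF that, of n j] by (simp add: H_def)
    show "d z = 0" using z by (simp add: H_def)
   qed (rule subspaceD(1)[OF sub])
   thus "z : G p n j" by (simp only: linD(3)[OF d] add_0_right)
  qed
 qed
 have Ghigh: "G p n j = snd (H n j)" if "pb <= p" for p n j
 proof
  show "G p n j \<subseteq> snd (H n j)" unfolding G_def H_def using high[OF that] by auto
  show "snd (H n j) \<subseteq> G p n j"
  proof
   fix z assume "z : snd (H n j)"
   then obtain y where y: "z = d y" "y : F pa (n - 1) j" by (auto simp: H_def)
   hence "0 + d y : G p n j" by (intro GI subspaceD(1)[OF sub] linD(3)[OF d])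
   thus "z : G p n j" using y(1) by (simp only: add_0)
  qed
 qed
 have Gmono: "G p' n j \<subseteq> G p n j" if "p <= p'" for p p' n j using mono[OF that] unfolding G_def by blast
 have stable: "pages r p q j \<cong>\<^sub>\<rat> (G p (p + q) j, G (p + 1) (p + q) j)"
  and zero_out: "!!z. z : Z (int r) p (p + q) j ==> d z = 0"
  and zero_in: "!!w. w : F (p - int r) (p + q - 1) j ==> d w : F p (p + q) j ==> d w : Bd (int r) p (p + q) j"
  if r: "r \<ge> 2" "p + int r \<ge> pb + 1" "p - int r + 1 <= pa" for r p q j
 proof -
  let ?r = "int r"
  show zo: "d z = 0" if "z : Z ?r p (p + q) j" for z
   using ZD(2)[OF that] high[of "p + ?r"] r by auto
  have zo': "d z = 0" if "z : Z (?r - 1) (p + 1) (p + q) j" for z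
   using ZD(2)[OF that] high[of "p + ?r"] r by auto
  have Zi: "x : F p (p + q) j ==> d x = 0 ==> x : Z ?r p (p + q) j"
   "x : F (p + 1) (p + q) j ==> d x = 0 ==> x : Z (?r - 1) (p + 1) (p + q) j" for x
   using subspaceD(1)[OF sub] by (auto simp: Z_def)
  have yi: "y : Z (?r - 1) (p - ?r + 1) (p + q - 1) j" if "y : F pa (p + q - 1) j" "d y : F p (p + q) j" for y
   using that low[of "p - ?r + 1"] r by (simp add: Z_def)
  have pp: "pages r p q j = (Z ?r p (p + q) j, Bd ?r p (p + q) j)" by (simp add: pages_def)
  show "d w : Bd ?r p (p + q) j" if "w : F (p - ?r) (p + q - 1) j" "d w : F p (p + q) j" for w
   using that all by (intro BdI2 yi) auto
  show "pages r p q j \<cong>\<^sub>\<rat> (G p (p + q) j, G (p + 1) (p + q) j)"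
  proof (rule subq_isomorphicI[of _ _ "%x. x"])
   show "subquotient (pages r p q j)" using r by (intro subquotient_pages) auto
   show "subquotient (G p (p + q) j, G (p + 1) (p + q) j)"
    using subG Gmono[of p "p + 1"] by (simp add: subquotient_def)
   show "lin (%x. x)" by (rule lin_id)
   show "x : fst (G p (p + q) j, G (p + 1) (p + q) j)" if "x : fst (pages r p q j)" for x
   proof -
    have x: "x : Z ?r p (p + q) j" using that by (simp add: pp)
    have "x + d 0 : G p (p + q) j" by (intro GI ZD(1)[OF x] zo[OF x] subspaceD(1)[OF sub])
    thus ?thesis by (simp only: linD(3)[OF d] add_0_right fst_conv)
   qed
   show "x : snd (G p (p + q) j, G (p + 1) (p + q) j)" if x: "x : snd (pages r p q j)" for x
   proof -
    have "x : Bd ?r p (p + q) j" using x by (simp add: pp)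
    then obtain u y where *: "x = u + d y" "u : Z (?r - 1) (p + 1) (p + q) j" "y : Z (?r - 1) (p - ?r + 1) (p + q - 1) j"
     by (rule BdE)
    have "y : F pa (p + q - 1) j" using ZD(1)[OF *(3)] all by blast
    thus ?thesis unfolding *(1) snd_conv by (intro GI ZD(1)[OF *(2)] zo'[OF *(2)])
   qed
   show "z : snd (pages r p q j)" if z: "z : fst (pages r p q j)" "z : snd (G p (p + q) j, G (p + 1) (p + q) j)" for z
   proof -
    obtain x y where *: "z = x + d y" "x : F (p + 1) (p + q) j" "d x = 0" "y : F pa (p + q - 1) j"
     using z(2) unfolding G_def by auto
    have "d y = z - x" using *(1) by simp
    moreover have "z : F p (p + q) j" using z(1) ZD(1) by (simp add: pp)
    ultimately have "d y : F p (p + q) j" using subspaceD(4)[OF sub] mem_F[OF *(2), of p] by simp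
    hence "y : Z (?r - 1) (p - ?r + 1) (p + q - 1) j" using yi *(4) by blast
    moreover have "x : Z (?r - 1) (p + 1) (p + q) j" using Zi(2) * by blast
    ultimately show ?thesis unfolding pp Bd_def using *(1) by auto
   qed
   show "\<exists>z\<in>fst (pages r p q j). z' - z : snd (G p (p + q) j, G (p + 1) (p + q) j)"
    if z': "z' : fst (G p (p + q) j, G (p + 1) (p + q) j)" for z'
   proof -
    obtain x y where *: "z' = x + d y" "x : F p (p + q) j" "d x = 0" "y : F pa (p + q - 1) j"
     using z' unfolding G_def by auto
    have "0 + d y : G (p + 1) (p + q) j" by (intro GI subspaceD(1)[OF sub] linD(3)[OF d] *(4))
    moreover have "z' - x = 0 + d y" using *(1) by simp
    ultimately have "z' - x : G (p + 1) (p + q) j" by simp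
    moreover have "x : fst (pages r p q j)" using Zi(1) * by (simp add: pp)
    ultimately show ?thesis by auto
   qed
  qed
 qed
 show ?thesis
  unfolding converges_to_def
 proof (intro exI[of _ G] conjI allI)
  show "fun_vs.subspace (G p n j)" for p n j by (rule subG)
  show "G (p + 1) n j \<subseteq> G p n j" for p n j by (rule Gmono) simp
  show "snd (H n j) \<subseteq> G p n j" for n j p
   using Ghigh[of "max p pb" n j] Gmono[of p "max p pb" n j] by simp
  show "G p n j \<subseteq> fst (H n j)" for n j p
   using Glow[of "min p pa" n j] Gmono[of "min p pa" p n j] by simp
  show "\<exists>p0 p1. \<forall>j. G p0 n j = fst (H n j) & G p1 n j = snd (H n j)" for n
   using Glow[of pa] Ghigh[of pb] by blast
  fix p q
  \<comment> \<open>From here on p + r exceeds pb and p - r + 1 is at most pa, so the differentials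
    at (p, q) vanish.\<close>
  define r0 where "r0 = 2 + nat \<bar>pb - p\<bar> + nat \<bar>p - pa\<bar>"
  show "\<exists>r0\<ge>2. \<forall>r\<ge>r0. \<forall>j.
     induces_zero (page_maps r p q j) (pages r p q j) (pages r (p + int r) (q - int r + 1) j) &
     induces_zero (page_maps r (p - int r) (q + int r - 1) j)
      (pages r (p - int r) (q + int r - 1) j) (pages r p q j) &
     pages r p q j \<cong>\<^sub>\<rat> (G p (p + q) j, G (p + 1) (p + q) j)"
  proof (intro exI[of _ r0] conjI allI impI)
   show "2 <= r0" by (simp add: r0_def)
   fix r j assume "r0 <= r"
   hence r: "r \<ge> 2" "p + int r \<ge> pb + 1" "p - int r + 1 <= pa" unfolding r0_def by linarith+
   show "pages r p q j \<cong>\<^sub>\<rat> (G p (p + q) j, G (p + 1) (p + q) j)" by (rule stable[OF r])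
   have sq: "subquotient (pages r (p + int r) (q - int r + 1) j)" using r by (intro subquotient_pages) auto
   show "induces_zero (page_maps r p q j) (pages r p q j) (pages r (p + int r) (q - int r + 1) j)"
    unfolding induces_zero_def page_maps_def
   proof (rule image_subsetI)
    fix z assume "z : fst (pages r p q j)"
    hence "d z = 0" using zero_out[OF r] by (simp add: pages_def)
    thus "d z : snd (pages r (p + int r) (q - int r + 1) j)" using sq by (simp add: subquotient_def subspaceD(1))
   qed
   show "induces_zero (page_maps r (p - int r) (q + int r - 1) j)
      (pages r (p - int r) (q + int r - 1) j) (pages r p q j)"
    unfolding induces_zero_def page_maps_def
   proof (rule image_subsetI)
    fix w assume "w : fst (pages r (p - int r) (q + int r - 1) j)"
    hence w: "w : Z (int r) (p - int r) (p + q - 1) j" by (simp add: pages_def algebra_simps)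
    have "d w : F p (p + q) j" using ZD(2)[OF w] by simp
    thus "d w : snd (pages r p q j)" using zero_in[OF r ZD(1)[OF w]] by (simp add: pages_def)
   qed
  qed
 qed
qed

end

section \<open>Complexes with a bigraded basis\<close>

lemma subspace_spanned_by: "fun_vs.subspace (spanned_by S)"
 by (rule subspaceI) (auto simp: spanned_by_def fscale_def)

lemma spanned_byI: "(!!x. f x ~= 0 ==> x : S) ==> f : spanned_by S"
 by (auto simp: spanned_by_def)

lemma spanned_byD: "f : spanned_by S ==> f x ~= 0 ==> x : S"
 by (auto simp: spanned_by_def)

lemma lin_matrix_map: "lin (matrix_map B M)"
 by (rule linI) (auto simp: matrix_map_def fun_eq_iff fscale_def sum.distrib sum_distrib_left algebra_simps)

lemma matrix_map_nonzero:
 assumes "matrix_map B M f y ~= 0"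
 obtains x where "y : B" "x : B" "M y x ~= 0" "f x ~= 0"
proof -
 have "y : B" "(\<Sum>x\<in>B. M y x * f x) ~= 0" using assms by (auto simp: matrix_map_def split: if_splits)
 moreover then obtain x where "x : B" "M y x * f x ~= 0" by (elim sum.not_neutral_contains_not_neutral)
 ultimately show thesis using that[of x] by simp
qed

lemma matrix_map_compose:
 "matrix_map B M (matrix_map B N f) = matrix_map B (%y x. \<Sum>z\<in>B. M y z * N z x) f"
proof
 fix y
 have "(\<Sum>z\<in>B. M y z * (\<Sum>x\<in>B. N z x * f x)) = (\<Sum>z\<in>B. \<Sum>x\<in>B. M y z * N z x * f x)"
  by (simp add: sum_distrib_left mult.assoc)
 also have "\<dots> = (\<Sum>x\<in>B. \<Sum>z\<in>B. M y z * N z x * f x)" by (rule sum.swap)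
 finally show "matrix_map B M (matrix_map B N f) y = matrix_map B (%y x. \<Sum>z\<in>B. M y z * N z x) f y"
  by (simp add: matrix_map_def sum_distrib_right)
qed

text \<open>P is the column, Q the row and J the internal degree of a basis element;
  \<open>deg\<close> says that M is the sum of a vertical and a horizontal part. The filtration is
  by columns.\<close>

locale bigraded_complex =
 fixes B :: "'b set" and M :: "'b => 'b => rat" and P Q J :: "'b => int" and pa pb :: int
 assumes fin: "finite B"
  and square: "!!x z. x : B ==> z : B ==> (\<Sum>y\<in>B. M z y * M y x) = 0"
  and deg: "!!x y. x : B ==> y : B ==> M y x ~= 0 ==>
   J y = J x & (P y = P x & Q y = Q x + 1 \<or> P y = P x + 1 & Q y = Q x)"
  and range: "!!x. x : B ==> pa <= P x & P x < pb"
begin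

definition "F p n j = spanned_by {x : B. P x + Q x = n & J x = j & p <= P x}"
definition "col p q j = spanned_by {x : B. P x = p & Q x = q & J x = j}"
abbreviation "d \<equiv> matrix_map B M"
definition "d0 = matrix_map B (%y x. if P y = P x then M y x else 0)"
definition "d1 = matrix_map B (%y x. if P y = P x then 0 else M y x)"
definition proj :: "int => ('b => rat) => 'b => rat" where "proj k f = (%y. if P y = k then f y else 0)"

lemma lin_d0: "lin d0" and lin_d1: "lin d1" unfolding d0_def d1_def by (rule lin_matrix_map)+

lemma lin_proj: "lin (proj k)" by (rule linI) (auto simp: proj_def fun_eq_iff fscale_def)

lemma dd: "d (d f) = 0"
 unfolding matrix_map_compose using square by (auto simp: matrix_map_def fun_eq_iff)

lemma d_split: "d f = d0 f + d1 f"
proof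
 fix y
 show "d f y = (d0 f + d1 f) y"
  by (auto simp: d0_def d1_def matrix_map_def simp flip: sum.distrib intro!: sum.cong)
qed

text \<open>The vertical part stays in its column and the horizontal part comes from the preceding
  one.\<close>

lemma proj_d: "proj k (d f) = d0 (proj k f) + d1 (proj (k - 1) f)"
proof
 fix y
 have z0: "(if P y = P x then M y x else 0) * proj k f x = (if P y = k then (if P y = P x then M y x else 0) * f x else 0)" for x
  by (auto simp: proj_def)
 have z1: "(if P y = P x then 0 else M y x) * proj (k - 1) f x = (if P y = k then (if P y = P x then 0 else M y x) * f x else 0)"
  if "y : B" "x : B" for x
  using deg[OF that(2,1)] by (cases "M y x = 0") (auto simp: proj_def)
 show "proj k (d f) y = (d0 (proj k f) + d1 (proj (k - 1) f)) y"
 proof (cases "y : B")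
  case True
  have "(\<Sum>x\<in>B. (if P y = P x then 0 else M y x) * proj (k - 1) f x)
   = (\<Sum>x\<in>B. if P y = k then (if P y = P x then 0 else M y x) * f x else 0)"
   using z1[OF True] by (intro sum.cong) auto
  hence "d1 (proj (k - 1) f) y = (if P y = k then d1 f y else 0)" using True by (simp add: d1_def matrix_map_def)
  moreover have "d0 (proj k f) y = (if P y = k then d0 f y else 0)" using True by (simp add: d0_def matrix_map_def z0)
  moreover have "d f y = d0 f y + d1 f y" using d_split[of f] by simp
  ultimately show ?thesis by (simp add: proj_def)
 qed (simp add: proj_def d0_def d1_def matrix_map_def)
qed

lemma col_F': "x : col p q j ==> p' <= p ==> n = p + q ==> x : F p' n j"
 unfolding col_def F_def spanned_by_def by auto

lemma proj_col: "x : F p n j ==> proj k x : col k (n - k) j"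
 unfolding col_def F_def spanned_by_def proj_def by auto

lemma proj_F_less: "x : F p n j ==> k < p ==> proj k x = 0"
 unfolding F_def spanned_by_def proj_def by (auto simp: fun_eq_iff)

lemma F_step: "x : F p n j ==> proj p x = 0 ==> x : F (p + 1) n j"
proof -
 assume x: "x : F p n j" and "proj p x = 0"
 have "P y ~= p" if "x y ~= 0" for y
 proof
  assume "P y = p"
  hence "proj p x y = x y" by (simp add: proj_def)
  thus False using that \<open>proj p x = 0\<close> by simp
 qed
 moreover have "y : {y : B. P y + Q y = n & J y = j & p <= P y}" if "x y ~= 0" for y
  using x that unfolding F_def by (rule spanned_byD)
 ultimately have "y : {y : B. P y + Q y = n & J y = j & p + 1 <= P y}" if "x y ~= 0" for y
  using that by fastforce
 thus ?thesis unfolding F_def by (rule spanned_byI)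
qed

lemma proj_col_same: "x : col p q j ==> proj p x = x"
 unfolding col_def spanned_by_def proj_def by (auto simp: fun_eq_iff)

lemma proj_col_other: "x : col p q j ==> k ~= p ==> proj k x = 0"
 unfolding col_def spanned_by_def proj_def by (auto simp: fun_eq_iff)

lemma d0_col: "x : col p q j ==> d0 x : col p (q + 1) j"
 unfolding col_def d0_def
 by (rule spanned_byI, elim matrix_map_nonzero) (use deg in "fastforce dest: spanned_byD split: if_splits")

lemma d1_col: "x : col p q j ==> d1 x : col (p + 1) q j"
 unfolding col_def d1_def
 by (rule spanned_byI, elim matrix_map_nonzero) (use deg in "fastforce dest: spanned_byD split: if_splits")

lemma d_F: "x : F p n j ==> d x : F p (n + 1) j"
 unfolding F_def
 by (rule spanned_byI, elim matrix_map_nonzero) (use deg in "fastforce dest: spanned_byD split: if_splits")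

lemma subspace_F: "fun_vs.subspace (F p n j)" unfolding F_def by (rule subspace_spanned_by)
lemma subspace_col: "fun_vs.subspace (col p q j)" unfolding col_def by (rule subspace_spanned_by)

sublocale fc: filtered_complex F d pa pb
proof (rule filtered_complex.intro)
 show "F p n j = F pa n j" if "p <= pa" for p n j
 proof -
  have "{x : B. P x + Q x = n & J x = j & p <= P x} = {x : B. P x + Q x = n & J x = j & pa <= P x}"
   using that range by fastforce
  thus ?thesis by (simp add: F_def)
 qed
 show "F p n j = {0}" if "pb <= p" for p n j
 proof -
  have "{x : B. P x + Q x = n & J x = j & p <= P x} = {}"
   using that range by fastforce
  thus ?thesis by (auto simp: F_def spanned_by_def fun_eq_iff)
 qed
 show "F p' n j \<subseteq> F p n j" if "p <= p'" for p p' n j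
  using that unfolding F_def spanned_by_def by auto
qed (rule subspace_F lin_matrix_map d_F dd | assumption)+

definition VC :: "int => int => int => 'b subq" where
 "VC q j p = ({z : col p q j. d0 z = 0}, d0 ` col p (q - 1) j)"

text \<open>Compare the components of d (d x) = 0 in the columns p, p + 1 and p + 2.\<close>

lemma anticommute:
 assumes "x : col p q j"
 shows "d0 (d0 x) = 0" "d0 (d1 x) = - d1 (d0 x)" "d1 (d1 x) = 0"
proof -
 have 1: "proj k (d (d x)) = d0 (d0 (proj k x)) + d0 (d1 (proj (k - 1) x)) + d1 (d0 (proj (k - 1) x)) + d1 (d1 (proj (k - 2) x))" for k
 proof -
  have k2: "k - 1 - 1 = k - 2" by simp
  show ?thesis unfolding proj_d[of k "d x"] proj_d[of k x] proj_d[of "k - 1" x]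
   linD(1)[OF lin_d0] linD(1)[OF lin_d1] k2 by (simp only: add.assoc)
 qed
 have z: "proj k (d (d x)) = 0" for k unfolding dd by (rule linD(3)[OF lin_proj])
 note zero = linD(3)[OF lin_d0] linD(3)[OF lin_d1]
 have s: "proj p x = x" "proj (p - 1) x = 0" "proj (p - 2) x = 0" "proj (p + 1) x = 0" "proj (1 + p) x = 0" "proj (p + 2) x = 0"
  using proj_col_same[OF assms] proj_col_other[OF assms] by auto
 show "d0 (d0 x) = 0" using 1[of p] z[of p] by (simp add: s zero)
 have "d0 (d1 x) + d1 (d0 x) = 0" using 1[of "p + 1"] z[of "p + 1"] by (simp add: s zero)
 thus "d0 (d1 x) = - d1 (d0 x)" by (simp add: eq_neg_iff_add_eq_0)
 show "d1 (d1 x) = 0" using 1[of "p + 2"] z[of "p + 2"] by (simp add: s zero)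
qed

lemma subquotient_VC: "subquotient (VC q j p)"
proof -
 have "fun_vs.subspace {z : col p q j. d0 z = 0}"
  using subspace_Z[OF lin_d0 subspace_col fun_vs.subspace_single_0, of p q j] by (simp only: singleton_iff)
 moreover have "d0 x : col p q j" "d0 (d0 x) = 0" if "x : col p (q - 1) j" for x
  using d0_col[OF that] anticommute(1)[OF that] by simp_all
 ultimately show ?thesis unfolding subquotient_def VC_def
  using subspace_image[OF lin_d0 subspace_col] by auto
qed

lemma d1_VC:
 shows "z : fst (VC q j p) ==> d1 z : fst (VC q j (p + 1))"
  and "z : snd (VC q j p) ==> d1 z : snd (VC q j (p + 1))"
  and "z : fst (VC q j p) ==> d1 (d1 z) = 0"
proof -
 show "d1 z : fst (VC q j (p + 1))" if "z : fst (VC q j p)"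
 proof -
  have z: "z : col p q j" "d0 z = 0" using that by (auto simp: VC_def)
  hence "d0 (d1 z) = 0" using anticommute(2)[OF z(1)] linD(3)[OF lin_d1] by simp
  thus ?thesis using d1_col[OF z(1)] by (simp add: VC_def)
 qed
 show "d1 z : snd (VC q j (p + 1))" if zz: "z : snd (VC q j p)"
 proof -
  obtain x where x: "x : col p (q - 1) j" "z = d0 x" using zz by (auto simp: VC_def)
  have "d1 z = d0 (- d1 x)" unfolding x(2) linD(5)[OF lin_d0] using anticommute(2)[OF x(1)] by simp
  moreover have "- d1 x : col (p + 1) (q - 1) j" using d1_col[OF x(1)] subspaceD(5)[OF subspace_col] by blast
  ultimately show ?thesis by (auto simp: VC_def)
 qed
 show "d1 (d1 z) = 0" if "z : fst (VC q j p)" using that anticommute(3) by (auto simp: VC_def)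
qed

lemma cochain_VC: "cochain_complex (VC q j) (%p. d1)"
proof -
 have "0 : snd (VC q j p)" for p using subquotient_VC[of q j p] by (simp add: subquotient_def subspaceD(1))
 thus ?thesis unfolding cochain_complex_def induces_map_def induces_zero_def
  using subquotient_VC d1_VC lin_d1 by (auto simp: image_subset_iff)
qed

text \<open>Take the leading component, in column p. The component of d x in column p + 1 vanishes,
  which says that the horizontal differential of the leading component is a vertical
  boundary.\<close>

lemma E2_VC: "fc.pages 2 p q j \<cong>\<^sub>\<rat> cohomology (VC q j) (%p. d1) p"
proof (rule subq_isomorphicI[of _ _ "proj p"])
 show "subquotient (fc.pages 2 p q j)" by (rule fc.subquotient_pages) simp
 note zero = linD(3)[OF lin_d0] linD(3)[OF lin_d1]
 have e1: "fst (fc.pages 2 p q j) = fc.Z 2 p (p + q) j" "snd (fc.pages 2 p q j) = fc.Bd 2 p (p + q) j"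
  by (simp_all add: fc.pages_def)
 have e2: "fst (cohomology (VC q j) (%p. d1) p) = {z : col p q j. d0 z = 0 & d1 z : d0 ` col (p + 1) (q - 1) j}"
  "snd (cohomology (VC q j) (%p. d1) p) =
   {d1 w + b | w b. (w : col (p - 1) q j & d0 w = 0) & b : d0 ` col p (q - 1) j}"
  by (auto simp: cohomology_def middle_cohomology_def VC_def)
 show "subquotient (cohomology (VC q j) (%p. d1) p)" unfolding cohomology_def
 proof (rule subquotient_middle[OF lin_d1 lin_d1 subquotient_VC subquotient_VC subquotient_VC])
  have "0 : snd (VC q j p)" for p using subquotient_VC[of q j p] by (simp add: subquotient_def subspaceD(1))
  thus "d1 (d1 x) : snd (VC q j (p + 1))" if "x : fst (VC q j (p - 1))" for x using d1_VC(3)[OF that] by simp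
  show "d1 x : fst (VC q j p)" if "x : fst (VC q j (p - 1))" for x using d1_VC(1)[OF that] by simp
 qed (rule d1_VC(2))
 show "lin (proj p)" by (rule lin_proj)
 show "proj p x : fst (cohomology (VC q j) (%p. d1) p)" if x': "x : fst (fc.pages 2 p q j)" for x
 proof -
  have x: "x : F p (p + q) j" "d x : F (p + 2) (p + q + 1) j" using x' fc.ZD[of x 2 p "p + q" j] by (simp_all add: e1)
  have "d0 (proj p x) + d1 (proj (p - 1) x) = 0" using proj_d[of p x] proj_F_less[OF x(2), of p] by simp
  hence 1: "d0 (proj p x) = 0" using proj_F_less[OF x(1), of "p - 1"] by (simp add: zero)
  have "d0 (proj (p + 1) x) + d1 (proj p x) = 0" using proj_d[of "p + 1" x] proj_F_less[OF x(2), of "p + 1"] by simp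
  hence "d1 (proj p x) = d0 (- proj (p + 1) x)" unfolding linD(5)[OF lin_d0]
   by (simp add: eq_neg_iff_add_eq_0 add.commute)
  moreover have "- proj (p + 1) x : col (p + 1) (q - 1) j"
   using proj_col[OF x(1), of "p + 1"] subspaceD(5)[OF subspace_col] by (simp add: algebra_simps)
  moreover have "proj p x : col p q j" using proj_col[OF x(1), of p] by simp
  ultimately show ?thesis using 1 by (simp add: e2)
 qed
 show "proj p x : snd (cohomology (VC q j) (%p. d1) p)" if x': "x : snd (fc.pages 2 p q j)" for x
 proof -
  obtain u y where *: "x = u + d y" "u : fc.Z (2 - 1) (p + 1) (p + q) j" "y : fc.Z (2 - 1) (p - 2 + 1) (p + q - 1) j"
   by (rule fc.BdE[OF x'[unfolded e1]])
  have u: "proj p u = 0" using fc.ZD(1)[OF *(2)] by (rule proj_F_less) simp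
  have y: "y : F (p - 1) (p + q - 1) j" "d y : F p (p + q) j" using fc.ZD[OF *(3)] by simp_all
  have "proj p x = proj p u + proj p (d y)" unfolding *(1) by (rule linD(1)[OF lin_proj])
  hence "proj p x = d1 (proj (p - 1) y) + d0 (proj p y)" using u proj_d[of p y] by (simp add: add.commute)
  moreover have "d0 (proj (p - 1) y) + d1 (proj (p - 1 - 1) y) = 0" using proj_d[of "p - 1" y] proj_F_less[OF y(2), of "p - 1"] by simp
  hence "d0 (proj (p - 1) y) = 0" using proj_F_less[OF y(1), of "p - 1 - 1"] by (simp add: zero)
  moreover have "proj (p - 1) y : col (p - 1) q j" "proj p y : col p (q - 1) j"
   using proj_col[OF y(1), of "p - 1"] proj_col[OF y(1), of p] by (simp_all add: algebra_simps)
  ultimately show ?thesis unfolding e2 by blast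
 qed
 show "z : snd (fc.pages 2 p q j)" if z': "z : fst (fc.pages 2 p q j)" "proj p z : snd (cohomology (VC q j) (%p. d1) p)" for z
 proof -
  have z: "z : F p (p + q) j" "d z : F (p + 2) (p + q + 1) j" using z'(1) fc.ZD[of z 2 p "p + q" j] by (simp_all add: e1)
  obtain w v where wv: "proj p z = d1 w + d0 v" "w : col (p - 1) q j" "d0 w = 0" "v : col p (q - 1) j"
   using z'(2) unfolding e2 by blast
  \<comment> \<open>The differential of w + v has the same component in column p as z, so the
    remainder starts in column p + 1.\<close>
  define y where "y = w + v"
  have y: "y : F (p - 1) (p + q - 1) j" unfolding y_def
   by (intro subspaceD(2)[OF subspace_F] col_F'[OF wv(2)] col_F'[OF wv(4)]) auto
  have dy: "d y = (d1 w + d0 v) + d1 v" unfolding y_def linD(1)[OF lin_matrix_map] d_split[of w] d_split[of v] wv(3)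
   by (simp add: add_ac)
  have m1: "d1 w : F p (p + q) j" "d0 v : F p (p + q) j" "d1 v : F p (p + q) j"
   by (rule col_F'[OF d1_col[OF wv(2)]] col_F'[OF d0_col[OF wv(4)]] col_F'[OF d1_col[OF wv(4)]]; simp)+
  hence dyF: "d y : F p (p + q) j" unfolding dy using subspaceD(2)[OF subspace_F] by blast
  have yZ: "y : fc.Z (2 - 1) (p - 2 + 1) (p + q - 1) j" using y dyF by (simp add: fc.Z_def)
  define x where "x = z - d y"
  have pd: "proj p (d y) = proj p z"
  proof -
   have "proj p (d1 w + d0 v) = d1 w + d0 v"
    using subspaceD(2)[OF subspace_col, of "d1 w" p q j "d0 v"] d1_col[OF wv(2)] d0_col[OF wv(4)]
    by (intro proj_col_same) simp
   moreover have "proj p (d1 v) = 0" using proj_col_other[OF d1_col[OF wv(4)], of p] by simp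
   ultimately show ?thesis unfolding dy linD(1)[OF lin_proj, of p "d1 w + d0 v"] wv(1) by simp
  qed
  have "x : F (p + 1) (p + q) j"
  proof (rule F_step)
   show "x : F p (p + q) j" unfolding x_def using z(1) dyF subspaceD(4)[OF subspace_F] by blast
   show "proj p x = 0" unfolding x_def linD(4)[OF lin_proj] using pd by simp
  qed
  moreover have "d x = d z" unfolding x_def linD(4)[OF lin_matrix_map] dd by simp
  ultimately have xZ: "x : fc.Z (2 - 1) (p + 1) (p + q) j" using z(2) by (simp add: fc.Z_def add.commute)
  have "z = x + d y" by (simp add: x_def)
  thus ?thesis unfolding e1 fc.Bd_def using xZ yZ by blast
 qed
 show "\<exists>z\<in>fst (fc.pages 2 p q j). z' - proj p z : snd (cohomology (VC q j) (%p. d1) p)"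
  if z': "z' : fst (cohomology (VC q j) (%p. d1) p)" for z'
 proof -
  have zc: "z' : col p q j" "d0 z' = 0" using z' by (auto simp: e2)
  obtain w where w: "w : col (p + 1) (q - 1) j" "d1 z' = d0 w" using z' by (auto simp: e2)
  \<comment> \<open>The correction w in column p + 1 cancels d1 z' = d0 w, so that d z starts in
    column p + 2.\<close>
  define z where "z = z' - w"
  have zF: "z : F p (p + q) j" unfolding z_def
   by (intro subspaceD(4)[OF subspace_F] col_F'[OF zc(1)] col_F'[OF w(1)]) auto
  have "d z = - d1 w" unfolding z_def linD(4)[OF lin_matrix_map] d_split[of z'] d_split[of w] zc(2) w(2) by simp
  moreover have "- d1 w : F (p + 2) (p + q + 1) j"
   by (intro subspaceD(5)[OF subspace_F] col_F'[OF d1_col[OF w(1)]]) auto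
  ultimately have "z : fst (fc.pages 2 p q j)" using zF by (simp add: e1 fc.Z_def)
  moreover have "proj p z = z'" unfolding z_def linD(4)[OF lin_proj]
   using proj_col_same[OF zc(1)] proj_col_other[OF w(1), of p] by simp
  moreover have "0 : snd (cohomology (VC q j) (%p. d1) p)"
  proof -
   have "(0 :: 'b => rat) = d1 0 + d0 0" by (simp add: zero)
   moreover have "0 : col (p - 1) q j" "0 : col p (q - 1) j" by (rule subspaceD(1)[OF subspace_col])+
   ultimately show ?thesis unfolding e2 using zero by blast
  qed
  ultimately show ?thesis by (intro bexI[of _ z]) auto
 qed
qed

end

section \<open>Transport of cohomology along a change of basis\<close>

text \<open>A sign changes neither kernels nor images, so commuting up to one constant sign
  suffices. Since ka * ka = 1, preimages can be rescaled by ka.\<close>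

lemma cohomology_transport:
 fixes V :: "int => 'a subq" and V' :: "int => 'b subq"
 assumes V: "cochain_complex V (%p. D)" and T: "lin T" and D': "lin D'"
  and V': "!!p. V' p = (T ` fst (V p), T ` snd (V p))"
  and inj: "!!p x. x : fst (V p) ==> T x = 0 ==> x = 0"
  and com: "!!p x. x : fst (V p) ==> D' (T x) = fscale ka (T (D x))" and k: "ka = 1 \<or> ka = -1"
 shows "cochain_complex V' (%p. D')" "cohomology V (%p. D) p \<cong>\<^sub>\<rat> cohomology V' (%p. D') p"
proof -
 have D: "lin D" "subquotient (V p)" "x : fst (V p) ==> D x : fst (V (p + 1))" "x : snd (V p) ==> D x : snd (V (p + 1))"
  "x : fst (V p) ==> D (D x) : snd (V (p + 2))" for p x
  using V unfolding cochain_complex_def induces_map_def induces_zero_def by fastforce+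
 have sV: "fun_vs.subspace (fst (V p))" "fun_vs.subspace (snd (V p))" "snd (V p) \<subseteq> fst (V p)" for p
  using D(2) by (auto simp: subquotient_def)
 have injT: "x = y" if "x : fst (V p)" "y : fst (V p)" "T x = T y" for p x y
 proof -
  have "T (x - y) = 0" using that(3) linD(4)[OF T] by simp
  thus ?thesis using inj[of "x - y" p] subspaceD(4)[OF sV(1) that(1,2)] by simp
 qed
 have sq': "subquotient (V' p)" for p
  unfolding subquotient_def V' fst_conv snd_conv using subspace_image[OF T] sV by blast
 have com': "D' (T x) = T (fscale ka (D x))" if "x : fst (V p)" for x p
  using com[OF that] linD(2)[OF T] by simp
 have m1: "D' y : fst (V' (p + 1))" if y: "y : fst (V' p)" for y p
 proof -
  obtain x where x: "x : fst (V p)" "y = T x" using y V' by auto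
  thus ?thesis using com'[OF x(1)] subspaceD(3)[OF sV(1) D(3)[OF x(1)]] by (simp add: V')
 qed
 have m2: "D' y : snd (V' (p + 1))" if y: "y : snd (V' p)" for y p
 proof -
  obtain x where x: "x : snd (V p)" "y = T x" using y V' by auto
  thus ?thesis using com'[of x p] subspaceD(3)[OF sV(2) D(4)[OF x(1)]] sV(3) by (auto simp: V')
 qed
 have m3: "D' (D' y) : snd (V' (p + 2))" if y: "y : fst (V' p)" for y p
 proof -
  obtain x where x: "x : fst (V p)" "y = T x" using y V' by auto
  have "D' (D' y) = T (fscale ka (D (fscale ka (D x))))"
   unfolding x(2) com'[OF x(1)] by (rule com'[OF subspaceD(3)[OF sV(1) D(3)[OF x(1)]]])
  also have "\<dots> = T (fscale ka (fscale ka (D (D x))))" by (simp only: linD(2)[OF D(1)])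
  finally show ?thesis using subspaceD(3)[OF sV(2) subspaceD(3)[OF sV(2) D(5)[OF x(1)]]] by (simp add: V')
 qed
 show c': "cochain_complex V' (%p. D')"
  unfolding cochain_complex_def induces_map_def induces_zero_def using sq' m1 m2 m3 D' by (auto simp: image_subset_iff)
 have kk: "fscale ka (fscale ka x) = x" for x :: "'a => rat" using k by (auto simp: fscale_def fun_eq_iff)
 have sub: "subquotient (cohomology W (%p. E) p)" if "cochain_complex W (%p. E)" for W :: "int => 'c subq" and E
 proof -
  have E: "lin E" "subquotient (W p)" "x : fst (W p) ==> E x : fst (W (p + 1))" "x : snd (W p) ==> E x : snd (W (p + 1))"
   "x : fst (W p) ==> E (E x) : snd (W (p + 2))" for p x
   using that unfolding cochain_complex_def induces_map_def induces_zero_def by fastforce+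
  show ?thesis unfolding cohomology_def
  proof (rule subquotient_middle[OF E(1,1,2,2,2)])
   show "E x : fst (W p)" if "x : fst (W (p - 1))" for x using E(3)[OF that] by simp
   show "E (E x) : snd (W (p + 1))" if "x : fst (W (p - 1))" for x using E(5)[OF that] by (simp add: add.commute)
  qed (rule E(4))
 qed
 have f1: "fst (cohomology V (%p. D) p) = {z : fst (V p). D z : snd (V (p + 1))}"
  "snd (cohomology V (%p. D) p) = {D w + b | w b. w : fst (V (p - 1)) & b : snd (V p)}"
  by (simp_all add: cohomology_def middle_cohomology_def)
 have f2: "fst (cohomology V' (%p. D') p) = {z : fst (V' p). D' z : snd (V' (p + 1))}"
  "snd (cohomology V' (%p. D') p) = {D' w + b | w b. w : fst (V' (p - 1)) & b : snd (V' p)}"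
  by (simp_all add: cohomology_def middle_cohomology_def)
 have D1: "D w : fst (V p)" if "w : fst (V (p - 1))" for w using D(3)[OF that] by simp
 have im2: "snd (cohomology V' (%p. D') p) = T ` snd (cohomology V (%p. D) p)"
 proof
  show "snd (cohomology V' (%p. D') p) \<subseteq> T ` snd (cohomology V (%p. D) p)"
  proof
   fix y assume "y : snd (cohomology V' (%p. D') p)"
   then obtain w b where wb: "y = D' (T w) + T b" "w : fst (V (p - 1))" "b : snd (V p)" unfolding f2 V' by auto
   have "y = T (D (fscale ka w) + b)" unfolding wb(1) com'[OF wb(2)] linD(1)[OF T] linD(2)[OF D(1)] ..
   thus "y : T ` snd (cohomology V (%p. D) p)" unfolding f1 using wb subspaceD(3)[OF sV(1) wb(2)] by blast
  qed
  show "T ` snd (cohomology V (%p. D) p) \<subseteq> snd (cohomology V' (%p. D') p)"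
  proof
   fix y assume "y : T ` snd (cohomology V (%p. D) p)"
   then obtain w b where wb: "y = T (D w + b)" "w : fst (V (p - 1))" "b : snd (V p)" unfolding f1 by auto
   have kw: "fscale ka w : fst (V (p - 1))" using subspaceD(3)[OF sV(1) wb(2)] .
   have "D' (T (fscale ka w)) = T (D w)" unfolding com'[OF kw] linD(2)[OF D(1)] kk ..
   hence "y = D' (T (fscale ka w)) + T b" unfolding wb(1) linD(1)[OF T] by simp
   thus "y : snd (cohomology V' (%p. D') p)" unfolding f2 V' using kw wb(3) by auto
  qed
 qed
 have sub1: "snd (cohomology V (%p. D) p) \<subseteq> fst (V p)" using sub[OF V] f1(1) by (auto simp: subquotient_def)
 have iffZ: "D' (T x) : snd (V' (p + 1)) \<longleftrightarrow> D x : snd (V (p + 1))" if x: "x : fst (V p)" for x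
 proof
  assume "D' (T x) : snd (V' (p + 1))"
  then obtain y where y: "y : snd (V (p + 1))" "T (fscale ka (D x)) = T y" unfolding com'[OF x] V' by auto
  have "fscale ka (D x) = y"
   using injT[OF _ _ y(2), of "p + 1"] subspaceD(3)[OF sV(1) D(3)[OF x]] y(1) sV(3) by blast
  hence "D x = fscale ka y" using kk by metis
  thus "D x : snd (V (p + 1))" using subspaceD(3)[OF sV(2) y(1)] by simp
 next
  assume "D x : snd (V (p + 1))"
  thus "D' (T x) : snd (V' (p + 1))" unfolding com'[OF x] V' using subspaceD(3)[OF sV(2)] by auto
 qed
 show "cohomology V (%p. D) p \<cong>\<^sub>\<rat> cohomology V' (%p. D') p"
 proof (rule subq_isomorphicI[OF sub[OF V] sub[OF c'] T])
  show "T x : fst (cohomology V' (%p. D') p)" if "x : fst (cohomology V (%p. D) p)" for x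
   using that iffZ[of x] unfolding f1 f2 by (auto simp: V')
  show "T x : snd (cohomology V' (%p. D') p)" if "x : snd (cohomology V (%p. D) p)" for x
   unfolding im2 using that by blast
  show "z : snd (cohomology V (%p. D) p)"
   if z: "z : fst (cohomology V (%p. D) p)" "T z : snd (cohomology V' (%p. D') p)" for z
  proof -
   obtain y where y: "y : snd (cohomology V (%p. D) p)" "T z = T y" using z(2) unfolding im2 by blast
   have "z = y" using injT[OF _ _ y(2), of p] z(1) y(1) sub1 unfolding f1 by blast
   thus ?thesis using y by simp
  qed
  show "\<exists>z\<in>fst (cohomology V (%p. D) p). z' - T z : snd (cohomology V' (%p. D') p)"
   if z': "z' : fst (cohomology V' (%p. D') p)" for z'
  proof -
   obtain x where x: "x : fst (V p)" "z' = T x" "D' (T x) : snd (V' (p + 1))" using z' unfolding f2 V' by auto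
   have "x : fst (cohomology V (%p. D) p)" unfolding f1 using iffZ[OF x(1)] x by blast
   moreover have "z' - T x = 0" using x by simp
   moreover have "0 : snd (cohomology V' (%p. D') p)" using sub[OF c'] by (simp add: subquotient_def subspaceD(1))
   ultimately show ?thesis by (intro bexI[of _ x]) auto
  qed
 qed
qed

text \<open>A monomial change of basis; the factors s will be the signs comparing two orders of the
  crossings.\<close>

definition transport :: "('a => 'b) => 'a set => ('a => rat) => ('a => rat) => 'b => rat" where
 "transport Ph B s f = (%t. if t : Ph ` B then s (inv_into B Ph t) * f (inv_into B Ph t) else 0)"

lemma lin_transport: "lin (transport Ph B s)"
 by (rule linI) (auto simp: transport_def fun_eq_iff fscale_def algebra_simps)

lemma transport_at: "inj_on Ph B ==> x : B ==> transport Ph B s f (Ph x) = s x * f x"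
 by (simp add: transport_def)

lemma transport_spanned:
 assumes inj: "inj_on Ph B" and s: "!!x. x : B ==> s x * s x = 1" and S: "S \<subseteq> B"
 shows "transport Ph B s ` spanned_by S = spanned_by (Ph ` S)"
proof (intro equalityI subsetI)
 fix g assume "g : transport Ph B s ` spanned_by S"
 then obtain f where f: "f : spanned_by S" "g = transport Ph B s f" by blast
 show "g : spanned_by (Ph ` S)"
 proof (rule spanned_byI)
  fix t assume t: "g t ~= 0"
  hence tB: "t : Ph ` B" unfolding f(2) transport_def by (auto split: if_splits)
  then obtain x where x: "x : B" "t = Ph x" by blast
  have "f x ~= 0" using t unfolding f(2) x(2) transport_at[OF inj x(1)] by auto
  thus "t : Ph ` S" using spanned_byD[OF f(1)] x(2) by blast
 qed
next
 fix g assume g: "g : spanned_by (Ph ` S)"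
 define f where "f x = (if x : S then s x * g (Ph x) else 0)" for x
 have f: "f : spanned_by S" by (rule spanned_byI) (auto simp: f_def split: if_splits)
 have "transport Ph B s f = g"
 proof
  fix t
  show "transport Ph B s f t = g t"
  proof (cases "t : Ph ` B")
   case True
   then obtain x where x: "x : B" "t = Ph x" by blast
   show ?thesis
   proof (cases "x : S")
    case True thus ?thesis unfolding x(2) transport_at[OF inj x(1)] f_def using s[OF x(1)] by (simp add: mult.assoc[symmetric])
   next
    case False
    hence "Ph x ~: Ph ` S" using inj x(1) S by (auto dest: inj_onD)
    hence "g (Ph x) = 0" using spanned_byD[OF g] by blast
    thus ?thesis unfolding x(2) transport_at[OF inj x(1)] f_def using False by simp
   qed
  next
   case False
   hence "t ~: Ph ` S" using S by blast
   hence "g t = 0" using spanned_byD[OF g] by blast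
   thus ?thesis using False by (simp add: transport_def)
  qed
 qed
 thus "g : transport Ph B s ` spanned_by S" using f by blast
qed

lemma transport_eq_0:
 assumes inj: "inj_on Ph B" and s: "!!x. x : B ==> s x * s x = 1" and f: "f : spanned_by B" "transport Ph B s f = 0"
 shows "f = 0"
proof
 fix x
 show "f x = 0 x"
 proof (cases "x : B")
  case True
  have "s x * f x = 0" using transport_at[OF inj True, of s f] f(2) by simp
  moreover have "s x ~= 0" using s[OF True] by auto
  ultimately show ?thesis by simp
 next
  case False thus ?thesis using spanned_byD[OF f(1)] by auto
 qed
qed

lemma transport_matrix:
 assumes inj: "inj_on Ph B" and s: "!!x. x : B ==> s x * s x = 1" and f: "f : spanned_by S" "S \<subseteq> B"
  and M: "!!x y. x : S ==> y : B ==> M' (Ph y) (Ph x) = ka * (s y * s x * M y x)"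
 shows "matrix_map (Ph ` B) M' (transport Ph B s f) = fscale ka (transport Ph B s (matrix_map B M f))"
proof
 fix t
 show "matrix_map (Ph ` B) M' (transport Ph B s f) t = fscale ka (transport Ph B s (matrix_map B M f)) t"
 proof (cases "t : Ph ` B")
  case True
  then obtain y where y: "y : B" "t = Ph y" by blast
  have e: "M' (Ph y) (Ph x) * transport Ph B s f (Ph x) = ka * s y * (M y x * f x)" if x: "x : B" for x
  proof (cases "x : S")
   case True
   have "M' (Ph y) (Ph x) * transport Ph B s f (Ph x) = ka * (s y * s x * M y x) * (s x * f x)"
    unfolding M[OF True y(1)] transport_at[OF inj x] ..
   also have "\<dots> = ka * s y * (M y x * f x) * (s x * s x)" by (simp add: algebra_simps)
   finally show ?thesis using s[OF x] by simp
  next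
   case False
   hence "f x = 0" using spanned_byD[OF f(1)] by blast
   thus ?thesis unfolding transport_at[OF inj x] by simp
  qed
  have "matrix_map (Ph ` B) M' (transport Ph B s f) t = (\<Sum>x\<in>B. M' (Ph y) (Ph x) * transport Ph B s f (Ph x))"
   using True y(2) by (simp add: matrix_map_def sum.reindex[OF inj])
  also have "\<dots> = (\<Sum>x\<in>B. ka * s y * (M y x * f x))" by (intro sum.cong refl e)
  also have "\<dots> = ka * (s y * matrix_map B M f y)" using y(1) by (simp add: matrix_map_def sum_distrib_left mult.assoc)
  finally show ?thesis unfolding y(2) fscale_def transport_at[OF inj y(1)] .
 next
  case False thus ?thesis by (simp add: matrix_map_def fscale_def transport_def)
 qed
qed

section \<open>Tensor products with a space that has a basis\<close>

text \<open>Since the first factor has a basis, a tensor is a family of rows, one for each basis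
  element x. A single row is a pure tensor, and there are finitely many rows.\<close>

lemma span_tensors:
 assumes fin: "finite G" and W: "!!k. fun_vs.subspace (W k)"
 shows "fun_vs.span (\<Union>k. pure_tensors (spanned_by {x : G. deg x = k}) (W (j - k))) =
  {g. (\<forall>x y. x ~: G --> g (x, y) = 0) & (\<forall>x\<in>G. (%y. g (x, y)) : W (j - deg x))}" (is "fun_vs.span ?P = ?S")
proof (intro equalityI)
 have z: "(%y. 0) : W k" for k using subspaceD(1)[OF W] by (simp add: zero_fun_def)
 show "fun_vs.span ?P \<subseteq> ?S"
 proof (rule fun_vs.span_minimal)
  show "?P \<subseteq> ?S"
  proof
   fix g assume "g : ?P"
   then obtain k u w where g: "g = (%(x, y). u x * w y)" "u : spanned_by {x : G. deg x = k}" "w : W (j - k)"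
    unfolding pure_tensors_def by blast
   have "(%y. g (x, y)) : W (j - deg x)" for x
   proof (cases "u x = 0")
    case True thus ?thesis using z by (simp add: g(1))
   next
    case False
    hence "deg x = k" using spanned_byD[OF g(2)] by blast
    thus ?thesis using subspaceD(3)[OF W g(3), of "u x"] by (simp add: g(1) fscale_def)
   qed
   moreover have "g (x, y) = 0" if "x ~: G" for x y
   proof -
    have "u x = 0" using spanned_byD[OF g(2)] that by blast
    thus ?thesis by (simp add: g(1))
   qed
   ultimately show "g : ?S" by blast
  qed
  show "fun_vs.subspace ?S"
  proof (rule subspaceI)
   show "0 : ?S" using z by simp
   show "f + g : ?S" if fg: "f : ?S" "g : ?S" for f g
   proof -
    have "(%y. f (x, y)) + (%y. g (x, y)) : W (j - deg x)" if "x : G" for x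
     using fg that by (intro subspaceD(2)[OF W]) blast+
    thus ?thesis using fg by (simp add: plus_fun_def)
   qed
   show "fscale c f : ?S" if f: "f : ?S" for c f
   proof -
    have "fscale c (%y. f (x, y)) : W (j - deg x)" if "x : G" for x
     using f that by (intro subspaceD(3)[OF W]) blast
    thus ?thesis using f by (simp add: fscale_def)
   qed
  qed
 qed
 show "?S \<subseteq> fun_vs.span ?P"
 proof
  fix g assume g: "g : ?S"
  define t where "t x = (%(x', y). (if x' = x then 1 else 0) * g (x, y))" for x
  have "t x : ?P" if x: "x : G" for x
  proof -
   have "(%x'. if x' = x then 1 else 0) : spanned_by {x' : G. deg x' = deg x}"
    using x by (intro spanned_byI) (auto split: if_splits)
   moreover have "(%y. g (x, y)) : W (j - deg x)" using g x by blast
   ultimately have "t x : pure_tensors (spanned_by {x' : G. deg x' = deg x}) (W (j - deg x))"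
    unfolding pure_tensors_def t_def
    by (intro CollectI exI[of _ "%x'. if x' = x then 1 else 0"] exI[of _ "%y. g (x, y)"] conjI refl)
   thus ?thesis by blast
  qed
  hence "(\<Sum>x\<in>G. t x) : fun_vs.span ?P" by (intro fun_vs.span_sum fun_vs.span_base)
  moreover have "(\<Sum>x\<in>G. t x) = g"
  proof
   fix z :: "'a \<times> 'c"
   obtain x y where xy: "z = (x, y)" by (cases z)
   have "(\<Sum>x\<in>G. t x) z = (\<Sum>x'\<in>G. t x' z)" using fin by (induction G rule: finite_induct) auto
   also have "\<dots> = (\<Sum>x'\<in>G. if x' = x then g (x, y) else 0)" unfolding t_def xy by (intro sum.cong refl) auto
   also have "\<dots> = g z" using fin g xy by (auto simp: sum.delta)
   finally show "(\<Sum>x\<in>G. t x) z = g z" .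
  qed
  ultimately show "g : fun_vs.span ?P" by simp
 qed
qed

lemma graded_tensor_eq:
 assumes fin: "finite G" and W: "!!k. fun_vs.subspace (fst (W k))" "!!k. fun_vs.subspace (snd (W k))"
 shows "graded_tensor (%k. (spanned_by {x : G. deg x = k}, {0})) W j =
  ({g. (\<forall>x y. x ~: G --> g (x, y) = 0) & (\<forall>x\<in>G. (%y. g (x, y)) : fst (W (j - deg x)))},
  {g. (\<forall>x y. x ~: G --> g (x, y) = 0) & (\<forall>x\<in>G. (%y. g (x, y)) : snd (W (j - deg x)))})"
proof -
 have z: "pure_tensors {0} X \<subseteq> {0}" for X :: "('b => rat) set" by (auto simp: pure_tensors_def fun_eq_iff)
 let ?P = "\<Union>k. pure_tensors (spanned_by {x : G. deg x = k}) (snd (W (j - k)))"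
 have "fun_vs.span (\<Union>k. pure_tensors (spanned_by {x : G. deg x = k}) (snd (W (j - k))) Un pure_tensors {0} (fst (W (j - k)))) =
   fun_vs.span ?P"
 proof (intro equalityI)
  have "pure_tensors {0} (fst (W (j - k))) \<subseteq> fun_vs.span ?P" for k
   using z[of "fst (W (j - k))"] fun_vs.span_zero[of ?P] by (metis (no_types, lifting) empty_subsetI insert_subset order_trans)
  moreover have "?P \<subseteq> fun_vs.span ?P" by (rule fun_vs.span_superset)
  ultimately have "(\<Union>k. pure_tensors (spanned_by {x : G. deg x = k}) (snd (W (j - k))) Un pure_tensors {0} (fst (W (j - k)))) \<subseteq> fun_vs.span ?P"
   by blast
  thus "fun_vs.span (\<Union>k. pure_tensors (spanned_by {x : G. deg x = k}) (snd (W (j - k))) Un pure_tensors {0} (fst (W (j - k)))) \<subseteq> fun_vs.span ?P"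
   by (rule fun_vs.span_minimal) (rule fun_vs.subspace_span)
  show "fun_vs.span ?P \<subseteq> fun_vs.span (\<Union>k. pure_tensors (spanned_by {x : G. deg x = k}) (snd (W (j - k))) Un pure_tensors {0} (fst (W (j - k))))"
   by (rule fun_vs.span_mono) blast
 qed
 thus ?thesis unfolding graded_tensor_def using span_tensors[where W = "%k. fst (W k)", OF fin W(1)] span_tensors[where W = "%k. snd (W k)", OF fin W(2)] by simp
qed

text \<open>N stands for the partitions, X A for generators on the inner circles of one side, Y A
  for generators of the closure of the other side, with differential K A.\<close>

locale split_basis =
 fixes N :: "'n set" and X :: "'n => 'x set" and Y :: "'n => 'y set" and K :: "'n => 'y => 'y => rat"
  and h1 g1 :: "'x => int" and h2 g2 :: "'n => 'y => int"
 assumes finN: "finite N" and finX: "!!A. A : N ==> finite (X A)" and finY: "!!A. A : N ==> finite (Y A)"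
begin

definition "SG = {(A, x, y). A : N & x : X A & y : Y A}"
definition "SM = (%(A2, x2, y2) (A1, x1, y1). if A2 = A1 & x2 = x1 then K A1 y2 y1 else 0)"
definition "kd A = matrix_map (Y A) (K A)"
definition "kc A q j = spanned_by {y : Y A. h2 A y = q & g2 A y = j}"
definition "KH A q j = cohomology (%i. (kc A i j, {0})) (%_. kd A) q"
definition "cell p q j = {(A, x, y) : SG. h1 x = p & h2 A y = q & g1 x + g2 A y = j}"

lemma finSG: "finite SG"
proof -
 have "SG = Sigma N (%A. X A \<times> Y A)" by (auto simp: SG_def)
 thus ?thesis using finN finX finY by simp
qed

lemma KH_eq: "KH A q j = ({z : kc A q j. kd A z = 0}, kd A ` kc A (q - 1) j)"
 unfolding KH_def cohomology_def middle_cohomology_def by auto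

lemma lin_kd: "lin (kd A)" unfolding kd_def by (rule lin_matrix_map)

lemma subspace_KH: "fun_vs.subspace (fst (KH A q j))" "fun_vs.subspace (snd (KH A q j))"
proof -
 have k: "fun_vs.subspace (kc A q j)" for q unfolding kc_def by (rule subspace_spanned_by)
 have "fun_vs.subspace {0 :: 'y => rat}" by (rule fun_vs.subspace_single_0)
 from subspace_Z[OF lin_kd k this] show "fun_vs.subspace (fst (KH A q j))" unfolding KH_eq by simp
 show "fun_vs.subspace (snd (KH A q j))" unfolding KH_eq using subspace_image[OF lin_kd k] by simp
qed

lemma SM_row:
 assumes "A : N" "x : X A" shows "(%y. matrix_map SG SM f (A, x, y)) = kd A (%y. f (A, x, y))"
proof
 fix y
 show "matrix_map SG SM f (A, x, y) = kd A (%y. f (A, x, y)) y"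
 proof (cases "y : Y A")
  case True
  hence t: "(A, x, y) : SG" using assms by (simp add: SG_def)
  let ?i = "%y'. (A, x, y')"
  have sub: "?i ` Y A \<subseteq> SG" using assms by (auto simp: SG_def)
  have "matrix_map SG SM f (A, x, y) = (\<Sum>t\<in>SG. SM (A, x, y) t * f t)" using t by (simp add: matrix_map_def)
  also have "\<dots> = (\<Sum>t\<in>?i ` Y A. SM (A, x, y) t * f t)"
   by (rule sum.mono_neutral_right[OF finSG sub]) (auto simp: SM_def SG_def)
  also have "\<dots> = (\<Sum>y'\<in>Y A. K A y y' * f (A, x, y'))" by (subst sum.reindex) (auto simp: inj_on_def SM_def)
  finally show ?thesis using True by (simp add: kd_def matrix_map_def)
 next
  case False thus ?thesis by (simp add: kd_def matrix_map_def SG_def)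
 qed
qed

lemma cell_iff:
 "f : spanned_by (cell p q j) \<longleftrightarrow> (\<forall>A x y. A ~: N --> f (A, x, y) = 0) &
  (\<forall>A\<in>N. (\<forall>x y. x ~: {x : X A. h1 x = p} --> f (A, x, y) = 0) &
   (\<forall>x\<in>{x : X A. h1 x = p}. (%y. f (A, x, y)) : kc A q (j - g1 x)))"
  (is "_ \<longleftrightarrow> ?R")
proof
 assume "f : spanned_by (cell p q j)"
 thus ?R unfolding spanned_by_def cell_def SG_def kc_def by auto
next
 assume h: ?R
 show "f : spanned_by (cell p q j)"
 proof (rule spanned_byI)
  fix t assume t: "f t ~= 0"
  obtain A x y where e: "t = (A, x, y)" by (cases t)
  have A: "A : N" using h t unfolding e by blast
  have x: "x : {x : X A. h1 x = p}" using h A t unfolding e by blast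
  have "(%y. f (A, x, y)) : kc A q (j - g1 x)" using h A x by blast
  hence "y : {y : Y A. h2 A y = q & g2 A y = j - g1 x}"
   using spanned_byD[of "%y. f (A, x, y)"] t unfolding e kc_def by blast
  thus "t : cell p q j" using A x unfolding e by (simp add: cell_def SG_def)
 qed
qed

text \<open>Tensoring with a space that has a basis is exact: kernel and image of the vertical
  differential are found row by row.\<close>

lemma vertical:
 "direct_sum N (%A. graded_tensor (%k. (spanned_by {x : X A. h1 x = p & g1 x = k}, {0})) (KH A q) j) =
  ({f : spanned_by (cell p q j). matrix_map SG SM f = 0}, matrix_map SG SM ` spanned_by (cell p (q - 1) j))"
proof -
 define G where "G A = {x : X A. h1 x = p}" for A
 have G: "{x : X A. h1 x = p & g1 x = k} = {x : G A. g1 x = k}" for A k by (auto simp: G_def)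
 have gt: "graded_tensor (%k. (spanned_by {x : X A. h1 x = p & g1 x = k}, {0})) (KH A q) j =
  ({g. (\<forall>x y. x ~: G A --> g (x, y) = 0) & (\<forall>x\<in>G A. (%y. g (x, y)) : fst (KH A q (j - g1 x)))},
  {g. (\<forall>x y. x ~: G A --> g (x, y) = 0) & (\<forall>x\<in>G A. (%y. g (x, y)) : snd (KH A q (j - g1 x)))})" if "A : N" for A
  unfolding G by (rule graded_tensor_eq) (use finX[OF that] subspace_KH in "simp_all add: G_def")
 have row0: "matrix_map SG SM f = 0 \<longleftrightarrow> (\<forall>A\<in>N. \<forall>x\<in>X A. kd A (%y. f (A, x, y)) = 0)" for f
 proof
  assume h: "matrix_map SG SM f = 0"
  show "\<forall>A\<in>N. \<forall>x\<in>X A. kd A (%y. f (A, x, y)) = 0"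
  proof (intro ballI)
   fix A x assume "A : N" "x : X A"
   from SM_row[OF this, of f] show "kd A (%y. f (A, x, y)) = 0" unfolding h by (simp add: fun_eq_iff)
  qed
 next
  assume h: "\<forall>A\<in>N. \<forall>x\<in>X A. kd A (%y. f (A, x, y)) = 0"
  show "matrix_map SG SM f = 0"
  proof
   fix t :: "'n \<times> 'x \<times> 'y"
   obtain A x y where t: "t = (A, x, y)" by (cases t)
   show "matrix_map SG SM f t = 0 t"
   proof (cases "A : N & x : X A")
    case True thus ?thesis using fun_cong[OF SM_row[of A x f], of y] h unfolding t by simp
   next
    case False thus ?thesis unfolding t by (auto simp: matrix_map_def SG_def)
   qed
  qed
 qed
 have kd0: "kd A (%y. 0) = 0" for A using linD(3)[OF lin_kd] by (simp add: zero_fun_def)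
 have "{f. (\<forall>A\<in>N. (%z. f (A, z)) : {g. (\<forall>x y. x ~: G A --> g (x, y) = 0) & (\<forall>x\<in>G A. (%y. g (x, y)) : fst (KH A q (j - g1 x)))}) &
    (\<forall>A z. A ~: N --> f (A, z) = 0)} = {f : spanned_by (cell p q j). matrix_map SG SM f = 0}" (is "?L = ?R")
 proof (intro set_eqI)
  fix f
  have "f : ?R \<longleftrightarrow> f : spanned_by (cell p q j) & (\<forall>A\<in>N. \<forall>x\<in>G A. kd A (%y. f (A, x, y)) = 0)"
  proof -
   have "kd A (%y. f (A, x, y)) = 0" if "f : spanned_by (cell p q j)" "A : N" "x ~: G A" for A x
   proof -
    have "(%y. f (A, x, y)) = (%y. 0)" using that unfolding cell_iff G_def by blast
    thus ?thesis by (simp only: kd0)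
   qed
   moreover have "G A \<subseteq> X A" for A by (auto simp: G_def)
   ultimately show ?thesis unfolding mem_Collect_eq row0 by blast
  qed
  also have "\<dots> \<longleftrightarrow> f : ?L" unfolding cell_iff KH_eq G_def[symmetric] by auto
  finally show "f : ?L \<longleftrightarrow> f : ?R" by blast
 qed
 moreover have "{f. (\<forall>A\<in>N. (%z. f (A, z)) : {g. (\<forall>x y. x ~: G A --> g (x, y) = 0) & (\<forall>x\<in>G A. (%y. g (x, y)) : snd (KH A q (j - g1 x)))}) &
    (\<forall>A z. A ~: N --> f (A, z) = 0)} = matrix_map SG SM ` spanned_by (cell p (q - 1) j)" (is "?L = ?R")
 proof (intro equalityI subsetI)
  fix f assume "f : ?L"
  hence f: "!!A x y. A : N ==> x ~: G A ==> f (A, x, y) = 0" "!!A x. A : N ==> x : G A ==> (%y. f (A, x, y)) : kd A ` kc A (q - 1) (j - g1 x)"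
   "!!A x y. A ~: N ==> f (A, x, y) = 0" by (auto simp: KH_eq)
  \<comment> \<open>A preimage is chosen for every row, and the rows are reassembled.\<close>
  have "\<forall>A x. \<exists>w. A : N --> x : G A --> w : kc A (q - 1) (j - g1 x) & kd A w = (%y. f (A, x, y))"
   using f(2) by (metis (no_types, lifting) imageE)
  then obtain w where w: "!!A x. A : N ==> x : G A ==> w A x : kc A (q - 1) (j - g1 x)" "!!A x. A : N ==> x : G A ==> kd A (w A x) = (%y. f (A, x, y))"
   by metis
  define h where "h = (%(A, x, y). if A : N & x : G A then w A x y else 0)"
  have hw: "(%y. h (A, x, y)) = (if A : N & x : G A then w A x else (%y. 0))" for A x by (auto simp: h_def)
  have "h : spanned_by (cell p (q - 1) j)" unfolding cell_iff G_def[symmetric] hw using w(1) by (auto simp: h_def)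
  moreover have "matrix_map SG SM h = f"
  proof
   fix t :: "'n \<times> 'x \<times> 'y"
   obtain A x y where t: "t = (A, x, y)" by (cases t)
   show "matrix_map SG SM h t = f t"
   proof (cases "A : N & x : X A")
    case True
    hence "matrix_map SG SM h t = kd A (%y. h (A, x, y)) y" unfolding t using fun_cong[OF SM_row[of A x h], of y] by simp
    also have "\<dots> = f t" unfolding hw t using True w(2)[of A x] kd0[of A] f(1)[of A x y] by auto
    finally show ?thesis .
   next
    case False
    hence "A ~: N \<or> x ~: G A" by (auto simp: G_def)
    hence "f t = 0" unfolding t using f(1,3) by blast
    thus ?thesis using False unfolding t by (auto simp: matrix_map_def SG_def)
   qed
  qed
  ultimately show "f : ?R" by blast
 next
  fix f assume "f : ?R"
  then obtain h where h: "h : spanned_by (cell p (q - 1) j)" "f = matrix_map SG SM h" by blast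
  note h' = h(1)[unfolded cell_iff G_def[symmetric]]
  have "f (A, z) = 0" if "A ~: N" for A z unfolding h(2) using that by (cases z) (simp add: matrix_map_def SG_def)
  moreover have "f (A, x, y) = 0" if A: "A : N" "x ~: G A" for A x y
  proof (cases "x : X A")
   case True
   have "(%y. h (A, x, y)) = (%y. 0)" using h' A by blast
   thus ?thesis unfolding h(2) using fun_cong[OF SM_row[OF A(1) True, of h], of y] kd0 by simp
  next
   case False thus ?thesis unfolding h(2) by (simp add: matrix_map_def SG_def)
  qed
  moreover have "(%y. f (A, x, y)) : kd A ` kc A (q - 1) (j - g1 x)" if A: "A : N" "x : G A" for A x
  proof -
   have "x : X A" using A(2) by (simp add: G_def)
   thus ?thesis unfolding h(2) SM_row[OF A(1) \<open>x : X A\<close>] using h' A by blast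
  qed
  ultimately show "f : ?L" by (simp add: KH_eq)
 qed
 ultimately show ?thesis unfolding direct_sum_def direct_sum_of_spaces_def using gt by (simp cong: ball_cong)
qed

end

lemma closing_simps:
 "crossings (closing T A) = crossings T" "positive (closing T A) = positive T" "arcs (closing T A) = arcs T"
 "num_pos (closing T A) = num_pos T" "num_neg (closing T A) = num_neg T"
 by (simp_all add: closing_def num_pos_def num_neg_def)

section \<open>Splitting the generators and the differential along the cut\<close>

context two_sides
begin

abbreviation "CC \<equiv> circles (diagram_of L)"
abbreviation "sp \<equiv> split_gen L C R R'"

lemma split_gen_eq:
 "sp (al, ep) = (part al, (al Int R, restrict ep (inn al)), (al Int R', \<lambda>w\<in>out al. ep (tau al w)))"
proof -
 have "(\<lambda>w\<in>out al. ep (THE z. z : CC al & \<Union>z Int (R' - R) = \<Union>w)) = (\<lambda>w\<in>out al. ep (tau al w))"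
  by (rule restrict_ext) (simp only: the_tau)
 thus ?thesis unfolding split_gen_def Let_def prod.case tang_def[symmetric] state_part by (simp only:)
qed

lemma crossings_side: "CR Int R = CR Int U" "CR Int R' = CR Int W"
 using off_cut by blast+

lemma state_sides:
 assumes "al \<subseteq> CR"
 shows "al = (al Int R) Un (al Int R')" "al Int R \<subseteq> CR Int U" "al Int R' \<subseteq> CR Int W"
 using assms crossings_split[OF UW] crossings_side by blast+

lemma generators_iff: "(al, ep) : generators (diagram_of L) \<longleftrightarrow> al \<subseteq> CR & ep : labellings (CC al)"
 by (simp add: generators_def diagram_of_simps)

lemma split_mem: assumes x: "(al, ep) : generators (diagram_of L)" shows "sp (al, ep) : split_generators L C R R'"
proof -
 have a: "al \<subseteq> CR" and e: "ep : labellings (CC al)" using x unfolding generators_iff by auto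
 have "restrict ep (inn al) : labellings (inn al)"
  using e unfolding labellings_def circles_split by (simp add: PiE_iff)
 moreover have "(\<lambda>w\<in>out al. ep (tau al w)) : labellings (out al)"
  using e unfolding labellings_def circles_split by (simp add: PiE_iff)
 ultimately show ?thesis unfolding split_gen_eq split_generators_def inner_generators_def generators_def tang_def[symmetric]
  using state_sides(2,3)[OF a] part_NC state_part[of al] tang_simps(3)[OF side(1)] tang_simps(3)[OF side(2)]
  by (simp add: closing_simps)
qed

lemma split_inj: "inj_on sp (generators (diagram_of L))"
proof (rule inj_onI, clarify)
 fix al ep bet et
 assume x: "(al, ep) : generators (diagram_of L)" "(bet, et) : generators (diagram_of L)" "sp (al, ep) = sp (bet, et)"
 have a: "al \<subseteq> CR" "bet \<subseteq> CR" and e: "ep : labellings (CC al)" "et : labellings (CC bet)"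
  using x(1,2) unfolding generators_iff by auto
 have "al Int R = bet Int R" "al Int R' = bet Int R'" using x(3) unfolding split_gen_eq prod.inject by blast+
 hence ab: "al = bet" using state_sides(1)[OF a(1)] state_sides(1)[OF a(2)] by simp
 have r: "restrict ep (inn al) = restrict et (inn al)" "(\<lambda>w\<in>out al. ep (tau al w)) = (\<lambda>w\<in>out al. et (tau al w))"
  using x(3) unfolding split_gen_eq ab prod.inject by simp_all
 have "ep z = et z" for z
 proof (cases "z : CC al")
  case True
  then consider "z : inn al" | w where "w : out al" "z = tau al w" unfolding circles_split by blast
  thus ?thesis
  proof cases
   case 1 thus ?thesis using fun_cong[OF r(1), of z] by simp
  next
   case 2 thus ?thesis using fun_cong[OF r(2), of w] by simp
  qed
 next
  case False
  thus ?thesis using e unfolding ab labellings_def by (metis PiE_arb)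
 qed
 thus "al = bet & ep = et" using ab by blast
qed

text \<open>A labelling of the circles of L is put together from the labels of the inner circles
  and, through the inverse of \<open>tau\<close>, those of the closure.\<close>

lemma split_surj: assumes t: "t : split_generators L C R R'" shows "t : sp ` generators (diagram_of L)"
proof -
 obtain A bet ep1 ga ep2 where t': "t = (A, (bet, ep1), (ga, ep2))" by (metis surj_pair)
 have b: "bet \<subseteq> CR Int U" "state_partition (tang U) bet = A" "ep1 : labellings (inner_circles (tang U) bet)"
  using t unfolding t' split_generators_def inner_generators_def tang_def[symmetric] by (simp_all add: tang_simps(3)[OF side(1)])
 have c: "ga \<subseteq> CR Int W" "ep2 : labellings (circles (closing (tang W) A) ga)"
  using t unfolding t' split_generators_def generators_def tang_def[symmetric] by (simp_all add: tang_simps(3)[OF side(2)] closing_simps)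
 define al where "al = bet Un ga"
 have a: "al Int R = bet" "al Int R' = ga" "al \<subseteq> CR" using b(1) c(1) side(3) off_cut unfolding al_def by blast+
 have A: "part al = A" using state_part[of al] a(1) b(2) by simp
 have b3: "ep1 : labellings (inn al)" and c2: "ep2 : labellings (out al)" using b(3) c(2) a(1,2) A by simp_all
 have ti: "inj_on (tau al) (out al)" using tau_inj[of al al] by simp
 have dis: "inn al Int tau al ` out al = {}" using inner_tau_disjoint[of al al] by simp
 define ep where "ep = (\<lambda>z\<in>CC al. if z : inn al then ep1 z else ep2 (inv_into (out al) (tau al) z))"
 have e1: "ep z = ep1 z" if "z : inn al" for z using that unfolding ep_def circles_split by simp
 have e2: "ep (tau al w) = ep2 w" if w: "w : out al" for w
 proof -
  have "tau al w ~: inn al" "tau al w : CC al" using dis w unfolding circles_split by blast+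
  thus ?thesis unfolding ep_def using inv_into_f_f[OF ti w] by simp
 qed
 have "ep z : {1, -1}" if "z : CC al" for z
 proof -
  from that consider "z : inn al" | w where "w : out al" "z = tau al w" unfolding circles_split by blast
  thus ?thesis
  proof cases
   case 1 show ?thesis unfolding e1[OF 1] by (rule PiE_mem[OF b3[unfolded labellings_def] 1])
  next
   case 2 show ?thesis unfolding 2(2) e2[OF 2(1)] by (rule PiE_mem[OF c2[unfolded labellings_def] 2(1)])
  qed
 qed
 hence "ep : labellings (CC al)" unfolding labellings_def by (intro PiE_I) (simp_all add: ep_def)
 hence g: "(al, ep) : generators (diagram_of L)" unfolding generators_iff using a(3) by simp
 have x: "ep1 : extensional (inn al)" "ep2 : extensional (out al)" using b3 c2 unfolding labellings_def by (simp_all add: PiE_iff)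
 have "restrict ep (inn al) = ep1" by (rule extensionalityI[OF restrict_extensional x(1)]) (simp only: restrict_apply' e1)
 moreover have "(\<lambda>w\<in>out al. ep (tau al w)) = ep2"
  by (rule extensionalityI[OF restrict_extensional x(2)]) (simp only: restrict_apply' e2)
 ultimately have "sp (al, ep) = t" unfolding split_gen_eq t' A a by simp
 thus ?thesis using g by (metis imageI)
qed

lemma split_image: "sp ` generators (diagram_of L) = split_generators L C R R'"
proof (intro equalityI subsetI)
 fix t assume "t : sp ` generators (diagram_of L)"
 then obtain al ep where "(al, ep) : generators (diagram_of L)" "t = sp (al, ep)" by (metis imageE surj_pair)
 thus "t : split_generators L C R R'" using split_mem by simp
qed (rule split_surj)

lemma finite_chi: "finite CR"
 using kh.finite_crossings by (simp add: diagram_of_simps)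

lemma split_card: "X \<subseteq> CR ==> card X = card (X Int U) + card (X Int W)"
proof -
 assume X: "X \<subseteq> CR"
 have "X = X Int U Un X Int W" using X crossings_split[OF UW] by blast
 hence "card X = card (X Int U Un X Int W)" by simp
 also have "\<dots> = card (X Int U) + card (X Int W)"
  using side(3) finite_subset[OF X finite_chi] by (intro card_Un_disjoint) auto
 finally show ?thesis .
qed

lemma split_num:
 "num_pos (diagram_of L) = num_pos (tang U) + num_pos (tang W)" "num_neg (diagram_of L) = num_neg (tang U) + num_neg (tang W)"
proof -
 have e: "{c : CR. p c} Int Y = {c : CR Int Y. p c}" for p Y by blast
 show "num_pos (diagram_of L) = num_pos (tang U) + num_pos (tang W)"
  unfolding num_pos_def diagram_of_simps tang_simps(3,4)[OF side(1)] tang_simps(3,4)[OF side(2)]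
  using split_card[of "{c : CR. positive_crossing L c}"] unfolding e by blast
 show "num_neg (diagram_of L) = num_neg (tang U) + num_neg (tang W)"
  unfolding num_neg_def diagram_of_simps tang_simps(3,4)[OF side(1)] tang_simps(3,4)[OF side(2)]
  using split_card[of "{c : CR. ~ positive_crossing L c}"] unfolding e by blast
qed

lemma state_card: assumes "al \<subseteq> CR" shows "card al = card (al Int R) + card (al Int R')"
proof -
 have "al Int R = al Int U" "al Int R' = al Int W" using assms off_cut by blast+
 thus ?thesis using split_card[OF assms] by simp
qed

text \<open>The circles of L are the disjoint union of the inner ones and the images under
  \<open>tau\<close>, and the signed crossings are distributed over the two sides, so the degrees
  add up.\<close>

lemma split_degrees:
 assumes x: "(al, ep) : generators (diagram_of L)" and s: "sp (al, ep) = (A, u, v)"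
 shows "hdeg (tang U) u = int (card (al Int R)) - int (num_neg (tang U))"
  "hdeg (closing (tang W) A) v = int (card (al Int R')) - int (num_neg (tang W))"
  "qdeg (tang U) (inner_circles (tang U)) u + qdeg (closing (tang W) A) (circles (closing (tang W) A)) v =
   qdeg (diagram_of L) CC (al, ep)"
proof -
 have a: "al \<subseteq> CR" using x unfolding generators_iff by auto
 have uv: "A = part al" "u = (al Int R, restrict ep (inn al))" "v = (al Int R', \<lambda>w\<in>out al. ep (tau al w))"
  using s unfolding split_gen_eq by auto
 show "hdeg (tang U) u = int (card (al Int R)) - int (num_neg (tang U))"
  "hdeg (closing (tang W) A) v = int (card (al Int R')) - int (num_neg (tang W))"
  unfolding uv hdeg_def by (simp_all add: closing_simps)
 have ti: "inj_on (tau al) (out al)" using tau_inj[of al al] by simp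
 have dis: "inn al Int tau al ` out al = {}" using inner_tau_disjoint[of al al] by simp
 have "finite (CC al)" using kh.fam[of al] unfolding fam_def by blast
 hence fin: "finite (inn al)" "finite (tau al ` out al)" unfolding circles_split by simp_all
 have "sum ep (CC al) = sum ep (inn al) + sum ep (tau al ` out al)"
  unfolding circles_split by (rule sum.union_disjoint[OF fin dis])
 also have "sum ep (tau al ` out al) = (\<Sum>w\<in>out al. (\<lambda>w\<in>out al. ep (tau al w)) w)"
  unfolding sum.reindex[OF ti] by (intro sum.cong refl) simp
 also have "sum ep (inn al) = (\<Sum>z\<in>inn al. restrict ep (inn al) z)" by (intro sum.cong refl) simp
 finally show "qdeg (tang U) (inner_circles (tang U)) u + qdeg (closing (tang W) A) (circles (closing (tang W) A)) v =
   qdeg (diagram_of L) CC (al, ep)"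
  unfolding uv qdeg_def prod.case closing_simps split_num state_card[OF a] by simp
qed

text \<open>A change at a crossing in W affects neither the inner circles in U nor the partition nor
  \<open>tau\<close>. So the arrow of the closure is the arrow of L renamed by \<open>tau\<close>,
  with the inner circles as spectators, and only the sign comes from o'.\<close>

lemma split_coeff_eq:
 assumes x: "(al, ep) : generators (diagram_of L)" and y: "(bet, et) : generators (diagram_of L)"
 shows "split_coeff L C R' o' (sp (bet, et)) (sp (al, ep)) = (\<Sum>c\<in>CR Int W - al.
  if bet = insert c al then weight o' (al Int R') c * edge_coeff (CC al) ep (CC bet) et else 0)"
proof (cases "bet Int R = al Int R")
 case ab: True
 have a: "al \<subseteq> CR" "bet \<subseteq> CR" using x y unfolding generators_iff by auto
 have p: "part bet = part al" "tau bet = tau al" using part_cong[OF ab] tau_cong[OF ab] by simp_all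
 have r: "restrict et (inn al) = restrict ep (inn al) \<longleftrightarrow> agree (inn al) ep et"
 proof
  assume h: "restrict et (inn al) = restrict ep (inn al)"
  show "agree (inn al) ep et" unfolding agree_def
  proof
   fix z assume "z : inn al" thus "ep z = et z" using fun_cong[OF h, of z] by simp
  qed
 next
  assume "agree (inn al) ep et"
  thus "restrict et (inn al) = restrict ep (inn al)" unfolding agree_def by (intro restrict_ext) metis
 qed
 have ec: "edge_coeff (CC al) ep (CC bet) et = (if agree (inn al) ep et
   then edge_coeff (out al) (\<lambda>w\<in>out al. ep (tau al w)) (out bet) (\<lambda>w\<in>out bet. et (tau al w)) else 0)"
 proof -
  have cb: "CC bet = inn al Un tau al ` out bet" unfolding circles_split[of bet] ab p ..
  have "edge_coeff (out al) (%w. ep (tau al w)) (out bet) (%w. et (tau al w)) =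
    edge_coeff (out al) (\<lambda>w\<in>out al. ep (tau al w)) (out bet) (\<lambda>w\<in>out bet. et (tau al w))"
   by (rule edge_coeff_cong) simp_all
  thus ?thesis unfolding cb unfolding circles_split[of al]
   using edge_coeff_image[OF tau_inj[OF ab[symmetric]] inner_tau_disjoint[OF ab[symmetric]], of ep et] by simp
 qed
 have cr: "CR Int W - al Int R' = CR Int W - al" by blast
 have st: "bet Int R' = insert c (al Int R') \<longleftrightarrow> bet = insert c al" if c: "c : CR Int W - al" for c
 proof
  assume h: "bet Int R' = insert c (al Int R')"
  have "bet = (al Int R) Un insert c (al Int R')" using state_sides(1)[OF a(2)] unfolding ab h .
  also have "\<dots> = insert c al" using state_sides(1)[OF a(1)] by blast
  finally show "bet = insert c al" .
 next
  assume "bet = insert c al"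
  thus "bet Int R' = insert c (al Int R')" using c by blast
 qed
 have "split_coeff L C R' o' (sp (bet, et)) (sp (al, ep)) = (if agree (inn al) ep et then
   kh_coeff (closing (tang W) (part al)) o' (bet Int R', \<lambda>w\<in>out bet. et (tau al w)) (al Int R', \<lambda>w\<in>out al. ep (tau al w)) else 0)"
  unfolding split_gen_eq split_coeff_def prod.case tang_def[symmetric] p ab prod.inject r by simp
 also have "\<dots> = (\<Sum>c\<in>CR Int W - al. if bet = insert c al then weight o' (al Int R') c * edge_coeff (CC al) ep (CC bet) et else 0)"
 proof -
  have "kh_coeff (closing (tang W) (part al)) o' (bet Int R', \<lambda>w\<in>out bet. et (tau al w)) (al Int R', \<lambda>w\<in>out al. ep (tau al w)) =
   (\<Sum>c\<in>CR Int W - al. if bet = insert c al then weight o' (al Int R') c *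
    edge_coeff (out al) (\<lambda>w\<in>out al. ep (tau al w)) (out bet) (\<lambda>w\<in>out bet. et (tau al w)) else 0)"
   unfolding kh_coeff_def prod.case closing_simps tang_simps(3)[OF side(2)] cr weight_def[symmetric] p[symmetric]
   by (intro sum.cong refl) (simp only: st)
  thus ?thesis unfolding ec by (cases "agree (inn al) ep et") (simp_all cong: if_cong)
 qed
 finally show ?thesis .
next
 \<comment> \<open>The states differ on U, which no change at a crossing in W can cause, so both
   sides vanish.\<close>
 case False
 have "~ bet = insert c al" if "c : CR Int W - al" for c
 proof
  assume "bet = insert c al"
  moreover have "c ~: R" using that side(3) off_cut by blast
  ultimately show False using False by blast
 qed
 hence "(\<Sum>c\<in>CR Int W - al.
  if bet = insert c al then weight o' (al Int R') c * edge_coeff (CC al) ep (CC bet) et else 0) = 0"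
  by (intro sum.neutral) simp
 moreover have "split_coeff L C R' o' (sp (bet, et)) (sp (al, ep)) = 0"
  unfolding split_gen_eq split_coeff_def prod.case prod.inject using False by simp
 ultimately show ?thesis by simp
qed

end

lemma finite_NC: "finite (NC n)"
proof -
 have "NC n \<subseteq> Pow (Pow {1..n})" unfolding NC_def partition_on_def by blast
 thus ?thesis by (rule finite_subset) simp
qed

lemma finite_circles: "finite (arcs D) ==> finite (circles D al)"
 unfolding circles_def quotient_def by simp

lemma finite_generators: "finite (crossings D) ==> finite (arcs D) ==> finite (generators D)"
proof -
 assume f: "finite (crossings D)" "finite (arcs D)"
 have "generators D = Sigma (Pow (crossings D)) (%al. labellings (circles D al))" by (auto simp: generators_def)
 thus ?thesis using f labellings_finite[OF finite_circles[OF f(2)]] by simp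
qed

lemma finite_inner_generators:
 assumes f: "finite (crossings T)" "finite (arcs T)" shows "finite (inner_generators T A)"
proof (rule finite_subset)
 show "inner_generators T A \<subseteq> Sigma (Pow (crossings T)) (%bet. labellings (inner_circles T bet))"
  by (auto simp: inner_generators_def)
 have "finite (circles (full_closing T) bet)" for bet
  using f(2) by (intro finite_circles) (simp add: full_closing_def closing_simps)
 hence "finite (inner_circles T bet)" for bet unfolding inner_circles_def by (rule finite_subset[rotated]) blast
 thus "finite (Sigma (Pow (crossings T)) (%bet. labellings (inner_circles T bet)))"
  by (intro finite_SigmaI labellings_finite) (simp add: f(1))
qed

section \<open>The double complex of a cut\<close>

text \<open>U1 and U2 are the open sides belonging to R1 and R2. Taking them in the two possible
  roles, in \<open>s1\<close> and \<open>s2\<close> below, gives the two descriptions of the double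
  complex.\<close>

locale cut_complex = tangle_cut L C R1 R2 for L C R1 R2 +
 fixes U1 U2 :: "complex set" and ord ord1 ord2 :: "complex rel"
 assumes UU: "{U1, U2} = {inside (path_image C), outside (path_image C)}"
  and R12: "R1 = U1 Un path_image C" "R2 = U2 Un path_image C"
  and ord: "linear_order_on (crossing_points L) ord"
  and ord1: "linear_order_on (crossing_points L Int R1) ord1"
  and ord2: "linear_order_on (crossing_points L Int R2) ord2"
begin

sublocale s1: two_sides L C R1 R2 U1 U2 by unfold_locales (rule UU)
sublocale s2: two_sides L C R1 R2 U2 U1 by unfold_locales (use UU in "simp add: insert_commute")

abbreviation "B \<equiv> generators (diagram_of L)"
abbreviation "Ph \<equiv> split_gen L C R1 R2"
abbreviation "Ps \<equiv> split_gen L C R2 R1"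
abbreviation "SG \<equiv> split_generators L C R1 R2"

text \<open>With R2 before R1, a change in R2 sees only crossings in R2, and the vertical signs are
  those of ord2. A change in R1 sees all 1-smoothings in R2, a sign that is constant on
  rows.\<close>

definition ord' :: "complex rel" where
 "ord' = {(b, c). b : R2 & c : R1 \<or> b : R1 & c : R1 & (b, c) : ord1 \<or> b : R2 & c : R2 & (b, c) : ord2}"
definition sgn :: "kh_gen => rat" where "sgn x = disorder ord ord' (fst x)"
definition P :: "kh_gen => int" where "P x = int (card (fst x Int R1)) - int (num_neg (tang U1))"
definition Q :: "kh_gen => int" where "Q x = int (card (fst x Int R2)) - int (num_neg (tang U2))"
abbreviation "J \<equiv> qdeg (diagram_of L) (circles (diagram_of L))"
abbreviation "M \<equiv> kh_coeff (diagram_of L) ord"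

lemma R_split: "c : CR ==> c : R1 \<longleftrightarrow> c ~: R2"
 using crossings_split[OF UU] s1.side(3) s1.off_cut unfolding R12 by blast

lemma chi_U: "CR Int U1 = CR Int R1" "CR Int U2 = CR Int R2" using s1.crossings_side unfolding R12 by blast+

lemma sgn_square: "sgn x * sgn x = 1" unfolding sgn_def by (rule disorder_square)

lemma ord_total:
 assumes bc: "b : CR" "c : CR" "b ~= c"
 shows "(b, c) : ord \<longleftrightarrow> (c, b) ~: ord" "(b, c) : ord' \<longleftrightarrow> (c, b) ~: ord'"
proof -
 have lin: "(b, c) : r \<longleftrightarrow> (c, b) ~: r" if "linear_order_on X r" "b : X" "c : X" for X r
  using that bc(3) unfolding linear_order_on_def partial_order_on_def antisym_def total_on_def by blast
 show "(b, c) : ord \<longleftrightarrow> (c, b) ~: ord" by (rule lin[OF ord bc(1,2)])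
 consider "b : R1" "c : R1" | "b : R2" "c : R2" | "b : R1" "c : R2" | "b : R2" "c : R1" using R_split bc by blast
 thus "(b, c) : ord' \<longleftrightarrow> (c, b) ~: ord'"
 proof cases
  case 1
  hence "b ~: R2" "c ~: R2" using R_split bc by blast+
  thus ?thesis unfolding ord'_def using 1 lin[OF ord1] bc by simp
 next
  case 2
  hence "b ~: R1" "c ~: R1" using R_split bc by blast+
  thus ?thesis unfolding ord'_def using 2 lin[OF ord2] bc by simp
 next
  case 3
  hence "b ~: R2" "c ~: R1" using R_split bc by blast+
  thus ?thesis unfolding ord'_def using 3 by simp
 next
  case 4
  hence "b ~: R1" "c ~: R2" using R_split bc by blast+
  thus ?thesis unfolding ord'_def using 4 by simp
 qed
qed

lemma weight_ord':
 assumes a: "al \<subseteq> CR" and c: "c : CR"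
 shows "c : R2 ==> weight ord' al c = weight ord2 (al Int R2) c"
  "c : R1 ==> weight ord' al c = (- 1) ^ card (al Int R2) * weight ord1 (al Int R1) c"
proof -
 assume c2: "c : R2"
 hence "c ~: R1" using R_split c by blast
 hence "{b : al. (b, c) : ord'} = {b : al Int R2. (b, c) : ord2}" unfolding ord'_def using c2 by blast
 thus "weight ord' al c = weight ord2 (al Int R2) c" by (simp add: weight_def)
next
 assume c1: "c : R1"
 hence c2: "c ~: R2" using R_split c by blast
 have "{b : al. (b, c) : ord'} = (al Int R2) Un {b : al Int R1. (b, c) : ord1}" unfolding ord'_def using c1 c2 by blast
 moreover have "card ((al Int R2) Un {b : al Int R1. (b, c) : ord1}) = card (al Int R2) + card {b : al Int R1. (b, c) : ord1}"
  using finite_subset[OF a s1.finite_chi] R_split a by (intro card_Un_disjoint) auto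
 ultimately show "weight ord' al c = (- 1) ^ card (al Int R2) * weight ord1 (al Int R1) c" by (simp add: weight_def power_add)
qed

definition part_coeff :: "complex set => kh_gen => kh_gen => rat" where
 "part_coeff Y = (%(bet, et) (al, ep). \<Sum>c\<in>CR Int Y - al. if bet = insert c al
  then weight ord' al c * edge_coeff (circles (diagram_of L) al) ep (circles (diagram_of L) bet) et else 0)"

text \<open>Conjugating by \<open>sgn\<close> replaces ord by ord', after which the sum over the
  crossings divides according to the sides.\<close>

lemma signed_coeff:
 assumes x: "x : B" and y: "y : B"
 shows "sgn y * sgn x * M y x = part_coeff R1 y x + part_coeff R2 y x"
proof -
 obtain al ep bet et where e: "x = (al, ep)" "y = (bet, et)" by (metis surj_pair)
 have a: "al \<subseteq> CR" using x unfolding e s1.generators_iff by auto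
 have fa: "finite al" using finite_subset[OF a s1.finite_chi] .
 let ?t = "%c. if bet = insert c al then weight ord' al c * edge_coeff (circles (diagram_of L) al) ep (circles (diagram_of L) bet) et else 0"
 have "sgn y * sgn x * M y x = (\<Sum>c\<in>CR - al. sgn y * sgn x * (if bet = insert c al then weight ord al c *
   edge_coeff (circles (diagram_of L) al) ep (circles (diagram_of L) bet) et else 0))"
  unfolding e kh.kh_coeff_weight diagram_of_simps by (simp only: sum_distrib_left)
 also have "\<dots> = (\<Sum>c\<in>CR - al. ?t c)"
 proof (intro sum.cong refl)
  fix c assume c: "c : CR - al"
  show "sgn y * sgn x * (if bet = insert c al then weight ord al c *
   edge_coeff (circles (diagram_of L) al) ep (circles (diagram_of L) bet) et else 0) = ?t c"
  proof (cases "bet = insert c al")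
   case True
   have w: "weight ord al c = sgn y * sgn x * weight ord' al c"
    unfolding sgn_def e fst_conv True by (rule disorder_insert[OF fa]) (use c a ord_total in blast)+
   have "sgn y * sgn x * weight ord al c = (sgn y * sgn y) * (sgn x * sgn x) * weight ord' al c" unfolding w by (simp only: mult_ac)
   hence "sgn y * sgn x * weight ord al c = weight ord' al c" unfolding sgn_square by simp
   thus ?thesis using True by (simp add: mult.assoc[symmetric])
  next
   case False thus ?thesis by simp
  qed
 qed
 also have "CR - al = (CR Int R1 - al) Un (CR Int R2 - al)" using R_split by blast
 also have "(\<Sum>c\<in>(CR Int R1 - al) Un (CR Int R2 - al). ?t c) = (\<Sum>c\<in>CR Int R1 - al. ?t c) + (\<Sum>c\<in>CR Int R2 - al. ?t c)"
  using s1.finite_chi R_split by (intro sum.union_disjoint) auto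
 finally show ?thesis unfolding part_coeff_def e prod.case .
qed

lemma card_insert_R:
 assumes "al \<subseteq> CR" "c : CR" "c ~: al"
 shows "card (insert c al Int R) = card (al Int R) + (if c : R then 1 else 0)"
proof -
 have "finite (al Int R)" using finite_subset[OF assms(1) s1.finite_chi] by simp
 thus ?thesis using assms(3) by (simp add: Int_insert_left)
qed

lemma part_coeff_zero:
 assumes x: "x : B" and y: "y : B"
 shows "P y = P x ==> part_coeff R1 y x = 0" "P y ~= P x ==> part_coeff R2 y x = 0"
proof -
 obtain al ep bet et where e: "x = (al, ep)" "y = (bet, et)" by (metis surj_pair)
 have a: "al \<subseteq> CR" using x unfolding e s1.generators_iff by auto
 have *: "part_coeff Y y x = 0" if "!!c. c : CR ==> c : Y ==> c ~: al ==> bet ~= insert c al" for Y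
  unfolding part_coeff_def e prod.case using that by (intro sum.neutral) auto
 show "part_coeff R1 y x = 0" if p: "P y = P x"
 proof (rule *)
  fix c assume c: "c : CR" "c : R1" "c ~: al"
  show "bet ~= insert c al" using p c(2) card_insert_R[OF a c(1,3), of R1] unfolding P_def e by auto
 qed
 show "part_coeff R2 y x = 0" if p: "P y ~= P x"
 proof (rule *)
  fix c assume c: "c : CR" "c : R2" "c ~: al"
  have "c ~: R1" using R_split c by blast
  thus "bet ~= insert c al" using p card_insert_R[OF a c(1,3), of R1] unfolding P_def e by auto
 qed
qed

lemma vertical_coeff:
 assumes x: "x : B" and y: "y : B"
 shows "split_coeff L C R2 ord2 (Ph y) (Ph x) = 1 * (sgn y * sgn x * (if P y = P x then M y x else 0))"
proof -
 obtain al ep bet et where e: "x = (al, ep)" "y = (bet, et)" by (metis surj_pair)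
 have a: "al \<subseteq> CR" using x unfolding e s1.generators_iff by auto
 have "split_coeff L C R2 ord2 (Ph y) (Ph x) = part_coeff R2 y x"
  unfolding e part_coeff_def prod.case
  unfolding R12 s1.split_coeff_eq[OF x[unfolded e] y[unfolded e]]
  unfolding R12[symmetric] chi_U
  by (intro sum.cong refl) (use weight_ord'(1)[OF a] in simp)
 thus ?thesis using signed_coeff[OF x y] part_coeff_zero[OF x y] by (cases "P y = P x") auto
qed

text \<open>Sign of moving a crossing in \<open>R1\<close> past those in \<open>R2\<close>; it is constant on rows.\<close>

definition kappa :: "int => rat" where "kappa q = (- 1) ^ nat (q + int (num_neg (tang U2)))"

lemma to_second: "x : B ==> to_second L C R1 R2 (Ph x) = Ps x"
 unfolding to_second_def R12 using s1.split_inj by (simp add: inv_into_f_f)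

text \<open>The second description is \<open>split_coeff_eq\<close> with the sides exchanged. The
  weights for ord1 and for ord' differ by the factor \<open>kappa q\<close>.\<close>

lemma horizontal_coeff:
 assumes x: "x : B" "Q x = q" and y: "y : B"
 shows "split_coeff L C R1 ord1 (to_second L C R1 R2 (Ph y)) (to_second L C R1 R2 (Ph x)) =
  kappa q * (sgn y * sgn x * (if P y = P x then 0 else M y x))"
proof -
 obtain al ep bet et where e: "x = (al, ep)" "y = (bet, et)" by (metis surj_pair)
 have a: "al \<subseteq> CR" using x(1) unfolding e s1.generators_iff by auto
 have "q + int (num_neg (tang U2)) = int (card (al Int R2))" using x(2) unfolding Q_def e by simp
 hence k: "kappa q = (- 1) ^ card (al Int R2)" by (simp add: kappa_def)
 have w: "weight ord1 (al Int R1) c = kappa q * weight ord' al c" if "c : CR" "c : R1" for c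
 proof -
  have "kappa q * kappa q = 1" unfolding k by (simp add: power_mult_distrib[symmetric])
  thus ?thesis unfolding weight_ord'(2)[OF a that] k[symmetric] by (simp add: mult.assoc[symmetric])
 qed
 have "split_coeff L C R1 ord1 (Ps y) (Ps x) = kappa q * part_coeff R1 y x"
  unfolding e part_coeff_def prod.case sum_distrib_left
  unfolding R12 s2.split_coeff_eq[OF x(1)[unfolded e] y[unfolded e]]
  unfolding R12[symmetric] chi_U
  by (intro sum.cong refl) (use w in "simp add: mult.assoc")
 thus ?thesis unfolding to_second[OF x(1)] to_second[OF y]
  using signed_coeff[OF x(1) y] part_coeff_zero[OF x(1) y] by (cases "P y = P x") auto
qed

lemma hdeg_sum: "x : B ==> hdeg (diagram_of L) x = P x + Q x"
proof -
 assume x: "x : B"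
 obtain al ep where e: "x = (al, ep)" by (metis surj_pair)
 have a: "al \<subseteq> CR" using x unfolding e s1.generators_iff by auto
 show ?thesis unfolding hdeg_def P_def Q_def e prod.case fst_conv s1.split_num using s1.state_card[OF a] unfolding R12 by simp
qed

text \<open>Columns start at - l_1^-, where all crossings in R1 have value 0, and never exceed the
  number of all crossings.\<close>

sublocale bc: bigraded_complex B M P Q J "- int (num_neg (tang U1))" "int (card CR) + 1"
proof
 show "finite B" by (rule kh.finite_generators)
 show "(\<Sum>y\<in>B. M z y * M y x) = 0" if "x : B" "z : B" for x z
  by (rule kh.square_zero) (use ord that in "simp_all add: diagram_of_simps")
 show "J y = J x & (P y = P x & Q y = Q x + 1 \<or> P y = P x + 1 & Q y = Q x)"
  if xy: "x : B" "y : B" and ne: "M y x ~= 0" for x y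
 proof -
  obtain al ep c et where e: "x = (al, ep)" "c : crossings (diagram_of L) - al" "y = (insert c al, et)"
   "sum et (circles (diagram_of L) (insert c al)) = sum ep (circles (diagram_of L) al) - 1"
   by (rule kh.kh_coeff_nonzero[OF xy ne])
  have c: "c : CR" "c ~: al" using e(2) by (simp_all add: diagram_of_simps)
  have a: "al \<subseteq> CR" using xy(1) unfolding e s1.generators_iff by auto
  have "card (insert c al) = card al + 1" using c finite_subset[OF a s1.finite_chi] by simp
  hence "J y = J x" unfolding qdeg_def e(1,3) prod.case e(4) by simp
  moreover have "P y = P x & Q y = Q x + 1 \<or> P y = P x + 1 & Q y = Q x"
   unfolding P_def Q_def e(1,3) fst_conv card_insert_R[OF a c] using R_split[OF c(1)] by simp
  ultimately show ?thesis by blast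
 qed
 show "- int (num_neg (tang U1)) <= P x & P x < int (card CR) + 1" if x: "x : B" for x
 proof -
  obtain al ep where e: "x = (al, ep)" by (metis surj_pair)
  have a: "al \<subseteq> CR" using x unfolding e s1.generators_iff by auto
  have "card (al Int R1) <= card CR" using a s1.finite_chi by (intro card_mono) auto
  thus ?thesis unfolding P_def e by simp
 qed
qed

lemma H_eq: "bc.fc.H = Kh (diagram_of L) ord"
proof (intro ext)
 fix i j
 have F: "bc.F (- int (num_neg (tang U1))) i j = kh_chains (diagram_of L) i j" for i
  unfolding bc.F_def kh_chains_def
  by (rule arg_cong[where f = spanned_by]) (use hdeg_sum bc.range in auto)
 show "bc.fc.H i j = Kh (diagram_of L) ord i j"
  unfolding bc.fc.H_def Kh_def cohomology_def middle_cohomology_def F kh_diff_def by auto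
qed

abbreviation "T \<equiv> transport Ph B sgn"

lemma Phi: "inj_on Ph B" "Ph ` B = SG" unfolding R12 by (rule s1.split_inj, rule s1.split_image)

lemma finite_side: "finite (crossings (tang U1))" "finite (arcs (tang U1))" "finite (crossings (tang U2))" "finite (arcs (tang U2))"
 using s1.finite_chi finite_components s1.split_arcs(1) unfolding tang_simps(1,3)[OF s1.side(1)] tang_simps(1,3)[OF s1.side(2)] by simp_all

sublocale sb: split_basis "NC n" "%A. inner_generators (tang U1) A" "%A. generators (closing (tang U2) A)"
 "%A. kh_coeff (closing (tang U2) A) ord2" "hdeg (tang U1)" "qdeg (tang U1) (inner_circles (tang U1))"
 "%A. hdeg (closing (tang U2) A)" "%A. qdeg (closing (tang U2) A) (circles (closing (tang U2) A))"
 by unfold_locales (use finite_side in "simp_all add: finite_NC finite_inner_generators finite_generators closing_simps")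

lemma sb_SG: "sb.SG = SG" unfolding sb.SG_def unfolding split_generators_def R12 tang_def ..

lemma sb_SM: "sb.SM = split_coeff L C R2 ord2" unfolding sb.SM_def unfolding split_coeff_def R12 tang_def ..

lemma sb_KH: "sb.KH A q = Kh (closing (tang U2) A) ord2 q"
 unfolding sb.KH_def[abs_def] Kh_def[abs_def] sb.kc_def sb.kd_def kh_chains_def kh_diff_def ..

lemma vertical_eq: "vertical_cohomology L C R1 R2 ord2 q j p =
 ({f : spanned_by (sb.cell p q j). matrix_map SG (split_coeff L C R2 ord2) f = 0},
 matrix_map SG (split_coeff L C R2 ord2) ` spanned_by (sb.cell p (q - 1) j))"
 using sb.vertical[of p q j] unfolding sb_SG sb_SM sb_KH
 unfolding vertical_cohomology_def inner_chains_def tang_def R12 .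

lemma cell_eq: "sb.cell p q j = Ph ` {x : B. P x = p & Q x = q & J x = j}"
proof -
 have *: "Ph x : sb.cell p q j \<longleftrightarrow> P x = p & Q x = q & J x = j" if x: "x : B" for x
 proof -
  obtain al ep where e: "x = (al, ep)" by (metis surj_pair)
  obtain A u v where t: "Ph x = (A, u, v)" by (metis surj_pair)
  have "Ph x : SG" using Phi(2) x by blast
  hence m: "(A, u, v) : SG" unfolding t .
  note d = s1.split_degrees[OF x[unfolded e] t[unfolded e R12]]
  show ?thesis unfolding sb.cell_def sb_SG t P_def Q_def
   using m d unfolding e fst_conv R12 by auto
 qed
 have "sb.cell p q j \<subseteq> Ph ` B" unfolding Phi(2) sb.cell_def sb_SG by auto
 thus ?thesis using * by blast
qed

lemma T_vertical: "f : spanned_by B ==> matrix_map SG (split_coeff L C R2 ord2) (T f) = T (bc.d0 f)"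
proof -
 assume f: "f : spanned_by B"
 have "matrix_map (Ph ` B) (split_coeff L C R2 ord2) (T f) = fscale 1 (T (bc.d0 f))"
  unfolding bc.d0_def by (rule transport_matrix[OF Phi(1) sgn_square f subset_refl]) (rule vertical_coeff)
 thus ?thesis unfolding Phi(2) by (simp add: fscale_def)
qed

lemma T_horizontal:
 assumes f: "f : bc.col p q j"
 shows "d_hor L C R1 R2 ord1 (T f) = fscale (kappa q) (T (bc.d1 f))"
proof -
 have "matrix_map (Ph ` B) (%y x. split_coeff L C R1 ord1 (to_second L C R1 R2 y) (to_second L C R1 R2 x)) (T f) =
   fscale (kappa q) (T (bc.d1 f))"
  unfolding bc.d1_def by (rule transport_matrix[OF Phi(1) sgn_square f[unfolded bc.col_def]]) (use horizontal_coeff in auto)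
 thus ?thesis unfolding Phi(2) d_hor_def .
qed

lemma spanned_mono: "S \<subseteq> S' ==> spanned_by S \<subseteq> spanned_by S'" by (auto simp: spanned_by_def)

lemma col_B: "f : bc.col p q j ==> f : spanned_by B"
 unfolding bc.col_def using spanned_mono[of "{x : B. P x = p & Q x = q & J x = j}" B] by blast

lemma T_col: "T ` bc.col p q j = spanned_by (sb.cell p q j)"
 unfolding cell_eq bc.col_def by (rule transport_spanned[OF Phi(1) sgn_square]) blast

text \<open>T is injective on the columns and intertwines the vertical differentials exactly,
  without a sign, so it carries kernels to kernels and images to images.\<close>

lemma vertical_transport: "vertical_cohomology L C R1 R2 ord2 q j p = (T ` fst (bc.VC q j p), T ` snd (bc.VC q j p))"
proof -
 let ?d = "matrix_map SG (split_coeff L C R2 ord2)"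
 have T0: "T 0 = 0" using linD(3)[OF lin_transport] .
 have "{f : T ` bc.col p q j. ?d f = 0} = T ` {z : bc.col p q j. bc.d0 z = 0}"
 proof (intro equalityI subsetI)
  fix f assume "f : {f : T ` bc.col p q j. ?d f = 0}"
  then obtain z where z: "z : bc.col p q j" "f = T z" "?d (T z) = 0" by blast
  have "T (bc.d0 z) = 0" using T_vertical[OF col_B[OF z(1)]] z(3) by simp
  hence "bc.d0 z = 0" using transport_eq_0[where s = sgn, OF Phi(1) sgn_square col_B[OF bc.d0_col[OF z(1)]]] by blast
  thus "f : T ` {z : bc.col p q j. bc.d0 z = 0}" using z by blast
 next
  fix f assume "f : T ` {z : bc.col p q j. bc.d0 z = 0}"
  then obtain z where z: "z : bc.col p q j" "f = T z" "bc.d0 z = 0" by blast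
  have "?d f = 0" unfolding z(2) T_vertical[OF col_B[OF z(1)]] z(3) T0 ..
  thus "f : {f : T ` bc.col p q j. ?d f = 0}" using z by blast
 qed
 moreover have "?d ` (T ` bc.col p (q - 1) j) = T ` (bc.d0 ` bc.col p (q - 1) j)"
  unfolding image_image by (intro image_cong refl T_vertical col_B)
 ultimately show ?thesis unfolding vertical_eq T_col[symmetric] bc.VC_def by simp
qed

lemma kappa_sign: "kappa q = 1 \<or> kappa q = - 1"
 unfolding kappa_def by (cases "even (nat (q + int (num_neg (tang U2))))") simp_all

lemma conclusion:
 "cochain_complex (vertical_cohomology L C R1 R2 ord2 q j) (%p. d_hor L C R1 R2 ord1)"
 "cohomology (bc.VC q j) (%p. bc.d1) p \<cong>\<^sub>\<rat> cohomology (vertical_cohomology L C R1 R2 ord2 q j) (%p. d_hor L C R1 R2 ord1) p"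
proof -
 have D: "lin (d_hor L C R1 R2 ord1)" unfolding d_hor_def by (rule lin_matrix_map)
 have col: "x : bc.col p q j" if "x : fst (bc.VC q j p)" for p x using that unfolding bc.VC_def by simp
 have inj: "x = 0" if "x : fst (bc.VC q j p)" "T x = 0" for p x
  using transport_eq_0[where s = sgn, OF Phi(1) sgn_square col_B[OF col[OF that(1)]]] that(2) .
 have com: "d_hor L C R1 R2 ord1 (T x) = fscale (kappa q) (T (bc.d1 x))" if "x : fst (bc.VC q j p)" for p x
  by (rule T_horizontal[OF col[OF that]])
 note t = cohomology_transport[where T = T and D = bc.d1 and D' = "d_hor L C R1 R2 ord1" and ka = "kappa q" and V = "bc.VC q j"
   and V' = "vertical_cohomology L C R1 R2 ord2 q j", OF bc.cochain_VC lin_transport D vertical_transport inj com kappa_sign]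
 show "cochain_complex (vertical_cohomology L C R1 R2 ord2 q j) (%p. d_hor L C R1 R2 ord1)" by (rule t(1))
 show "cohomology (bc.VC q j) (%p. bc.d1) p \<cong>\<^sub>\<rat> cohomology (vertical_cohomology L C R1 R2 ord2 q j) (%p. d_hor L C R1 R2 ord1) p"
  by (rule t(2))
qed

end

theorem theorem1p2:
  fixes L :: link_diagram and C :: "real \<Rightarrow> complex" and R1 R2 :: "complex set"
    and ord ord1 ord2 :: "complex rel"
  assumes "is_link_diagram L"
    and "admissible_cut L C"
    and "cut_discs L C R1 R2"
    and "linear_order_on (crossing_points L) ord"
    and "linear_order_on (crossing_points L \<inter> R1) ord1"
    and "linear_order_on (crossing_points L \<inter> R2) ord2"
  shows "(\<forall>q j. cochain_complex (vertical_cohomology L C R1 R2 ord2 q j)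
                   (\<lambda>p. d_hor L C R1 R2 ord1)) \<and>
    (\<exists>(E :: kh_gen pages) d.
       spectral_sequence E d \<and>
       converges_to E d (Kh (diagram_of L) ord) \<and>
       (\<forall>p q j. E 2 p q j \<cong>\<^sub>\<rat>
          cohomology (vertical_cohomology L C R1 R2 ord2 q j) (\<lambda>p. d_hor L C R1 R2 ord1) p))"
proof -
 have "{R1, R2} = {inside (path_image C) Un path_image C, outside (path_image C) Un path_image C}"
  using assms(3) by (simp add: cut_discs_def)
 then obtain U1 U2 where U: "{U1, U2} = {inside (path_image C), outside (path_image C)}"
   "R1 = U1 Un path_image C" "R2 = U2 Un path_image C"
  by (metis doubleton_eq_iff)
 interpret cut_complex L C R1 R2 U1 U2 ord ord1 ord2
  by unfold_locales (use assms U in simp_all)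
 have "bc.fc.pages 2 p q j \<cong>\<^sub>\<rat> cohomology (vertical_cohomology L C R1 R2 ord2 q j) (%p. d_hor L C R1 R2 ord1) p" for p q j
  by (rule subq_isomorphic_trans[OF bc.E2_VC conclusion(2)])
 thus ?thesis using conclusion(1) bc.fc.spectral bc.fc.converges unfolding H_eq by blast
qed

end
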